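(* For arbitrary quotas $q(w)\in\mathbb{Z}_{>0}$, $w\in W$, the poset of rotations $(\mathcal{R},\lessdot)$ can be constructed in time $O(|E|^2)$ (including oracle calls). That is, there is an algorithm which, given the bipartite graph $G=(V=W\sqcup F,E)$, the linear orders $>_w$ and quotas $q(w)$ ($w\in W$) and oracles for the choice functions $C_f$ ($f\in F$), constructs the set $\mathcal{R}$ of all rotations and the partial order $\lessdot$ on it, in time $O(|E|^2)$.
   Context: Setting. $G=(V,E)$ is a finite connected bipartite graph without multiple edges, with vertex parts $W$ and $F$; the edge joining $w\in W$ and $f\in F$ is denoted $wf$. $E_v$ is the set of edges incident to $v\in V$, and $X_v:=X\cap E_v$ for $X\subseteq E$. Each $w\in W$ has a strict linear order $>_w$ on $E_w$ ($e>_w e'$ means that $e$ is preferred to $e'$) and a quota $q(w)\in\mathbb{Z}_{>0}$; for $Z\subseteq E_w$, $C_w(Z)$ is the set of the $\min\{q(w),|Z|\}$ largest elements of $Z$ with respect to $>_w$. Each $f\in F$ has a choice function $C_f:2^{E_f}\to 2^{E_f}$ with $C_f(Z)\subseteq Z$, satisfying for all $Z,Z'\subseteq E_f$: (A1) if $Z\supseteq Z'\supseteq C_f(Z)$ then $C_f(Z')=C_f(Z)$; (A2) if $Z\supseteq Z'$ then $C_f(Z)\cap Z'\subseteq C_f(Z')$; (A3) if $Z\supseteq Z'$ then $|C_f(Z)|\ge |C_f(Z')|$. Stability. A matching is an arbitrary subset $X\subseteq E$. A set $Z\subseteq E_v$ is acceptable if $C_v(Z)=Z$; $X\subseteq E$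 is acceptable if all $X_v$, $v\in V$, are. For acceptable $Z,Z'\subseteq E_v$, $Z\succeq_v Z'$ means $C_v(Z\cup Z')=Z$. For distinct acceptable matchings $X,Y$, $X\succ_F Y$ (also written $Y\prec_F X$) means $X_f\succeq_f Y_f$ for all $f\in F$. An acceptable $X$ is stable if there is no edge $e=wf\in E\setminus X$ with both $e\in C_w(X_w\cup\{e\})$ and $e\in C_f(X_f\cup\{e\})$. $\mathcal{S}$ is the set of stable matchings. It is known that $\mathcal{S}\neq\emptyset$ and $(\mathcal{S},\prec_F)$ is a distributive lattice; its minimal and maximal elements are denoted $X^{\min}$, $X^{\max}$. Active graph and rotations. Let $X\in\mathcal{S}$. For $w\in W$ with $|X_w|=q(w)$ (fully filled), let $x_w$ be the last (least preferred) edge of $X_w$. If the set of edges $e=wf\in E_w$ with $x_w>_w e$ and $e\in C_f(X_f\cup\{e\})$ is nonempty, its $>_w$-largest element is called $W$-admissible and denoted $a_w$. If $a_w=wf$ and $C_f(X_f\cup\{a_w\})=(X_f\setminus\{e'\})\cup\{a_w\}$ for some $e'\in X_f$, then $e'$ is called $F$-admissible, is denoted $b^w_f$ and said to be associated with $a_w$, and $(a_w,b^w_f)$ is called a tandem passing $f$ (the only other possibility is $C_f(X_f\cup\{a_w\})=X_f\cup\{a_w\}$, when $a_w$ generates no tandem). Let $D(X)$ be the directed graph on $V$ whose edges are the $W$-admissible edges directed from $W$ to $F$ and the $F$-admissible edges directed from $F$ to $W$. Cleaning procedure: as long as the current graph has a vertex $w\in W$ with a leaving edge $a_w=(w,f)$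 but no entering edge, delete $a_w$, and if $a_w$ has an associated edge $b^w_f$ which occurs in no other tandem passing $f$ in the current graph, delete $b^w_f$ as well; isolated vertices are removed. The final graph $\Gamma(X)$ is the active graph of $X$. In it every $w\in W$ that remains has exactly one entering and one leaving edge, and for every remaining $f\in F$ the tandems passing $f$ partition the set of edges at $f$. Hence $\Gamma(X)$ decomposes uniquely into pairwise edge-disjoint directed cycles (edge-simple, possibly visiting a vertex of $F$ several times) which at each $w\in W$ go from the entering to the leaving edge, and at each visit to $f\in F$ traverse a tandem ($a_w$, then $b^w_f$). These cycles are the rotations generated by $X$; their set is $\mathcal{L}(X)$. For a rotation $L$, $L^+$ is the set of its edges going from $W$ to $F$ and $L^-$ the set of its edges going from $F$ to $W$ (both regarded as subsets of $E$); a rotation is identified by the pair $(L^+,L^-)$. Applying $L\in\mathcal{L}(X)$ to $X$ gives $(X\setminus L^-)\cup L^+$, which is again a stable matching. Poset of rotations. A route from $X_0$ to $X_N$ is a sequence $X_0,X_1,\ldots,X_N$ with $X_0$ stable and $X_i=(X_{i-1}\setminus L_i^-)\cup L_i^+$ for some $L_i\in\mathcal{L}(X_{i-1})$; its set of rotations is $\{L_1,\ldots,L_N\}$. A full route is one from $X^{\min}$ to $X^{\max}$. All full routes have the same set of rotations, denoted $\mathcal{R}$. For $R,R'\in\mathcal{R}$, $R\lessdot R'$ means that in every full route $R$ is applied earlier than $R'$; this is a partial order. Computational model. Each $C_f$ is given by an oracle that, asked about $Z\subseteq E_f$, returns $C_f(Z)$, each call counted as $O(1)$ time; time is the number of standard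 operations plus oracle calls. To construct the poset means to output the list of all rotations and a directed graph on it (the Hasse diagram) determining $\lessdot$. *)

theory Defs
  imports Main
begin

section \<open>Stable matchings with linear orders on one side and choice functions on the other\<close>

text \<open>
  The two vertex parts have separate types, so they are disjoint as vertex sets of
  \<open>W <+> F\<close>.  An edge \<open>wf\<close> is the pair \<open>(w, f)\<close>, so there are no multiple edges.
\<close>

locale bipartite_graph =
  fixes W :: "'w set" and F :: "'f set" and E :: "('w \<times> 'f) set"
  assumes finite_W: "finite W"
    and finite_F: "finite F"
    and edges: "E \<subseteq> W \<times> F"
    and connected:
      "\<And>u v. u \<in> W <+> F \<Longrightarrow> v \<in> W <+> F \<Longrightarrow>
        (u, v) \<in> ({(Inl w, Inr f) |w f. (w, f) \<in> E} \<union> {(Inr f, Inl w) |w f. (w, f) \<in> E})\<^sup>*"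
begin

definition EW :: "'w \<Rightarrow> ('w \<times> 'f) set" where
  "EW w = {e \<in> E. fst e = w}"

definition EF :: "'f \<Rightarrow> ('w \<times> 'f) set" where
  "EF f = {e \<in> E. snd e = f}"

end

text \<open>\<open>(e, e') \<in> gt w\<close> stands for \<open>e >\<^sub>w e'\<close>.\<close>

locale stable_market = bipartite_graph W F E
  for W :: "'w set" and F :: "'f set" and E :: "('w \<times> 'f) set" +
  fixes gt :: "'w \<Rightarrow> ('w \<times> 'f) rel"
    and q :: "'w \<Rightarrow> nat"
    and C :: "'f \<Rightarrow> ('w \<times> 'f) set \<Rightarrow> ('w \<times> 'f) set"
  assumes gt_on_EW: "\<And>w. w \<in> W \<Longrightarrow> gt w \<subseteq> EW w \<times> EW w"
    and gt_linear: "\<And>w. w \<in> W \<Longrightarrow> strict_linear_order_on (EW w) (gt w)"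
    and quota_pos: "\<And>w. w \<in> W \<Longrightarrow> 0 < q w"
    and choice_subset: "\<And>f Z. f \<in> F \<Longrightarrow> Z \<subseteq> EF f \<Longrightarrow> C f Z \<subseteq> Z"
    and A1: "\<And>f Z Z'. f \<in> F \<Longrightarrow> Z \<subseteq> EF f \<Longrightarrow> Z' \<subseteq> Z \<Longrightarrow> C f Z \<subseteq> Z' \<Longrightarrow> C f Z' = C f Z"
    and A2: "\<And>f Z Z'. f \<in> F \<Longrightarrow> Z \<subseteq> EF f \<Longrightarrow> Z' \<subseteq> Z \<Longrightarrow> C f Z \<inter> Z' \<subseteq> C f Z'"
    and A3: "\<And>f Z Z'. f \<in> F \<Longrightarrow> Z \<subseteq> EF f \<Longrightarrow> Z' \<subseteq> Z \<Longrightarrow> card (C f Z') \<le> card (C f Z)"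
begin

subsection \<open>Stability\<close>

definition CW :: "'w \<Rightarrow> ('w \<times> 'f) set \<Rightarrow> ('w \<times> 'f) set" where
  "CW w Z = (THE T. T \<subseteq> Z \<and> card T = min (q w) (card Z) \<and>
                (\<forall>e\<in>T. \<forall>e'\<in>Z - T. (e, e') \<in> gt w))"

definition acceptable :: "('w \<times> 'f) set \<Rightarrow> bool" where
  "acceptable X \<longleftrightarrow> X \<subseteq> E \<and>
     (\<forall>w\<in>W. CW w (X \<inter> EW w) = X \<inter> EW w) \<and>
     (\<forall>f\<in>F. C f (X \<inter> EF f) = X \<inter> EF f)"

definition stable :: "('w \<times> 'f) set \<Rightarrow> bool" where
  "stable X \<longleftrightarrow> acceptable X \<and>
     \<not> (\<exists>w f. (w, f) \<in> E - X \<and>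
           (w, f) \<in> CW w (insert (w, f) (X \<inter> EW w)) \<and>
           (w, f) \<in> C f (insert (w, f) (X \<inter> EF f)))"

definition prec_F :: "('w \<times> 'f) set \<Rightarrow> ('w \<times> 'f) set \<Rightarrow> bool" where
  "prec_F Y X \<longleftrightarrow> acceptable X \<and> acceptable Y \<and> X \<noteq> Y \<and>
     (\<forall>f\<in>F. C f ((X \<inter> EF f) \<union> (Y \<inter> EF f)) = X \<inter> EF f)"

definition X_min :: "('w \<times> 'f) set" where
  "X_min = (THE X. stable X \<and> \<not> (\<exists>Y. stable Y \<and> prec_F Y X))"

definition X_max :: "('w \<times> 'f) set" where
  "X_max = (THE X. stable X \<and> \<not> (\<exists>Y. stable Y \<and> prec_F X Y))"

subsection \<open>Active graph and rotations\<close>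

definition last_edge :: "('w \<times> 'f) set \<Rightarrow> 'w \<Rightarrow> 'w \<times> 'f" where
  "last_edge X w = (THE x. x \<in> X \<inter> EW w \<and> (\<forall>e\<in>X \<inter> EW w - {x}. (e, x) \<in> gt w))"

definition candidates :: "('w \<times> 'f) set \<Rightarrow> 'w \<Rightarrow> ('w \<times> 'f) set" where
  "candidates X w = {e \<in> EW w. (last_edge X w, e) \<in> gt w \<and>
                       e \<in> C (snd e) (insert e (X \<inter> EF (snd e)))}"

text \<open>\<open>W_admissible X a\<close> says that \<open>a\<close> is the edge \<open>a\<^sub>w\<close> for \<open>w = fst a\<close>.\<close>

definition W_admissible :: "('w \<times> 'f) set \<Rightarrow> 'w \<times> 'f \<Rightarrow> bool" where
  "W_admissible X a \<longleftrightarrow> fst a \<in> W \<and> card (X \<inter> EW (fst a)) = q (fst a) \<and>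
     a \<in> candidates X (fst a) \<and> (\<forall>e\<in>candidates X (fst a) - {a}. (a, e) \<in> gt (fst a))"

text \<open>\<open>tandem X a b\<close> says that \<open>b\<close> is the \<open>F\<close>-admissible edge associated with \<open>a\<close>;
  the tandem passes \<open>snd a\<close>, which is also \<open>snd b\<close>.\<close>

definition tandem :: "('w \<times> 'f) set \<Rightarrow> 'w \<times> 'f \<Rightarrow> 'w \<times> 'f \<Rightarrow> bool" where
  "tandem X a b \<longleftrightarrow> W_admissible X a \<and> b \<in> X \<inter> EF (snd a) \<and>
     C (snd a) (insert a (X \<inter> EF (snd a))) = insert a (X \<inter> EF (snd a) - {b})"

text \<open>
  A subgraph of \<open>D(X)\<close> is a pair \<open>(A, B)\<close>: the edges in \<open>A\<close> are directed from \<open>W\<close> to \<open>F\<close>,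
  those in \<open>B\<close> from \<open>F\<close> to \<open>W\<close>.  Isolated vertices are never represented.
\<close>

definition D_graph :: "('w \<times> 'f) set \<Rightarrow> ('w \<times> 'f) set \<times> ('w \<times> 'f) set" where
  "D_graph X = ({a. W_admissible X a}, {b. \<exists>a. tandem X a b})"

inductive clean_step ::
  "('w \<times> 'f) set \<Rightarrow> ('w \<times> 'f) set \<times> ('w \<times> 'f) set \<Rightarrow> ('w \<times> 'f) set \<times> ('w \<times> 'f) set \<Rightarrow> bool"
  for X where
  "a \<in> A \<Longrightarrow> \<forall>b\<in>B. fst b \<noteq> fst a \<Longrightarrow>
   clean_step X (A, B) (A - {a}, B - {b. tandem X a b \<and> \<not> (\<exists>a'\<in>A - {a}. tandem X a' b)})"

definition active_graph :: "('w \<times> 'f) set \<Rightarrow> ('w \<times> 'f) set \<times> ('w \<times> 'f) set" where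
  "active_graph X = (THE G. (clean_step X)\<^sup>*\<^sup>* (D_graph X) G \<and> \<not> (\<exists>G'. clean_step X G G'))"

text \<open>
  A cycle of the decomposition is listed as the cyclic sequence of the tandems
  \<open>(a, b)\<close> it traverses; from \<open>b\<close> it enters a vertex \<open>w\<close> and leaves \<open>w\<close> by the next \<open>a\<close>.
\<close>

definition active_cycle :: "('w \<times> 'f) set \<Rightarrow> (('w \<times> 'f) \<times> ('w \<times> 'f)) list \<Rightarrow> bool" where
  "active_cycle X ts \<longleftrightarrow> ts \<noteq> [] \<and> distinct (map fst ts) \<and> distinct (map snd ts) \<and>
     (\<forall>(a, b)\<in>set ts. a \<in> fst (active_graph X) \<and> b \<in> snd (active_graph X) \<and> tandem X a b) \<and>
     (\<forall>i<length ts. fst (snd (ts ! i)) = fst (fst (ts ! (Suc i mod length ts))))"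

text \<open>A rotation \<open>L\<close> is the pair \<open>(L\<^sup>+, L\<^sup>-)\<close>.\<close>

definition rotations_at :: "('w \<times> 'f) set \<Rightarrow> (('w \<times> 'f) set \<times> ('w \<times> 'f) set) set" where
  "rotations_at X = {(fst ` set ts, snd ` set ts) |ts. active_cycle X ts}"

subsection \<open>The poset of rotations\<close>

definition apply_rotation ::
  "('w \<times> 'f) set \<times> ('w \<times> 'f) set \<Rightarrow> ('w \<times> 'f) set \<Rightarrow> ('w \<times> 'f) set" where
  "apply_rotation L X = (X - snd L) \<union> fst L"

text \<open>\<open>route X\<^sub>0 Ls X\<^sub>N\<close>: \<open>Ls\<close> is the sequence of rotations of a route from \<open>X\<^sub>0\<close> to \<open>X\<^sub>N\<close>.\<close>

inductive route ::
  "('w \<times> 'f) set \<Rightarrow> (('w \<times> 'f) set \<times> ('w \<times> 'f) set) list \<Rightarrow> ('w \<times> 'f) set \<Rightarrow> bool" where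
  route_Nil: "stable X \<Longrightarrow> route X [] X"
| route_snoc: "route X Ls Y \<Longrightarrow> L \<in> rotations_at Y \<Longrightarrow> route X (Ls @ [L]) (apply_rotation L Y)"

definition full_route :: "(('w \<times> 'f) set \<times> ('w \<times> 'f) set) list \<Rightarrow> bool" where
  "full_route Ls \<longleftrightarrow> route X_min Ls X_max"

text \<open>All full routes use the same set of rotations, which therefore is their union.\<close>

definition rotations :: "(('w \<times> 'f) set \<times> ('w \<times> 'f) set) set" where
  "rotations = (\<Union>Ls\<in>{Ls. full_route Ls}. set Ls)"

definition rot_less ::
  "('w \<times> 'f) set \<times> ('w \<times> 'f) set \<Rightarrow> ('w \<times> 'f) set \<times> ('w \<times> 'f) set \<Rightarrow> bool" where
  "rot_less R R' \<longleftrightarrow> R \<in> rotations \<and> R' \<in> rotations \<and>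
     (\<forall>Ls. full_route Ls \<longrightarrow> (\<exists>i j. i < j \<and> j < length Ls \<and> Ls ! i = R \<and> Ls ! j = R'))"

definition rot_hasse ::
  "('w \<times> 'f) set \<times> ('w \<times> 'f) set \<Rightarrow> ('w \<times> 'f) set \<times> ('w \<times> 'f) set \<Rightarrow> bool" where
  "rot_hasse R R' \<longleftrightarrow> rot_less R R' \<and> \<not> (\<exists>R''. rot_less R R'' \<and> rot_less R'' R')"

end

section \<open>Computational model: random access programs with a choice oracle\<close>

text \<open>
  Memory consists of finitely many (per program) named two-dimensional arrays of natural
  numbers; a scalar \<open>x\<close> is the cell \<open>x[0,0]\<close> and a one-dimensional array uses the second
  index 0.  The arithmetic operations are addition and truncated subtraction only, so that
  unit cost cannot be exploited by multiplying up large numbers.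
\<close>

type_synonym memory = "string \<Rightarrow> nat \<Rightarrow> nat \<Rightarrow> nat"

datatype aexp =
    Const nat
  | Read string aexp aexp
  | Plus aexp aexp
  | Minus aexp aexp

datatype bexp =
    Equal aexp aexp
  | Less aexp aexp
  | Not bexp
  | And bexp bexp

datatype com =
    Skip
  | Write string aexp aexp aexp
  | Oracle aexp string string
  | Seq com com
  | If bexp com com
  | While bexp com

primrec aval :: "aexp \<Rightarrow> memory \<Rightarrow> nat" where
  "aval (Const n) m = n"
| "aval (Read x i j) m = m x (aval i m) (aval j m)"
| "aval (Plus a b) m = aval a m + aval b m"
| "aval (Minus a b) m = aval a m - aval b m"

primrec bval :: "bexp \<Rightarrow> memory \<Rightarrow> bool" where
  "bval (Equal a b) m = (aval a m = aval b m)"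
| "bval (Less a b) m = (aval a m < aval b m)"
| "bval (Not b) m = (\<not> bval b m)"
| "bval (And b c) m = (bval b m \<and> bval c m)"

primrec acost :: "aexp \<Rightarrow> nat" where
  "acost (Const n) = 1"
| "acost (Read x i j) = acost i + acost j + 1"
| "acost (Plus a b) = acost a + acost b + 1"
| "acost (Minus a b) = acost a + acost b + 1"

primrec bcost :: "bexp \<Rightarrow> nat" where
  "bcost (Equal a b) = acost a + acost b + 1"
| "bcost (Less a b) = acost a + acost b + 1"
| "bcost (Not b) = bcost b + 1"
| "bcost (And b c) = bcost b + bcost c + 1"

definition store :: "memory \<Rightarrow> string \<Rightarrow> nat \<Rightarrow> nat \<Rightarrow> nat \<Rightarrow> memory" where
  "store m x i j v = m(x := (m x)(i := (m x i)(j := v)))"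

text \<open>
  Oracle call: the query \<open>Z \<subseteq> E\<^sub>f\<close> is the set of the edges \<open>(w, f)\<close> with a nonzero entry
  \<open>x[w,f]\<close>, and the answer \<open>C\<^sub>f(Z)\<close> is written as a 0/1 vector to the entries \<open>y[w,f]\<close>
  with \<open>(w, f) \<in> E\<^sub>f\<close>.
\<close>

definition oracle_query :: "(nat \<times> nat) set \<Rightarrow> memory \<Rightarrow> string \<Rightarrow> nat \<Rightarrow> (nat \<times> nat) set" where
  "oracle_query E m x f = {(w, f') \<in> E. f' = f \<and> m x w f' \<noteq> 0}"

definition oracle_answer ::
  "(nat \<times> nat) set \<Rightarrow> memory \<Rightarrow> string \<Rightarrow> nat \<Rightarrow> (nat \<times> nat) set \<Rightarrow> memory" where
  "oracle_answer E m y f Z =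
     m(y := (\<lambda>i j. if (i, j) \<in> E \<and> j = f then (if (i, j) \<in> Z then 1 else 0) else m y i j))"

text \<open>
  \<open>exec E C c m t m'\<close>: with the oracles \<open>C\<close> for the graph with edge set \<open>E\<close>, program \<open>c\<close>
  started in memory \<open>m\<close> halts in memory \<open>m'\<close> after time \<open>t\<close>.
\<close>

inductive exec ::
  "(nat \<times> nat) set \<Rightarrow> (nat \<Rightarrow> (nat \<times> nat) set \<Rightarrow> (nat \<times> nat) set) \<Rightarrow>
   com \<Rightarrow> memory \<Rightarrow> nat \<Rightarrow> memory \<Rightarrow> bool"
  for E C where
  exec_Skip: "exec E C Skip m 1 m"
| exec_Write:
    "exec E C (Write x i j a) m (acost i + acost j + acost a + 1)
       (store m x (aval i m) (aval j m) (aval a m))"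
| exec_Oracle:
    "exec E C (Oracle a x y) m (acost a + 1)
       (oracle_answer E m y (aval a m) (C (aval a m) (oracle_query E m x (aval a m))))"
| exec_Seq:
    "exec E C c m t m' \<Longrightarrow> exec E C d m' t' m'' \<Longrightarrow> exec E C (Seq c d) m (t + t') m''"
| exec_IfTrue:
    "bval b m \<Longrightarrow> exec E C c m t m' \<Longrightarrow> exec E C (If b c d) m (bcost b + t + 1) m'"
| exec_IfFalse:
    "\<not> bval b m \<Longrightarrow> exec E C d m t m' \<Longrightarrow> exec E C (If b c d) m (bcost b + t + 1) m'"
| exec_WhileFalse:
    "\<not> bval b m \<Longrightarrow> exec E C (While b c) m (bcost b + 1) m"
| exec_WhileTrue:
    "bval b m \<Longrightarrow> exec E C c m t m' \<Longrightarrow> exec E C (While b c) m' t' m'' \<Longrightarrow>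
     exec E C (While b c) m (bcost b + t + t' + 1) m''"

lemma exec_deterministic:
  assumes "exec E C c m t m'" and "exec E C c m u m''"
  shows "u = t \<and> m'' = m'"
  using assms
proof (induction arbitrary: u m'' rule: exec.induct)
  case exec_Skip
  then show ?case by (auto elim: exec.cases)
next
  case exec_Write
  then show ?case by (auto elim: exec.cases)
next
  case exec_Oracle
  then show ?case by (auto elim: exec.cases)
next
  case exec_Seq
  from exec_Seq.prems exec_Seq.IH show ?case by cases blast
next
  case exec_IfTrue
  from exec_IfTrue.prems exec_IfTrue.IH exec_IfTrue.hyps show ?case by cases blast+
next
  case exec_IfFalse
  from exec_IfFalse.prems exec_IfFalse.IH exec_IfFalse.hyps show ?case by cases blast+
next
  case exec_WhileFalse
  from exec_WhileFalse.prems exec_WhileFalse.hyps show ?case by cases auto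
next
  case exec_WhileTrue
  from exec_WhileTrue.prems exec_WhileTrue.IH exec_WhileTrue.hyps show ?case by cases blast+
qed

subsection \<open>Input and output conventions\<close>

text \<open>
  The vertices are numbered: \<open>W = {..<k}\<close> and \<open>F = {..<l}\<close>.  The edges at \<open>w\<close> and their
  order are given by the list of the neighbours of \<open>w\<close>, the most preferred one first.
\<close>

definition pref_list :: "memory \<Rightarrow> nat \<Rightarrow> (nat \<times> nat) list" where
  "pref_list m w = map (\<lambda>i. (w, m ''pref'' w i)) [0..<m ''deg'' w 0]"

definition input_memory ::
  "nat \<Rightarrow> nat \<Rightarrow> (nat \<times> nat) set \<Rightarrow> (nat \<Rightarrow> (nat \<times> nat) rel) \<Rightarrow> (nat \<Rightarrow> nat) \<Rightarrow> memory \<Rightarrow> bool" where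
  "input_memory k l E gt q m \<longleftrightarrow>
     m ''W_size'' 0 0 = k \<and> m ''F_size'' 0 0 = l \<and>
     (\<forall>w<k. set (pref_list m w) = {e \<in> E. fst e = w} \<and>
            sorted_wrt (\<lambda>e e'. (e, e') \<in> gt w) (pref_list m w) \<and>
            m ''quota'' w 0 = q w) \<and>
     (\<forall>x i j. m x i j \<noteq> 0 \<longrightarrow>
        x \<in> {''W_size'', ''F_size''} \<and> i = 0 \<and> j = 0 \<or>
        x \<in> {''deg'', ''quota''} \<and> i < k \<and> j = 0 \<or>
        x = ''pref'' \<and> i < k \<and> j < m ''deg'' i 0)"

text \<open>
  The rotations are output as a list; the \<open>i\<close>-th one is given by a list of the edges of
  \<open>L\<^sup>+\<close> and a list of the edges of \<open>L\<^sup>-\<close>.  The Hasse diagram is output as an adjacency matrix.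
\<close>

definition plus_list :: "memory \<Rightarrow> nat \<Rightarrow> (nat \<times> nat) list" where
  "plus_list m i = map (\<lambda>j. (m ''plus_w'' i j, m ''plus_f'' i j)) [0..<m ''plus_len'' i 0]"

definition minus_list :: "memory \<Rightarrow> nat \<Rightarrow> (nat \<times> nat) list" where
  "minus_list m i = map (\<lambda>j. (m ''minus_w'' i j, m ''minus_f'' i j)) [0..<m ''minus_len'' i 0]"

definition output_rotation :: "memory \<Rightarrow> nat \<Rightarrow> (nat \<times> nat) set \<times> (nat \<times> nat) set" where
  "output_rotation m i = (set (plus_list m i), set (minus_list m i))"

definition output_poset ::
  "memory \<Rightarrow> ((nat \<times> nat) set \<times> (nat \<times> nat) set) set \<Rightarrow>
   ((nat \<times> nat) set \<times> (nat \<times> nat) set \<Rightarrow> (nat \<times> nat) set \<times> (nat \<times> nat) set \<Rightarrow> bool) \<Rightarrow> bool" where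
  "output_poset m \<R> hasse \<longleftrightarrow>
     (let N = m ''rot_count'' 0 0 in
      bij_betw (output_rotation m) {..<N} \<R> \<and>
      (\<forall>i<N. distinct (plus_list m i) \<and> distinct (minus_list m i)) \<and>
      (\<forall>i<N. \<forall>j<N. m ''hasse'' i j \<noteq> 0 \<longleftrightarrow> hasse (output_rotation m i) (output_rotation m j)))"

end

theory Submission
  imports Defs
begin

text \<open>
  Cleaning never destroys a cycle of tandems, so the rotations at a stable matching are exactly
  the cycles of the partial map that sends \<open>w\<close> to the end in \<open>W\<close> of the edge associated with
  \<open>a\<^sub>w\<close> (\<open>rotations_at_iff\<close>).  Two facts about tandems carry the theory.  A tandem \<open>(a, b)\<close>
  remains one at every \<open>F\<close>-better stable matching that still contains \<open>b\<close>, since a firm that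
  refuses \<open>b\<close> goes on refusing it when more is on offer (\<open>tandem_persists\<close>).  And an admissible edge
  that generates no tandem never gets one (\<open>free_persists\<close>), since all stable matchings have
  the same cardinality at each vertex (\<open>join_cards\<close>).  It follows that rotations which are
  available together commute (\<open>rotations_commute\<close>), and that a rotation which becomes available
  after each of two such rotations alone was available before them (\<open>rotation_meet\<close>): a tandem
  standing in its way has to lose its second edge, and only one of the two can take that edge.
  The first property makes the set of rotations independent of the full route.  By the second, a
  rotation never has a choice between alternative predecessors, so that whatever makes it
  available anywhere precedes it everywhere (\<open>enabling_precedes\<close>).

  This yields the immediate successors of a rotation \<open>r\<close> from a single full route: go through
  the route once, skip \<open>r\<close>, and apply each other rotation if it is available at its turn.  The
  rotations that are applied are those not above \<open>r\<close>; and when \<open>r\<close> is applied at the end, its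
  immediate successors are what is available then (\<open>greedy_hasse\<close>).

  The program first finds \<open>X\<^sup>m\<^sup>i\<^sup>n\<close> by deferred acceptance.  It finds a full route by walking
  from vertex to vertex along tandems.  The walk is kept on a stack, because computing a tandem
  requires a scan for the dropped edge: when the walk closes a cycle, this rotation is applied
  and cut off the top, and by \<open>tandem_persists\<close> the tandems below remain valid; when the walk
  cannot continue, no vertex on it will ever be on a rotation, so all of them are discarded
  (\<open>stuck_backwards\<close>).  So there are \<open>O(|E| + |W|)\<close> steps of cost \<open>O(|E| + |W|)\<close>.  Finally, for
  each \<open>r\<close>, the pass described above is made.  Here the tandems of the rotations are known, and they
  do not depend on the matching at which a rotation is available (\<open>rotation_pairs\<close>); so availability
  is tested without scanning, with one oracle call for each tandem and for each edge passed by
  the pointers into the preference lists.  As rejections are never revoked (\<open>settled_mono\<close>), the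
  pointers only advance and a pass takes \<open>O(|E|)\<close> steps.  Each rotation advances a pointer, so
  there are at most \<open>|E|\<close> rotations, and \<open>|W| \<le> |E| + 1\<close> because the graph is connected.
\<close>

section \<open>Choice functions and stability\<close>

lemma (in bipartite_graph) finite_E [simp]: "finite E"
  using finite_subset[OF edges] finite_W finite_F by auto

lemma (in bipartite_graph) EW_iff: "e \<in> EW w \<longleftrightarrow> e \<in> E \<and> fst e = w"
  by (auto simp: EW_def)

lemma (in bipartite_graph) EF_iff: "e \<in> EF f \<longleftrightarrow> e \<in> E \<and> snd e = f"
  by (auto simp: EF_def)

lemma (in bipartite_graph) finite_EW [simp]: "finite (EW w)"
  by (simp add: EW_def)

lemma (in bipartite_graph) finite_EF [simp]: "finite (EF f)"
  by (simp add: EF_def)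

lemma (in bipartite_graph) edge_ends: "e \<in> E \<Longrightarrow> fst e \<in> W" "e \<in> E \<Longrightarrow> snd e \<in> F"
  using edges by auto

lemma (in bipartite_graph) card_by_W:
  assumes "S \<subseteq> E" shows "card S = (\<Sum>w\<in>W. card (S \<inter> EW w))"
proof -
  have "S = (\<Union>w\<in>W. S \<inter> EW w)"
    using assms edge_ends by (auto simp: EW_iff)
  moreover have "card (\<Union>w\<in>W. S \<inter> EW w) = (\<Sum>w\<in>W. card (S \<inter> EW w))"
    by (rule card_UN_disjoint) (auto simp: finite_W EW_iff)
  ultimately show ?thesis by simp
qed

lemma (in bipartite_graph) card_by_F:
  assumes "S \<subseteq> E" shows "card S = (\<Sum>f\<in>F. card (S \<inter> EF f))"
proof -
  have "S = (\<Union>f\<in>F. S \<inter> EF f)"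
    using assms edge_ends by (auto simp: EF_iff)
  moreover have "card (\<Union>f\<in>F. S \<inter> EF f) = (\<Sum>f\<in>F. card (S \<inter> EF f))"
    by (rule card_UN_disjoint) (auto simp: finite_F EF_iff)
  ultimately show ?thesis by simp
qed

context stable_market
begin

lemma gt_trans: "w \<in> W \<Longrightarrow> (x, y) \<in> gt w \<Longrightarrow> (y, z) \<in> gt w \<Longrightarrow> (x, z) \<in> gt w"
  using gt_linear unfolding strict_linear_order_on_def by (meson transD)

lemma gt_irrefl: "w \<in> W \<Longrightarrow> (x, x) \<notin> gt w"
  using gt_linear unfolding strict_linear_order_on_def by (meson irreflD)

lemma gt_asym: "w \<in> W \<Longrightarrow> (x, y) \<in> gt w \<Longrightarrow> (y, x) \<notin> gt w"
  using gt_trans gt_irrefl by blast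

lemma gt_total: "w \<in> W \<Longrightarrow> x \<in> EW w \<Longrightarrow> y \<in> EW w \<Longrightarrow> x \<noteq> y \<Longrightarrow> (x, y) \<in> gt w \<or> (y, x) \<in> gt w"
  using gt_linear unfolding strict_linear_order_on_def total_on_def by blast

lemma extremal_edges:
  assumes w: "w \<in> W" and S: "S \<noteq> {}" "S \<subseteq> EW w"
  shows "\<exists>x\<in>S. \<forall>e\<in>S - {x}. (x, e) \<in> gt w" "\<exists>x\<in>S. \<forall>e\<in>S - {x}. (e, x) \<in> gt w"
proof -
  have "finite S" using finite_subset[OF S(2)] by simp
  then have "(\<exists>x\<in>S. \<forall>e\<in>S - {x}. (x, e) \<in> gt w) \<and> (\<exists>x\<in>S. \<forall>e\<in>S - {x}. (e, x) \<in> gt w)"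
    using S
  proof (induction rule: finite_ne_induct)
    case (insert a S)
    then obtain x y where x: "x \<in> S" "\<forall>e\<in>S - {x}. (x, e) \<in> gt w" and y: "y \<in> S" "\<forall>e\<in>S - {y}. (e, y) \<in> gt w"
      by blast
    have a: "(a, z) \<in> gt w \<or> (z, a) \<in> gt w" if "z \<in> S" for z
      using gt_total[OF w, of a z] insert that by blast
    have "\<exists>x\<in>insert a S. \<forall>e\<in>insert a S - {x}. (x, e) \<in> gt w"
    proof (cases "(a, x) \<in> gt w")
      case True
      then have "\<forall>e\<in>insert a S - {a}. (a, e) \<in> gt w" using x gt_trans[OF w] by blast
      then show ?thesis by blast
    qed (use x a in blast)
    moreover have "\<exists>x\<in>insert a S. \<forall>e\<in>insert a S - {x}. (e, x) \<in> gt w"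
    proof (cases "(y, a) \<in> gt w")
      case True
      then have "\<forall>e\<in>insert a S - {a}. (e, a) \<in> gt w" using y gt_trans[OF w] by blast
      then show ?thesis by blast
    qed (use y a in blast)
    ultimately show ?case by blast
  qed auto
  then show "\<exists>x\<in>S. \<forall>e\<in>S - {x}. (x, e) \<in> gt w" "\<exists>x\<in>S. \<forall>e\<in>S - {x}. (e, x) \<in> gt w" by auto
qed

text \<open>
  Ranking the edges of \<open>Z\<close> is a bijection onto \<open>{..<card Z}\<close>, so the edges of rank below the
  quota satisfy the characterisation of the choice.  Any other set of this size would contain an
  edge outside and miss an edge inside, each of them preferred to the other.
\<close>

lemma CW_eq:
  assumes w: "w \<in> W" and Z: "Z \<subseteq> EW w"
  shows "CW w Z = {p \<in> Z. card {y \<in> Z. (y, p) \<in> gt w} < q w}"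
    and "card (CW w Z) = min (q w) (card Z)"
proof -
  define rk where "rk p = card {y \<in> Z. (y, p) \<in> gt w}" for p
  define T where "T = {p \<in> Z. rk p < q w}"
  have fin: "finite Z" using Z finite_EW finite_subset by blast
  have rk_less: "rk x < rk y" if "x \<in> Z" "y \<in> Z" "(x, y) \<in> gt w" for x y
  proof -
    have "{z \<in> Z. (z, x) \<in> gt w} \<subset> {z \<in> Z. (z, y) \<in> gt w}"
      using that gt_trans[OF w] gt_irrefl[OF w] by blast
    then show ?thesis unfolding rk_def using fin by (intro psubset_card_mono) auto
  qed
  have tot: "(x, y) \<in> gt w \<or> (y, x) \<in> gt w" if "x \<in> Z" "y \<in> Z" "x \<noteq> y" for x y
    using gt_total[OF w] that Z by blast
  have inj: "inj_on rk Z"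
    by (rule inj_onI) (metis rk_less tot less_irrefl)
  have "rk p < card Z" if "p \<in> Z" for p
    unfolding rk_def using fin
  proof (rule psubset_card_mono)
    show "{y \<in> Z. (y, p) \<in> gt w} \<subset> Z" using that gt_irrefl[OF w] by blast
  qed
  then have "rk ` Z \<subseteq> {..<card Z}" by auto
  then have img: "rk ` Z = {..<card Z}"
    using card_image[OF inj] by (intro card_subset_eq) auto
  have "rk ` T = {..<min (q w) (card Z)}"
  proof -
    have "rk ` T = rk ` Z \<inter> {..<q w}" unfolding T_def by auto
    then show ?thesis unfolding img by auto
  qed
  moreover have "inj_on rk T" using inj unfolding T_def by (rule inj_on_subset) auto
  ultimately have cT: "card T = min (q w) (card Z)"
    by (metis card_image card_lessThan)
  have dom: "(e, e') \<in> gt w" if "e \<in> T" "e' \<in> Z - T" for e e'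
  proof -
    have "\<not> (e', e) \<in> gt w" "e \<noteq> e'" "e \<in> Z" "e' \<in> Z"
      using that rk_less[of e' e] unfolding T_def by auto
    then show ?thesis using tot by blast
  qed
  have "CW w Z = T" unfolding CW_def
  proof (rule the_equality)
    show "T \<subseteq> Z \<and> card T = min (q w) (card Z) \<and> (\<forall>e\<in>T. \<forall>e'\<in>Z - T. (e, e') \<in> gt w)"
      using cT dom unfolding T_def by blast
  next
    fix T' assume T': "T' \<subseteq> Z \<and> card T' = min (q w) (card Z) \<and> (\<forall>e\<in>T'. \<forall>e'\<in>Z - T'. (e, e') \<in> gt w)"
    have TZ: "T \<subseteq> Z" unfolding T_def by auto
    have finT: "finite T" "finite T'" using TZ T' fin finite_subset by auto
    show "T' = T"
    proof (cases "T' \<subseteq> T")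
      case True
      then show ?thesis using cT T' finT by (intro card_subset_eq) auto
    next
      case False
      then obtain p where p: "p \<in> T'" "p \<notin> T" by auto
      have "\<not> T \<subseteq> T'" using p cT T' finT card_subset_eq[of T' T] by auto
      then obtain p' where p': "p' \<in> T" "p' \<notin> T'" by auto
      have "(p, p') \<in> gt w" "(p', p) \<in> gt w" using p p' T' dom TZ by blast+
      then show ?thesis using gt_asym[OF w] by blast
    qed
  qed
  then show "CW w Z = {p \<in> Z. card {y \<in> Z. (y, p) \<in> gt w} < q w}" "card (CW w Z) = min (q w) (card Z)"
    using cT unfolding T_def rk_def by auto
qed

lemma choice_idem: "f \<in> F \<Longrightarrow> Z \<subseteq> EF f \<Longrightarrow> C f (C f Z) = C f Z"
  using A1[of f Z "C f Z"] choice_subset by blast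

lemma path_independence:
  assumes "f \<in> F" "Z \<subseteq> EF f" "Z' \<subseteq> EF f"
  shows "C f (C f Z \<union> Z') = C f (Z \<union> Z')"
proof (rule A1)
  show "C f (Z \<union> Z') \<subseteq> C f Z \<union> Z'"
    using A2[of f "Z \<union> Z'" Z] choice_subset[of f "Z \<union> Z'"] assms by auto
  show "C f Z \<union> Z' \<subseteq> Z \<union> Z'"
    using choice_subset[of f Z] assms by auto
qed (use assms in auto)

definition accepts :: "('w \<times> 'f) set \<Rightarrow> 'w \<times> 'f \<Rightarrow> bool" where
  "accepts X e \<longleftrightarrow> e \<in> C (snd e) (insert e (X \<inter> EF (snd e)))"

definition F_acceptable :: "('w \<times> 'f) set \<Rightarrow> bool" where
  "F_acceptable X \<longleftrightarrow> X \<subseteq> E \<and> (\<forall>f\<in>F. C f (X \<inter> EF f) = X \<inter> EF f)"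

lemma F_acceptableD:
  assumes "F_acceptable X" shows "X \<subseteq> E" "f \<in> F \<Longrightarrow> C f (X \<inter> EF f) = X \<inter> EF f"
  using assms unfolding F_acceptable_def by auto

text \<open>
  With respect to a linear order and a quota, an edge is refused iff the quota is used up by better
  edges.  So the conditions at \<open>W\<close> become cardinalities.
\<close>

lemma stable_iff:
  "stable X \<longleftrightarrow> F_acceptable X \<and> (\<forall>w\<in>W. card (X \<inter> EW w) \<le> q w) \<and>
     (\<forall>e\<in>E - X. accepts X e \<longrightarrow>
        card (X \<inter> EW (fst e)) = q (fst e) \<and> (\<forall>y\<in>X \<inter> EW (fst e). (y, e) \<in> gt (fst e)))"
proof -
  have quota: "CW w (X \<inter> EW w) = X \<inter> EW w \<longleftrightarrow> card (X \<inter> EW w) \<le> q w" if w: "w \<in> W" for w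
  proof
    assume "CW w (X \<inter> EW w) = X \<inter> EW w"
    then show "card (X \<inter> EW w) \<le> q w" using CW_eq(2)[OF w, of "X \<inter> EW w"] by auto
  next
    assume le: "card (X \<inter> EW w) \<le> q w"
    have "card (CW w (X \<inter> EW w)) = card (X \<inter> EW w)"
      using CW_eq(2)[OF w, of "X \<inter> EW w"] le by auto
    then show "CW w (X \<inter> EW w) = X \<inter> EW w"
      using CW_eq(1)[OF w, of "X \<inter> EW w"] by (intro card_subset_eq) auto
  qed
  have block: "e \<in> CW (fst e) (insert e (X \<inter> EW (fst e))) \<longleftrightarrow>
      \<not> (card (X \<inter> EW (fst e)) = q (fst e) \<and> (\<forall>y\<in>X \<inter> EW (fst e). (y, e) \<in> gt (fst e)))"
    if e: "e \<in> E - X" and le: "card (X \<inter> EW (fst e)) \<le> q (fst e)" for e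
  proof -
    let ?w = "fst e" and ?Y = "{y \<in> X \<inter> EW (fst e). (y, e) \<in> gt (fst e)}"
    have w: "?w \<in> W" using e edge_ends by auto
    have "{y \<in> insert e (X \<inter> EW ?w). (y, e) \<in> gt ?w} = ?Y"
      using gt_irrefl[OF w] by auto
    then have *: "e \<in> CW ?w (insert e (X \<inter> EW ?w)) \<longleftrightarrow> card ?Y < q ?w"
      using CW_eq(1)[OF w, of "insert e (X \<inter> EW ?w)"] e by (auto simp: EW_iff)
    have fin: "finite (X \<inter> EW ?w)" by simp
    have "card ?Y \<le> card (X \<inter> EW ?w)" by (rule card_mono) auto
    moreover have "card ?Y = card (X \<inter> EW ?w) \<longleftrightarrow> ?Y = X \<inter> EW ?w"
      using card_subset_eq[OF fin, of ?Y] by auto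
    ultimately show ?thesis unfolding * using le by auto
  qed
  show ?thesis
  proof (cases "F_acceptable X \<and> (\<forall>w\<in>W. card (X \<inter> EW w) \<le> q w)")
    case True
    then have "acceptable X" unfolding acceptable_def F_acceptable_def using quota by auto
    then have "stable X \<longleftrightarrow> \<not> (\<exists>e\<in>E - X. e \<in> CW (fst e) (insert e (X \<inter> EW (fst e))) \<and> accepts X e)"
      unfolding stable_def accepts_def by force
    then show ?thesis using True block edge_ends by blast
  next
    case False
    then show ?thesis unfolding stable_def acceptable_def F_acceptable_def using quota by auto
  qed
qed

lemma stableD:
  assumes "stable X"
  shows "F_acceptable X" "X \<subseteq> E" "w \<in> W \<Longrightarrow> card (X \<inter> EW w) \<le> q w"
    "f \<in> F \<Longrightarrow> C f (X \<inter> EF f) = X \<inter> EF f"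
    "e \<in> E - X \<Longrightarrow> accepts X e \<Longrightarrow> card (X \<inter> EW (fst e)) = q (fst e)"
    "e \<in> E - X \<Longrightarrow> accepts X e \<Longrightarrow> y \<in> X \<inter> EW (fst e) \<Longrightarrow> (y, e) \<in> gt (fst e)"
  using assms unfolding stable_iff F_acceptable_def by auto

subsection \<open>The order of the firms\<close>

definition leF :: "('w \<times> 'f) set \<Rightarrow> ('w \<times> 'f) set \<Rightarrow> bool" where
  "leF X Y \<longleftrightarrow> (\<forall>f\<in>F. C f ((X \<inter> EF f) \<union> (Y \<inter> EF f)) = Y \<inter> EF f)"

lemma leFD: "leF X Y \<Longrightarrow> f \<in> F \<Longrightarrow> C f ((X \<inter> EF f) \<union> (Y \<inter> EF f)) = Y \<inter> EF f"
  unfolding leF_def by auto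

lemma leF_refl: "F_acceptable X \<Longrightarrow> leF X X"
  unfolding leF_def F_acceptable_def by auto

lemma leF_trans:
  assumes XY: "leF X Y" and YZ: "leF Y Z" shows "leF X Z"
  unfolding leF_def
proof
  fix f assume f: "f \<in> F"
  let ?X = "X \<inter> EF f" and ?Y = "Y \<inter> EF f" and ?Z = "Z \<inter> EF f"
  have "C f (?X \<union> ?Z) = C f (C f (?Y \<union> ?Z) \<union> ?X)"
    using leFD[OF YZ f] by (simp add: Un_commute)
  also have "\<dots> = C f (?Y \<union> ?Z \<union> ?X)" using f by (intro path_independence) auto
  also have "\<dots> = C f (?X \<union> ?Y \<union> ?Z)" by (simp add: Un_ac)
  also have "\<dots> = C f (C f (?X \<union> ?Y) \<union> ?Z)" using f by (intro path_independence[symmetric]) auto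
  also have "\<dots> = ?Z" using leFD[OF XY f] leFD[OF YZ f] by simp
  finally show "C f (?X \<union> ?Z) = ?Z" .
qed

lemma eq_by_F: "X \<subseteq> E \<Longrightarrow> Y \<subseteq> E \<Longrightarrow> (\<And>f. f \<in> F \<Longrightarrow> X \<inter> EF f = Y \<inter> EF f) \<Longrightarrow> X = Y"
proof -
  assume a: "X \<subseteq> E" "Y \<subseteq> E" "\<And>f. f \<in> F \<Longrightarrow> X \<inter> EF f = Y \<inter> EF f"
  have "e \<in> X \<longleftrightarrow> e \<in> Y" if "e \<in> E" for e
    using a(3)[OF edge_ends(2)[OF that]] that EF_iff by blast
  then show ?thesis using a by blast
qed

lemma leF_antisym: "leF X Y \<Longrightarrow> leF Y X \<Longrightarrow> X \<subseteq> E \<Longrightarrow> Y \<subseteq> E \<Longrightarrow> X = Y"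
proof (rule eq_by_F)
  fix f assume a: "leF X Y" "leF Y X" "f \<in> F"
  show "X \<inter> EF f = Y \<inter> EF f"
    using leFD[OF a(1,3)] leFD[OF a(2,3)] by (simp add: Un_commute)
qed

lemma prec_F_iff: "prec_F X Y \<longleftrightarrow> acceptable X \<and> acceptable Y \<and> X \<noteq> Y \<and> leF X Y"
  unfolding prec_F_def leF_def by (auto simp: Un_commute)

text \<open>
  The two extreme matchings are defined by minimality and maximality; in the applications a least
  and a greatest element are at hand.
\<close>

lemma X_min_eq:
  assumes "stable X" and least: "\<And>Y. stable Y \<Longrightarrow> leF X Y"
  shows "X_min = X"
  unfolding X_min_def
proof (rule the_equality)
  show "stable X \<and> \<not> (\<exists>Y. stable Y \<and> prec_F Y X)"
    using assms leF_antisym stableD(2) unfolding prec_F_iff by metis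
  show "Y = X" if "stable Y \<and> \<not> (\<exists>Z. stable Z \<and> prec_F Z Y)" for Y
    using that assms unfolding prec_F_iff stable_def by blast
qed

lemma X_max_eq:
  assumes "stable X" and greatest: "\<And>Y. stable Y \<Longrightarrow> leF Y X"
  shows "X_max = X"
  unfolding X_max_def
proof (rule the_equality)
  show "stable X \<and> \<not> (\<exists>Y. stable Y \<and> prec_F X Y)"
    using assms leF_antisym stableD(2) unfolding prec_F_iff by metis
  show "Y = X" if "stable Y \<and> \<not> (\<exists>Z. stable Z \<and> prec_F Y Z)" for Y
    using that assms unfolding prec_F_iff stable_def by blast
qed

text \<open>
  Path independence: what was on offer in the worse matching \<open>X\<close> may be added to the offers at
  \<open>Y\<close> without any effect.  All monotonicity along the order of the firms comes from here.
\<close>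

lemma choice_insert:
  assumes "leF X Y" "e \<in> E"
  shows "C (snd e) (insert e (Y \<inter> EF (snd e))) =
         C (snd e) (insert e ((X \<inter> EF (snd e)) \<union> (Y \<inter> EF (snd e))))"
proof -
  let ?f = "snd e"
  have f: "?f \<in> F" "{e} \<subseteq> EF ?f" using assms edge_ends by (auto simp: EF_iff)
  show ?thesis
    using path_independence[OF f(1) _ f(2), of "(X \<inter> EF ?f) \<union> (Y \<inter> EF ?f)"] leFD[OF assms(1) f(1)]
    by simp
qed

text \<open>
  Neither kind of edge is ever added by a later rotation: \<open>F\<close>-improvement keeps rejected
  edges rejected, and an edge that was given up has been rejected.
\<close>

definition settled :: "('w \<times> 'f) set \<Rightarrow> 'w \<times> 'f \<Rightarrow> bool" where
  "settled X e \<longleftrightarrow> e \<in> X \<or> \<not> accepts X e"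

lemma accepts_antimono:
  assumes "leF X Y" "e \<in> E" "accepts Y e" shows "accepts X e"
proof -
  let ?f = "snd e"
  have f: "?f \<in> F" "e \<in> EF ?f" using assms edge_ends by (auto simp: EF_iff)
  have "e \<in> C ?f (insert e ((X \<inter> EF ?f) \<union> (Y \<inter> EF ?f)))"
    using assms choice_insert unfolding accepts_def by blast
  then show ?thesis
    using A2[OF f(1), of "insert e ((X \<inter> EF ?f) \<union> (Y \<inter> EF ?f))" "insert e (X \<inter> EF ?f)"] f
    unfolding accepts_def by auto
qed

lemma settled_mono:
  assumes le: "leF X Y" and e: "e \<in> E" and s: "settled X e" shows "settled Y e"
proof (cases "e \<in> X \<and> e \<notin> Y")
  case True
  let ?f = "snd e"
  have f: "?f \<in> F" "e \<in> EF ?f" using e edge_ends by (auto simp: EF_iff)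
  have "insert e ((X \<inter> EF ?f) \<union> (Y \<inter> EF ?f)) = (X \<inter> EF ?f) \<union> (Y \<inter> EF ?f)" using True f by auto
  then show ?thesis
    using choice_insert[OF le e] leFD[OF le f(1)] True unfolding settled_def accepts_def by auto
next
  case False
  then show ?thesis using accepts_antimono[OF le e] s unfolding settled_def by auto
qed

text \<open>
  Cardinal monotonicity and substitutability leave only one way for the choice from
  \<open>X\<^sub>f \<union> A\<close> once \<open>card A\<close> members of \<open>X\<^sub>f\<close> are known to be rejected.
\<close>

lemma choice_exchange:
  assumes X: "F_acceptable X" and f: "f \<in> F"
    and A: "A \<subseteq> EF f" "A \<inter> X = {}" and B: "B \<subseteq> X \<inter> EF f" and card: "card A \<le> card B"
    and rej: "B \<inter> C f ((X \<inter> EF f) \<union> A) = {}"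
  shows "C f ((X \<inter> EF f) \<union> A) = (X \<inter> EF f - B) \<union> A"
proof -
  let ?X = "X \<inter> EF f"
  have fin: "finite A" "finite B" using A(1) B finite_subset[OF _ finite_EF] by blast+
  have "C f (?X \<union> A) \<subseteq> (?X - B) \<union> A"
    using choice_subset[OF f, of "?X \<union> A"] rej A by blast
  moreover have "card ((?X - B) \<union> A) \<le> card ?X"
  proof -
    have "card (?X - B) = card ?X - card B" using B fin by (intro card_Diff_subset) auto
    moreover have "card B \<le> card ?X" using B by (intro card_mono) auto
    moreover have "card ((?X - B) \<union> A) \<le> card (?X - B) + card A" by (rule card_Un_le)
    ultimately show ?thesis using card by linarith
  qed
  moreover have "card ?X \<le> card (C f (?X \<union> A))"
    using A3[OF f, of "?X \<union> A" ?X] A F_acceptableD(2)[OF X f] by auto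
  moreover have "finite ((?X - B) \<union> A)" using fin by auto
  ultimately show ?thesis by (meson card_seteq le_trans)
qed

subsection \<open>Admissible edges and tandems of a stable matching\<close>

lemma candidates_eq:
  assumes X: "stable X" and w: "w \<in> W" and full: "card (X \<inter> EW w) = q w"
  shows "candidates X w = {e \<in> EW w. \<not> settled X e}"
proof -
  let ?x = "last_edge X w"
  have "card (X \<inter> EW w) > 0" using quota_pos[OF w] full by simp
  then have ne: "X \<inter> EW w \<noteq> {}" by (metis card.empty less_irrefl)
  have uniq: "\<exists>!x. x \<in> X \<inter> EW w \<and> (\<forall>e\<in>X \<inter> EW w - {x}. (e, x) \<in> gt w)"
    using extremal_edges(2)[OF w, of "X \<inter> EW w"] ne gt_asym[OF w] by (metis Diff_iff Int_lower2 singletonD)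
  have last: "?x \<in> X \<inter> EW w" "\<And>e. e \<in> X \<inter> EW w - {?x} \<Longrightarrow> (e, ?x) \<in> gt w"
    using theI'[OF uniq] unfolding last_edge_def[symmetric] by blast+
  have "e \<notin> X" if "(?x, e) \<in> gt w" "e \<in> EW w" for e
    using that last(2)[of e] gt_asym[OF w] gt_irrefl[OF w] by blast
  moreover have "(?x, e) \<in> gt w" if "e \<in> EW w" "e \<notin> X" "accepts X e" for e
    using that last(1) stableD(6)[OF X, of e ?x] by (auto simp: EW_iff)
  ultimately show ?thesis unfolding candidates_def settled_def accepts_def by auto
qed

text \<open>In a stable matching only a fully filled vertex has an edge outside the matching that
  the other side accepts, and that edge then lies below all matched ones.\<close>

lemma W_admissible_iff:
  assumes X: "stable X"
  shows "W_admissible X a \<longleftrightarrow> a \<in> E \<and> \<not> settled X a \<and>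
    (\<forall>e\<in>E. fst e = fst a \<and> \<not> settled X e \<and> e \<noteq> a \<longrightarrow> (a, e) \<in> gt (fst a))"
proof (cases "a \<in> E \<and> \<not> settled X a")
  case True
  then have "fst a \<in> W" "card (X \<inter> EW (fst a)) = q (fst a)"
    using edge_ends stableD(5)[OF X] unfolding settled_def by auto
  then show ?thesis unfolding W_admissible_def using True candidates_eq[OF X]
    by (auto simp: EW_iff)
next
  case False
  then show ?thesis unfolding W_admissible_def using candidates_eq[OF X] by (auto simp: EW_iff)
qed

lemma W_admissible_unique:
  assumes "stable X" "W_admissible X a" "W_admissible X a'" "fst a = fst a'"
  shows "a = a'"
  using assms unfolding W_admissible_iff[OF assms(1)] using gt_asym edge_ends(1) by metis

lemma W_admissible_exists:
  assumes X: "stable X" and e: "e \<in> E" "\<not> settled X e"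
  shows "\<exists>a. W_admissible X a \<and> fst a = fst e \<and> (a = e \<or> (a, e) \<in> gt (fst e))"
proof -
  let ?w = "fst e" and ?S = "{a \<in> E. fst a = fst e \<and> \<not> settled X a}"
  have w: "?w \<in> W" using e edge_ends by auto
  obtain a where a: "a \<in> ?S" "\<forall>e'\<in>?S - {a}. (a, e') \<in> gt ?w"
  proof (rule bexE[OF extremal_edges(1)[OF w]])
    show "?S \<noteq> {}" using e by blast
    show "?S \<subseteq> EW ?w" using EW_iff by blast
  qed
  then have "W_admissible X a" unfolding W_admissible_iff[OF X] by auto
  then show ?thesis using a e by blast
qed

lemma tandem_iff:
  assumes X: "stable X"
  shows "tandem X a b \<longleftrightarrow> W_admissible X a \<and> b \<in> X \<inter> EF (snd a) \<and>
    b \<notin> C (snd a) (insert a (X \<inter> EF (snd a)))"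
proof
  assume t: "tandem X a b"
  then have "a \<notin> X" unfolding tandem_def W_admissible_iff[OF X] settled_def by auto
  then show "W_admissible X a \<and> b \<in> X \<inter> EF (snd a) \<and> b \<notin> C (snd a) (insert a (X \<inter> EF (snd a)))"
    using t unfolding tandem_def by auto
next
  assume a: "W_admissible X a \<and> b \<in> X \<inter> EF (snd a) \<and> b \<notin> C (snd a) (insert a (X \<inter> EF (snd a)))"
  then have aE: "a \<in> E" "a \<notin> X" unfolding W_admissible_iff[OF X] settled_def by auto
  have "C (snd a) ((X \<inter> EF (snd a)) \<union> {a}) = (X \<inter> EF (snd a) - {b}) \<union> {a}"
    using a aE edge_ends(2) by (intro choice_exchange stableD(1)[OF X]) (auto simp: EF_iff)
  then show "tandem X a b" unfolding tandem_def using a by auto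
qed

lemma tandemD:
  assumes "stable X" "tandem X a b"
  shows "W_admissible X a" "a \<in> E" "a \<notin> X" "b \<in> X" "b \<in> E" "snd b = snd a" "\<not> settled X a"
    "b \<notin> C (snd a) (insert a (X \<inter> EF (snd a)))" "accepts X a"
  using assms unfolding tandem_iff[OF assms(1)] W_admissible_iff[OF assms(1)] settled_def
  by (auto simp: EF_iff)

lemma tandem_unique: "stable X \<Longrightarrow> tandem X a b \<Longrightarrow> tandem X a b' \<Longrightarrow> b = b'"
proof -
  assume X: "stable X" and t: "tandem X a b" "tandem X a b'"
  have "a \<notin> X" using t(1) W_admissible_iff[OF X] unfolding tandem_def settled_def by auto
  moreover have "insert a (X \<inter> EF (snd a) - {b}) = insert a (X \<inter> EF (snd a) - {b'})"
    "b \<in> X \<inter> EF (snd a)" using t unfolding tandem_def by auto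
  ultimately show "b = b'" by (metis Diff_iff Int_iff insert_iff singletonD singletonI)
qed

lemma no_tandem:
  assumes X: "stable X" and a: "W_admissible X a" and no: "\<nexists>b. tandem X a b"
  shows "C (snd a) (insert a (X \<inter> EF (snd a))) = insert a (X \<inter> EF (snd a))"
proof -
  have aE: "a \<in> E" "accepts X a"
    using a unfolding W_admissible_iff[OF X] settled_def by auto
  have "X \<inter> EF (snd a) \<subseteq> C (snd a) (insert a (X \<inter> EF (snd a)))"
    using no a unfolding tandem_iff[OF X] by blast
  moreover have "C (snd a) (insert a (X \<inter> EF (snd a))) \<subseteq> insert a (X \<inter> EF (snd a))"
    using aE edge_ends by (intro choice_subset) (auto simp: EF_iff)
  ultimately show ?thesis using aE(2) unfolding accepts_def by auto
qed

end

context stable_market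
begin

section \<open>Rural hospitals\<close>

definition join :: "('w \<times> 'f) set \<Rightarrow> ('w \<times> 'f) set \<Rightarrow> ('w \<times> 'f) set" where
  "join X Y = {e \<in> E. e \<in> C (snd e) ((X \<inter> EF (snd e)) \<union> (Y \<inter> EF (snd e)))}"

lemma join_F: "f \<in> F \<Longrightarrow> join X Y \<inter> EF f = C f ((X \<inter> EF f) \<union> (Y \<inter> EF f))"
  using choice_subset[of f "(X \<inter> EF f) \<union> (Y \<inter> EF f)"] unfolding join_def by (auto simp: EF_iff)

lemma join_subset: "join X Y \<subseteq> X \<union> Y"
proof
  fix e assume e: "e \<in> join X Y"
  then have "snd e \<in> F" using edge_ends unfolding join_def by blast
  then show "e \<in> X \<union> Y"
    using e choice_subset[of "snd e" "(X \<inter> EF (snd e)) \<union> (Y \<inter> EF (snd e))"] unfolding join_def by blast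
qed

text \<open>
  The proof counts.  The choice of the workers and the choice of the firms from \<open>X \<union> Y\<close>
  have only members of \<open>X \<inter> Y\<close> in common: an edge of \<open>X - Y\<close> which both ends choose would
  block \<open>Y\<close>.  So together they have at most \<open>card X + card Y\<close> elements, while by cardinal
  monotonicity each of them has, vertex by vertex, at least as many as \<open>X\<close> and as \<open>Y\<close>.
  Hence equality holds everywhere.
\<close>

lemma join_cards:
  assumes X: "stable X" and Y: "stable Y"
  shows "f \<in> F \<Longrightarrow> card (join X Y \<inter> EF f) = card (X \<inter> EF f)"
    and "f \<in> F \<Longrightarrow> card (X \<inter> EF f) = card (Y \<inter> EF f)"
    and "w \<in> W \<Longrightarrow> card (join X Y \<inter> EW w) = card (X \<inter> EW w)"
proof -
  define Z where "Z = join X Y"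
  define V where "V = {e \<in> E. e \<in> CW (fst e) ((X \<inter> EW (fst e)) \<union> (Y \<inter> EW (fst e)))}"
  note XE = stableD(2)[OF X] and YE = stableD(2)[OF Y]
  have CWsub: "CW w U \<subseteq> U" if "w \<in> W" "U \<subseteq> EW w" for w U
    using CW_eq(1)[OF that] by auto
  have Vw: "V \<inter> EW w = CW w ((X \<inter> EW w) \<union> (Y \<inter> EW w))" if w: "w \<in> W" for w
    using CWsub[OF w, of "(X \<inter> EW w) \<union> (Y \<inter> EW w)"] unfolding V_def by (auto simp: EW_iff)
  have VXY: "V \<subseteq> X \<union> Y"
  proof
    fix e assume e: "e \<in> V"
    then have "fst e \<in> W" using edge_ends unfolding V_def by blast
    then show "e \<in> X \<union> Y"
      using e CWsub[of "fst e" "(X \<inter> EW (fst e)) \<union> (Y \<inter> EW (fst e))"] unfolding V_def by blast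
  qed
  have ZE: "Z \<subseteq> E" and VE: "V \<subseteq> E" unfolding Z_def V_def join_def by auto
  have fin: "finite X" "finite Y" "finite Z" "finite V"
    using XE YE ZE VE finite_E finite_subset by blast+
  have cross: "e \<in> Y'" if X': "stable X'" and Y': "stable Y'" and e: "e \<in> X'" "e \<in> E"
    "e \<in> C (snd e) ((X' \<inter> EF (snd e)) \<union> (Y' \<inter> EF (snd e)))"
    "e \<in> CW (fst e) ((X' \<inter> EW (fst e)) \<union> (Y' \<inter> EW (fst e)))" for X' Y' e
  proof (rule ccontr)
    assume n: "e \<notin> Y'"
    let ?f = "snd e" and ?w = "fst e"
    let ?U = "(X' \<inter> EW ?w) \<union> (Y' \<inter> EW ?w)"
    have f: "?f \<in> F" and w: "?w \<in> W" using e edge_ends by auto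
    have "accepts Y' e" unfolding accepts_def
      using A2[OF f, of "(X' \<inter> EF ?f) \<union> (Y' \<inter> EF ?f)" "insert e (Y' \<inter> EF ?f)"] e by (auto simp: EF_iff)
    then have full: "card (Y' \<inter> EW ?w) = q ?w" "\<forall>y\<in>Y' \<inter> EW ?w. (y, e) \<in> gt ?w"
      using n e stableD(5,6)[OF Y'] by auto
    have "card (Y' \<inter> EW ?w) \<le> card {y \<in> ?U. (y, e) \<in> gt ?w}"
      using full by (intro card_mono) auto
    then show False using CW_eq(1)[OF w, of ?U] e(4) full(1) by auto
  qed
  have VZ: "V \<inter> Z \<subseteq> X \<inter> Y"
  proof
    fix e assume e: "e \<in> V \<inter> Z"
    then have E: "e \<in> E" using VE by auto
    consider "e \<in> X" | "e \<in> Y" using e VXY by auto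
    then show "e \<in> X \<inter> Y"
    proof cases
      case 1
      then show ?thesis using cross[OF X Y 1 E] e unfolding V_def Z_def join_def by auto
    next
      case 2
      then show ?thesis using cross[OF Y X 2 E] e unfolding V_def Z_def join_def
        by (auto simp: Un_commute)
    qed
  qed
  have sub: "V \<union> Z \<subseteq> X \<union> Y" using VXY join_subset unfolding Z_def by auto
  have Vge: "card (X \<inter> EW w) \<le> card (V \<inter> EW w)" "card (Y \<inter> EW w) \<le> card (V \<inter> EW w)" if w: "w \<in> W" for w
  proof -
    have "card (X \<inter> EW w) \<le> card ((X \<inter> EW w) \<union> (Y \<inter> EW w))"
      "card (Y \<inter> EW w) \<le> card ((X \<inter> EW w) \<union> (Y \<inter> EW w))" by (intro card_mono; simp)+
    then show "card (X \<inter> EW w) \<le> card (V \<inter> EW w)" "card (Y \<inter> EW w) \<le> card (V \<inter> EW w)"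
      using CW_eq(2)[OF w, of "(X \<inter> EW w) \<union> (Y \<inter> EW w)"] stableD(3)[OF X w] stableD(3)[OF Y w] Vw[OF w] by auto
  qed
  have Zge: "card (X \<inter> EF f) \<le> card (Z \<inter> EF f)" "card (Y \<inter> EF f) \<le> card (Z \<inter> EF f)" if f: "f \<in> F" for f
    using A3[OF f, of "(X \<inter> EF f) \<union> (Y \<inter> EF f)" "X \<inter> EF f"] A3[OF f, of "(X \<inter> EF f) \<union> (Y \<inter> EF f)" "Y \<inter> EF f"]
      stableD(4)[OF X f] stableD(4)[OF Y f] join_F[OF f, of X Y] unfolding Z_def by auto
  have tot: "card V + card Z = card (V \<union> Z) + card (V \<inter> Z)" "card X + card Y = card (X \<union> Y) + card (X \<inter> Y)"
    using card_Un_Int fin by blast+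
  have le: "card (V \<union> Z) \<le> card (X \<union> Y)" "card (V \<inter> Z) \<le> card (X \<inter> Y)"
    using sub VZ fin by (auto intro!: card_mono)
  have VX: "card X \<le> card V" "card Y \<le> card V"
    using sum_mono[of W "\<lambda>w. card (X \<inter> EW w)" "\<lambda>w. card (V \<inter> EW w)"]
      sum_mono[of W "\<lambda>w. card (Y \<inter> EW w)" "\<lambda>w. card (V \<inter> EW w)"]
      Vge card_by_W[OF XE] card_by_W[OF YE] card_by_W[OF VE] by auto
  have ZX: "card X \<le> card Z" "card Y \<le> card Z"
    using sum_mono[of F "\<lambda>w. card (X \<inter> EF w)" "\<lambda>w. card (Z \<inter> EF w)"]
      sum_mono[of F "\<lambda>w. card (Y \<inter> EF w)" "\<lambda>w. card (Z \<inter> EF w)"]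
      Zge card_by_F[OF XE] card_by_F[OF YE] card_by_F[OF ZE] by auto
  have eq: "card V = card X" "card V = card Y" "card Z = card X" "card Z = card Y"
    "card (V \<union> Z) = card (X \<union> Y)" "card (V \<inter> Z) = card (X \<inter> Y)"
    using tot le VX ZX by linarith+
  have UN: "V \<union> Z = X \<union> Y" using eq(5) sub fin by (intro card_subset_eq) auto
  have IN: "V \<inter> Z = X \<inter> Y" using eq(6) VZ fin by (intro card_subset_eq) auto
  have ptw: "g i = h i" if "sum g A = sum h A" "\<And>i. i \<in> A \<Longrightarrow> g i \<le> h i" "finite A" "i \<in> A"
    for g h :: "'z \<Rightarrow> nat" and A i
    using sum_mono_inv[OF that(1,2,4,3)] .
  have Veq: "card (X \<inter> EW w) = card (V \<inter> EW w)" "card (Y \<inter> EW w) = card (V \<inter> EW w)" if w: "w \<in> W" for w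
    using ptw[of "\<lambda>w. card (X \<inter> EW w)" W "\<lambda>w. card (V \<inter> EW w)" w]
      ptw[of "\<lambda>w. card (Y \<inter> EW w)" W "\<lambda>w. card (V \<inter> EW w)" w]
      Vge card_by_W[OF XE] card_by_W[OF YE] card_by_W[OF VE] eq w finite_W by auto
  have Zeq: "card (X \<inter> EF w) = card (Z \<inter> EF w)" "card (Y \<inter> EF w) = card (Z \<inter> EF w)" if w: "w \<in> F" for w
    using ptw[of "\<lambda>w. card (X \<inter> EF w)" F "\<lambda>w. card (Z \<inter> EF w)" w]
      ptw[of "\<lambda>w. card (Y \<inter> EF w)" F "\<lambda>w. card (Z \<inter> EF w)" w]
      Zge card_by_F[OF XE] card_by_F[OF YE] card_by_F[OF ZE] eq w finite_F by auto
  show "f \<in> F \<Longrightarrow> card (join X Y \<inter> EF f) = card (X \<inter> EF f)"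
    "f \<in> F \<Longrightarrow> card (X \<inter> EF f) = card (Y \<inter> EF f)"
    using Zeq unfolding Z_def by auto
  show "card (join X Y \<inter> EW w) = card (X \<inter> EW w)" if w: "w \<in> W"
  proof -
    have "(V \<inter> EW w) \<union> (Z \<inter> EW w) = (X \<inter> EW w) \<union> (Y \<inter> EW w)"
      "(V \<inter> EW w) \<inter> (Z \<inter> EW w) = (X \<inter> EW w) \<inter> (Y \<inter> EW w)"
      using UN IN by blast+
    then have "card (V \<inter> EW w) + card (Z \<inter> EW w) = card (X \<inter> EW w) + card (Y \<inter> EW w)"
      using card_Un_Int[of "V \<inter> EW w" "Z \<inter> EW w"] card_Un_Int[of "X \<inter> EW w" "Y \<inter> EW w"] by simp
    then show ?thesis using Veq[OF w] unfolding Z_def by auto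
  qed
qed

section \<open>Rotations\<close>

text \<open>
  The cleaning procedure ends in the largest set of admissible edges in which each tail is
  entered by the second edge of some tandem.  A cycle of tandems is such a set, so it survives:
  rotations are simply the cycles of tandems.
\<close>

definition supported :: "('w \<times> 'f) set \<Rightarrow> ('w \<times> 'f) set \<Rightarrow> bool" where
  "supported X A \<longleftrightarrow> A \<subseteq> {a. W_admissible X a} \<and>
     (\<forall>a\<in>A. \<exists>a'\<in>A. \<exists>b. tandem X a' b \<and> fst b = fst a)"

lemma active_graph_eq:
  "active_graph X = (\<Union>{A. supported X A}, {b. \<exists>a\<in>\<Union>{A. supported X A}. tandem X a b})"
proof -
  let ?K = "\<Union>{A. supported X A}" and ?bs = "\<lambda>A. {b. \<exists>a\<in>A. tandem X a b}"
  have K: "supported X ?K" unfolding supported_def by blast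
  have fin: "finite {a. W_admissible X a}"
    by (rule finite_subset[OF _ finite_E]) (auto simp: W_admissible_def candidates_def EW_iff)
  have inv: "?K \<subseteq> fst G \<and> fst G \<subseteq> {a. W_admissible X a} \<and> snd G = ?bs (fst G)"
    if "(clean_step X)\<^sup>*\<^sup>* (D_graph X) G" for G
    using that
  proof (induction rule: rtranclp_induct)
    case base
    then show ?case using K unfolding D_graph_def supported_def tandem_def by auto
  next
    case (step G G')
    obtain A B a where G: "G = (A, B)" "a \<in> A" "\<forall>b\<in>B. fst b \<noteq> fst a"
      "G' = (A - {a}, B - {b. tandem X a b \<and> \<not> (\<exists>a'\<in>A - {a}. tandem X a' b)})"
      using step(2) by (auto elim!: clean_step.cases)
    have IH: "?K \<subseteq> A" "A \<subseteq> {a. W_admissible X a}" "B = ?bs A" using step(3) G by auto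
    have "a \<notin> ?K"
    proof
      assume "a \<in> ?K"
      then obtain a' b where "a' \<in> ?K" "tandem X a' b" "fst b = fst a"
        using K unfolding supported_def by meson
      then show False using IH G(3) by blast
    qed
    then have "?K \<subseteq> A - {a}" using IH by blast
    moreover have "B - {b. tandem X a b \<and> \<not> (\<exists>a'\<in>A - {a}. tandem X a' b)} = ?bs (A - {a})"
      using IH(3) by blast
    ultimately show ?case using G IH by auto
  qed
  have terminal: "G = (?K, ?bs ?K)"
    if G: "(clean_step X)\<^sup>*\<^sup>* (D_graph X) G" and t: "\<not> (\<exists>G'. clean_step X G G')" for G
  proof -
    obtain A B where AB: "G = (A, B)" by (cases G)
    have "\<exists>b\<in>B. fst b = fst a" if "a \<in> A" for a
      using t that clean_step.intros[of a A B X] AB by blast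
    moreover have "A \<subseteq> {a. W_admissible X a}" "B = ?bs A" using inv[OF G] AB by auto
    ultimately have "supported X A" unfolding supported_def by blast
    then have "A = ?K" using inv[OF G] AB by auto
    then show ?thesis using inv[OF G] AB by auto
  qed
  have ex: "\<exists>G'. (clean_step X)\<^sup>*\<^sup>* G G' \<and> \<not> (\<exists>G''. clean_step X G' G'')" if "finite (fst G)" for G
    using that
  proof (induction "card (fst G)" arbitrary: G rule: less_induct)
    case less
    show ?case
    proof (cases "\<exists>G'. clean_step X G G'")
      case True
      then obtain G' where G': "clean_step X G G'" by auto
      then have "card (fst G') < card (fst G)" "finite (fst G')"
        using less(2) card_Diff1_less by (force elim!: clean_step.cases)+
      then show ?thesis using less(1)[of G'] G' by (meson converse_rtranclp_into_rtranclp)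
    qed blast
  qed
  obtain G where G: "(clean_step X)\<^sup>*\<^sup>* (D_graph X) G \<and> \<not> (\<exists>G'. clean_step X G G')"
    using ex[of "D_graph X"] fin unfolding D_graph_def by auto
  show ?thesis unfolding active_graph_def
    by (rule the_equality) (use G terminal in blast)+
qed

definition tandem_cycle :: "('w \<times> 'f) set \<Rightarrow> (('w \<times> 'f) \<times> ('w \<times> 'f)) list \<Rightarrow> bool" where
  "tandem_cycle X ts \<longleftrightarrow> ts \<noteq> [] \<and> distinct (map fst ts) \<and> distinct (map snd ts) \<and>
     (\<forall>t\<in>set ts. tandem X (fst t) (snd t)) \<and>
     (\<forall>i<length ts. fst (snd (ts ! i)) = fst (fst (ts ! (Suc i mod length ts))))"

lemma mod_Suc_surj: "j < n \<Longrightarrow> \<exists>i<n. Suc i mod n = j"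
proof -
  assume j: "j < n"
  show ?thesis
  proof (cases j)
    case 0
    then show ?thesis using j by (intro exI[of _ "n - 1"]) auto
  next
    case (Suc i)
    then show ?thesis using j by (intro exI[of _ i]) auto
  qed
qed

lemma active_cycle_iff: "active_cycle X ts \<longleftrightarrow> tandem_cycle X ts"
proof
  assume "active_cycle X ts"
  then show "tandem_cycle X ts" unfolding active_cycle_def tandem_cycle_def by fastforce
next
  assume ts: "tandem_cycle X ts"
  let ?A = "fst ` set ts"
  have "supported X ?A" unfolding supported_def
  proof (intro conjI ballI)
    show "?A \<subseteq> {a. W_admissible X a}" using ts unfolding tandem_cycle_def tandem_def by auto
    fix a assume "a \<in> ?A"
    then obtain j where j: "j < length ts" "a = fst (ts ! j)" by (metis imageE in_set_conv_nth)
    obtain i where i: "i < length ts" "Suc i mod length ts = j" using mod_Suc_surj[OF j(1)] by auto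
    have "tandem X (fst (ts ! i)) (snd (ts ! i))" "fst (snd (ts ! i)) = fst a"
      using ts i j unfolding tandem_cycle_def by auto
    then show "\<exists>a'\<in>?A. \<exists>b. tandem X a' b \<and> fst b = fst a" using i by (metis image_eqI nth_mem)
  qed
  then have sub: "?A \<subseteq> \<Union>{A. supported X A}" by blast
  have "fst t \<in> fst (active_graph X) \<and> snd t \<in> snd (active_graph X) \<and> tandem X (fst t) (snd t)"
    if "t \<in> set ts" for t
  proof -
    have "tandem X (fst t) (snd t)" using ts that unfolding tandem_cycle_def by blast
    moreover have "fst t \<in> \<Union>{A. supported X A}" using sub that by blast
    ultimately show ?thesis unfolding active_graph_eq by auto
  qed
  then show "active_cycle X ts" using ts unfolding active_cycle_def tandem_cycle_def by auto
qed

lemma rotations_at_iff: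
  "L \<in> rotations_at X \<longleftrightarrow> (\<exists>ts. L = (fst ` set ts, snd ` set ts) \<and> tandem_cycle X ts)"
  unfolding rotations_at_def active_cycle_iff by auto

text \<open>
  Distinct vertices suffice: then the first edges have distinct tails and the second edges
  distinct heads.
\<close>

lemma cycle_of_tandems:
  assumes n: "0 < n" and inj: "inj_on v {..<n}"
    and t: "\<And>i. i < n \<Longrightarrow> tandem X (A i) (B i) \<and> fst (A i) = v i \<and> fst (B i) = v (Suc i mod n)"
  shows "tandem_cycle X (map (\<lambda>i. (A i, B i)) [0..<n])"
proof -
  have "inj_on A {..<n}" using inj t unfolding inj_on_def by (metis lessThan_iff)
  moreover have "inj_on B {..<n}"
  proof (rule inj_onI)
    fix i j assume ij: "i \<in> {..<n}" "j \<in> {..<n}" "B i = B j"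
    then have "v (Suc i mod n) = v (Suc j mod n)" using t by (metis lessThan_iff)
    then have "Suc i mod n = Suc j mod n" using inj n by (auto dest: inj_onD)
    then show "i = j" using ij by (auto simp: mod_Suc split: if_splits)
  qed
  ultimately show ?thesis unfolding tandem_cycle_def using n t
    by (auto simp: distinct_map comp_def atLeast0LessThan)
qed

lemma rotation_of_cycle: "tandem_cycle X ts \<Longrightarrow> (fst ` set ts, snd ` set ts) \<in> rotations_at X"
  unfolding rotations_at_iff by blast

text \<open>
  The last two claims express that a rotation changes no cardinality.  At \<open>f\<close> its tandems pair
  the added with the removed edges; at \<open>w\<close> at most one edge is added and one is removed, as each
  vertex of \<open>W\<close> has only one admissible edge.
\<close>

lemma rotationD:
  assumes X: "stable X" and L: "L \<in> rotations_at X"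
  shows "fst L \<noteq> {}" "fst L \<subseteq> E - X" "snd L \<subseteq> X" "finite (fst L)" "finite (snd L)"
    and "a \<in> fst L \<Longrightarrow> \<exists>b\<in>snd L. tandem X a b" and "b \<in> snd L \<Longrightarrow> \<exists>a\<in>fst L. tandem X a b"
    and "fst ` fst L = fst ` snd L" and "inj_on fst (fst L)" and "inj_on fst (snd L)"
    and "card (fst L \<inter> EF f) = card (snd L \<inter> EF f)"
    and "card (fst L \<inter> EW w) = card (snd L \<inter> EW w)"
proof -
  obtain ts where L: "L = (fst ` set ts, snd ` set ts)" and ts: "tandem_cycle X ts"
    using L unfolding rotations_at_iff by auto
  note t = ts[unfolded tandem_cycle_def]
  have tan: "tandem X (fst u) (snd u)" if "u \<in> set ts" for u using t that by auto
  show "fst L \<noteq> {}" "finite (fst L)" "finite (snd L)" using L t by auto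
  show "fst L \<subseteq> E - X" "snd L \<subseteq> X" using L tandemD(2-4)[OF X tan] by auto
  then have sub: "fst L \<subseteq> E" "snd L \<subseteq> E" using stableD(2)[OF X] by auto
  show "\<exists>b\<in>snd L. tandem X a b" if "a \<in> fst L" for a using that L tan by force
  show "\<exists>a\<in>fst L. tandem X a b" if "b \<in> snd L" for b using that L tan by force
  show ends: "fst ` fst L = fst ` snd L"
  proof
    show "fst ` snd L \<subseteq> fst ` fst L"
    proof
      fix v assume "v \<in> fst ` snd L"
      then obtain i where i: "i < length ts" "v = fst (snd (ts ! i))"
        using L by (auto simp: in_set_conv_nth)
      then have "v = fst (fst (ts ! (Suc i mod length ts)))" using t by auto
      moreover have "Suc i mod length ts < length ts" using i by (intro mod_less_divisor) auto
      ultimately show "v \<in> fst ` fst L" using L nth_mem by fastforce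
    qed
    show "fst ` fst L \<subseteq> fst ` snd L"
    proof
      fix v assume "v \<in> fst ` fst L"
      then obtain j where j: "j < length ts" "v = fst (fst (ts ! j))"
        using L by (auto simp: in_set_conv_nth)
      then obtain i where i: "i < length ts" "Suc i mod length ts = j" using mod_Suc_surj by blast
      then have "v = fst (snd (ts ! i))" using t j by auto
      then show "v \<in> fst ` snd L" using L i nth_mem by fastforce
    qed
  qed
  show inj1: "inj_on fst (fst L)"
  proof (rule inj_onI)
    fix a a' assume a: "a \<in> fst L" "a' \<in> fst L" "fst a = fst a'"
    then have "W_admissible X a" "W_admissible X a'" using L tan unfolding tandem_def by auto
    then show "a = a'" using W_admissible_unique[OF X] a by auto
  qed
  show inj2: "inj_on fst (snd L)"
  proof (rule eq_card_imp_inj_on)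
    show "finite (snd L)" using L by auto
    have "card (fst L) = length ts" "card (snd L) = length ts"
      using t L distinct_card[of "map fst ts"] distinct_card[of "map snd ts"] by auto
    then show "card (fst ` snd L) = card (snd L)" using ends card_image[OF inj1] by simp
  qed
  have "card (S \<inter> EW w) = card (fst ` S \<inter> {w})" if "inj_on fst S" "S \<subseteq> E" for S
  proof -
    have "inj_on fst (S \<inter> EW w)" using that by (auto intro: inj_on_subset)
    moreover have "fst ` (S \<inter> EW w) = fst ` S \<inter> {w}" 
    proof
      show "fst ` (S \<inter> EW w) \<subseteq> fst ` S \<inter> {w}" using EW_iff by blast
      show "fst ` S \<inter> {w} \<subseteq> fst ` (S \<inter> EW w)"
      proof
        fix v assume "v \<in> fst ` S \<inter> {w}"
        then obtain x where "x \<in> S" "fst x = w" "v = w" by auto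
        then show "v \<in> fst ` (S \<inter> EW w)" using that EW_iff by blast
      qed
    qed
    ultimately show ?thesis using card_image by metis
  qed
  from this[OF inj1 sub(1)] this[OF inj2 sub(2)] ends
  show "card (fst L \<inter> EW w) = card (snd L \<inter> EW w)" by simp
  show "card (fst L \<inter> EF f) = card (snd L \<inter> EF f)"
  proof -
    let ?ts = "filter (\<lambda>u. snd (fst u) = f) ts"
    have same: "snd (snd u) = snd (fst u)" if "u \<in> set ts" for u using tandemD(6)[OF X tan[OF that]] .
    have "fst L \<inter> EF f = set (map fst ?ts)" using L sub(1) by (auto simp: EF_iff)
    moreover have "snd L \<inter> EF f = set (map snd ?ts)" 
    proof -
      have "snd L \<inter> EF f = {b \<in> snd L. snd b = f}" using sub(2) EF_iff by blast
      also have "\<dots> = snd ` {u \<in> set ts. snd (snd u) = f}" using L by auto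
      also have "{u \<in> set ts. snd (snd u) = f} = set ?ts"
        unfolding set_filter by (rule Collect_cong) (metis same)
      finally show ?thesis by simp
    qed
    moreover have "distinct (map fst ?ts)" "distinct (map snd ?ts)" using t distinct_map_filter by blast+
    ultimately show ?thesis using distinct_card[of "map fst ?ts"] distinct_card[of "map snd ?ts"] by simp
  qed
qed

lemma rotation_tandem:
  assumes "stable X" "L \<in> rotations_at X"
  shows "a \<in> fst L \<Longrightarrow> W_admissible X a" and "a \<in> fst L \<Longrightarrow> \<not> settled X a"
    and "snd L = {b. \<exists>a\<in>fst L. tandem X a b}"
    and "a \<in> fst L \<Longrightarrow> tandem X a b \<Longrightarrow> b \<in> snd L"
proof -
  show "a \<in> fst L \<Longrightarrow> W_admissible X a" using rotationD(6)[OF assms] unfolding tandem_def by blast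
  then show "a \<in> fst L \<Longrightarrow> \<not> settled X a" using W_admissible_iff[OF assms(1)] by blast
  show *: "snd L = {b. \<exists>a\<in>fst L. tandem X a b}"
    using rotationD(6,7)[OF assms] tandem_unique[OF assms(1)] by blast
  then show "a \<in> fst L \<Longrightarrow> tandem X a b \<Longrightarrow> b \<in> snd L" by blast
qed

text \<open>
  Where a walk along tandems goes is determined by its present vertex.  So two rotations with
  a common vertex of \<open>W\<close> coincide.
\<close>

lemma rotation_disjoint:
  assumes X: "stable X" and L: "L \<in> rotations_at X" and M: "M \<in> rotations_at X" and ne: "L \<noteq> M"
  shows "fst ` fst L \<inter> fst ` fst M = {}" "fst L \<inter> fst M = {}" "snd L \<inter> snd M = {}"
proof -
  have sub: "fst L \<subseteq> fst M"
    if L: "L \<in> rotations_at X" and M: "M \<in> rotations_at X" and a: "a \<in> fst L" "a \<in> fst M" for L M a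
  proof -
    obtain ts where Lts: "L = (fst ` set ts, snd ` set ts)" and ts: "tandem_cycle X ts"
      using L unfolding rotations_at_iff by auto
    note t = ts[unfolded tandem_cycle_def]
    let ?n = "length ts"
    have n: "0 < ?n" using t by auto
    obtain i where i: "i < ?n" "a = fst (ts ! i)" using a Lts by (auto simp: in_set_conv_nth)
    have step: "fst (ts ! ((i + m) mod ?n)) \<in> fst M" for m
    proof (induction m)
      case 0
      then show ?case using i a by auto
    next
      case (Suc m)
      let ?j = "(i + m) mod ?n"
      have j: "?j < ?n" using n by simp
      then have "tandem X (fst (ts ! ?j)) (snd (ts ! ?j))" using t nth_mem by blast
      then have "snd (ts ! ?j) \<in> snd M" using rotation_tandem(4)[OF X M Suc] by blast
      then have "fst (snd (ts ! ?j)) \<in> fst ` fst M" using rotationD(8)[OF X M] by auto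
      moreover have "fst (snd (ts ! ?j)) = fst (fst (ts ! (Suc ?j mod ?n)))" using t j by blast
      ultimately obtain a' where a': "a' \<in> fst M" "fst a' = fst (fst (ts ! (Suc ?j mod ?n)))" by fastforce
      have "fst (ts ! (Suc ?j mod ?n)) \<in> fst L" using Lts n by auto
      then have "a' = fst (ts ! (Suc ?j mod ?n))"
        using a' rotation_tandem(1)[OF X L] rotation_tandem(1)[OF X M] W_admissible_unique[OF X] by metis
      moreover have "Suc ?j mod ?n = (i + Suc m) mod ?n" by (simp add: mod_Suc_eq)
      ultimately show ?case using a' by metis
    qed
    show ?thesis
    proof
      fix x assume "x \<in> fst L"
      then obtain j where j: "j < ?n" "x = fst (ts ! j)" using Lts by (auto simp: in_set_conv_nth)
      have "(i + (?n - i + j)) mod ?n = j" using i j by simp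
      then show "x \<in> fst M" using step[of "?n - i + j"] j by simp
    qed
  qed
  have dis: "fst L \<inter> fst M = {}"
  proof (rule ccontr)
    assume "fst L \<inter> fst M \<noteq> {}"
    then have "fst L = fst M" using sub[OF L M] sub[OF M L] by blast
    then show False using rotation_tandem(3)[OF X L] rotation_tandem(3)[OF X M] ne by (simp add: prod_eq_iff)
  qed
  then show W: "fst ` fst L \<inter> fst ` fst M = {}"
    using rotation_tandem(1)[OF X L] rotation_tandem(1)[OF X M] W_admissible_unique[OF X] by blast
  show "fst L \<inter> fst M = {}" by (rule dis)
  show "snd L \<inter> snd M = {}" using W rotationD(8)[OF X L] rotationD(8)[OF X M] by blast
qed

subsection \<open>What rotations preserve\<close>

text \<open>
  The second edge of a tandem is dropped by its firm in favour of the first edge; with more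
  edges on offer it is dropped all the more.  So the tandem stays as long as its second edge does.
\<close>

lemma tandem_persists:
  assumes X: "stable X" and Y: "stable Y" and le: "leF X Y" and t: "tandem X a b" and b: "b \<in> Y"
  shows "tandem Y a b"
proof -
  let ?f = "snd a"
  note td = tandemD[OF X t]
  have f: "?f \<in> F" "a \<in> EF ?f" "b \<in> EF ?f" using td edge_ends by (auto simp: EF_iff)
  have rej: "b \<notin> C ?f (insert a (Y \<inter> EF ?f))"
  proof
    assume "b \<in> C ?f (insert a (Y \<inter> EF ?f))"
    then have "b \<in> C ?f (insert a ((X \<inter> EF ?f) \<union> (Y \<inter> EF ?f)))" using choice_insert[OF le td(2)] by simp
    then have "b \<in> C ?f (insert a (X \<inter> EF ?f))"
      using A2[OF f(1), of "insert a ((X \<inter> EF ?f) \<union> (Y \<inter> EF ?f))" "insert a (X \<inter> EF ?f)"] f td(4) by auto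
    then show False using td(8) by blast
  qed
  have "\<not> settled Y a"
  proof
    assume "settled Y a"
    then consider "a \<in> Y" | "a \<notin> C ?f (insert a (Y \<inter> EF ?f))" unfolding settled_def accepts_def by auto
    then show False
    proof cases
      case 1
      then have "insert a (Y \<inter> EF ?f) = Y \<inter> EF ?f" using f by auto
      then show False using rej stableD(4)[OF Y f(1)] b f by auto
    next
      case 2
      then have "C ?f (insert a (Y \<inter> EF ?f)) \<subseteq> Y \<inter> EF ?f"
        using choice_subset[OF f(1), of "insert a (Y \<inter> EF ?f)"] f by auto
      then have "C ?f (Y \<inter> EF ?f) = C ?f (insert a (Y \<inter> EF ?f))"
        using A1[OF f(1), of "insert a (Y \<inter> EF ?f)" "Y \<inter> EF ?f"] f by auto
      then show False using rej stableD(4)[OF Y f(1)] b f by auto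
    qed
  qed
  then have "W_admissible Y a"
    using td(1) settled_mono[OF le] unfolding W_admissible_iff[OF X] W_admissible_iff[OF Y] by blast
  then show ?thesis using b f rej unfolding tandem_iff[OF Y] by auto
qed

text \<open>
  An admissible edge without tandem would enlarge the set of its firm.  It never becomes part
  of a tandem, since the cardinalities at the firms are the same for all stable matchings.
\<close>

lemma free_persists:
  assumes X: "stable X" and Y: "stable Y" and le: "leF X Y"
    and a: "W_admissible X a" and no: "\<nexists>b. tandem X a b"
  shows "W_admissible Y a" "\<nexists>b. tandem Y a b"
proof -
  let ?f = "snd a"
  have aX: "a \<in> E" "a \<notin> X" using a unfolding W_admissible_iff[OF X] settled_def by auto
  have f: "?f \<in> F" "a \<in> EF ?f" using aX edge_ends by (auto simp: EF_iff)
  have "card (C ?f (insert a (X \<inter> EF ?f))) = Suc (card (X \<inter> EF ?f))"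
    using no_tandem[OF X a no] aX by simp
  moreover have "card (C ?f (insert a (X \<inter> EF ?f))) \<le> card (C ?f (insert a ((X \<inter> EF ?f) \<union> (Y \<inter> EF ?f))))"
    using f by (intro A3) auto
  ultimately have big: "card (C ?f (insert a (Y \<inter> EF ?f))) > card (Y \<inter> EF ?f)"
    using choice_insert[OF le aX(1)] join_cards(2)[OF X Y f(1)] by simp
  have uns: "\<not> settled Y a"
  proof
    assume "settled Y a"
    then consider "a \<in> Y" | "a \<notin> C ?f (insert a (Y \<inter> EF ?f))" unfolding settled_def accepts_def by auto
    then show False
    proof cases
      case 1
      then have "insert a (Y \<inter> EF ?f) = Y \<inter> EF ?f" using f by auto
      then show False using big stableD(4)[OF Y f(1)] by simp
    next
      case 2
      then have "C ?f (insert a (Y \<inter> EF ?f)) \<subseteq> Y \<inter> EF ?f"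
        using choice_subset[OF f(1), of "insert a (Y \<inter> EF ?f)"] f by auto
      then show False using big card_mono[of "Y \<inter> EF ?f"] by (simp add: leD)
    qed
  qed
  then show "W_admissible Y a"
    using a settled_mono[OF le] unfolding W_admissible_iff[OF X] W_admissible_iff[OF Y] by blast
  show "\<nexists>b. tandem Y a b"
  proof
    assume "\<exists>b. tandem Y a b"
    then obtain b where t: "tandem Y a b" by auto
    then have "b \<in> Y \<inter> EF ?f" "a \<notin> Y" using tandemD[OF Y t] by (auto simp: EF_iff)
    moreover have "C ?f (insert a (Y \<inter> EF ?f)) = insert a (Y \<inter> EF ?f - {b})" using t unfolding tandem_def by auto
    moreover have "Suc (card (Y \<inter> EF ?f - {b})) = card (Y \<inter> EF ?f)"
      using \<open>b \<in> Y \<inter> EF ?f\<close> card.remove[of "Y \<inter> EF ?f" b] by simp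
    ultimately show False using big by simp
  qed
qed

text \<open>
  Candidates are only lost when the firms improve, so the vertex of a tandem of \<open>Y\<close> already had an
  admissible edge at \<open>X\<close>; by the two persistence lemmas this edge was in a tandem, which is the
  same one unless it has lost its second edge.
\<close>

lemma tandem_reflects:
  assumes X: "stable X" and Y: "stable Y" and le: "leF X Y" and t: "tandem Y a b"
  obtains a' b' where "tandem X a' b'" "fst a' = fst a" "b' \<in> Y \<Longrightarrow> a' = a \<and> b' = b"
proof -
  have "a \<in> E" "\<not> settled X a" using tandemD(2,7)[OF Y t] settled_mono[OF le] by blast+
  then obtain a' where a': "W_admissible X a'" "fst a' = fst a" using W_admissible_exists[OF X] by blast
  have "\<exists>b'. tandem X a' b'"
  proof (rule ccontr)
    assume no: "\<nexists>b'. tandem X a' b'"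
    then have "a' = a" using free_persists(1)[OF X Y le a'(1)] a'(2) tandemD(1)[OF Y t] W_admissible_unique[OF Y] by metis
    then show False using free_persists(2)[OF X Y le a'(1) no] t by blast
  qed
  then obtain b' where b': "tandem X a' b'" by auto
  have "a' = a \<and> b' = b" if "b' \<in> Y"
  proof -
    have t': "tandem Y a' b'" using tandem_persists[OF X Y le b' that] .
    then have "a' = a" using tandemD(1)[OF Y t'] tandemD(1)[OF Y t] a'(2) W_admissible_unique[OF Y] by metis
    then show ?thesis using tandem_unique[OF Y] t t' by metis
  qed
  then show thesis using that b' a' by blast
qed

text \<open>
  At each firm the removed edges are refused, and by cardinalities nothing else changes.  A worker
  who exchanges an edge for \<open>a\<^sub>w\<close> cannot be in a blocking edge between its old last edge and \<open>a\<^sub>w\<close>,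
  because \<open>a\<^sub>w\<close> is the best candidate.
\<close>

lemma apply_rotation_stable:
  assumes X: "stable X" and L: "L \<in> rotations_at X"
  shows "stable (apply_rotation L X)" "leF X (apply_rotation L X)"
proof -
  let ?X = "apply_rotation L X"
  note rd = rotationD[OF X L]
  have XE: "X \<subseteq> E" using stableD(2)[OF X] .
  have choice: "C f ((X \<inter> EF f) \<union> (fst L \<inter> EF f)) = ?X \<inter> EF f" if f: "f \<in> F" for f
  proof -
    have "(snd L \<inter> EF f) \<inter> C f ((X \<inter> EF f) \<union> (fst L \<inter> EF f)) = {}"
    proof -
      have "b \<notin> C f ((X \<inter> EF f) \<union> (fst L \<inter> EF f))" if b: "b \<in> snd L" "b \<in> EF f" for b
      proof
        assume c: "b \<in> C f ((X \<inter> EF f) \<union> (fst L \<inter> EF f))"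
        obtain a where a: "a \<in> fst L" "tandem X a b" using rd(7) b by blast
        note td = tandemD[OF X a(2)]
        have fa: "snd a = f" using td b by (auto simp: EF_iff)
        then have "insert a (X \<inter> EF f) \<subseteq> (X \<inter> EF f) \<union> (fst L \<inter> EF f)" using a td by (auto simp: EF_iff)
        then show False
          using A2[OF f, of "(X \<inter> EF f) \<union> (fst L \<inter> EF f)" "insert a (X \<inter> EF f)"] c td b fa by auto
      qed
      then show ?thesis by blast
    qed
    then have "C f ((X \<inter> EF f) \<union> (fst L \<inter> EF f)) = (X \<inter> EF f - (snd L \<inter> EF f)) \<union> (fst L \<inter> EF f)"
      using rd f by (intro choice_exchange stableD(1)[OF X]) auto
    then show ?thesis unfolding apply_rotation_def by auto
  qed
  have "?X \<subseteq> E" using rd XE unfolding apply_rotation_def by auto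
  moreover have "C f (?X \<inter> EF f) = ?X \<inter> EF f" if "f \<in> F" for f
    using choice_idem[OF that, of "(X \<inter> EF f) \<union> (fst L \<inter> EF f)"] choice[OF that] by auto
  ultimately have acc: "F_acceptable ?X" unfolding F_acceptable_def by auto
  show le: "leF X ?X" unfolding leF_def
  proof
    fix f assume f: "f \<in> F"
    have "(X \<inter> EF f) \<union> (?X \<inter> EF f) = (X \<inter> EF f) \<union> (fst L \<inter> EF f)" unfolding apply_rotation_def by auto
    then show "C f ((X \<inter> EF f) \<union> (?X \<inter> EF f)) = ?X \<inter> EF f" using choice[OF f] by simp
  qed
  have card: "card (?X \<inter> EW w) = card (X \<inter> EW w)" for w
  proof -
    have "?X \<inter> EW w = (X \<inter> EW w - snd L \<inter> EW w) \<union> (fst L \<inter> EW w)" unfolding apply_rotation_def by auto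
    then have "card (?X \<inter> EW w) = card (X \<inter> EW w - snd L \<inter> EW w) + card (fst L \<inter> EW w)"
    proof -
      have "finite (fst L \<inter> EW w)" "(X \<inter> EW w - snd L \<inter> EW w) \<inter> (fst L \<inter> EW w) = {}"
        using rd(2) by auto
      then show ?thesis using card_Un_disjoint[of "X \<inter> EW w - snd L \<inter> EW w" "fst L \<inter> EW w"]
          \<open>?X \<inter> EW w = _\<close> by simp
    qed
    moreover have "card (X \<inter> EW w - snd L \<inter> EW w) = card (X \<inter> EW w) - card (snd L \<inter> EW w)"
      using rd(3,5) by (intro card_Diff_subset) auto
    moreover have "card (snd L \<inter> EW w) \<le> card (X \<inter> EW w)" using rd(3) by (intro card_mono) auto
    ultimately show ?thesis using rd(12)[of w] by linarith
  qed
  show "stable ?X" unfolding stable_iff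
  proof (intro conjI ballI impI)
    show "F_acceptable ?X" by (rule acc)
    show "card (?X \<inter> EW w) \<le> q w" if "w \<in> W" for w using card stableD(3)[OF X that] by simp
    fix e assume e: "e \<in> E - ?X" "accepts ?X e"
    then have "\<not> settled X e" using settled_mono[OF le, of e] unfolding settled_def by auto
    then have eX: "e \<in> E - X" "accepts X e" using e unfolding settled_def by auto
    show "card (?X \<inter> EW (fst e)) = q (fst e)" using card stableD(5)[OF X eX] by simp
    fix y assume y: "y \<in> ?X \<inter> EW (fst e)"
    show "(y, e) \<in> gt (fst e)"
    proof (cases "y \<in> X")
      case True
      then show ?thesis using stableD(6)[OF X eX] y by auto
    next
      case False
      then have yL: "y \<in> fst L" using y unfolding apply_rotation_def by auto
      have "fst e = fst y" "e \<noteq> y" using y e by (auto simp: EW_iff)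
      then show ?thesis
        using rotation_tandem(1)[OF X L yL] \<open>\<not> settled X e\<close> eX(1) unfolding W_admissible_iff[OF X]
        by (metis Diff_iff)
    qed
  qed
qed

lemma rotation_transfer:
  assumes L: "L \<in> rotations_at X"
    and t: "\<And>a b. a \<in> fst L \<Longrightarrow> b \<in> snd L \<Longrightarrow> tandem X a b \<Longrightarrow> tandem Y a b"
  shows "L \<in> rotations_at Y"
proof -
  obtain ts where ts: "L = (fst ` set ts, snd ` set ts)" "tandem_cycle X ts"
    using L unfolding rotations_at_iff by auto
  then have "tandem Y (fst u) (snd u)" if "u \<in> set ts" for u
    using that t[of "fst u" "snd u"] unfolding tandem_cycle_def by auto
  then have "tandem_cycle Y ts" using ts(2) unfolding tandem_cycle_def by auto
  then show ?thesis using ts(1) unfolding rotations_at_iff by auto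
qed

lemma rotations_commute:
  assumes X: "stable X" and L: "L \<in> rotations_at X" and M: "M \<in> rotations_at X" and ne: "L \<noteq> M"
  shows "M \<in> rotations_at (apply_rotation L X)"
    and "apply_rotation M (apply_rotation L X) = apply_rotation L (apply_rotation M X)"
proof -
  note dis = rotation_disjoint[OF X L M ne]
  show "M \<in> rotations_at (apply_rotation L X)"
  proof (rule rotation_transfer[OF M])
    fix a b assume b: "b \<in> snd M" and t: "tandem X a b"
    have "b \<in> apply_rotation L X"
      using dis(3) b rotationD(3)[OF X M] unfolding apply_rotation_def by blast
    then show "tandem (apply_rotation L X) a b"
      using tandem_persists[OF X apply_rotation_stable[OF X L] t] by blast
  qed
  show "apply_rotation M (apply_rotation L X) = apply_rotation L (apply_rotation M X)"
  proof -
    have "fst L \<inter> snd M = {}" "fst M \<inter> snd L = {}"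
      using rotationD(2,3)[OF X L] rotationD(2,3)[OF X M] by auto
    then show ?thesis unfolding apply_rotation_def by auto
  qed
qed

text \<open>
  This makes precedence a conjunction of conditions and never a choice between alternatives:
  a tandem of \<open>X\<close> that is destroyed by \<open>L\<close> loses its second edge to \<open>L\<close>, so it is not
  destroyed by \<open>M\<close>.
\<close>

lemma rotation_meet:
  assumes X: "stable X" and L: "L \<in> rotations_at X" and M: "M \<in> rotations_at X" and ne: "L \<noteq> M"
    and R: "R \<in> rotations_at (apply_rotation L X)" "R \<in> rotations_at (apply_rotation M X)"
  shows "R \<in> rotations_at X"
proof (rule rotation_transfer[OF R(1)])
  fix a b assume ab: "a \<in> fst R" "b \<in> snd R" "tandem (apply_rotation L X) a b"
  note SL = apply_rotation_stable[OF X L] and SM = apply_rotation_stable[OF X M]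
  obtain b2 where tM: "tandem (apply_rotation M X) a b2" using rotationD(6)[OF SM(1) R(2)] ab by blast
  obtain a' b' where t': "tandem X a' b'" "fst a' = fst a" "b' \<in> apply_rotation L X \<Longrightarrow> a' = a \<and> b' = b"
    using tandem_reflects[OF X SL ab(3)] by blast
  obtain a'' b'' where t'': "tandem X a'' b''" "fst a'' = fst a" "b'' \<in> apply_rotation M X \<Longrightarrow> a'' = a \<and> b'' = b2"
    using tandem_reflects[OF X SM tM] by blast
  have "a'' = a'" using tandemD(1)[OF X t'(1)] tandemD(1)[OF X t''(1)] t' t'' W_admissible_unique[OF X] by metis
  then have "b'' = b'" using t' t'' tandem_unique[OF X] by blast
  have "b' \<in> apply_rotation L X \<or> b' \<in> apply_rotation M X"
    using rotation_disjoint(3)[OF X L M ne] tandemD(4)[OF X t'(1)] unfolding apply_rotation_def by blast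
  then show "tandem X a b"
  proof
    assume "b' \<in> apply_rotation L X"
    then show ?thesis using t' by blast
  next
    assume b: "b' \<in> apply_rotation M X"
    then have "a' = a" using t'' \<open>b'' = b'\<close> \<open>a'' = a'\<close> by blast
    moreover have "b' = b"
    proof (rule ccontr)
      assume "b' \<noteq> b"
      then have "b' \<notin> apply_rotation L X" using t' by blast
      have tM': "tandem (apply_rotation M X) a b'"
        using tandem_persists[OF X SM t'(1) b] \<open>a' = a\<close> by blast
      have "b' = b2" using tM tM' tandem_unique[OF SM(1)] by blast
      have "b2 \<in> snd R" using rotation_tandem(4)[OF SM(1) R(2) ab(1) tM] .
      then have "b' \<in> apply_rotation L X" using \<open>b' = b2\<close> rotationD(3)[OF SL(1) R(1)] by blast
      then show False using \<open>b' \<notin> apply_rotation L X\<close> by blast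
    qed
    ultimately show ?thesis using t' by blast
  qed
qed

lemma rotation_not_repeated:
  assumes X: "stable X" and L: "L \<in> rotations_at X" and Y: "stable Y" "leF (apply_rotation L X) Y"
  shows "L \<notin> rotations_at Y"
proof
  assume LY: "L \<in> rotations_at Y"
  obtain a where a: "a \<in> fst L" using rotationD(1)[OF X L] by blast
  then have "settled (apply_rotation L X) a" unfolding settled_def apply_rotation_def by auto
  then have "settled Y a" using settled_mono[OF Y(2)] rotationD(2)[OF X L] a by blast
  then show False using rotation_tandem(2)[OF Y(1) LY a] by blast
qed

subsection \<open>The two extreme stable matchings\<close>

text \<open>
  Iteration from any point becomes periodic by finiteness; the least period at a periodic point
  gives a cycle without repetitions.
\<close>

lemma finite_cycle:
  assumes "finite A" "A \<noteq> {}" "g ` A \<subseteq> A"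
  obtains y n where "y \<in> A" "0 < n" "(g ^^ n) y = y" "inj_on (\<lambda>i. (g ^^ i) y) {..<n}"
proof -
  obtain x where x: "x \<in> A" using assms by auto
  have inA: "(g ^^ i) z \<in> A" if "z \<in> A" for i z using that assms(3) by (induction i) auto
  have "\<not> inj_on (\<lambda>i. (g ^^ i) x) (UNIV :: nat set)"
    using finite_imageD[of "\<lambda>i. (g ^^ i) x" UNIV] finite_subset[OF _ assms(1), of "range (\<lambda>i. (g ^^ i) x)"] inA[OF x]
    by auto
  then obtain i j where ij: "i < j" "(g ^^ i) x = (g ^^ j) x"
    unfolding inj_on_def by (metis linorder_neqE_nat)
  define y where "y = (g ^^ i) x"
  have "(g ^^ (j - i)) y = y" unfolding y_def using ij by (metis add_diff_inverse_nat comp_apply funpow_add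
      add.commute less_imp_not_less)
  then have ex: "\<exists>n. 0 < n \<and> (g ^^ n) y = y" using ij by (intro exI[of _ "j - i"]) auto
  define n where "n = (LEAST n. 0 < n \<and> (g ^^ n) y = y)"
  have n: "0 < n" "(g ^^ n) y = y" using LeastI_ex[OF ex] unfolding n_def by auto
  have min: "m \<ge> n" if "0 < m" "(g ^^ m) y = y" for m unfolding n_def by (rule Least_le) (use that in blast)
  have "inj_on (\<lambda>i. (g ^^ i) y) {..<n}"
  proof (rule linorder_inj_onI')
    fix a b assume ab: "a \<in> {..<n}" "b \<in> {..<n}" "a < b"
    show "(g ^^ a) y \<noteq> (g ^^ b) y"
    proof
      assume e: "(g ^^ a) y = (g ^^ b) y"
      have "(g ^^ (n - b + a)) y = (g ^^ (n - b)) ((g ^^ b) y)" using e by (simp add: funpow_add)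
      also have "\<dots> = (g ^^ n) y" using ab by (metis comp_apply funpow_add le_add_diff_inverse2 lessThan_iff less_imp_le)
      finally show False using min[of "n - b + a"] n ab by auto
    qed
  qed
  then show thesis using that[of y n] n inA[OF x] unfolding y_def by blast
qed

text \<open>
  If \<open>Y\<close> is not below \<open>X\<close>, the join of \<open>X\<close> and \<open>Y\<close> has edges outside \<open>X\<close>.  At each vertex of \<open>W\<close> on
  such an edge there is a tandem of \<open>X\<close>, and its second edge is missing in the join.  As \<open>X\<close> and
  the join have the same size everywhere, this edge leads to another vertex of the same kind.
\<close>

lemma rotation_exists:
  assumes X: "stable X" and Y: "stable Y" and nle: "\<not> leF Y X"
  shows "rotations_at X \<noteq> {}"
proof -
  define Z where "Z = join X Y"
  have ZE: "Z \<subseteq> E" unfolding Z_def join_def by auto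
  note XE = stableD(2)[OF X]
  obtain f where f: "f \<in> F" "Z \<inter> EF f \<noteq> X \<inter> EF f"
    using nle join_F[of _ X Y] unfolding leF_def Z_def by (auto simp: Un_commute)
  have cardF: "card (Z \<inter> EF g) = card (X \<inter> EF g)" if "g \<in> F" for g
    using join_cards(1)[OF X Y that] unfolding Z_def .
  have "\<not> Z \<inter> EF f \<subseteq> X \<inter> EF f" using f cardF[OF f(1)] card_subset_eq[of "X \<inter> EF f" "Z \<inter> EF f"] by auto
  then have ne: "fst ` (Z - X) \<noteq> {}" by blast
  have next_vertex: "\<exists>b. (\<exists>a. tandem X a b \<and> fst a = w) \<and> fst b \<in> fst ` (Z - X)" if w: "w \<in> fst ` (Z - X)" for w
  proof -
    obtain e where e: "e \<in> Z" "e \<notin> X" "fst e = w" using w by auto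
    let ?f = "snd e"
    have eE: "e \<in> E" and eY: "e \<in> Y" using e ZE join_subset[of X Y] unfolding Z_def by auto
    have ef: "?f \<in> F" "e \<in> EF ?f" using edge_ends eE by (auto simp: EF_iff)
    have "accepts X e" unfolding accepts_def
      using A2[OF ef(1), of "(X \<inter> EF ?f) \<union> (Y \<inter> EF ?f)" "insert e (X \<inter> EF ?f)"] e eY ef
      unfolding Z_def join_def by auto
    then have "\<not> settled X e" using e unfolding settled_def by auto
    then obtain a where a: "W_admissible X a" "fst a = w" "a = e \<or> (a, e) \<in> gt w"
      using W_admissible_exists[OF X eE] e(3) by blast
    let ?g = "snd a"
    have aX: "a \<in> E" "a \<notin> X" using a(1) unfolding W_admissible_iff[OF X] settled_def by auto
    have g: "?g \<in> F" "a \<in> EF ?g" using edge_ends aX by (auto simp: EF_iff)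
    let ?U = "(X \<inter> EF ?g) \<union> (Y \<inter> EF ?g)"
    \<comment> \<open>Either the firm keeps \<open>a\<close> in the join, or it refuses \<open>a\<close> there because \<open>Y\<close> is stable.\<close>
    have insU: "C ?g (insert a ?U) = Z \<inter> EF ?g"
    proof (cases "a \<in> Y")
      case True
      then have "insert a ?U = ?U" using g by auto
      then show ?thesis using join_F[OF g(1)] unfolding Z_def by simp
    next
      case False
      then have "(a, e) \<in> gt w" using a eY by auto
      have "\<not> accepts Y a"
      proof
        assume "accepts Y a"
        then have "(e, a) \<in> gt (fst a)"
          using stableD(6)[OF Y, of a e] False aX eY eE e a by (auto simp: EW_iff)
        then show False using \<open>(a, e) \<in> gt w\<close> a(2) gt_asym edge_ends(1)[OF aX(1)] by metis
      qed
      have "a \<notin> C ?g (insert a ?U)"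
      proof
        assume "a \<in> C ?g (insert a ?U)"
        then have "accepts Y a" unfolding accepts_def
          using A2[OF g(1), of "insert a ?U" "insert a (Y \<inter> EF ?g)"] g by auto
        then show False using \<open>\<not> accepts Y a\<close> by blast
      qed
      then have "C ?g (insert a ?U) \<subseteq> ?U" using choice_subset[OF g(1), of "insert a ?U"] g by auto
      then have "C ?g ?U = C ?g (insert a ?U)" using A1[OF g(1), of "insert a ?U" ?U] g by auto
      then show ?thesis using join_F[OF g(1)] unfolding Z_def by simp
    qed
    have "\<exists>b. tandem X a b"
    proof (rule ccontr)
      assume "\<nexists>b. tandem X a b"
      then have "card (C ?g (insert a (X \<inter> EF ?g))) = Suc (card (X \<inter> EF ?g))"
        using no_tandem[OF X a(1)] aX by simp
      moreover have "card (C ?g (insert a (X \<inter> EF ?g))) \<le> card (C ?g (insert a ?U))"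
        using g by (intro A3) auto
      ultimately show False using insU cardF[OF g(1)] by simp
    qed
    then obtain b where b: "tandem X a b" by auto
    note td = tandemD[OF X b]
    have bg: "b \<in> EF ?g" using td by (auto simp: EF_iff)
    have "b \<notin> C ?g (insert a ?U)"
      using A2[OF g(1), of "insert a ?U" "insert a (X \<inter> EF ?g)"] g td bg by auto
    then have bZ: "b \<notin> Z" using insU bg by auto
    let ?v = "fst b"
    have v: "?v \<in> W" using edge_ends td by auto
    have "\<not> Z \<inter> EW ?v \<subseteq> X \<inter> EW ?v"
    proof
      assume "Z \<inter> EW ?v \<subseteq> X \<inter> EW ?v"
      then have "Z \<inter> EW ?v = X \<inter> EW ?v"
        using join_cards(3)[OF X Y v] card_subset_eq[of "X \<inter> EW ?v" "Z \<inter> EW ?v"] unfolding Z_def by auto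
      then show False using bZ td(4,5) EW_iff by blast
    qed
    then obtain z where "z \<in> Z - X" "fst z = ?v" using EW_iff by blast
    then have "?v \<in> fst ` (Z - X)" by (metis imageI)
    then show ?thesis using a b by blast
  qed
  then obtain B where B: "\<And>w. w \<in> fst ` (Z - X) \<Longrightarrow> (\<exists>a. tandem X a (B w) \<and> fst a = w) \<and> fst (B w) \<in> fst ` (Z - X)"
    by metis
  then obtain A where A: "\<And>w. w \<in> fst ` (Z - X) \<Longrightarrow> tandem X (A w) (B w) \<and> fst (A w) = w" by metis
  let ?g = "\<lambda>w. fst (B w)" and ?S = "fst ` (Z - X)"
  have "finite ?S" using ZE finite_subset[OF _ finite_E] by blast
  moreover have im: "?g ` ?S \<subseteq> ?S" using B by blast
  ultimately obtain y n where y: "y \<in> ?S" "0 < n" "(?g ^^ n) y = y" "inj_on (\<lambda>i. (?g ^^ i) y) {..<n}"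
    using finite_cycle[OF _ ne] by metis
  have inS: "(?g ^^ i) y \<in> ?S" for i using y(1) im by (induction i) auto
  have "(?g ^^ (Suc i mod n)) y = fst (B ((?g ^^ i) y))" if "i < n" for i
    using that y(3) by (cases "Suc i = n") auto
  then have "tandem_cycle X (map (\<lambda>i. (A ((?g ^^ i) y), B ((?g ^^ i) y))) [0..<n])"
    using A inS by (intro cycle_of_tandems[OF y(2,4)]) auto
  from rotation_of_cycle[OF this] show ?thesis by blast
qed

lemma no_rotation_at_max:
  assumes X: "stable X" "rotations_at X = {}" shows "X_max = X" "rotations_at X_max = {}" "stable X_max"
proof -
  show "X_max = X" using rotation_exists[OF X(1)] X(2) by (intro X_max_eq[OF X(1)]) blast
  then show "rotations_at X_max = {}" "stable X_max" using X by simp_all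
qed

text \<open>
  \<open>P\<close> is the set of edges proposed so far in deferred acceptance, and \<open>X\<close> the set of the
  proposals that are presently held.
\<close>

definition deferred :: "('w \<times> 'f) set \<Rightarrow> ('w \<times> 'f) set \<Rightarrow> bool" where
  "deferred X P \<longleftrightarrow> X \<subseteq> P \<and> P \<subseteq> E \<and> F_acceptable X \<and> (\<forall>w\<in>W. card (X \<inter> EW w) \<le> q w) \<and>
     (\<forall>e\<in>P. \<forall>e'. (e', e) \<in> gt (fst e) \<longrightarrow> e' \<in> P) \<and>
     (\<forall>e\<in>P. settled X e) \<and> (\<forall>Y. stable Y \<longrightarrow> Y \<inter> P \<subseteq> X)"

lemma deferred_empty: "deferred {} {}"
proof -
  have "C f {} = {}" if "f \<in> F" for f using choice_subset[OF that, of "{}"] by auto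
  then show ?thesis unfolding deferred_def F_acceptable_def by auto
qed

text \<open>
  If \<open>Y\<close> had its quota at this vertex filled with better edges, these would have been proposed
  earlier and, belonging to a stable matching, would still be held: one proposal too many.
\<close>

lemma deferred_refused:
  assumes d: "deferred X P" and Y: "stable Y" and p: "p \<in> X" "p \<notin> Y"
  shows "\<not> accepts Y p"
proof
  assume a: "accepts Y p"
  have pE: "p \<in> E" "p \<in> P" using p d unfolding deferred_def by auto
  have w: "fst p \<in> W" using edge_ends pE by auto
  have full: "card (Y \<inter> EW (fst p)) = q (fst p)" "\<And>y. y \<in> Y \<inter> EW (fst p) \<Longrightarrow> (y, p) \<in> gt (fst p)"
    using stableD(5,6)[OF Y _ a] p pE by auto
  have "Y \<inter> EW (fst p) \<subseteq> X"
    using d full(2) pE Y unfolding deferred_def by blast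
  then have "Y \<inter> EW (fst p) \<subset> X \<inter> EW (fst p)" using p pE EW_iff by blast
  then have "card (Y \<inter> EW (fst p)) < card (X \<inter> EW (fst p))" by (intro psubset_card_mono) auto
  then show False using full(1) d w unfolding deferred_def by (simp add: leD)
qed

lemma refused_choice:
  assumes f: "f \<in> F" and Y: "stable Y" and U: "U \<subseteq> EF f"
    and ref: "\<And>p. p \<in> U - Y \<Longrightarrow> \<not> accepts Y p"
  shows "C f (U \<union> (Y \<inter> EF f)) = Y \<inter> EF f"
proof -
  have "C f (U \<union> (Y \<inter> EF f)) \<subseteq> Y \<inter> EF f"
  proof
    fix p assume p: "p \<in> C f (U \<union> (Y \<inter> EF f))"
    then have pU: "p \<in> U \<union> (Y \<inter> EF f)" using choice_subset[OF f, of "U \<union> (Y \<inter> EF f)"] U by auto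
    show "p \<in> Y \<inter> EF f"
    proof (rule ccontr)
      assume n: "p \<notin> Y \<inter> EF f"
      have pf: "snd p = f" "p \<in> EF f" using pU U by (auto simp: EF_iff)
      have "p \<in> C f (insert p (Y \<inter> EF f))"
        using A2[OF f, of "U \<union> (Y \<inter> EF f)" "insert p (Y \<inter> EF f)"] p pU U by auto
      then have "accepts Y p" using pf unfolding accepts_def by simp
      moreover have "p \<in> U - Y" using n pU pf by auto
      ultimately show False using ref by blast
    qed
  qed
  then have "C f (Y \<inter> EF f) = C f (U \<union> (Y \<inter> EF f))" using A1[OF f, of "U \<union> (Y \<inter> EF f)" "Y \<inter> EF f"] U by auto
  then show ?thesis using stableD(4)[OF Y f] by simp
qed

text \<open>
  No edge of a stable matching \<open>Y\<close> is ever rejected: the proposals held by the firm that are not in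
  \<open>Y\<close> are refused at \<open>Y\<close>, so they do not prevent the firm from choosing its edges of \<open>Y\<close>.
\<close>

lemma deferred_step:
  assumes d: "deferred X P" and e: "e \<in> E" "e \<notin> P" and top: "\<And>e'. (e', e) \<in> gt (fst e) \<Longrightarrow> e' \<in> P"
    and room: "card (X \<inter> EW (fst e)) < q (fst e)"
  shows "deferred ((X - EF (snd e)) \<union> C (snd e) (insert e (X \<inter> EF (snd e)))) (insert e P)"
proof -
  let ?f = "snd e"
  let ?U = "insert e (X \<inter> EF ?f)"
  let ?X = "(X - EF ?f) \<union> C ?f ?U"
  have dd: "X \<subseteq> P" "P \<subseteq> E" "F_acceptable X" "\<forall>w\<in>W. card (X \<inter> EW w) \<le> q w"
    "\<forall>e\<in>P. settled X e" "\<And>Y. stable Y \<Longrightarrow> Y \<inter> P \<subseteq> X" using d unfolding deferred_def by auto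
  have f: "?f \<in> F" "e \<in> EF ?f" and w: "fst e \<in> W" using e edge_ends by (auto simp: EF_iff)
  have CU: "C ?f ?U \<subseteq> ?U" using f by (intro choice_subset) auto
  have sub: "?X \<subseteq> insert e X" using CU by auto
  have Xf: "?X \<inter> EF ?f = C ?f ?U" using CU f by auto
  have Xg: "?X \<inter> EF g = X \<inter> EF g" if "g \<noteq> ?f" for g using that CU f by (auto simp: EF_iff)
  have acc: "F_acceptable ?X" unfolding F_acceptable_def
  proof (intro conjI ballI)
    show "?X \<subseteq> E" using sub e dd by blast
    fix g assume g: "g \<in> F"
    show "C g (?X \<inter> EF g) = ?X \<inter> EF g"
    proof (cases "g = ?f")
      case True
      then show ?thesis using Xf choice_idem[OF f(1), of ?U] f by simp
    next
      case False
      then show ?thesis using Xg[OF False] F_acceptableD(2)[OF dd(3) g] by simp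
    qed
  qed
  have le: "leF X ?X" unfolding leF_def
  proof
    fix g assume g: "g \<in> F"
    show "C g ((X \<inter> EF g) \<union> (?X \<inter> EF g)) = ?X \<inter> EF g"
    proof (cases "g = ?f")
      case True
      have "C ?f ((X \<inter> EF ?f) \<union> C ?f ?U) = C ?f ?U" using f CU by (intro A1) auto
      then show ?thesis using True Xf by simp
    next
      case False
      then show ?thesis using Xg[OF False] F_acceptableD(2)[OF dd(3) g] by simp
    qed
  qed
  have "card (?X \<inter> EW v) \<le> q v" if v: "v \<in> W" for v
  proof (cases "v = fst e")
    case True
    have "card (?X \<inter> EW v) \<le> card (insert e (X \<inter> EW v))" using sub by (intro card_mono) auto
    also have "\<dots> \<le> Suc (card (X \<inter> EW v))" by (rule card_insert_le_m1) auto
    finally show ?thesis using room True by simp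
  next
    case False
    then have "?X \<inter> EW v \<subseteq> X \<inter> EW v" using sub by (auto simp: EW_iff)
    then have "card (?X \<inter> EW v) \<le> card (X \<inter> EW v)" by (intro card_mono) auto
    then show ?thesis using dd(4) v le_trans by blast
  qed
  moreover have "settled ?X e'" if e': "e' \<in> insert e P" for e'
  proof (cases "e' = e \<and> e \<notin> C ?f ?U")
    case True
    then have "C ?f ?U \<subseteq> X \<inter> EF ?f" using CU by auto
    then have "C ?f ?U = X \<inter> EF ?f"
      using A1[OF f(1), of ?U "X \<inter> EF ?f"] F_acceptableD(2)[OF dd(3) f(1)] f by auto
    then have "\<not> accepts ?X e" using True Xf unfolding accepts_def by simp
    then show ?thesis using True unfolding settled_def by simp
  next
    case False
    then consider "e' = e" "e \<in> C ?f ?U" | "e' \<in> P" using e' by auto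
    then show ?thesis
    proof cases
      case 1
      then show ?thesis unfolding settled_def by auto
    next
      case 2
      then show ?thesis using settled_mono[OF le] dd by blast
    qed
  qed
  moreover have "Y \<inter> insert e P \<subseteq> ?X" if Y: "stable Y" for Y
  proof
    fix p assume p: "p \<in> Y \<inter> insert e P"
    have ref: "\<not> accepts Y p" if p: "p \<in> ?U - Y" for p
    proof (cases "p = e")
      case True
      show ?thesis
      proof
        assume a: "accepts Y p"
        have full: "card (Y \<inter> EW (fst e)) = q (fst e)" "\<And>y. y \<in> Y \<inter> EW (fst e) \<Longrightarrow> (y, e) \<in> gt (fst e)"
          using stableD(5,6)[OF Y _ a] p e True by auto
        have "Y \<inter> EW (fst e) \<subseteq> X \<inter> EW (fst e)" using top full(2) dd(6)[OF Y] by blast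
        then have "card (Y \<inter> EW (fst e)) \<le> card (X \<inter> EW (fst e))" by (intro card_mono) auto
        then show False using full(1) room by simp
      qed
    next
      case False
      then show ?thesis using deferred_refused[OF d Y] p by auto
    qed
    show "p \<in> ?X"
    proof (cases "p \<in> ?U")
      case True
      have U: "?U \<subseteq> EF ?f" using f by auto
      have "p \<in> Y \<inter> EF ?f" using p True U by auto
      then have "p \<in> C ?f (?U \<union> (Y \<inter> EF ?f))" using refused_choice[OF f(1) Y U ref] by simp
      then show ?thesis using A2[OF f(1), of "?U \<union> (Y \<inter> EF ?f)" ?U] True f by auto
    next
      case False
      then show ?thesis using p dd(6)[OF Y] by auto
    qed
  qed
  moreover have "e'' \<in> insert e P" if "e' \<in> insert e P" "(e'', e') \<in> gt (fst e')" for e' e''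
    using that top d unfolding deferred_def by blast
  moreover have "?X \<subseteq> insert e P" "insert e P \<subseteq> E" using sub dd e by auto
  ultimately show ?thesis using acc unfolding deferred_def by blast
qed

lemma deferred_final:
  assumes d: "deferred X P" and stop: "\<And>w. w \<in> W \<Longrightarrow> card (X \<inter> EW w) < q w \<Longrightarrow> EW w \<subseteq> P"
  shows "stable X" "X_min = X"
proof -
  have dd: "X \<subseteq> P" "P \<subseteq> E" "F_acceptable X" "\<And>w. w \<in> W \<Longrightarrow> card (X \<inter> EW w) \<le> q w"
    "\<And>e. e \<in> P \<Longrightarrow> settled X e" "\<And>e e'. e \<in> P \<Longrightarrow> (e', e) \<in> gt (fst e) \<Longrightarrow> e' \<in> P"
    using d unfolding deferred_def by auto
  show st: "stable X" unfolding stable_iff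
  proof (intro conjI ballI impI)
    show "F_acceptable X" "\<And>w. w \<in> W \<Longrightarrow> card (X \<inter> EW w) \<le> q w" using dd by auto
    fix e assume e: "e \<in> E - X" "accepts X e"
    then have w: "fst e \<in> W" and nP: "e \<notin> P" using edge_ends dd(5)[of e] unfolding settled_def by auto
    then show "card (X \<inter> EW (fst e)) = q (fst e)" using stop[OF w] dd(4)[OF w] e EW_iff by fastforce
    fix y assume y: "y \<in> X \<inter> EW (fst e)"
    then have "y \<in> P" "fst y = fst e" using dd(1) by (auto simp: EW_iff)
    then have "(e, y) \<notin> gt (fst e)" using dd(6)[of y e] nP by auto
    then show "(y, e) \<in> gt (fst e)" using gt_total[OF w, of e y] y e by (auto simp: EW_iff)
  qed
  show "X_min = X"
  proof (rule X_min_eq[OF st])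
    fix Y assume Y: "stable Y"
    show "leF X Y" unfolding leF_def
      using refused_choice[OF _ Y] deferred_refused[OF d Y] by blast
  qed
qed

end

section \<open>The poset of rotations\<close>

context stable_market
begin

primrec feasible :: "('w \<times> 'f) set \<Rightarrow> (('w \<times> 'f) set \<times> ('w \<times> 'f) set) list \<Rightarrow> bool" where
  "feasible X [] \<longleftrightarrow> True"
| "feasible X (L # Ls) \<longleftrightarrow> L \<in> rotations_at X \<and> feasible (apply_rotation L X) Ls"

primrec result :: "('w \<times> 'f) set \<Rightarrow> (('w \<times> 'f) set \<times> ('w \<times> 'f) set) list \<Rightarrow> ('w \<times> 'f) set" where
  "result X [] = X"
| "result X (L # Ls) = result (apply_rotation L X) Ls"

lemma feasible_append: "feasible X (u @ v) \<longleftrightarrow> feasible X u \<and> feasible (result X u) v"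
  by (induction u arbitrary: X) auto

lemma result_append: "result X (u @ v) = result (result X u) v"
  by (induction u arbitrary: X) auto

lemma feasible_stable: "stable X \<Longrightarrow> feasible X u \<Longrightarrow> stable (result X u)"
  by (induction u arbitrary: X) (auto simp: apply_rotation_stable)

lemma feasible_leF: "stable X \<Longrightarrow> feasible X u \<Longrightarrow> leF X (result X u)"
proof (induction u arbitrary: X)
  case Nil
  then show ?case by (simp add: leF_refl stableD(1))
next
  case (Cons L u)
  then have "leF (apply_rotation L X) (result (apply_rotation L X) u)" "leF X (apply_rotation L X)"
    using apply_rotation_stable by auto
  then show ?case using leF_trans by auto
qed

lemma route_iff: "route X u Y \<longleftrightarrow> stable X \<and> feasible X u \<and> Y = result X u"
proof
  assume "route X u Y"
  then show "stable X \<and> feasible X u \<and> Y = result X u"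
    by induction (auto simp: feasible_append result_append)
next
  assume "stable X \<and> feasible X u \<and> Y = result X u"
  then show "route X u Y"
  proof (induction u arbitrary: Y rule: rev_induct)
    case Nil
    then show ?case using route_Nil by auto
  next
    case (snoc L u)
    then show ?case using route_snoc[of X u "result X u" L] by (auto simp: feasible_append result_append)
  qed
qed

lemma feasible_distinct: "stable X \<Longrightarrow> feasible X u \<Longrightarrow> distinct u"
proof (induction u arbitrary: X)
  case (Cons L u)
  let ?Y = "apply_rotation L X"
  have Y: "stable ?Y" "L \<in> rotations_at X" "feasible ?Y u" using Cons apply_rotation_stable by auto
  have "L \<notin> set u"
  proof
    assume "L \<in> set u"
    then obtain u1 u2 where "u = u1 @ L # u2" by (meson split_list)
    then have "feasible ?Y u1" "L \<in> rotations_at (result ?Y u1)" using Y(3) by (auto simp: feasible_append)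
    then show False
      using rotation_not_repeated[OF Cons.prems(1) Y(2)] feasible_stable[OF Y(1)] feasible_leF[OF Y(1)] by blast
  qed
  then show ?case using Cons.IH[OF Y(1,3)] by auto
qed auto

text \<open>
  Rotations that are available together may be applied in any order; so an available rotation
  can be moved to the front of a route.
\<close>

lemma move_to_front:
  assumes "stable X" "feasible X u" "x \<in> rotations_at X"
  shows "feasible (apply_rotation x X) (remove1 x u)"
    and "result (apply_rotation x X) (remove1 x u) =
         (if x \<in> set u then result X u else apply_rotation x (result X u))"
    and "x \<notin> set u \<Longrightarrow> x \<in> rotations_at (result X u)"
  using assms
proof (induction u arbitrary: X)
  case (Cons y u)
  {
    case 1
    show ?case
    proof (cases "y = x")
      case False
      have "x \<in> rotations_at (apply_rotation y X)" "y \<in> rotations_at (apply_rotation x X)"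
        "apply_rotation x (apply_rotation y X) = apply_rotation y (apply_rotation x X)"
        using rotations_commute 1 False by auto
      then show ?thesis using Cons.IH(1)[of "apply_rotation y X"] 1 apply_rotation_stable False by auto
    qed (use 1 in auto)
  next
    case 2
    show ?case
    proof (cases "y = x")
      case False
      have "x \<in> rotations_at (apply_rotation y X)"
        "apply_rotation x (apply_rotation y X) = apply_rotation y (apply_rotation x X)"
        using rotations_commute 2 False by auto
      then show ?thesis using Cons.IH(2)[of "apply_rotation y X"] 2 apply_rotation_stable False by auto
    qed (use 2 in auto)
  next
    case 3
    then have y: "y \<in> rotations_at X" "y \<noteq> x" by auto
    have "x \<in> rotations_at (apply_rotation y X)" using rotations_commute(1)[OF _ y(1) _ y(2)] 3 by blast
    then show ?case using Cons.IH(3)[of "apply_rotation y X"] 3 apply_rotation_stable by auto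
  }
qed auto

lemma routes_join:
  assumes "stable X" "feasible X u" "feasible X v"
  shows "feasible (result X u) (filter (\<lambda>x. x \<notin> set u) v)"
    and "feasible (result X v) (filter (\<lambda>x. x \<notin> set v) u)"
    and "result (result X u) (filter (\<lambda>x. x \<notin> set u) v) = result (result X v) (filter (\<lambda>x. x \<notin> set v) u)"
proof -
  have "feasible (result X u) (filter (\<lambda>x. x \<notin> set u) v) \<and>
     feasible (result X v) (filter (\<lambda>x. x \<notin> set v) u) \<and>
     result (result X u) (filter (\<lambda>x. x \<notin> set u) v) = result (result X v) (filter (\<lambda>x. x \<notin> set v) u)"
    using assms
  proof (induction u arbitrary: X v)
    case (Cons x u)
    let ?X = "apply_rotation x X" and ?v = "remove1 x v"
    have x: "x \<in> rotations_at X" "feasible ?X u" "stable ?X" using Cons.prems apply_rotation_stable by auto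
    have dist: "distinct v" "x \<notin> set u" using feasible_distinct Cons.prems by fastforce+
    note mv = move_to_front[OF Cons.prems(1,3) x(1)]
    have IH: "feasible (result ?X u) (filter (\<lambda>z. z \<notin> set u) ?v)"
      "feasible (result ?X ?v) (filter (\<lambda>z. z \<notin> set ?v) u)"
      "result (result ?X u) (filter (\<lambda>z. z \<notin> set u) ?v) = result (result ?X ?v) (filter (\<lambda>z. z \<notin> set ?v) u)"
      using Cons.IH[OF x(3,2) mv(1)] by auto
    have f1: "filter (\<lambda>z. z \<notin> set u) ?v = filter (\<lambda>z. z \<notin> set (x # u)) v"
      using dist(1) by (auto simp: distinct_remove1_removeAll removeAll_filter_not_eq intro!: filter_cong)
    have f2: "filter (\<lambda>z. z \<notin> set ?v) u = filter (\<lambda>z. z \<notin> set v) u"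
      using dist by (intro filter_cong) auto
    show ?case
    proof (cases "x \<in> set v")
      case True
      then show ?thesis using IH f1 f2 mv(2) by auto
    next
      case False
      then have "?v = v" by (simp add: remove1_idem)
      then show ?thesis using IH f1 f2 mv(2,3) False by auto
    qed
  qed auto
  then show "feasible (result X u) (filter (\<lambda>x. x \<notin> set u) v)"
    "feasible (result X v) (filter (\<lambda>x. x \<notin> set v) u)"
    "result (result X u) (filter (\<lambda>x. x \<notin> set u) v) = result (result X v) (filter (\<lambda>x. x \<notin> set v) u)"
    by auto
qed

text \<open>
  A rotation is the same cycle of tandems wherever it is available: the tandems of both
  places survive in the join.
\<close>

lemma rotation_pairs:
  assumes X: "stable X" and u: "feasible X u" "L \<in> rotations_at (result X u)"
    and v: "feasible X v" "L \<in> rotations_at (result X v)" and a: "a \<in> fst L"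
    and t: "tandem (result X u) a b" "tandem (result X v) a b'"
  shows "b = b'"
proof -
  note j = routes_join[OF X u(1) v(1)]
  note Su = feasible_stable[OF X u(1)] and Sv = feasible_stable[OF X v(1)]
  let ?v = "filter (\<lambda>x. x \<notin> set u) v"
  let ?J = "result (result X u) ?v"
  have "feasible X (u @ [L])" "feasible X (v @ [L])" using u v by (simp_all add: feasible_append)
  then have "L \<notin> set u" "L \<notin> set v" using feasible_distinct[OF X] by fastforce+
  then have LJ: "L \<in> rotations_at ?J" using move_to_front(3)[OF Su j(1) u(2)] by auto
  have J: "stable ?J" "leF (result X u) ?J" "leF (result X v) ?J"
    using feasible_stable[OF Su j(1)] feasible_leF[OF Su j(1)] feasible_leF[OF Sv j(2)] j(3) by auto
  have "b \<in> ?J" "b' \<in> ?J"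
    using rotation_tandem(4)[OF Su u(2) a t(1)] rotation_tandem(4)[OF Sv v(2) a t(2)] rotationD(3)[OF J(1) LJ] by auto
  then have "tandem ?J a b" "tandem ?J a b'"
    using tandem_persists[OF Su J(1,2) t(1)] tandem_persists[OF Sv J(1,3) t(2)] by auto
  then show ?thesis using tandem_unique[OF J(1)] by blast
qed

text \<open>
  By induction along \<open>t\<close>, \<open>rotation_meet\<close> moves the availability of \<open>z\<close> back to \<open>X\<close>.  In other
  words, if \<open>z\<close> waits for \<open>y\<close> at \<open>X\<close>, then nothing else can make it available.
\<close>

lemma rotation_waits:
  assumes "stable X" "feasible X t" "y \<in> rotations_at X" "z \<in> rotations_at (apply_rotation y X)"
    "z \<in> rotations_at (result X t)" "y \<notin> set t" "z \<notin> set t" "z \<noteq> y"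
  shows "z \<in> rotations_at X"
  using assms
proof (induction t arbitrary: X)
  case (Cons x t)
  let ?X = "apply_rotation x X"
  have x: "x \<in> rotations_at X" "stable ?X" "x \<noteq> y" "x \<noteq> z" using Cons.prems apply_rotation_stable by auto
  have y: "y \<in> rotations_at ?X" "x \<in> rotations_at (apply_rotation y X)"
    "apply_rotation x (apply_rotation y X) = apply_rotation y ?X"
    using rotations_commute Cons.prems(1,3) x by metis+
  have "stable (apply_rotation y X)" using Cons.prems apply_rotation_stable by auto
  then have "z \<in> rotations_at (apply_rotation y ?X)"
    using rotations_commute(1)[OF _ y(2) Cons.prems(4) x(4)] y(3) by simp
  then have "z \<in> rotations_at ?X" using Cons.IH[OF x(2) _ y(1)] Cons.prems by auto
  then show ?case using rotation_meet[OF Cons.prems(1) x(1) Cons.prems(3) x(3)] Cons.prems(4) by blast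
qed auto

definition precedes :: "'z list \<Rightarrow> 'z \<Rightarrow> 'z \<Rightarrow> bool" where
  "precedes xs x y \<longleftrightarrow> (\<exists>i j. i < j \<and> j < length xs \<and> xs ! i = x \<and> xs ! j = y)"

lemma precedes_split:
  assumes "distinct (xs @ y # ys)" shows "precedes (xs @ y # ys) x y \<longleftrightarrow> x \<in> set xs"
proof
  assume "precedes (xs @ y # ys) x y"
  then obtain i j where ij: "i < j" "j < length (xs @ y # ys)" "(xs @ y # ys) ! i = x" "(xs @ y # ys) ! j = y"
    unfolding precedes_def by auto
  then have "j = length xs"
    using nth_eq_iff_index_eq[OF assms, of j "length xs"] by auto
  then show "x \<in> set xs" using ij by (auto simp: nth_append)
next
  assume "x \<in> set xs"
  then obtain i where "i < length xs" "xs ! i = x" by (auto simp: in_set_conv_nth)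
  then show "precedes (xs @ y # ys) x y" unfolding precedes_def
    by (intro exI[of _ i] exI[of _ "length xs"]) (auto simp: nth_append)
qed

lemma precedes_after:
  assumes "distinct (xs @ y # ys)" "precedes (xs @ y # ys) y z" shows "z \<in> set ys"
proof -
  obtain i j where ij: "i < j" "j < length (xs @ y # ys)" "(xs @ y # ys) ! i = y" "(xs @ y # ys) ! j = z"
    using assms(2) unfolding precedes_def by auto
  then have "i = length xs" using nth_eq_iff_index_eq[OF assms(1), of i "length xs"] by auto
  then obtain k where "j = Suc (length xs + k)" using ij(1) less_iff_Suc_add by auto
  then have "k < length ys" "ys ! k = z" using ij by (auto simp: nth_append)
  then show ?thesis by (metis nth_mem)
qed

lemma precedes_trans:
  assumes "distinct xs" "precedes xs x y" "precedes xs y z" shows "precedes xs x z"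
proof -
  obtain i j where "i < j" "j < length xs" "xs ! i = x" "xs ! j = y"
    using assms(2) unfolding precedes_def by blast
  moreover obtain j' k where "j' < k" "k < length xs" "xs ! j' = y" "xs ! k = z"
    using assms(3) unfolding precedes_def by blast
  moreover from calculation have "j = j'" using nth_eq_iff_index_eq[OF assms(1), of j j'] by auto
  ultimately have "i < k \<and> k < length xs \<and> xs ! i = x \<and> xs ! k = z" by simp
  then show ?thesis unfolding precedes_def by blast
qed

lemma first_enabled:
  assumes "z \<notin> rotations_at X" "z \<in> rotations_at (result X d)"
  shows "\<exists>d1 y d2. d = d1 @ y # d2 \<and> z \<notin> rotations_at (result X d1) \<and>
           z \<in> rotations_at (apply_rotation y (result X d1))"
  using assms
proof (induction d arbitrary: X)
  case (Cons x d)
  show ?case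
  proof (cases "z \<in> rotations_at (apply_rotation x X)")
    case True
    then show ?thesis using Cons.prems by (intro exI[of _ "[]"]) auto
  next
    case False
    then obtain d1 y d2 where "d = d1 @ y # d2" "z \<notin> rotations_at (result (apply_rotation x X) d1)"
      "z \<in> rotations_at (apply_rotation y (result (apply_rotation x X) d1))"
      using Cons.IH[OF False] Cons.prems(2) by auto
    then show ?thesis by (intro exI[of _ "x # d1"]) auto
  qed
qed auto

primrec greedy :: "('w \<times> 'f) set \<Rightarrow> (('w \<times> 'f) set \<times> ('w \<times> 'f) set) list \<Rightarrow> ('w \<times> 'f) set" where
  "greedy X [] = X"
| "greedy X (L # Ls) = greedy (if L \<in> rotations_at X then apply_rotation L X else X) Ls"

lemma greedy_append: "greedy X (u @ v) = greedy (greedy X u) v"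
  by (induction u arbitrary: X) auto

lemma greedy_feasible: "feasible X u \<Longrightarrow> greedy X u = result X u"
  by (induction u arbitrary: X) auto

context
  assumes stable_min: "stable X_min" and top: "rotations_at X_max = {}"
begin

lemma full_route_iff: "full_route u \<longleftrightarrow> feasible X_min u \<and> result X_min u = X_max"
  unfolding full_route_def route_iff using stable_min by auto

lemma full_route_distinct: "full_route u \<Longrightarrow> distinct u"
  using feasible_distinct[OF stable_min] full_route_iff by auto

lemma feasible_at_max: "feasible X_max u \<longleftrightarrow> u = []"
  using top by (cases u) auto

text \<open>
  At the end of a full route nothing is available, so joining it with any other route adds nothing
  to it.
\<close>

lemma full_route_extend:
  assumes "full_route u" "feasible X_min v"
  shows "full_route (v @ filter (\<lambda>x. x \<notin> set v) u)" "set v \<subseteq> set u"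
proof -
  have u: "feasible X_min u" "result X_min u = X_max" using assms(1) full_route_iff by auto
  note j = routes_join[OF stable_min assms(2) u(1)]
  have "filter (\<lambda>x. x \<notin> set u) v = []" using j(2) u(2) feasible_at_max by auto
  then show "set v \<subseteq> set u" "full_route (v @ filter (\<lambda>x. x \<notin> set v) u)"
    using j assms(2) u unfolding full_route_iff by (auto simp: feasible_append result_append filter_empty_conv)
qed

lemma full_route_set: "full_route u \<Longrightarrow> rotations = set u"
  unfolding rotations_def using full_route_extend(2) full_route_iff by blast

lemma rot_less_iff: "full_route u \<Longrightarrow>
    rot_less x y \<longleftrightarrow> x \<in> set u \<and> y \<in> set u \<and> (\<forall>v. full_route v \<longrightarrow> precedes v x y)"
  unfolding rot_less_def precedes_def using full_route_set by auto

lemma rot_less_trans: "full_route u \<Longrightarrow> rot_less x y \<Longrightarrow> rot_less y z \<Longrightarrow> rot_less x z"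
  using rot_less_iff full_route_distinct precedes_trans by meson

text \<open>
  Suppose some full route applies \<open>z\<close> before \<open>y\<close>, and join its part before \<open>z\<close> with \<open>v\<close>.  Then
  \<open>z\<close> becomes available after \<open>v\<close> both by \<open>y\<close> and by rotations other than \<open>y\<close>.
\<close>

lemma enabling_precedes:
  assumes u: "full_route u" and v: "feasible X_min v" and y: "y \<in> rotations_at (result X_min v)"
    and z: "z \<notin> rotations_at (result X_min v)" "z \<in> rotations_at (apply_rotation y (result X_min v))"
  shows "rot_less y z"
proof -
  let ?S = "result X_min v"
  have S: "stable ?S" using feasible_stable[OF stable_min v] .
  have vyz: "feasible X_min (v @ [y, z])" using v y z(2) by (simp add: feasible_append)
  then have yz: "y \<in> set u" "z \<in> set u" using full_route_extend(2)[OF u vyz] by auto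
  have dist: "y \<notin> set v" "z \<notin> set v" "z \<noteq> y" using feasible_distinct[OF stable_min vyz] by auto
  have "precedes t y z" if t: "full_route t" for t
  proof -
    have "z \<in> set t" using yz full_route_set[OF u] full_route_set[OF t] by auto
    then obtain t1 t2 where t12: "t = t1 @ z # t2" by (meson split_list)
    have "y \<in> set t1"
    proof (rule ccontr)
      assume ny: "y \<notin> set t1"
      have d: "z \<notin> set t1" using full_route_distinct[OF t] t12 by auto
      have t1: "feasible X_min t1" "z \<in> rotations_at (result X_min t1)"
        using t t12 unfolding full_route_iff by (auto simp: feasible_append)
      note j = routes_join[OF stable_min v t1(1)]
      have "z \<in> rotations_at (result (result X_min t1) (filter (\<lambda>x. x \<notin> set t1) v))"
        using move_to_front(3)[OF feasible_stable[OF stable_min t1(1)] j(2) t1(2)] dist(2) by auto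
      then have "z \<in> rotations_at (result ?S (filter (\<lambda>x. x \<notin> set v) t1))" using j(3) by simp
      then have "z \<in> rotations_at ?S"
        using rotation_waits[OF S j(1) y z(2)] ny d dist by auto
      then show False using z by blast
    qed
    then show ?thesis using precedes_split full_route_distinct[OF t] t12 by metis
  qed
  then show ?thesis using rot_less_iff[OF u] yz by auto
qed

text \<open>
  The pass skips \<open>r\<close> and, after it, exactly the successors of \<open>r\<close>: a rotation that is not yet
  available has become so in the given route by some skipped one, hence it comes after \<open>r\<close>.
\<close>

lemma greedy_pass:
  assumes "full_route (a @ r # d @ s)" "\<And>x. x \<in> set d \<Longrightarrow> rot_less r x"
  shows "\<exists>a' d'. full_route (a' @ r # d') \<and> greedy (result X_min a) s = result X_min a' \<and>
           (\<forall>x\<in>set d'. rot_less r x)"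
  using assms
proof (induction s arbitrary: a d)
  case Nil
  then have "full_route (a @ r # d)" "\<forall>x\<in>set d. rot_less r x" by simp_all
  then show ?case unfolding greedy.simps by blast
next
  case (Cons z s)
  let ?S = "result X_min a"
  note full = Cons.prems(1)
  have fe: "feasible X_min a" "feasible ?S (r # d @ z # s)" and res: "result ?S (r # d @ z # s) = X_max"
    using full unfolding full_route_iff by (simp_all add: feasible_append result_append)
  have S: "stable ?S" using feasible_stable[OF stable_min fe(1)] .
  have dist: "distinct (a @ r # d @ z # s)" using full_route_distinct[OF full] .
  show ?case
  proof (cases "z \<in> rotations_at ?S")
    case True
    have rm: "remove1 z (r # d @ z # s) = r # d @ s" using dist by (auto simp: remove1_append)
    have "feasible (apply_rotation z ?S) (r # d @ s)" "result (apply_rotation z ?S) (r # d @ s) = X_max"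
      using move_to_front(1,2)[OF S fe(2) True] res unfolding rm by auto
    then have "full_route ((a @ [z]) @ r # d @ s)"
      using fe(1) True unfolding full_route_iff
      by (simp add: feasible_append result_append)
    then show ?thesis using Cons.IH[of "a @ [z]" d] Cons.prems(2) True by (simp add: result_append)
  next
    case False
    have "feasible ?S (r # d)" "z \<in> rotations_at (result ?S (r # d))"
      using fe(2) by (auto simp: feasible_append)
    then obtain d1 y d2 where y: "r # d = d1 @ y # d2" "z \<notin> rotations_at (result ?S d1)"
      "z \<in> rotations_at (apply_rotation y (result ?S d1))"
      using first_enabled[OF False] by blast
    have f: "feasible ?S (d1 @ y # d2)" using \<open>feasible ?S (r # d)\<close> y(1) by simp
    have "rot_less y z"
      using enabling_precedes[OF full, of "a @ d1" y z] f y fe(1)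
      by (simp add: feasible_append result_append)
    moreover have "y = r \<or> rot_less r y" using y(1) Cons.prems(2) by (metis in_set_conv_decomp set_ConsD)
    ultimately have "rot_less r z" using rot_less_trans[OF full] by blast
    then have "\<And>x. x \<in> set (d @ [z]) \<Longrightarrow> rot_less r x" using Cons.prems(2) by auto
    then show ?thesis using Cons.IH[of a "d @ [z]"] full False by auto
  qed
qed

text \<open>
  A rotation \<open>x\<close> that is available directly after \<open>r\<close> can be applied before any other rotation above
  \<open>r\<close>, hence none lies between.  Conversely, if \<open>x\<close> is not yet available, the rotation above
  \<open>r\<close> that makes it available lies between them.
\<close>

lemma available_iff_hasse:
  assumes full: "full_route (a @ r # d)" and d: "\<And>x. x \<in> set d \<Longrightarrow> rot_less r x"
    and x: "x \<in> set (a @ r # d)"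
  shows "x \<in> rotations_at (apply_rotation r (result X_min a)) \<longleftrightarrow> rot_hasse r x"
proof -
  let ?S = "apply_rotation r (result X_min a)"
  have fe: "feasible X_min a" "r \<in> rotations_at (result X_min a)" "feasible ?S d"
    using full unfolding full_route_iff by (auto simp: feasible_append)
  have far: "feasible X_min (a @ [r])" using fe by (simp add: feasible_append)
  have Sar: "?S = result X_min (a @ [r])" by (simp add: result_append)
  have S: "stable ?S" using feasible_stable[OF stable_min far] Sar by simp
  have dist: "distinct (a @ r # d)" using full_route_distinct[OF full] .
  show ?thesis
  proof
    assume av: "x \<in> rotations_at ?S"
    then have far': "feasible X_min ((a @ [r]) @ [x])" using far Sar by (simp add: feasible_append)
    then have "x \<notin> set (a @ [r])" using feasible_distinct[OF stable_min far'] by auto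
    then have "rot_less r x" using d x by auto
    moreover have "\<not> (rot_less r y \<and> rot_less y x)" for y
    proof
      assume y: "rot_less r y \<and> rot_less y x"
      obtain s where s: "full_route ((a @ [r]) @ x # s)"
        using full_route_extend(1)[OF full far'] by auto
      then have "precedes ((a @ [r]) @ x # s) y x" "precedes (a @ r # (x # s)) r y"
        using y s rot_less_iff[OF full] by auto
      moreover have dd: "distinct ((a @ [r]) @ x # s)" using full_route_distinct[OF s] .
      ultimately have "y \<in> set (a @ [r])" "y \<in> set (x # s)"
        using precedes_split[OF dd] precedes_after[of a r "x # s" y] by auto
      then show False using dd by auto
    qed
    ultimately show "rot_hasse r x" unfolding rot_hasse_def by blast
  next
    assume h: "rot_hasse r x"
    then have rx: "rot_less r x" unfolding rot_hasse_def by auto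
    then have "precedes (a @ r # d) r x" using rot_less_iff[OF full] full by blast
    then have "x \<in> set d" using precedes_after[OF dist] by blast
    then obtain d1 d2 where d12: "d = d1 @ x # d2" by (meson split_list)
    show "x \<in> rotations_at ?S"
    proof (rule ccontr)
      assume no: "x \<notin> rotations_at ?S"
      have fd: "feasible ?S d1" "x \<in> rotations_at (result ?S d1)"
        using fe(3) d12 by (auto simp: feasible_append)
      then obtain e1 y e2 where y: "d1 = e1 @ y # e2" "x \<notin> rotations_at (result ?S e1)"
        "x \<in> rotations_at (apply_rotation y (result ?S e1))"
        using first_enabled[OF no] by blast
      have "rot_less y x"
        using enabling_precedes[OF full, of "(a @ [r]) @ e1" y x] far fd y
        by (simp add: feasible_append result_append)
      moreover have "rot_less r y" using d y(1) d12 by auto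
      ultimately show False using h unfolding rot_hasse_def by blast
    qed
  qed
qed

text \<open>
  The state reached by avoiding \<open>r\<close> as long as possible has applied everything that is not
  above \<open>r\<close>.  So after \<open>r\<close> exactly the minimal elements above \<open>r\<close> become available.
\<close>

theorem greedy_hasse:
  assumes full: "full_route (u @ r # v)" and x: "x \<in> set (u @ r # v)"
  defines "G \<equiv> greedy X_min (u @ v)"
  shows "stable G" "r \<in> rotations_at G" "x \<in> rotations_at (apply_rotation r G) \<longleftrightarrow> rot_hasse r x"
proof -
  have u: "feasible X_min u" using full unfolding full_route_iff by (auto simp: feasible_append)
  obtain a d where ad: "full_route (a @ r # d)" "greedy (result X_min u) v = result X_min a"
    "\<forall>x\<in>set d. rot_less r x"
    using greedy_pass[of u r "[]" v] full by auto
  have G: "G = result X_min a" unfolding G_def greedy_append greedy_feasible[OF u] ad(2) ..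
  have "feasible X_min (a @ r # d)" using ad(1) full_route_iff by auto
  then show "stable G" "r \<in> rotations_at G"
    unfolding G using feasible_stable[OF stable_min] by (auto simp: feasible_append)
  have "set (a @ r # d) = set (u @ r # v)"
    using full_route_set[OF full] full_route_set[OF ad(1)] by simp
  then show "x \<in> rotations_at (apply_rotation r G) \<longleftrightarrow> rot_hasse r x"
    using available_iff_hasse[OF ad(1)] ad(3) x unfolding G by blast
qed

end

end

section \<open>Reasoning about programs and their running time\<close>

definition run ::
  "(nat \<times> nat) set \<Rightarrow> (nat \<Rightarrow> (nat \<times> nat) set \<Rightarrow> (nat \<times> nat) set) \<Rightarrow>
   com \<Rightarrow> memory \<Rightarrow> (nat \<Rightarrow> memory \<Rightarrow> bool) \<Rightarrow> bool" where
  "run E C c m Q \<longleftrightarrow> (\<exists>t m'. exec E C c m t m' \<and> Q t m')"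

lemma run_mono: "run E C c m Q \<Longrightarrow> (\<And>t m'. Q t m' \<Longrightarrow> Q' t m') \<Longrightarrow> run E C c m Q'"
  unfolding run_def by blast

lemma run_Skip: "run E C Skip m Q \<longleftrightarrow> Q 1 m"
  unfolding run_def by (metis exec_Skip exec_deterministic)

lemma run_Write: "run E C (Write x i j a) m Q \<longleftrightarrow>
    Q (acost i + acost j + acost a + 1) (store m x (aval i m) (aval j m) (aval a m))"
  unfolding run_def by (metis exec_Write exec_deterministic)

lemma run_Oracle: "run E C (Oracle a x y) m Q \<longleftrightarrow>
    Q (acost a + 1) (oracle_answer E m y (aval a m) (C (aval a m) (oracle_query E m x (aval a m))))"
  unfolding run_def by (metis exec_Oracle exec_deterministic)

lemma run_Seq: "run E C (Seq c d) m Q \<longleftrightarrow> run E C c m (\<lambda>t m'. run E C d m' (\<lambda>t' m''. Q (t + t') m''))"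
proof
  assume "run E C (Seq c d) m Q"
  then obtain t m' where e: "exec E C (Seq c d) m t m'" and Q: "Q t m'" unfolding run_def by auto
  from e show "run E C c m (\<lambda>t m'. run E C d m' (\<lambda>t' m''. Q (t + t') m''))"
    by cases (use Q in \<open>auto simp: run_def\<close>)
next
  assume "run E C c m (\<lambda>t m'. run E C d m' (\<lambda>t' m''. Q (t + t') m''))"
  then show "run E C (Seq c d) m Q" unfolding run_def using exec_Seq by meson
qed

lemma run_If: "run E C (If b c d) m Q \<longleftrightarrow>
    (if bval b m then run E C c m (\<lambda>t. Q (bcost b + t + 1)) else run E C d m (\<lambda>t. Q (bcost b + t + 1)))"
proof
  assume "run E C (If b c d) m Q"
  then obtain t m' where e: "exec E C (If b c d) m t m'" and Q: "Q t m'" unfolding run_def by auto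
  from e show "if bval b m then run E C c m (\<lambda>t. Q (bcost b + t + 1)) else run E C d m (\<lambda>t. Q (bcost b + t + 1))"
    by cases (use Q in \<open>auto simp: run_def\<close>)
next
  assume "if bval b m then run E C c m (\<lambda>t. Q (bcost b + t + 1)) else run E C d m (\<lambda>t. Q (bcost b + t + 1))"
  then show "run E C (If b c d) m Q" unfolding run_def
    using exec_IfTrue exec_IfFalse by (metis (full_types))
qed

lemmas run_simps = run_Skip run_Write run_Oracle run_Seq run_If

text \<open>The invariant speaks about the time spent so far, which allows amortised bounds.\<close>

lemma run_While:
  fixes f :: "memory \<Rightarrow> nat"
  assumes "I 0 m"
    and step: "\<And>t m. I t m \<Longrightarrow> bval b m \<Longrightarrow>
      run E C c m (\<lambda>t' m'. I (t + bcost b + t' + 1) m' \<and> f m' < f m)"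
    and exit: "\<And>t m. I t m \<Longrightarrow> \<not> bval b m \<Longrightarrow> Q (t + bcost b + 1) m"
  shows "run E C (While b c) m Q"
proof -
  have "\<exists>t' m'. exec E C (While b c) m t' m' \<and> Q (t + t') m'" if "I t m" for t m
    using that
  proof (induction "f m" arbitrary: m t rule: less_induct)
    case less
    show ?case
    proof (cases "bval b m")
      case True
      obtain t1 m1 where 1: "exec E C c m t1 m1" "I (t + bcost b + t1 + 1) m1" "f m1 < f m"
        using step[OF less(2) True] unfolding run_def by auto
      obtain t2 m2 where 2: "exec E C (While b c) m1 t2 m2" "Q (t + bcost b + t1 + 1 + t2) m2"
        using less(1)[OF 1(3,2)] by auto
      show ?thesis using exec_WhileTrue[OF True 1(1) 2(1)] 2(2)
        by (intro exI[of _ "bcost b + t1 + t2 + 1"] exI[of _ m2]) (simp add: ac_simps)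
    next
      case False
      then show ?thesis using exec_WhileFalse[OF False] exit[OF less(2) False]
        by (intro exI[of _ "bcost b + 1"] exI[of _ m]) (simp add: ac_simps)
    qed
  qed
  from this[OF assms(1)] show ?thesis unfolding run_def by simp
qed

abbreviation Var :: "string \<Rightarrow> aexp" where "Var x \<equiv> Read x (Const 0) (Const 0)"
abbreviation Arr :: "string \<Rightarrow> aexp \<Rightarrow> aexp" where "Arr x i \<equiv> Read x i (Const 0)"
abbreviation Assign :: "string \<Rightarrow> aexp \<Rightarrow> com" where "Assign x a \<equiv> Write x (Const 0) (Const 0) a"

definition For :: "string \<Rightarrow> aexp \<Rightarrow> com \<Rightarrow> com" where
  "For v n c = Seq (Assign v (Const 0)) (While (Less (Var v) n) (Seq c (Assign v (Plus (Var v) (Const 1)))))"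

lemma store_apply: "store m x i j v y = (if y = x then (m x)(i := (m x i)(j := v)) else m y)"
  by (simp add: store_def)

text \<open>
  The constants 13 and 9 cover initialising, testing and counting, besides the evaluation of
  the bound.
\<close>

lemma run_For:
  assumes init: "I 0 0 (store m v 0 0 0)"
    and bound: "\<And>i t m. I i t m \<Longrightarrow> i \<le> N \<Longrightarrow> aval n m = N \<and> m v 0 0 = i"
    and body: "\<And>i t m. I i t m \<Longrightarrow> i < N \<Longrightarrow>
      run E C c m (\<lambda>t' m'. m' v 0 0 = i \<and> I (Suc i) (t + t' + acost n + 13) (store m' v 0 0 (Suc i)))"
    and exit: "\<And>t m. I N t m \<Longrightarrow> Q (t + acost n + 9) m"
  shows "run E C (For v n c) m Q"
proof -
  let ?I = "\<lambda>t m. \<exists>i\<le>N. I i t m"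
  have "run E C (While (Less (Var v) n) (Seq c (Assign v (Plus (Var v) (Const 1))))) (store m v 0 0 0)
     (\<lambda>t. Q (4 + t))"
  proof (rule run_While[of "?I" _ _ _ _ _ "\<lambda>m. N - m v 0 0"])
    show "?I 0 (store m v 0 0 0)" using init by blast
  next
    fix t m assume I: "?I t m" and b: "bval (Less (Var v) n) m"
    then obtain i where i: "i \<le> N" "I i t m" by auto
    then have iN: "i < N" using bound[OF i(2,1)] b by auto
    show "run E C (Seq c (Assign v (Plus (Var v) (Const 1)))) m
       (\<lambda>t' m'. ?I (t + bcost (Less (Var v) n) + t' + 1) m' \<and> N - m' v 0 0 < N - m v 0 0)"
      unfolding run_simps
    proof (rule run_mono[OF body[OF i(2) iN]])
      fix t' m' assume a: "m' v 0 0 = i \<and> I (Suc i) (t + t' + acost n + 13) (store m' v 0 0 (Suc i))"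
      have e: "store m' v (aval (Const 0) m') (aval (Const 0) m') (aval (Plus (Var v) (Const 1)) m') = store m' v 0 0 (Suc i)"
        using a by simp
      have t: "t + bcost (Less (Var v) n) + (t' + (acost (Const 0) + acost (Const 0) + acost (Plus (Var v) (Const 1)) + 1)) + 1
        = t + t' + acost n + 13" by simp
      have "?I (t + t' + acost n + 13) (store m' v 0 0 (Suc i))"
        using a iN by (intro exI[of _ "Suc i"]) auto
      then show "?I (t + bcost (Less (Var v) n) + (t' + (acost (Const 0) + acost (Const 0) + acost (Plus (Var v) (Const 1)) + 1)) + 1)
          (store m' v (aval (Const 0) m') (aval (Const 0) m') (aval (Plus (Var v) (Const 1)) m')) \<and>
        N - store m' v (aval (Const 0) m') (aval (Const 0) m') (aval (Plus (Var v) (Const 1)) m') v 0 0 < N - m v 0 0"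
        unfolding e t using iN bound[OF i(2,1)] by (auto simp: store_apply)
    qed
  next
    fix t m assume I: "?I t m" and b: "\<not> bval (Less (Var v) n) m"
    then obtain i where i: "i \<le> N" "I i t m" by auto
    then have "i = N" using bound[OF i(2,1)] b by auto
    then show "Q (4 + (t + bcost (Less (Var v) n) + 1)) m" using exit i by (simp add: ac_simps)
  qed
  then show ?thesis unfolding For_def run_simps by (simp add: numeral_eq_Suc)
qed

lemma run_For_uniform:
  assumes init: "J 0 (store m v 0 0 0)"
    and bound: "\<And>i m. J i m \<Longrightarrow> i \<le> N \<Longrightarrow> aval n m = N \<and> m v 0 0 = i"
    and body: "\<And>i m. J i m \<Longrightarrow> i < N \<Longrightarrow>
      run E C c m (\<lambda>t m'. t \<le> B \<and> m' v 0 0 = i \<and> J (Suc i) (store m' v 0 0 (Suc i)))"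
    and exit: "\<And>t m. J N m \<Longrightarrow> t \<le> N * (B + acost n + 13) + acost n + 9 \<Longrightarrow> Q t m"
  shows "run E C (For v n c) m Q"
proof (rule run_For[of "\<lambda>i t m. J i m \<and> t \<le> i * (B + acost n + 13)" _ _ N])
  fix i t m assume I: "J i m \<and> t \<le> i * (B + acost n + 13)" "i < N"
  show "run E C c m (\<lambda>t' m'. m' v 0 0 = i \<and> (J (Suc i) (store m' v 0 0 (Suc i)) \<and>
      t + t' + acost n + 13 \<le> Suc i * (B + acost n + 13)))"
    by (rule run_mono[OF body]) (use I in auto)
qed (use init bound exit in auto)

text \<open>
  Frame conditions.  All programs below are specified by what they do to some arrays, together
  with a set of names outside of which the memory is unchanged.
\<close>

definition same_except :: "string set \<Rightarrow> memory \<Rightarrow> memory \<Rightarrow> bool" where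
  "same_except S m m' \<longleftrightarrow> (\<forall>x. x \<notin> S \<longrightarrow> m' x = m x)"

lemma same_exceptD: "same_except S m m' \<Longrightarrow> x \<notin> S \<Longrightarrow> m' x = m x"
  unfolding same_except_def by auto

lemma same_except_trans: "same_except S m m' \<Longrightarrow> same_except S' m' m'' \<Longrightarrow> S \<union> S' \<subseteq> T \<Longrightarrow> same_except T m m''"
  unfolding same_except_def by (metis UnCI subsetD)

lemma same_except_mono: "same_except S m m' \<Longrightarrow> S \<subseteq> T \<Longrightarrow> same_except T m m'"
  unfolding same_except_def by blast

lemma same_except_store: "same_except S m m' \<Longrightarrow> x \<in> S \<Longrightarrow> same_except S m (store m' x i j v)"
  unfolding same_except_def store_def by auto

lemma same_except_refl: "same_except S m m"
  unfolding same_except_def by simp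

definition search :: "string \<Rightarrow> aexp \<Rightarrow> bexp \<Rightarrow> com" where
  "search x n b = Seq (Assign x n) (For ''v'' n (If b (Assign x (Var ''v'')) Skip))"

lemma run_search:
  assumes x: "x \<noteq> ''v''" and n: "\<And>m'. same_except {x, ''v''} m m' \<Longrightarrow> aval n m' = N"
    and b: "\<And>m' i. same_except {x, ''v''} m m' \<Longrightarrow> m' ''v'' 0 0 = i \<Longrightarrow> i < N \<Longrightarrow> bval b m' = P i"
  shows "run E C (search x n b) m (\<lambda>t m'. same_except {x, ''v''} m m' \<and>
     t \<le> N * (bcost b + acost n + 25) + 2 * acost n + 20 \<and>
     (if \<exists>i<N. P i then m' x 0 0 < N \<and> P (m' x 0 0) else m' x 0 0 = N))"
proof -
  let ?J = "\<lambda>i m'. same_except {x, ''v''} m m' \<and> m' ''v'' 0 0 = i \<and>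
    (if \<exists>j<i. P j then m' x 0 0 < i \<and> P (m' x 0 0) else m' x 0 0 = N)"
  have N: "aval n m = N" using n by (simp add: same_except_def)
  have "run E C (For ''v'' n (If b (Assign x (Var ''v'')) Skip)) (store m x 0 0 N)
     (\<lambda>t m'. ?J N m' \<and> t \<le> N * (bcost b + acost n + 25) + acost n + 9)"
  proof (rule run_For_uniform[where J = ?J and N = N and B = "bcost b + 12"])
    show "?J 0 (store (store m x 0 0 N) ''v'' 0 0 0)" using x by (simp add: store_apply same_except_def)
  next
    fix i m' assume "?J i m'"
    then show "aval n m' = N \<and> m' ''v'' 0 0 = i" using n by blast
  next
    fix i m' assume J: "?J i m'" and i: "i < N"
    then have "bval b m' = P i" using b by blast
    then show "run E C (If b (Assign x (Var ''v'')) Skip) m'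
        (\<lambda>t m'. t \<le> bcost b + 12 \<and> m' ''v'' 0 0 = i \<and> ?J (Suc i) (store m' ''v'' 0 0 (Suc i)))"
    proof -
      have ex: "(\<exists>j<Suc i. P j) \<longleftrightarrow> P i \<or> (\<exists>j<i. P j)" by (auto simp: less_Suc_eq)
      have s: "same_except {x, ''v''} m m'" "m' ''v'' 0 0 = i" using J by auto
      have s': "same_except {x, ''v''} m (store (store m' x 0 0 i) ''v'' 0 0 (Suc i))"
        "same_except {x, ''v''} m (store m' ''v'' 0 0 (Suc i))"
        using s(1) by (simp_all add: same_except_def store_apply)
      show ?thesis
      proof (cases "P i")
        case True
        then show ?thesis unfolding run_simps ex using \<open>bval b m' = P i\<close> s s' x by (simp add: store_apply)
      next
        case False
        have "if \<exists>j<i. P j then m' x 0 0 < Suc i \<and> P (m' x 0 0) else m' x 0 0 = N"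
          using J by (auto split: if_splits)
        then show ?thesis unfolding run_simps ex using \<open>bval b m' = P i\<close> s s' x False
          by (simp add: store_apply)
      qed
    qed
  next
    fix t m' assume "?J N m'" "t \<le> N * (bcost b + 12 + acost n + 13) + acost n + 9"
    then show "?J N m' \<and> t \<le> N * (bcost b + acost n + 25) + acost n + 9" by (simp add: algebra_simps)
  qed
  then show ?thesis unfolding search_def run_Seq run_Write aval.simps(1) N
    by (rule run_mono) auto
qed

definition ind :: "(nat \<times> nat) set \<Rightarrow> nat \<Rightarrow> nat \<Rightarrow> nat" where
  "ind X = (\<lambda>w f. if (w, f) \<in> X then 1 else 0)"

lemma ind_insert: "(ind X)(w := (ind X w)(f := 1)) = ind (insert (w, f) X)"
  by (auto simp: ind_def fun_eq_iff)

lemmas ind_insert' = ind_insert[unfolded One_nat_def]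

lemma ind_remove: "(ind X)(w := (ind X w)(f := 0)) = ind (X - {(w, f)})"
  by (auto simp: ind_def fun_eq_iff)

section \<open>Proposals\<close>

locale market_input = stable_market "{..<k}" "{..<l}" E gt q C
  for k l :: nat and E :: "(nat \<times> nat) set" and gt :: "nat \<Rightarrow> (nat \<times> nat) rel"
    and q :: "nat \<Rightarrow> nat" and C :: "nat \<Rightarrow> (nat \<times> nat) set \<Rightarrow> (nat \<times> nat) set" +
  fixes m0 :: memory
  assumes input: "input_memory k l E gt q m0"
begin

abbreviation deg :: "nat \<Rightarrow> nat" where "deg w \<equiv> m0 ''deg'' w 0"
abbreviation nb :: "nat \<Rightarrow> nat \<Rightarrow> nat" where "nb w i \<equiv> m0 ''pref'' w i"

lemma input_size: "m0 ''W_size'' 0 0 = k" and input_quota: "w < k \<Longrightarrow> m0 ''quota'' w 0 = q w"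
  using input unfolding input_memory_def by auto

lemma input_zero: "x \<notin> {''W_size'', ''F_size'', ''deg'', ''quota'', ''pref''} \<Longrightarrow> m0 x i j = 0"
proof (rule ccontr)
  assume x: "x \<notin> {''W_size'', ''F_size'', ''deg'', ''quota'', ''pref''}" and nz: "m0 x i j \<noteq> 0"
  note inp = input[unfolded input_memory_def, THEN conjunct2, THEN conjunct2, THEN conjunct2]
  from inp[rule_format, OF nz] show False using x by auto
qed

lemma set_pref: "w < k \<Longrightarrow> (\<lambda>i. (w, nb w i)) ` {..<deg w} = EW w"
  using input unfolding input_memory_def pref_list_def EW_def by (auto simp: atLeast0LessThan)

lemma edge_nb: "w < k \<Longrightarrow> i < deg w \<Longrightarrow> (w, nb w i) \<in> E"
  using set_pref[of w] unfolding EW_def by blast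

lemma edge_index:
  assumes "e \<in> E" obtains i where "fst e < k" "i < deg (fst e)" "e = (fst e, nb (fst e) i)"
proof -
  have w: "fst e < k" using edge_ends[OF assms] by auto
  then have "e \<in> (\<lambda>i. (fst e, nb (fst e) i)) ` {..<deg (fst e)}" using set_pref assms EW_iff by auto
  then show thesis using that w by blast
qed

lemma nb_order_less: "w < k \<Longrightarrow> i < j \<Longrightarrow> j < deg w \<Longrightarrow> ((w, nb w i), (w, nb w j)) \<in> gt w"
  using input unfolding input_memory_def pref_list_def by (auto simp: sorted_wrt_iff_nth_less)

lemma nb_order: "w < k \<Longrightarrow> i < deg w \<Longrightarrow> j < deg w \<Longrightarrow> ((w, nb w i), (w, nb w j)) \<in> gt w \<longleftrightarrow> i < j"
  using nb_order_less gt_asym gt_irrefl by (metis lessThan_iff linorder_neqE_nat)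

lemma nb_inj: "w < k \<Longrightarrow> i < deg w \<Longrightarrow> j < deg w \<Longrightarrow> nb w i = nb w j \<longleftrightarrow> i = j"
  using nb_order gt_irrefl by (metis lessThan_iff linorder_neqE_nat)

lemma deg_card: "w < k \<Longrightarrow> deg w = card (EW w)"
  unfolding set_pref[symmetric] by (subst card_image) (auto simp: inj_on_def nb_inj)

lemma sum_deg: "(\<Sum>w<k. deg w) = card E"
  using card_by_W[of E] deg_card by (simp add: Int_absorb1 EW_def subset_iff Collect_conj_eq inf_absorb2)

lemma deg_le: "w < k \<Longrightarrow> deg w \<le> card E"
  using deg_card EW_iff by (simp add: card_mono subset_iff)

definition proposed :: "(nat \<Rightarrow> nat) \<Rightarrow> (nat \<times> nat) set" where
  "proposed p = {(w, nb w i) |w i. w < k \<and> i < p w}"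

lemma in_proposed:
  assumes "w < k" "i < deg w" "p w \<le> deg w" shows "(w, nb w i) \<in> proposed p \<longleftrightarrow> i < p w"
  using assms unfolding proposed_def by (auto simp: nb_inj)

lemma proposed_Suc:
  assumes "w < k" shows "proposed (p(w := Suc (p w))) = insert (w, nb w (p w)) (proposed p)"
  using assms unfolding proposed_def by (auto split: if_splits simp: less_Suc_eq)

text \<open>
  The pointer \<open>p w\<close> divides the list of \<open>w\<close>: before it everything is settled, from there on
  nothing is matched.  So the first accepted edge from the pointer on is the next proposal in
  deferred acceptance, and \<open>a\<^sub>w\<close> in a stable matching.
\<close>

definition ptr_ok :: "(nat \<times> nat) set \<Rightarrow> (nat \<Rightarrow> nat) \<Rightarrow> bool" where
  "ptr_ok X p \<longleftrightarrow> X \<subseteq> proposed p \<and> (\<forall>w<k. p w \<le> deg w) \<and> (\<forall>e\<in>proposed p. settled X e)"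

lemma ptr_ok_new:
  assumes "ptr_ok X p" "w < k" "p w \<le> i" "i < deg w" shows "(w, nb w i) \<notin> X"
proof -
  have "p w \<le> deg w" using assms unfolding ptr_ok_def by auto
  then show ?thesis using assms in_proposed[of w i p] unfolding ptr_ok_def by auto
qed

subsection \<open>Finding the next proposal and its consequence\<close>

definition inputs :: "memory \<Rightarrow> bool" where
  "inputs m \<longleftrightarrow> m ''W_size'' = m0 ''W_size'' \<and> m ''deg'' = m0 ''deg'' \<and>
     m ''pref'' = m0 ''pref'' \<and> m ''quota'' = m0 ''quota''"

end

abbreviation edge_left :: bexp where
  "edge_left \<equiv> And (Equal (Var ''go'') (Const 1)) (Less (Arr ''ptr'' (Var ''w'')) (Arr ''deg'' (Var ''w'')))"

text \<open>
  To ask whether \<open>f\<close> accepts an edge, the edge is entered into the matching for the duration of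
  the oracle call.  The answer remains in \<open>A\<close>, where the dropped edge can be looked up.
\<close>

abbreviation advance_step :: com where
  "advance_step \<equiv> Seq (Assign ''f'' (Read ''pref'' (Var ''w'') (Arr ''ptr'' (Var ''w''))))
       (Seq (Write ''X'' (Var ''w'') (Var ''f'') (Const 1))
       (Seq (Oracle (Var ''f'') ''X'' ''A'')
       (Seq (Write ''X'' (Var ''w'') (Var ''f'') (Const 0))
            (If (Equal (Read ''A'' (Var ''w'') (Var ''f'')) (Const 0))
               (Write ''ptr'' (Var ''w'') (Const 0) (Plus (Arr ''ptr'' (Var ''w'')) (Const 1)))
               (Assign ''go'' (Const 0))))))"

definition advance :: com where
  "advance = Seq (Assign ''go'' (Const 1))
     (While edge_left
       advance_step)"

abbreviation dropped_edge :: bexp where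
  "dropped_edge \<equiv> And (Less (Const 0) (Read ''X'' (Var ''v'') (Var ''f'')))
          (Equal (Read ''A'' (Var ''v'') (Var ''f'')) (Const 0))"

definition find_dropped :: com where
  "find_dropped = search ''b'' (Var ''W_size'')
     dropped_edge"

definition probe :: com where
  "probe = Seq advance (If (Equal (Var ''go'') (Const 0)) find_dropped (Assign ''b'' (Var ''W_size'')))"

context market_input
begin

lemma oracle_query_ind:
  assumes "X \<subseteq> E" shows "m ''X'' = ind X \<Longrightarrow> oracle_query E m ''X'' f = X \<inter> EF f"
  using assms unfolding oracle_query_def EF_def ind_def by auto

definition answer :: "(nat \<times> nat) set \<Rightarrow> nat \<Rightarrow> nat \<Rightarrow> nat \<Rightarrow> nat" where
  "answer X w f v = (if (v, f) \<in> C f (insert (w, f) (X \<inter> EF f)) then 1 else 0)"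

definition advanced :: "(nat \<times> nat) set \<Rightarrow> nat \<Rightarrow> memory \<Rightarrow> nat \<Rightarrow> memory \<Rightarrow> bool" where
  "advanced X w m n m' \<longleftrightarrow> m ''ptr'' w 0 \<le> n \<and> n \<le> deg w \<and>
     (\<forall>i. m ''ptr'' w 0 \<le> i \<and> i < n \<longrightarrow> \<not> accepts X (w, nb w i)) \<and>
     m' ''ptr'' = (m ''ptr'')(w := (m ''ptr'' w)(0 := n)) \<and>
     (if n < deg w then accepts X (w, nb w n) \<and> m' ''go'' 0 0 = 0 \<and> m' ''f'' 0 0 = nb w n \<and>
        (\<forall>v. (v, nb w n) \<in> E \<longrightarrow> m' ''A'' v (nb w n) = answer X w (nb w n) v)
      else m' ''go'' 0 0 = 1)"

lemma run_advance:
  assumes m: "inputs m" "m ''X'' = ind X" "X \<subseteq> E" "m ''w'' 0 0 = w" "w < k" "m ''ptr'' w 0 \<le> deg w"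
    and new: "\<And>i. m ''ptr'' w 0 \<le> i \<Longrightarrow> i < deg w \<Longrightarrow> (w, nb w i) \<notin> X"
  shows "run E C advance m (\<lambda>t m'. \<exists>n. advanced X w m n m' \<and>
     same_except {''go'', ''f'', ''A'', ''ptr'', ''X''} m m' \<and> m' ''X'' = ind X \<and>
     t + 100 * m ''ptr'' w 0 \<le> 100 * n + 100)"
proof -
  let ?p = "m ''ptr'' w 0"
  define I where "I t m' \<longleftrightarrow> (\<exists>n. ?p \<le> n \<and> n \<le> deg w \<and>
     (\<forall>i. ?p \<le> i \<and> i < n \<longrightarrow> \<not> accepts X (w, nb w i)) \<and>
     m' ''ptr'' = (m ''ptr'')(w := (m ''ptr'' w)(0 := n)) \<and>
     same_except {''go'', ''f'', ''A'', ''ptr'', ''X''} m m' \<and> m' ''X'' = ind X \<and>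
     (m' ''go'' 0 0 = 1 \<and> t + 100 * ?p \<le> 100 * n \<or>
      m' ''go'' 0 0 = 0 \<and> t + 100 * ?p \<le> 100 * n + 70 \<and> n < deg w \<and>
        accepts X (w, nb w n) \<and> m' ''f'' 0 0 = nb w n \<and>
        (\<forall>v. (v, nb w n) \<in> E \<longrightarrow> m' ''A'' v (nb w n) = answer X w (nb w n) v)))" for t m'
  have start: "I 0 (store m ''go'' 0 0 1)"
    unfolding I_def using m by (auto simp: store_apply same_except_def)
  show ?thesis unfolding advance_def run_Seq run_Write
  proof (rule run_While[of I _ _ _ _ _ "\<lambda>m'. (deg w - m' ''ptr'' w 0) + m' ''go'' 0 0"])
    show "I 0 (store m ''go'' (aval (Const 0) m) (aval (Const 0) m) (aval (Const 1) m))"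
      using start by simp
  next
    fix t m1
    assume I: "I t m1"
      and b: "bval edge_left m1"
    have go: "m1 ''go'' 0 0 = 1" using b by simp
    then obtain n where n: "?p \<le> n" "n \<le> deg w" "\<forall>i. ?p \<le> i \<and> i < n \<longrightarrow> \<not> accepts X (w, nb w i)"
      "m1 ''ptr'' = (m ''ptr'')(w := (m ''ptr'' w)(0 := n))"
      "same_except {''go'', ''f'', ''A'', ''ptr'', ''X''} m m1" "m1 ''X'' = ind X" "t + 100 * ?p \<le> 100 * n"
      using I unfolding I_def by auto
    have st: "m1 ''deg'' = m0 ''deg''" "m1 ''pref'' = m0 ''pref''" "m1 ''w'' 0 0 = w"
      using m same_exceptD[OF n(5)] unfolding inputs_def by auto
    have nd: "n < deg w" using b n(4) st by simp
    let ?f = "nb w n"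
    have e: "(w, ?f) \<in> E" "(w, ?f) \<notin> X" using edge_nb[OF m(5) nd] new n(1) nd by auto
    have ins: "insert (w, ?f) X \<subseteq> E" using e m by auto
    have query: "oracle_query E m' ''X'' ?f = insert (w, ?f) (X \<inter> EF ?f)" if "m' ''X'' = ind (insert (w, ?f) X)" for m'
      using oracle_query_ind[OF ins, of m' ?f] that e(1) by (auto simp: EF_iff)
    have restored: "(ind X)(w := (ind X w)(?f := 0)) = ind X"
      unfolding ind_remove using e by simp
    have acc: "accepts X (w, ?f) \<longleftrightarrow> (w, ?f) \<in> C ?f (insert (w, ?f) (X \<inter> EF ?f))"
      unfolding accepts_def by simp
    define m2 where "m2 = store (store m1 ''f'' 0 0 ?f) ''X'' w ?f 1"
    have m2: "m2 ''X'' = ind (insert (w, ?f) X)" unfolding m2_def by (simp add: store_apply n(6) ind_insert[symmetric])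
    define m3 where "m3 = oracle_answer E m2 ''A'' ?f (C ?f (insert (w, ?f) (X \<inter> EF ?f)))"
    define m4 where "m4 = store m3 ''X'' w ?f 0"
    have m4: "m4 ''X'' = ind X" "m4 ''A'' w ?f = (if accepts X (w, ?f) then 1 else 0)" "m4 ''w'' 0 0 = w"
      "m4 ''ptr'' = (m ''ptr'')(w := (m ''ptr'' w)(0 := n))" "m4 ''f'' 0 0 = ?f" "m4 ''go'' 0 0 = 1"
      "\<forall>v. (v, ?f) \<in> E \<longrightarrow> m4 ''A'' v ?f = answer X w ?f v"
      unfolding m4_def m3_def oracle_answer_def
      by (auto simp: store_apply restored n(6) acc e m2_def st n(4) go answer_def)
    have s4: "same_except {''go'', ''f'', ''A'', ''ptr'', ''X''} m m4"
      using n(5) unfolding same_except_def m4_def m3_def m2_def oracle_answer_def by (simp add: store_apply)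
    show "run E C advance_step m1
      (\<lambda>t' m'. I (t + bcost edge_left + t' + 1) m' \<and>
         (deg w - m' ''ptr'' w 0) + m' ''go'' 0 0 < (deg w - m1 ''ptr'' w 0) + m1 ''go'' 0 0)"
    proof -
      have f1: "aval (Read ''pref'' (Var ''w'') (Arr ''ptr'' (Var ''w''))) m1 = ?f" using st n(4) by simp
      have w1: "aval (Var ''w'') (store m1 ''f'' 0 0 ?f) = w" "aval (Var ''f'') (store m1 ''f'' 0 0 ?f) = ?f"
        using st by (simp_all add: store_apply)
      have w2: "aval (Var ''f'') m2 = ?f" unfolding m2_def by (simp add: store_apply)
      have w3: "aval (Var ''f'') m3 = ?f" "aval (Var ''w'') m3 = w"
        unfolding m3_def m2_def oracle_answer_def using st by (simp_all add: store_apply)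
      have fin1: "I T (store m4 ''ptr'' w 0 (n + 1))" if "\<not> accepts X (w, ?f)" "T \<le> t + 100" for T
        unfolding I_def
      proof (intro exI[of _ "n + 1"] conjI allI impI)
        fix i assume "?p \<le> i \<and> i < n + 1"
        then show "\<not> accepts X (w, nb w i)" using n(3) that(1) by (cases "i = n") auto
      qed (use n nd m4 s4 that in \<open>auto simp: store_apply same_except_def\<close>)
      have fin2: "I T (store m4 ''go'' 0 0 0)" if "accepts X (w, ?f)" "T \<le> t + 70" for T
        unfolding I_def
        by (intro exI[of _ n] conjI) (use n nd m4 s4 that in \<open>auto simp: store_apply same_except_def\<close>)
      show ?thesis
        unfolding run_Seq run_Write run_Oracle f1
        unfolding aval.simps(1) w1 m2_def[symmetric] w2 query[of m2, OF m2] m3_def[symmetric] w3 m4_def[symmetric] run_If run_Write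
        using fin1 fin2 m4 go n(4) nd by (auto simp: store_apply add.assoc)
    qed
  next
    fix t m1
    assume I: "I t m1"
      and b: "\<not> bval edge_left m1"
    obtain n where n: "?p \<le> n" "n \<le> deg w" "\<forall>i. ?p \<le> i \<and> i < n \<longrightarrow> \<not> accepts X (w, nb w i)"
      "m1 ''ptr'' = (m ''ptr'')(w := (m ''ptr'' w)(0 := n))"
      "same_except {''go'', ''f'', ''A'', ''ptr'', ''X''} m m1" "m1 ''X'' = ind X"
      "m1 ''go'' 0 0 = 1 \<and> t + 100 * ?p \<le> 100 * n \<or>
       m1 ''go'' 0 0 = 0 \<and> t + 100 * ?p \<le> 100 * n + 70 \<and> n < deg w \<and>
        accepts X (w, nb w n) \<and> m1 ''f'' 0 0 = nb w n \<and>
        (\<forall>v. (v, nb w n) \<in> E \<longrightarrow> m1 ''A'' v (nb w n) = answer X w (nb w n) v)"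
      using I unfolding I_def by auto
    have st: "m1 ''deg'' = m0 ''deg''" "m1 ''w'' 0 0 = w"
      using m same_exceptD[OF n(5)] unfolding inputs_def by auto
    have "advanced X w m n m1" unfolding advanced_def using n b st by auto
    then show "\<exists>n. advanced X w m n m1 \<and> same_except {''go'', ''f'', ''A'', ''ptr'', ''X''} m m1 \<and> m1 ''X'' = ind X \<and>
        acost (Const 0) + acost (Const 0) + acost (Const 1) + 1 +
        (t + bcost edge_left + 1)
        + 100 * ?p \<le> 100 * n + 100"
      using n by (intro exI[of _ n]) auto
  qed
qed

lemma run_find_dropped:
  assumes m: "m ''W_size'' 0 0 = k"
  defines "P \<equiv> \<lambda>v. 0 < m ''X'' v (m ''f'' 0 0) \<and> m ''A'' v (m ''f'' 0 0) = 0"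
  shows "run E C find_dropped m (\<lambda>t m'. same_except {''b'', ''v''} m m' \<and> t \<le> 100 * k + 100 \<and>
     (if \<exists>v<k. P v then m' ''b'' 0 0 < k \<and> P (m' ''b'' 0 0) else m' ''b'' 0 0 = k))"
  unfolding find_dropped_def
proof (rule run_mono[OF run_search[where N = k and P = P]])
  show "''b'' \<noteq> ''v''" by simp
next
  fix m' assume "same_except {''b'', ''v''} m m'"
  then show "aval (Var ''W_size'') m' = k" using m by (simp add: same_except_def)
next
  fix m' i assume "same_except {''b'', ''v''} m m'" "m' ''v'' 0 0 = i"
  then show "bval dropped_edge m' = P i"
    by (simp add: same_except_def P_def)
qed (simp add: algebra_simps)

text \<open>
  The outcome of a call of \<open>probe\<close>: the pointer of \<open>w\<close> moves over rejected edges to \<open>n\<close>, and the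
  edge there, if any, makes its firm drop the edge of vertex \<open>b\<close>, or nothing if \<open>b = k\<close>.
\<close>

definition probed :: "(nat \<times> nat) set \<Rightarrow> nat \<Rightarrow> memory \<Rightarrow> nat \<Rightarrow> memory \<Rightarrow> bool" where
  "probed X w m n m' \<longleftrightarrow> m ''ptr'' w 0 \<le> n \<and> n \<le> deg w \<and>
     (\<forall>i. m ''ptr'' w 0 \<le> i \<and> i < n \<longrightarrow> \<not> accepts X (w, nb w i)) \<and>
     m' ''ptr'' = (m ''ptr'')(w := (m ''ptr'' w)(0 := n)) \<and>
     (if n < deg w then let f = nb w n; b = m' ''b'' 0 0; D = (if b < k then {(b, f)} else {}) in
        m' ''go'' 0 0 = 0 \<and> m' ''f'' 0 0 = f \<and> b \<le> k \<and> D \<subseteq> X \<and> accepts X (w, f) \<and>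
        C f (insert (w, f) (X \<inter> EF f)) = insert (w, f) (X \<inter> EF f - D)
      else m' ''go'' 0 0 = 1 \<and> m' ''b'' 0 0 = k)"

lemma run_probe:
  assumes m: "inputs m" "m ''X'' = ind X" "F_acceptable X" "m ''w'' 0 0 = w" "w < k" "m ''ptr'' w 0 \<le> deg w"
    and new: "\<And>i. m ''ptr'' w 0 \<le> i \<Longrightarrow> i < deg w \<Longrightarrow> (w, nb w i) \<notin> X"
  shows "run E C probe m (\<lambda>t m'. \<exists>n. probed X w m n m' \<and>
     same_except {''go'', ''f'', ''A'', ''ptr'', ''X'', ''b'', ''v''} m m' \<and> m' ''X'' = ind X \<and>
     t \<le> 100 * deg w + 100 * k + 300)"
  unfolding probe_def run_Seq
proof (rule run_mono[OF run_advance[OF m(1,2) F_acceptableD(1)[OF m(3)] m(4-6) new]])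
  fix t m1
  assume "\<exists>n. advanced X w m n m1 \<and> same_except {''go'', ''f'', ''A'', ''ptr'', ''X''} m m1 \<and> m1 ''X'' = ind X \<and>
    t + 100 * m ''ptr'' w 0 \<le> 100 * n + 100"
  then obtain n where n: "advanced X w m n m1" and sm: "same_except {''go'', ''f'', ''A'', ''ptr'', ''X''} m m1"
    and X1: "m1 ''X'' = ind X" and t: "t + 100 * m ''ptr'' w 0 \<le> 100 * n + 100" by auto
  have W: "m1 ''W_size'' 0 0 = k" using sm m(1) input_size unfolding same_except_def inputs_def by simp
  have nd: "n \<le> deg w" using n unfolding advanced_def by auto
  show "run E C (If (Equal (Var ''go'') (Const 0)) find_dropped (Assign ''b'' (Var ''W_size''))) m1
     (\<lambda>t' m'. \<exists>n. probed X w m n m' \<and> same_except {''go'', ''f'', ''A'', ''ptr'', ''X'', ''b'', ''v''} m m' \<and>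
        m' ''X'' = ind X \<and> t + t' \<le> 100 * deg w + 100 * k + 300)"
  proof (cases "n < deg w")
    case True
    let ?f = "nb w n"
    have a: "accepts X (w, ?f)" "m1 ''go'' 0 0 = 0" "m1 ''f'' 0 0 = ?f"
      "\<And>v. (v, ?f) \<in> E \<Longrightarrow> m1 ''A'' v ?f = answer X w ?f v"
      using n True unfolding advanced_def by auto
    have e: "(w, ?f) \<in> E" "(w, ?f) \<notin> X"
      using edge_nb[OF m(5) True] new n True unfolding advanced_def by auto
    have f: "?f \<in> {..<l}" "(w, ?f) \<in> EF ?f" using edge_ends(2)[OF e(1)] e by (auto simp: EF_iff)
    have P: "0 < m1 ''X'' v ?f \<and> m1 ''A'' v ?f = 0 \<longleftrightarrow>
        (v, ?f) \<in> X \<and> (v, ?f) \<notin> C ?f (insert (w, ?f) (X \<inter> EF ?f))" for v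
      using a(4)[of v] F_acceptableD(1)[OF m(3)] X1 unfolding ind_def answer_def by auto
    have b: "bval (Equal (Var ''go'') (Const 0)) m1" using a(2) by simp
    show ?thesis unfolding run_If if_P[OF b]
    proof (rule run_mono[OF run_find_dropped[of m1, OF W]])
      fix t' m2
      assume r: "same_except {''b'', ''v''} m1 m2 \<and> t' \<le> 100 * k + 100 \<and>
        (if \<exists>v<k. 0 < m1 ''X'' v (m1 ''f'' 0 0) \<and> m1 ''A'' v (m1 ''f'' 0 0) = 0
         then m2 ''b'' 0 0 < k \<and> 0 < m1 ''X'' (m2 ''b'' 0 0) (m1 ''f'' 0 0) \<and> m1 ''A'' (m2 ''b'' 0 0) (m1 ''f'' 0 0) = 0
         else m2 ''b'' 0 0 = k)"
      let ?b = "m2 ''b'' 0 0"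
      let ?D = "if ?b < k then {(?b, ?f)} else {}"
      have s2: "m2 ''go'' = m1 ''go''" "m2 ''f'' = m1 ''f''" "m2 ''ptr'' = m1 ''ptr''" "m2 ''X'' = m1 ''X''"
        using r by (simp_all add: same_except_def)
      have drop: "?D \<subseteq> X \<and> C ?f (insert (w, ?f) (X \<inter> EF ?f)) = insert (w, ?f) (X \<inter> EF ?f - ?D) \<and> ?b \<le> k"
      proof (cases "\<exists>v<k. (v, ?f) \<in> X \<and> (v, ?f) \<notin> C ?f (insert (w, ?f) (X \<inter> EF ?f))")
        case True
        then have b: "?b < k" "(?b, ?f) \<in> X" "(?b, ?f) \<notin> C ?f (insert (w, ?f) (X \<inter> EF ?f))"
          using r unfolding a(3) P by auto
        have "C ?f ((X \<inter> EF ?f) \<union> {(w, ?f)}) = (X \<inter> EF ?f - {(?b, ?f)}) \<union> {(w, ?f)}"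
          using b e f F_acceptableD(1)[OF m(3)] by (intro choice_exchange m(3)) (auto simp: EF_iff)
        then show ?thesis using b by auto
      next
        case False
        then have b: "?b = k" using r unfolding a(3) P by auto
        have "v < k" if "(v, ?f) \<in> X" for v using that F_acceptableD(1)[OF m(3)] edge_ends(1)[of "(v, ?f)"] by auto
        then have "X \<inter> EF ?f \<subseteq> C ?f (insert (w, ?f) (X \<inter> EF ?f))" using False by (auto simp: EF_iff)
        moreover have "C ?f (insert (w, ?f) (X \<inter> EF ?f)) \<subseteq> insert (w, ?f) (X \<inter> EF ?f)"
          using f by (intro choice_subset) auto
        ultimately show ?thesis using a(1) b unfolding accepts_def by auto
      qed
      have "probed X w m n m2"
        using n True a drop unfolding probed_def advanced_def s2 by (simp add: Let_def)
      moreover have "same_except {''go'', ''f'', ''A'', ''ptr'', ''X'', ''b'', ''v''} m m2"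
        using r by (intro same_except_trans[OF sm, of "{''b'', ''v''}"]) auto
      ultimately show "\<exists>n. probed X w m n m2 \<and> same_except {''go'', ''f'', ''A'', ''ptr'', ''X'', ''b'', ''v''} m m2 \<and>
        m2 ''X'' = ind X \<and> t + (bcost (Equal (Var ''go'') (Const 0)) + t' + 1) \<le> 100 * deg w + 100 * k + 300"
        using X1 s2 r t nd by (intro exI[of _ n]) simp
    qed
  next
    case False
    then have a: "n = deg w" "m1 ''go'' 0 0 = 1" using n unfolding advanced_def by auto
    have "probed X w m n (store m1 ''b'' 0 0 k)"
      using n a unfolding probed_def advanced_def by (simp add: store_apply)
    moreover have "same_except {''go'', ''f'', ''A'', ''ptr'', ''X'', ''b'', ''v''} m (store m1 ''b'' 0 0 k)"
      using sm by (simp add: same_except_def store_apply)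
    ultimately show ?thesis unfolding run_If run_Write
      using a X1 t W by (auto simp: store_apply intro!: exI[of _ n])
  qed
qed

end

section \<open>Deferred acceptance\<close>

definition increment :: "string \<Rightarrow> aexp \<Rightarrow> com" where
  "increment x i = Write x i (Const 0) (Plus (Arr x i) (Const 1))"

abbreviation open_place :: bexp where
  "open_place \<equiv> And (Less (Arr ''cnt'' (Var ''v'')) (Arr ''quota'' (Var ''v'')))
                 (Less (Arr ''ptr'' (Var ''v'')) (Arr ''deg'' (Var ''v'')))"

abbreviation release_dropped :: com where
  "release_dropped \<equiv> If (Less (Var ''b'') (Var ''W_size''))
               (Seq (Write ''X'' (Var ''b'') (Var ''f'') (Const 0))
                    (Write ''cnt'' (Var ''b'') (Const 0) (Minus (Arr ''cnt'' (Var ''b'')) (Const 1))))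
               Skip"

abbreviation hold_proposal :: com where
  "hold_proposal \<equiv> If (Equal (Var ''go'') (Const 0))
            (Seq (Write ''X'' (Var ''w'') (Var ''f'') (Const 1))
            (Seq (increment ''cnt'' (Var ''w''))
            (Seq (increment ''ptr'' (Var ''w''))
            release_dropped)))
            Skip"

definition proposal_round :: com where
  "proposal_round =
     Seq (search ''w'' (Var ''W_size'')
            open_place)
     (If (Less (Var ''w'') (Var ''W_size''))
        (Seq probe
          hold_proposal)
        Skip)"

definition count_edges :: com where
  "count_edges = For ''v'' (Var ''W_size'') (Assign ''edges'' (Plus (Var ''edges'') (Arr ''deg'' (Var ''v''))))"

text \<open>
  Each round moves a pointer unless no vertex with an open place has edges left, so \<open>card E\<close> rounds are enough.
\<close>

definition deferred_acceptance :: com where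
  "deferred_acceptance = For ''t'' (Var ''edges'') proposal_round"

context market_input
begin

text \<open>
  With two or more vertices, connectedness gives every vertex an edge.
\<close>

lemma k_le: "k \<le> card E + 1"
proof (cases "k \<le> 1")
  case False
  have "\<exists>f. (w, f) \<in> E" if w: "w < k" for w
  proof -
    define v where "v = (if w = 0 then 1 else 0 :: nat)"
    have v: "v < k" "v \<noteq> w" using False unfolding v_def by auto
    have "(Inl w, Inl v) \<in> ({(Inl w, Inr f) |w f. (w, f) \<in> E} \<union> {(Inr f, Inl w) |w f. (w, f) \<in> E})\<^sup>*"
      using v w by (intro connected) auto
    then show ?thesis using v(2) by (cases rule: converse_rtranclE) auto
  qed
  then have "{..<k} \<subseteq> fst ` E" by force
  then have "card {..<k} \<le> card (fst ` E)" by (intro card_mono) auto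
  also have "\<dots> \<le> card E" by (rule card_image_le) simp
  finally show ?thesis by simp
qed auto

definition deferring :: "(nat \<times> nat) set \<Rightarrow> memory \<Rightarrow> bool" where
  "deferring X m \<longleftrightarrow> inputs m \<and> m ''X'' = ind X \<and> (\<forall>w<k. m ''ptr'' w 0 \<le> deg w) \<and>
     deferred X (proposed (\<lambda>w. m ''ptr'' w 0)) \<and> (\<forall>w<k. m ''cnt'' w 0 = card (X \<inter> EW w))"

lemma deferred_advance:
  assumes d: "deferred X (proposed p)" and w: "w < k" "p w \<le> n" "n \<le> deg w"
    and rej: "\<And>i. p w \<le> i \<Longrightarrow> i < n \<Longrightarrow> \<not> accepts X (w, nb w i)"
    and room: "card (X \<inter> EW w) < q w" and pd: "\<And>w. w < k \<Longrightarrow> p w \<le> deg w"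
  shows "deferred X (proposed (p(w := n)))"
    and "n < deg w \<Longrightarrow> deferred ((X - EF (nb w n)) \<union> C (nb w n) (insert (w, nb w n) (X \<inter> EF (nb w n))))
           (proposed (p(w := Suc n)))"
proof -
  have one_step: "deferred ((X - EF (nb w i)) \<union> C (nb w i) (insert (w, nb w i) (X \<inter> EF (nb w i)))) (proposed (p(w := Suc i)))"
    if d: "deferred X (proposed (p(w := i)))" and i: "i < deg w" "p w \<le> i" for i
  proof -
    have pi: "(p(w := i)) w \<le> deg w" using i by simp
    have "insert (w, nb w i) (proposed (p(w := i))) = proposed (p(w := Suc i))"
      using proposed_Suc[OF w(1), of "p(w := i)"] by simp
    moreover have "e' \<in> proposed (p(w := i))" if "(e', (w, nb w i)) \<in> gt w" for e'
    proof -
      have "e' \<in> EW w" using that gt_on_EW[of w] w(1) by auto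
      then obtain j where j: "j < deg w" "e' = (w, nb w j)" using set_pref[OF w(1)] by auto
      then have "j < i" using that nb_order[OF w(1)] i by auto
      then show ?thesis using j in_proposed[where p = "p(w := i)", OF w(1) j(1) pi] by simp
    qed
    ultimately show ?thesis
      using deferred_step[OF d, of "(w, nb w i)"] edge_nb[OF w(1) i(1)] in_proposed[where p = "p(w := i)", OF w(1) i(1) pi] room by simp
  qed
  have *: "deferred X (proposed (p(w := i)))" if "p w \<le> i" "i \<le> n" for i
    using that
  proof (induction i rule: dec_induct)
    case base
    then show ?case using d by simp
  next
    case (step i)
    have i: "i < deg w" using step w by simp
    have X: "F_acceptable X" using d unfolding deferred_def by auto
    let ?f = "nb w i" let ?U = "insert (w, ?f) (X \<inter> EF ?f)"
    have e: "(w, ?f) \<in> E" using edge_nb[OF w(1) i] .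
    have f: "?f \<in> {..<l}" "(w, ?f) \<in> EF ?f" using edge_ends(2)[OF e] e by (auto simp: EF_iff)
    have "(w, ?f) \<notin> C ?f ?U" using rej[of i] step unfolding accepts_def by simp
    then have "C ?f ?U \<subseteq> X \<inter> EF ?f" using choice_subset[OF f(1), of ?U] f(2) by auto
    then have "C ?f ?U = X \<inter> EF ?f" using A1[OF f(1), of ?U "X \<inter> EF ?f"] f(2) F_acceptableD(2)[OF X f(1)] by auto
    then have "(X - EF ?f) \<union> C ?f ?U = X" by auto
    moreover have "deferred X (proposed (p(w := i)))" by (rule step.IH) (use step.prems in simp_all)
    ultimately show ?case using one_step[of i, OF _ i] step(1) by metis
  qed
  show "deferred X (proposed (p(w := n)))" using * w by simp
  then show "n < deg w \<Longrightarrow> deferred ((X - EF (nb w n)) \<union> C (nb w n) (insert (w, nb w n) (X \<inter> EF (nb w n))))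
           (proposed (p(w := Suc n)))" using one_step * w by blast
qed

definition unfinished :: "memory \<Rightarrow> nat \<Rightarrow> bool" where
  "unfinished m w \<longleftrightarrow> m ''cnt'' w 0 < m ''quota'' w 0 \<and> m ''ptr'' w 0 < m ''deg'' w 0"

lemma run_proposal_round:
  assumes D: "deferring X m"
  shows "run E C proposal_round m (\<lambda>t m'. t \<le> 300 * (card E + k + 3) \<and> (\<exists>X'. deferring X' m') \<and>
     same_except {''go'', ''f'', ''A'', ''ptr'', ''X'', ''b'', ''v'', ''w'', ''cnt''} m m' \<and>
     (if \<exists>w<k. unfinished m w then (\<Sum>w<k. m ''ptr'' w 0) < (\<Sum>w<k. m' ''ptr'' w 0) else \<forall>w<k. \<not> unfinished m' w))"
proof -
  let ?S = "{''go'', ''f'', ''A'', ''ptr'', ''X'', ''b'', ''v'', ''w'', ''cnt''}"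
  let ?Q = "\<lambda>t m'. t \<le> 300 * (card E + k + 3) \<and> (\<exists>X'. deferring X' m') \<and> same_except ?S m m' \<and>
     (if \<exists>w<k. unfinished m w then (\<Sum>w<k. m ''ptr'' w 0) < (\<Sum>w<k. m' ''ptr'' w 0) else \<forall>w<k. \<not> unfinished m' w)"
  let ?Q' = "\<lambda>t m'. t \<le> 300 * (card E + k + 3) \<and> (\<exists>X'. deferring X' m') \<and> same_except ?S m m' \<and>
     (\<Sum>w<k. m ''ptr'' w 0) < (\<Sum>w<k. m' ''ptr'' w 0)"
  have inp: "inputs m" and W: "m ''W_size'' 0 0 = k" using D input_size unfolding deferring_def inputs_def by auto
  have s: "run E C (search ''w'' (Var ''W_size'')
            open_place) m
     (\<lambda>t m'. same_except {''w'', ''v''} m m' \<and> t \<le> 100 * k + 100 \<and>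
       (if \<exists>v<k. unfinished m v then m' ''w'' 0 0 < k \<and> unfinished m (m' ''w'' 0 0) else m' ''w'' 0 0 = k))"
  proof (rule run_mono[OF run_search[where N = k and P = "unfinished m"]])
    fix m' i assume "same_except {''w'', ''v''} m m'" "m' ''v'' 0 0 = i"
    then show "bval open_place m' = unfinished m i"
      by (simp add: same_except_def unfinished_def)
  next
    fix m' assume "same_except {''w'', ''v''} m m'"
    then show "aval (Var ''W_size'') m' = k" using W by (simp add: same_except_def)
  qed (simp_all add: algebra_simps)
  show ?thesis unfolding proposal_round_def run_Seq[of E C "search _ _ _"]
  proof (rule run_mono[OF s])
    fix t m1
    assume r: "same_except {''w'', ''v''} m m1 \<and> t \<le> 100 * k + 100 \<and>
       (if \<exists>v<k. unfinished m v then m1 ''w'' 0 0 < k \<and> unfinished m (m1 ''w'' 0 0) else m1 ''w'' 0 0 = k)"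
    have s1: "m1 ''W_size'' = m ''W_size''" "m1 ''deg'' = m ''deg''" "m1 ''pref'' = m ''pref''" "m1 ''quota'' = m ''quota''"
      "m1 ''ptr'' = m ''ptr''" "m1 ''X'' = m ''X''" "m1 ''cnt'' = m ''cnt''"
      using r by (simp_all add: same_except_def)
    have D1: "deferring X m1" using D unfolding deferring_def inputs_def by (simp add: s1)
    show "run E C (If (Less (Var ''w'') (Var ''W_size''))
        (Seq probe
          hold_proposal)
        Skip) m1 (\<lambda>t'. ?Q (t + t'))"
    proof (cases "m1 ''w'' 0 0 < k")
      case False
      then have no: "\<not> (\<exists>w<k. unfinished m w)" using r by (auto split: if_splits)
      then have "\<not> (\<exists>w<k. unfinished m1 w)" unfolding unfinished_def s1 .
      moreover have "same_except ?S m m1" using r by (auto intro: same_except_mono)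
      ultimately show ?thesis unfolding run_If run_Skip using False W s1 D1 r no by auto
    next
      case True
      define w where "w = m1 ''w'' 0 0"
      have w: "w < k" "m1 ''w'' 0 0 = w" "unfinished m w" using True r unfolding w_def by (auto split: if_splits)
      have ex: "\<exists>w<k. unfinished m w" using w by blast
      let ?p = "\<lambda>w. m ''ptr'' w 0"
      have X: "F_acceptable X" and dX: "deferred X (proposed ?p)" and pd: "\<And>w. w < k \<Longrightarrow> ?p w \<le> deg w"
        and Xm: "m1 ''X'' = ind X" and cnt: "\<And>w. w < k \<Longrightarrow> m ''cnt'' w 0 = card (X \<inter> EW w)"
        using D s1 unfolding deferring_def deferred_def by auto
      have room: "card (X \<inter> EW w) < q w" and pw: "?p w < deg w"
        using w(1,3) cnt inp input_quota unfolding unfinished_def inputs_def by auto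
      have new: "(w, nb w i) \<notin> X" if "?p w \<le> i" "i < deg w" for i
        using in_proposed[OF w(1) that(2), of ?p] pd[OF w(1)] that dX unfolding deferred_def by auto
      have in1: "inputs m1" using D1 unfolding deferring_def by auto
      have b: "bval (Less (Var ''w'') (Var ''W_size'')) m1" using True W s1 by simp
      show ?thesis unfolding if_P[OF ex] unfolding run_If[of E C "Less (Var ''w'') (Var ''W_size'')"] if_P[OF b] run_Seq[of E C probe]
      proof (rule run_mono[OF run_probe[OF in1 Xm X w(2,1)]])
        show "m1 ''ptr'' w 0 \<le> deg w" using pw s1 by simp
        show "\<And>i. m1 ''ptr'' w 0 \<le> i \<Longrightarrow> i < deg w \<Longrightarrow> (w, nb w i) \<notin> X" using new s1 by simp
      next
        fix t' m2
        assume "\<exists>n. probed X w m1 n m2 \<and> same_except {''go'', ''f'', ''A'', ''ptr'', ''X'', ''b'', ''v''} m1 m2 \<and>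
          m2 ''X'' = ind X \<and> t' \<le> 100 * deg w + 100 * k + 300"
        then obtain n where n: "probed X w m1 n m2" and s2: "same_except {''go'', ''f'', ''A'', ''ptr'', ''X'', ''b'', ''v''} m1 m2"
          and X2: "m2 ''X'' = ind X" and t': "t' \<le> 100 * deg w + 100 * k + 300" by auto
        have e2: "m2 ''W_size'' = m ''W_size''" "m2 ''deg'' = m ''deg''" "m2 ''pref'' = m ''pref''" "m2 ''quota'' = m ''quota''"
          "m2 ''cnt'' = m ''cnt''" "m2 ''w'' = m1 ''w''"
          using s2 s1 by (simp_all add: same_except_def)
        have in2: "inputs m2" using inp unfolding inputs_def by (simp add: e2)
        have n1: "?p w \<le> n" "n \<le> deg w" "\<And>i. ?p w \<le> i \<Longrightarrow> i < n \<Longrightarrow> \<not> accepts X (w, nb w i)"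
          "m2 ''ptr'' = (m ''ptr'')(w := (m ''ptr'' w)(0 := n))"
          using n s1 unfolding probed_def by auto
        have ptr2: "(\<lambda>v. m2 ''ptr'' v 0) = ?p(w := n)" using n1(4) by auto
        have adv: "deferred X (proposed (?p(w := n)))"
          using deferred_advance(1)[where p = ?p, OF dX w(1) n1(1,2) n1(3) room pd] by blast
        have same2: "same_except ?S m m2" using r s2
          by (intro same_except_trans[of "{''w'', ''v''}" m m1 "{''go'', ''f'', ''A'', ''ptr'', ''X'', ''b'', ''v''}" m2]) auto
        have tt: "t + t' \<le> 100 * card E + 200 * k + 400" using t' r deg_le[OF w(1)] by simp
        show "run E C hold_proposal m2 (\<lambda>t''. ?Q' (t + (bcost (Less (Var ''w'') (Var ''W_size'')) + (t' + t'') + 1)))"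
        proof (cases "n < deg w")
          case False
          then have nd: "n = deg w" "m2 ''go'' 0 0 = 1" using n n1(2) unfolding probed_def by auto
          have "deferring X m2" unfolding deferring_def ptr2
            using in2 X2 adv pd n1 cnt by (auto simp: e2)
          moreover have "(\<Sum>w<k. ?p w) < (\<Sum>w<k. m2 ''ptr'' w 0)"
            using w(1) pw nd n1(4) by (intro sum_strict_mono_ex1) auto
          ultimately show ?thesis unfolding run_If run_Skip using nd same2 tt by auto
        next
          case True
          let ?f = "nb w n" let ?b = "m2 ''b'' 0 0"
          let ?D = "if ?b < k then {(?b, ?f)} else {}"
          have a: "m2 ''go'' 0 0 = 0" "m2 ''f'' 0 0 = ?f" "?b \<le> k" "?D \<subseteq> X"
            "C ?f (insert (w, ?f) (X \<inter> EF ?f)) = insert (w, ?f) (X \<inter> EF ?f - ?D)"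
            using n True unfolding probed_def by (auto simp: Let_def)
          have wf: "(w, ?f) \<notin> X" "(w, ?f) \<in> E" using new n1(1) True edge_nb[OF w(1) True] by auto
          let ?X = "insert (w, ?f) X - ?D"
          have X': "(X - EF ?f) \<union> C ?f (insert (w, ?f) (X \<inter> EF ?f)) = ?X"
            unfolding a(5) using a(4) wf F_acceptableD(1)[OF X] by (auto simp: EF_iff)
          have dX': "deferred ?X (proposed (?p(w := Suc n)))"
            using deferred_advance(2)[where p = ?p, OF dX w(1) n1(1,2) n1(3) room pd True] X' by simp
          have sum: "(\<Sum>w<k. ?p w) < (\<Sum>v<k. ((?p(w := Suc n)) v))"
            using w(1) n1(1) by (intro sum_strict_mono_ex1) auto
          define m3 where "m3 = store (store (store m2 ''X'' w ?f 1) ''cnt'' w 0 (m2 ''cnt'' w 0 + 1)) ''ptr'' w 0 (n + 1)"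
          have m3: "m3 ''X'' = ind (insert (w, ?f) X)" "m3 ''ptr'' = (m ''ptr'')(w := (m ''ptr'' w)(0 := Suc n))"
            "m3 ''cnt'' = (m ''cnt'')(w := (m ''cnt'' w)(0 := Suc (m ''cnt'' w 0)))" "inputs m3"
            "m3 ''b'' = m2 ''b''" "m3 ''f'' = m2 ''f''" "m3 ''W_size'' = m ''W_size''" "same_except ?S m m3"
            using in2 same2 e2 unfolding m3_def
            by (simp_all add: store_apply X2 ind_insert' n1(4) inputs_def same_except_def)
          have cw: "card (insert (w, ?f) X \<inter> EW v) = (if v = w then Suc (card (X \<inter> EW v)) else card (X \<inter> EW v))" for v
          proof (cases "v = w")
            case True
            then have "insert (w, ?f) X \<inter> EW v = insert (w, ?f) (X \<inter> EW v)" using wf by (auto simp: EW_iff)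
            then show ?thesis using True wf by simp
          next
            case False
            then have "insert (w, ?f) X \<inter> EW v = X \<inter> EW v" by (auto simp: EW_iff)
            then show ?thesis using False by simp
          qed
          have k3: "m3 ''W_size'' 0 0 = k" using m3(7) W by simp
          have rest: "run E C release_dropped m3 (\<lambda>t m'. t \<le> 40 \<and> deferring ?X m' \<and> same_except ?S m m' \<and>
                  (\<Sum>w<k. ?p w) < (\<Sum>w<k. m' ''ptr'' w 0))"
          proof (cases "?b < k")
            case False
            have p3: "(\<lambda>v. m3 ''ptr'' v 0) = ?p(w := Suc n)" using m3(2) by auto
            have sum3: "(\<Sum>w<k. ?p w) < (\<Sum>w<k. m3 ''ptr'' w 0)" using sum unfolding p3[symmetric] .
            have "\<forall>v<k. m3 ''cnt'' v 0 = card (insert (w, ?f) X \<inter> EW v)"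
              unfolding cw m3(3) using cnt by auto
            then have "deferring ?X m3"
              unfolding deferring_def p3 using m3(1,2,4) dX' False pd True by auto
            with sum3 show ?thesis unfolding run_If run_Skip using False m3 k3 by auto
          next
            case bk: True
            define m4 where "m4 = store (store m3 ''X'' ?b ?f 0) ''cnt'' ?b 0 (m3 ''cnt'' ?b 0 - 1)"
            have m4: "m4 ''X'' = ind ?X" "m4 ''ptr'' = m3 ''ptr''"
              "m4 ''cnt'' = (m3 ''cnt'')(?b := (m3 ''cnt'' ?b)(0 := m3 ''cnt'' ?b 0 - 1))" "inputs m4" "same_except ?S m m4"
              using m3 bk unfolding m4_def
              by (simp_all add: store_apply ind_remove inputs_def same_except_def)
            have bw: "?b \<noteq> w" using a(4) bk wf by auto
            have bX: "(?b, ?f) \<in> X" "(?b, ?f) \<in> E" using a(4) bk F_acceptableD(1)[OF X] by auto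
            have "card (?X \<inter> EW v) = (if v = ?b then card (X \<inter> EW v) - 1 else card (insert (w, ?f) X \<inter> EW v))" for v
            proof (cases "v = ?b")
              case True
              then have "?X \<inter> EW v = X \<inter> EW v - {(?b, ?f)}" using bk bw wf by (auto simp: EW_iff)
              then show ?thesis using True bX by (simp add: EW_iff)
            next
              case False
              then have "?X \<inter> EW v = insert (w, ?f) X \<inter> EW v" using bk by (auto simp: EW_iff)
              then show ?thesis using False by simp
            qed
            then have "\<forall>v<k. m4 ''cnt'' v 0 = card (?X \<inter> EW v)"
              unfolding m4(3) m3(3) cw using cnt bw by auto
            moreover have p4: "(\<lambda>v. m4 ''ptr'' v 0) = ?p(w := Suc n)" using m3(2) m4(2) by auto
            ultimately have "deferring ?X m4"
              unfolding deferring_def p4 using m4(1,2,4) m3(2) dX' pd True by auto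
            moreover have "(\<Sum>w<k. ?p w) < (\<Sum>w<k. m4 ''ptr'' w 0)" using sum unfolding p4[symmetric] .
            ultimately show ?thesis unfolding run_If run_Seq run_Write
              using bk m3 k3 m4(5) a(2) by (auto simp: m4_def[symmetric] store_apply) (simp add: m4_def store_apply)+
          qed
          have go: "bval (Equal (Var ''go'') (Const 0)) m2" using a(1) by simp
          have v: "aval (Var ''w'') m2 = w" "aval (Var ''f'') m2 = ?f" using a w e2 by simp_all
          have v': "aval (Var ''w'') (store m2 ''X'' w ?f 1) = w"
            "aval (Plus (Arr ''cnt'' (Var ''w'')) (Const 1)) (store m2 ''X'' w ?f 1) = m2 ''cnt'' w 0 + 1"
            using w e2 by (simp_all add: store_apply)
          let ?m = "store (store m2 ''X'' w ?f 1) ''cnt'' w 0 (m2 ''cnt'' w 0 + 1)"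
          have v'': "aval (Var ''w'') ?m = w" "aval (Plus (Arr ''ptr'' (Var ''w'')) (Const 1)) ?m = n + 1"
            using w e2 n1(4) by (simp_all add: store_apply)
          show ?thesis unfolding run_If[of E C "Equal _ _"] if_P[OF go] increment_def run_Seq[of E C "Write _ _ _ _"] run_Write
              v aval.simps(1) v' v'' m3_def[symmetric]
            by (rule run_mono[OF rest]) (use tt in auto)
        qed
      qed
    qed
  qed
qed

lemma run_count_edges:
  assumes m: "inputs m" "m ''edges'' 0 0 = 0"
  shows "run E C count_edges m (\<lambda>t m'. t \<le> 40 * k + 40 \<and> same_except {''edges'', ''v''} m m' \<and> m' ''edges'' 0 0 = card E)"
proof -
  let ?J = "\<lambda>i m'. same_except {''edges'', ''v''} m m' \<and> m' ''v'' 0 0 = i \<and> m' ''edges'' 0 0 = (\<Sum>w<i. deg w)"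
  show ?thesis unfolding count_edges_def
  proof (rule run_For_uniform[where J = ?J and N = k and B = 20])
    show "?J 0 (store m ''v'' 0 0 0)" using m by (simp add: store_apply same_except_def)
  next
    fix i m' assume "?J i m'"
    then show "aval (Var ''W_size'') m' = k \<and> m' ''v'' 0 0 = i"
      using m input_size by (simp add: same_except_def inputs_def)
  next
    fix i m' assume J: "?J i m'"
    then have "m' ''deg'' = m0 ''deg''" using m by (simp add: same_except_def inputs_def)
    then show "run E C (Assign ''edges'' (Plus (Var ''edges'') (Arr ''deg'' (Var ''v'')))) m'
      (\<lambda>t m'. t \<le> 20 \<and> m' ''v'' 0 0 = i \<and> ?J (Suc i) (store m' ''v'' 0 0 (Suc i)))"
      unfolding run_simps using J by (simp add: store_apply same_except_def)
  next
    fix t m' assume "?J k m'" "t \<le> k * (20 + acost (Var ''W_size'') + 13) + acost (Var ''W_size'') + 9"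
    then show "t \<le> 40 * k + 40 \<and> same_except {''edges'', ''v''} m m' \<and> m' ''edges'' 0 0 = card E"
      using sum_deg by simp
  qed
qed

definition matched :: "(nat \<times> nat) set \<Rightarrow> memory \<Rightarrow> bool" where
  "matched X m \<longleftrightarrow> inputs m \<and> m ''X'' = ind X \<and> stable X \<and> ptr_ok X (\<lambda>w. m ''ptr'' w 0)"

lemma run_deferred_acceptance:
  assumes D: "deferring X m" and edges: "m ''edges'' 0 0 = card E"
  shows "run E C deferred_acceptance m (\<lambda>t m'. t \<le> card E * (300 * (card E + k + 3) + 20) + 20 \<and>
     matched X_min m' \<and>
     same_except {''go'', ''f'', ''A'', ''ptr'', ''X'', ''b'', ''v'', ''w'', ''cnt'', ''t''} m m')"
proof -
  let ?S = "{''go'', ''f'', ''A'', ''ptr'', ''X'', ''b'', ''v'', ''w'', ''cnt'', ''t''}"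
  let ?J = "\<lambda>i m'. same_except ?S m m' \<and> m' ''t'' 0 0 = i \<and> (\<exists>X'. deferring X' m') \<and>
    ((\<forall>w<k. \<not> unfinished m' w) \<or> i \<le> (\<Sum>w<k. m' ''ptr'' w 0))"
  have upd: "deferring X' (store m' ''t'' 0 0 i) = deferring X' m'"
    "unfinished (store m' ''t'' 0 0 i) w = unfinished m' w" for X' m' i w
    by (simp_all add: deferring_def unfinished_def inputs_def store_apply)
  show ?thesis unfolding deferred_acceptance_def
  proof (rule run_For_uniform[where J = ?J and N = "card E" and B = "300 * (card E + k + 3)"])
    show "?J 0 (store m ''t'' 0 0 0)" using D unfolding upd by (auto simp: store_apply same_except_def)
  next
    fix i m' assume "?J i m'"
    then show "aval (Var ''edges'') m' = card E \<and> m' ''t'' 0 0 = i"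
      using edges by (simp add: same_except_def)
  next
    fix i m' assume J: "?J i m'"
    then obtain X' where X': "deferring X' m'" by auto
    show "run E C proposal_round m' (\<lambda>t m'. t \<le> 300 * (card E + k + 3) \<and> m' ''t'' 0 0 = i \<and> ?J (Suc i) (store m' ''t'' 0 0 (Suc i)))"
    proof (rule run_mono[OF run_proposal_round[OF X']])
      fix t m''
      assume a: "t \<le> 300 * (card E + k + 3) \<and> (\<exists>X'. deferring X' m'') \<and>
        same_except {''go'', ''f'', ''A'', ''ptr'', ''X'', ''b'', ''v'', ''w'', ''cnt''} m' m'' \<and>
        (if \<exists>w<k. unfinished m' w then (\<Sum>w<k. m' ''ptr'' w 0) < (\<Sum>w<k. m'' ''ptr'' w 0) else \<forall>w<k. \<not> unfinished m'' w)"
      have fin: "(\<forall>w<k. \<not> unfinished m'' w) \<or> Suc i \<le> (\<Sum>w<k. m'' ''ptr'' w 0)"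
      proof (cases "\<exists>w<k. unfinished m' w")
        case True
        have "i \<le> (\<Sum>w<k. m' ''ptr'' w 0)" using J True by blast
        moreover have "(\<Sum>w<k. m' ''ptr'' w 0) < (\<Sum>w<k. m'' ''ptr'' w 0)" using a True by presburger
        ultimately show ?thesis by linarith
      next
        case False
        then show ?thesis using a by presburger
      qed
      from a have a2: "t \<le> 300 * (card E + k + 3)" "\<exists>X'. deferring X' m''" and
        sm: "same_except {''go'', ''f'', ''A'', ''ptr'', ''X'', ''b'', ''v'', ''w'', ''cnt''} m' m''" by blast+
      from J have J1: "same_except ?S m m'" "m' ''t'' 0 0 = i" by blast+
      have t: "m'' ''t'' = m' ''t''" by (rule same_exceptD[OF sm]) simp
      have "same_except ?S m m''" by (rule same_except_trans[OF J1(1) sm]) simp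
      then have "same_except ?S m (store m'' ''t'' 0 0 (Suc i))" by (rule same_except_store) simp
      then show "t \<le> 300 * (card E + k + 3) \<and> m'' ''t'' 0 0 = i \<and> ?J (Suc i) (store m'' ''t'' 0 0 (Suc i))"
        using J1(2) a2 fin t unfolding upd by (simp add: store_apply)
    qed
  next
    fix t m' assume J: "?J (card E) m'" and t: "t \<le> card E * (300 * (card E + k + 3) + acost (Var ''edges'') + 13) + acost (Var ''edges'') + 9"
    then obtain X' where X': "deferring X' m'" by auto
    let ?p = "\<lambda>w. m' ''ptr'' w 0"
    have x: "inputs m'" "m' ''X'' = ind X'" "\<And>w. w < k \<Longrightarrow> ?p w \<le> deg w" "deferred X' (proposed ?p)"
      "\<And>w. w < k \<Longrightarrow> m' ''cnt'' w 0 = card (X' \<inter> EW w)" using X' unfolding deferring_def by auto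
    have fin: "\<not> unfinished m' w" if w: "w < k" for w
    proof -
      {
        assume a: "card E \<le> (\<Sum>w<k. ?p w)"
        have "?p w = deg w"
        proof (rule ccontr)
          assume "?p w \<noteq> deg w"
          then have "(\<Sum>w<k. ?p w) < (\<Sum>w<k. deg w)" using x(3) w 
            by (intro sum_strict_mono_ex1) (auto intro!: bexI[of _ w] simp: le_neq_implies_less)
          then show False using a sum_deg by simp
        qed
      }
      then show ?thesis using J w x(1) unfolding unfinished_def inputs_def by auto
    qed
    have "EW w \<subseteq> proposed ?p" if w: "w \<in> {..<k}" and c: "card (X' \<inter> EW w) < q w" for w
    proof -
      have "deg w \<le> ?p w" using fin[of w] w c x(1,5) input_quota unfolding unfinished_def inputs_def by auto
      moreover have "EW w = (\<lambda>i. (w, nb w i)) ` {..<deg w}" using set_pref w by simp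
      ultimately show ?thesis using w unfolding proposed_def by (auto intro: less_le_trans)
    qed
    then have "stable X'" "X_min = X'" using deferred_final[OF x(4)] by auto
    moreover have "ptr_ok X' ?p" using x(3,4) unfolding ptr_ok_def deferred_def by auto
    ultimately have "matched X_min m'" using x(1,2) unfolding matched_def by auto
    then show "t \<le> card E * (300 * (card E + k + 3) + 20) + 20 \<and> matched X_min m' \<and> same_except ?S m m'"
      using J t by (simp add: algebra_simps)
  qed
qed

end

section \<open>Finding a full route\<close>

context stable_market
begin

definition stuck :: "('w \<times> 'f) set \<Rightarrow> 'w \<Rightarrow> bool" where
  "stuck X w \<longleftrightarrow> (\<forall>u. feasible X u \<longrightarrow> (\<forall>L\<in>rotations_at (result X u). w \<notin> fst ` fst L))"

lemma stuck_apply: "stuck X w \<Longrightarrow> L \<in> rotations_at X \<Longrightarrow> stuck (apply_rotation L X) w"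
  unfolding stuck_def
proof (intro allI impI)
  fix u assume a: "\<forall>u. feasible X u \<longrightarrow> (\<forall>L\<in>rotations_at (result X u). w \<notin> fst ` fst L)"
    "L \<in> rotations_at X" "feasible (apply_rotation L X) u"
  then show "\<forall>M\<in>rotations_at (result (apply_rotation L X) u). w \<notin> fst ` fst M"
    using a(1)[rule_format, of "L # u"] by auto
qed

text \<open>
  A later tandem at \<open>w\<close> would be reflected by one at \<open>X\<close>.
\<close>

lemma stuck_without_tandem:
  assumes X: "stable X" and no: "\<And>a b. tandem X a b \<Longrightarrow> fst a \<noteq> w"
  shows "stuck X w"
  unfolding stuck_def
proof (intro allI impI ballI notI)
  fix u L assume u: "feasible X u" and L: "L \<in> rotations_at (result X u)" and w: "w \<in> fst ` fst L"
  have Y: "stable (result X u)" "leF X (result X u)" using feasible_stable[OF X u] feasible_leF[OF X u] .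
  obtain a b where "a \<in> fst L" "fst a = w" "tandem (result X u) a b" using rotationD(6)[OF Y(1) L] w by blast
  then show False using tandem_reflects[OF X Y] no by metis
qed

text \<open>
  The second edge of a tandem into a stuck vertex is never removed, so the tandem stays, and a
  rotation through its first vertex would also pass through the stuck one.
\<close>

lemma stuck_backwards:
  assumes X: "stable X" and t: "tandem X a b" and s: "stuck X (fst b)"
  shows "stuck X (fst a)"
proof -
  have b: "b \<in> result X u" if "feasible X u" for u
    using that
  proof (induction u rule: rev_induct)
    case Nil
    then show ?case using tandemD(4)[OF X t] by simp
  next
    case (snoc L u)
    then have u: "feasible X u" "L \<in> rotations_at (result X u)" "b \<in> result X u"
      by (auto simp: feasible_append)
    then have "fst b \<notin> fst ` fst L" using s unfolding stuck_def by blast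
    then have "fst b \<notin> fst ` snd L" using rotationD(8)[OF feasible_stable[OF X u(1)] u(2)] by simp
    then have "b \<notin> snd L" by (metis imageI)
    then show ?case using u(3) by (simp add: result_append apply_rotation_def)
  qed
  show ?thesis unfolding stuck_def
  proof (intro allI impI ballI notI)
    fix u L assume u: "feasible X u" and L: "L \<in> rotations_at (result X u)" and w: "fst a \<in> fst ` fst L"
    have Y: "stable (result X u)" "leF X (result X u)" using feasible_stable[OF X u] feasible_leF[OF X u] .
    have tY: "tandem (result X u) a b" using tandem_persists[OF X Y t b[OF u]] .
    obtain a' where a': "a' \<in> fst L" "fst a' = fst a" using w by fastforce
    have "a' = a" using rotation_tandem(1)[OF Y(1) L a'(1)] tandemD(1)[OF Y(1) tY] a'(2)
      W_admissible_unique[OF Y(1)] by blast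
    then have "b \<in> snd L" using rotation_tandem(4)[OF Y(1) L a'(1)] tY by simp
    then have "fst b \<in> fst ` fst L" using rotationD(8)[OF Y(1) L] by simp
    then show False using s u L unfolding stuck_def by blast
  qed
qed

lemma no_rotation_if_stuck:
  assumes X: "stable X" and s: "\<And>w. w \<in> W \<Longrightarrow> stuck X w"
  shows "rotations_at X = {}"
proof (rule ccontr)
  assume "rotations_at X \<noteq> {}"
  then obtain L where L: "L \<in> rotations_at X" by auto
  then obtain a where a: "a \<in> fst L" using rotationD(1)[OF X] by blast
  then have "fst a \<in> W" using rotationD(2)[OF X L] edge_ends(1) by blast
  then have "fst a \<notin> fst ` fst L" using s L unfolding stuck_def by (metis feasible.simps(1) result.simps(1))
  then show False using a by auto
qed

end

subsection \<open>The program\<close>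

abbreviation apply_entry :: com where
  "apply_entry \<equiv> Seq (Write ''X'' (Read ''minus_w'' (Var ''i'') (Var ''j'')) (Read ''minus_f'' (Var ''i'') (Var ''j'')) (Const 0))
     (Seq (Write ''X'' (Read ''plus_w'' (Var ''i'') (Var ''j'')) (Read ''plus_f'' (Var ''i'') (Var ''j'')) (Const 1))
          (increment ''ptr'' (Read ''plus_w'' (Var ''i'') (Var ''j''))))"

definition apply_listed :: com where
  "apply_listed = For ''j'' (Arr ''plus_len'' (Var ''i''))
     apply_entry"

abbreviation list_entry :: com where
  "list_entry \<equiv> Seq (Assign ''w'' (Arr ''st'' (Plus (Var ''p'') (Var ''j''))))
     (Seq (Assign ''f'' (Read ''pref'' (Var ''w'') (Arr ''ptr'' (Var ''w''))))
     (Seq (Write ''plus_w'' (Var ''i'') (Var ''j'') (Var ''w''))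
     (Seq (Write ''plus_f'' (Var ''i'') (Var ''j'') (Var ''f''))
     (Seq (Write ''minus_w'' (Var ''i'') (Var ''j'') (Arr ''st'' (Plus (Plus (Var ''p'') (Var ''j'')) (Const 1))))
          (Write ''minus_f'' (Var ''i'') (Var ''j'') (Var ''f''))))))"

definition list_cycle :: com where
  "list_cycle = For ''j'' (Var ''len'')
     list_entry"

definition extract_cycle :: com where
  "extract_cycle =
     Seq (Assign ''len'' (Minus (Var ''s'') (Var ''p'')))
     (Seq (Assign ''i'' (Var ''rot_count''))
     (Seq list_cycle
     (Seq (Write ''plus_len'' (Var ''i'') (Const 0) (Var ''len''))
     (Seq (Write ''minus_len'' (Var ''i'') (Const 0) (Var ''len''))
     (Seq apply_listed
     (Seq (Assign ''rot_count'' (Plus (Var ''rot_count'') (Const 1)))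
          (Assign ''s'' (Var ''p''))))))))"

definition kill_path :: com where
  "kill_path = Seq (For ''v'' (Var ''s'') (Write ''dead'' (Arr ''st'' (Var ''v'')) (Const 0) (Const 1)))
     (Assign ''s'' (Const 0))"

definition start_path :: com where
  "start_path = Seq (search ''w'' (Var ''W_size'') (Equal (Arr ''dead'' (Var ''v'')) (Const 0)))
     (If (Less (Var ''w'') (Var ''W_size''))
       (Seq (Write ''st'' (Const 0) (Const 0) (Var ''w'')) (Assign ''s'' (Const 1))) Skip)"

abbreviation close_or_push :: com where
  "close_or_push \<equiv> If (Less (Var ''p'') (Var ''s'')) extract_cycle
             (Assign ''s'' (Plus (Var ''s'') (Const 1)))"

definition extend_path :: com where
  "extend_path = Seq (search ''p'' (Var ''s'') (Equal (Arr ''st'' (Var ''v'')) (Var ''b'')))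
     (Seq (Write ''st'' (Var ''s'') (Const 0) (Var ''b''))
          close_or_push)"

abbreviation end_alive :: bexp where
  "end_alive \<equiv> And (Less (Var ''b'') (Var ''W_size'')) (Equal (Arr ''dead'' (Var ''b'')) (Const 0))"

definition path_round :: com where
  "path_round = If (Equal (Var ''s'') (Const 0)) start_path
     (Seq (Assign ''w'' (Arr ''st'' (Minus (Var ''s'') (Const 1))))
     (Seq probe
          (If end_alive
             extend_path kill_path)))"

definition find_route :: com where
  "find_route = For ''t'' (Plus (Plus (Var ''edges'') (Var ''edges'')) (Plus (Var ''W_size'') (Plus (Var ''W_size'') (Const 1)))) path_round"

context market_input
begin

definition pointed :: "memory \<Rightarrow> nat \<Rightarrow> nat \<times> nat" where
  "pointed m w = (w, nb w (m ''ptr'' w 0))"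

lemma distinct_nth_take: "distinct xs \<Longrightarrow> j < length xs \<Longrightarrow> xs ! j \<notin> set (take j xs)"
  using distinct_take[of xs "Suc j"] by (simp add: take_Suc_conv_app_nth)

lemma ptr_ok_apply:
  assumes X: "stable X" and ok: "ptr_ok X p" and L: "L \<in> rotations_at X"
    and pt: "\<And>a. a \<in> fst L \<Longrightarrow> p (fst a) < deg (fst a) \<and> a = (fst a, nb (fst a) (p (fst a)))"
  defines "p' \<equiv> \<lambda>w. if w \<in> fst ` fst L then Suc (p w) else p w"
  shows "ptr_ok (apply_rotation L X) p'" "(\<Sum>w<k. p' w) = (\<Sum>w<k. p w) + card (fst L)"
proof -
  let ?X = "apply_rotation L X"
  have LE: "fst L \<subseteq> E" using rotationD(2)[OF X L] by auto
  have Lk: "fst a < k" if "a \<in> fst L" for a using edge_ends(1)[of a] LE that by auto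
  have mono: "proposed p \<subseteq> proposed p'" unfolding proposed_def p'_def by auto (metis less_SucI)
  have new: "fst L \<subseteq> proposed p'"
  proof
    fix a assume a: "a \<in> fst L"
    then have "p' (fst a) = Suc (p (fst a))" unfolding p'_def by auto
    then have "a = (fst a, nb (fst a) (p (fst a))) \<and> fst a < k \<and> p (fst a) < p' (fst a)" using pt[OF a] Lk[OF a] by auto
    then show "a \<in> proposed p'" unfolding proposed_def by blast
  qed
  show "ptr_ok ?X p'" unfolding ptr_ok_def
  proof (intro conjI allI impI ballI)
    show "?X \<subseteq> proposed p'" using ok mono new unfolding ptr_ok_def apply_rotation_def by blast
    show "p' w \<le> deg w" if "w < k" for w
      using ok that pt unfolding ptr_ok_def p'_def by (auto simp: Suc_leI)
    fix e assume "e \<in> proposed p'"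
    then obtain w i where e: "e = (w, nb w i)" "w < k" "i < p' w" unfolding proposed_def by auto
    show "settled ?X e"
    proof (cases "i < p w")
      case True
      then have "e \<in> proposed p" using e unfolding proposed_def by auto
      moreover have "e \<in> E" using True e ok edge_nb[OF e(2), of i] unfolding ptr_ok_def by (auto intro: less_le_trans)
      ultimately show ?thesis
        using ok settled_mono[OF apply_rotation_stable(2)[OF X L]] unfolding ptr_ok_def by blast
    next
      case False
      then have "w \<in> fst ` fst L" "i = p w" using e(3) unfolding p'_def by (auto split: if_splits)
      then have "e \<in> fst L" using e pt by fastforce
      then show ?thesis unfolding settled_def apply_rotation_def by auto
    qed
  qed
  have "(\<Sum>w<k. p' w) = (\<Sum>w<k. p w + (if w \<in> fst ` fst L then 1 else 0))"
    unfolding p'_def by (intro sum.cong) auto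
  also have "\<dots> = (\<Sum>w<k. p w) + card ({..<k} \<inter> fst ` fst L)"
    by (simp add: sum.distrib sum.If_cases)
  also have "{..<k} \<inter> fst ` fst L = fst ` fst L" using Lk by auto
  also have "card (fst ` fst L) = card (fst L)" using rotationD(9)[OF X L] by (rule card_image)
  finally show "(\<Sum>w<k. p' w) = (\<Sum>w<k. p w) + card (fst L)" .
qed

lemma run_apply_listed:
  assumes M: "matched X m" and i: "m ''i'' 0 0 = i" and L: "output_rotation m i \<in> rotations_at X"
    and len: "m ''minus_len'' i 0 = m ''plus_len'' i 0" and dist: "distinct (plus_list m i)"
    and pt: "\<And>a. a \<in> set (plus_list m i) \<Longrightarrow> m ''ptr'' (fst a) 0 < deg (fst a) \<and> a = pointed m (fst a)"
  shows "run E C apply_listed m (\<lambda>t m'. t \<le> 100 * m ''plus_len'' i 0 + 100 \<and>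
     same_except {''X'', ''ptr'', ''j''} m m' \<and> matched (apply_rotation (output_rotation m i) X) m' \<and>
     (\<Sum>w<k. m' ''ptr'' w 0) = (\<Sum>w<k. m ''ptr'' w 0) + m ''plus_len'' i 0 \<and>
     (\<forall>w. w \<notin> fst ` set (plus_list m i) \<longrightarrow> m' ''ptr'' w 0 = m ''ptr'' w 0))"
proof -
  let ?n = "m ''plus_len'' i 0" and ?as = "plus_list m i" and ?bs = "minus_list m i"
  let ?L = "output_rotation m i"
  have X: "stable X" and Xm: "m ''X'' = ind X" and ok: "ptr_ok X (\<lambda>w. m ''ptr'' w 0)" and inp: "inputs m"
    using M unfolding matched_def by auto
  have Lab: "fst ?L = set ?as" "snd ?L = set ?bs" unfolding output_rotation_def by auto
  have lab: "length ?as = ?n" "length ?bs = ?n" using len unfolding plus_list_def minus_list_def by auto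
  have nth: "?as ! j = (m ''plus_w'' i j, m ''plus_f'' i j)" "?bs ! j = (m ''minus_w'' i j, m ''minus_f'' i j)" if "j < ?n" for j
    using that len unfolding plus_list_def minus_list_def by auto
  note rd = rotationD[OF X L]
  have df: "distinct (map fst ?as)" using dist rd(9) Lab by (simp add: distinct_map)
  let ?Y = "\<lambda>j. (X - set (take j ?bs)) \<union> set (take j ?as)"
  let ?p = "\<lambda>j w. if w \<in> fst ` set (take j ?as) then Suc (m ''ptr'' w 0) else m ''ptr'' w 0"
  let ?J = "\<lambda>j m'. same_except {''X'', ''ptr'', ''j''} m m' \<and> m' ''j'' 0 0 = j \<and>
    m' ''X'' = ind (?Y j) \<and> (\<forall>w. m' ''ptr'' w 0 = ?p j w)"
  have Yn: "?Y ?n = apply_rotation ?L X" using lab Lab unfolding apply_rotation_def by simp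
  have pn: "?p ?n = (\<lambda>w. if w \<in> fst ` fst ?L then Suc (m ''ptr'' w 0) else m ''ptr'' w 0)" using lab Lab by simp
  show ?thesis unfolding apply_listed_def
  proof (rule run_For_uniform[where J = ?J and N = ?n and B = 70])
    show "?J 0 (store m ''j'' 0 0 0)" using Xm by (simp add: store_apply same_except_def)
  next
    fix j m' assume J: "?J j m'"
    then have sm: "same_except {''X'', ''ptr'', ''j''} m m'" by blast
    have "m' ''plus_len'' = m ''plus_len''" "m' ''i'' = m ''i''" by (rule same_exceptD[OF sm]; simp)+
    then show "aval (Arr ''plus_len'' (Var ''i'')) m' = ?n \<and> m' ''j'' 0 0 = j" using J i by simp
  next
    fix j m' assume J: "?J j m'" and j: "j < ?n"
    then have sm: "same_except {''X'', ''ptr'', ''j''} m m'" and mX: "m' ''X'' = ind (?Y j)"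
      and mp: "\<And>w. m' ''ptr'' w 0 = ?p j w" and mj: "m' ''j'' 0 0 = j" by blast+
    have st: "m' ''plus_w'' = m ''plus_w''" "m' ''plus_f'' = m ''plus_f''" "m' ''minus_w'' = m ''minus_w''"
      "m' ''minus_f'' = m ''minus_f''" "m' ''i'' = m ''i''"
      by (rule same_exceptD[OF sm]; simp)+
    obtain w f where a: "?as ! j = (w, f)" by (cases "?as ! j")
    obtain w' f' where b: "?bs ! j = (w', f')" by (cases "?bs ! j")
    have wf: "m ''plus_w'' i j = w" "m ''plus_f'' i j = f" "m ''minus_w'' i j = w'" "m ''minus_f'' i j = f'"
      using nth[OF j] a b by auto
    have ta: "set (take (Suc j) ?as) = insert (w, f) (set (take j ?as))"
      using j lab a by (simp add: take_Suc_conv_app_nth)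
    have tb: "set (take (Suc j) ?bs) = insert (w', f') (set (take j ?bs))"
      using j lab b by (simp add: take_Suc_conv_app_nth)
    have "(w', f') \<in> set ?bs" using b j lab by (metis nth_mem)
    then have "(w', f') \<notin> set ?as" using rd(2,3) Lab by auto
    then have "(w', f') \<notin> set (take j ?as)" by (meson in_set_takeD)
    then have Y: "insert (w, f) (?Y j - {(w', f')}) = ?Y (Suc j)" unfolding ta tb by auto
    have "w \<notin> set (take j (map fst ?as))"
      using distinct_nth_take[OF df, of j] j lab a by simp
    then have wn: "w \<notin> fst ` set (take j ?as)" by (simp add: take_map)
    have pS: "?p (Suc j) v = (if v = w then Suc (?p j v) else ?p j v)" for v
      unfolding ta using wn by auto
    let ?m = "store (store (store m' ''X'' w' f' 0) ''X'' w f 1) ''ptr'' w 0 (m' ''ptr'' w 0 + 1)"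
    have m1: "?m ''X'' = ind (?Y (Suc j))" unfolding Y[symmetric]
      by (simp add: store_apply mX ind_remove ind_insert')
    have m2: "\<forall>v. ?m ''ptr'' v 0 = ?p (Suc j) v" unfolding pS using mp by (simp add: store_apply)
    have m3: "same_except {''X'', ''ptr'', ''j''} m ?m"
      by (rule same_except_store same_except_store same_except_store sm)+ simp_all
    have "?J (Suc j) (store ?m ''j'' 0 0 (Suc j))"
      using m1 m2 same_except_store[OF m3, of "''j''"] by (simp add: store_apply)
    then show "run E C apply_entry m'
       (\<lambda>t m'. t \<le> 70 \<and> m' ''j'' 0 0 = j \<and> ?J (Suc j) (store m' ''j'' 0 0 (Suc j)))"
      unfolding run_simps increment_def
      by (simp add: store_apply st i mj wf)
  next
    fix t m' assume J: "?J ?n m'" and t: "t \<le> ?n * (70 + acost (Arr ''plus_len'' (Var ''i'')) + 13) + acost (Arr ''plus_len'' (Var ''i'')) + 9"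
    have pt': "m ''ptr'' (fst a) 0 < deg (fst a) \<and> a = (fst a, nb (fst a) (m ''ptr'' (fst a) 0))" if "a \<in> fst ?L" for a
      using pt that Lab unfolding pointed_def by auto
    have p: "(\<lambda>w. m' ''ptr'' w 0) = ?p ?n" using J by auto
    note pa = ptr_ok_apply[OF X ok L pt'] 
    have sm: "same_except {''X'', ''ptr'', ''j''} m m'" using J by blast
    have "inputs m'" using inp unfolding inputs_def using same_exceptD[OF sm] by simp
    moreover have "m' ''X'' = ind (apply_rotation ?L X)" using J Yn by simp
    ultimately have "matched (apply_rotation ?L X) m'"
      unfolding matched_def p pn using pa(1) apply_rotation_stable(1)[OF X L] by auto
    moreover have "card (fst ?L) = ?n" unfolding Lab using distinct_card[OF dist] lab by simp
    moreover have "(\<Sum>w<k. m' ''ptr'' w 0) = (\<Sum>w<k. ?p ?n w)" using J by simp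
    ultimately show "t \<le> 100 * ?n + 100 \<and> same_except {''X'', ''ptr'', ''j''} m m' \<and> matched (apply_rotation ?L X) m' \<and>
     (\<Sum>w<k. m' ''ptr'' w 0) = (\<Sum>w<k. m ''ptr'' w 0) + ?n \<and>
     (\<forall>w. w \<notin> fst ` set ?as \<longrightarrow> m' ''ptr'' w 0 = m ''ptr'' w 0)"
      using pa(2) sm t J lab unfolding pn by simp
  qed
qed

text \<open>
  The order of the two output lists is significant: entries with the same index form a tandem.
\<close>

definition recorded :: "memory \<Rightarrow> nat \<Rightarrow> (nat \<times> nat) set \<Rightarrow> bool" where
  "recorded m i Y \<longleftrightarrow> m ''minus_len'' i 0 = m ''plus_len'' i 0 \<and>
     tandem_cycle Y (zip (plus_list m i) (minus_list m i))"

lemma recordedD: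
  assumes "recorded m i Y"
  shows "output_rotation m i \<in> rotations_at Y" "distinct (plus_list m i)" "distinct (minus_list m i)"
    "length (plus_list m i) = length (minus_list m i)"
proof -
  let ?ts = "zip (plus_list m i) (minus_list m i)"
  show len: "length (plus_list m i) = length (minus_list m i)"
    using assms unfolding recorded_def plus_list_def minus_list_def by simp
  have ts: "tandem_cycle Y ?ts" using assms unfolding recorded_def by simp
  then show "distinct (plus_list m i)" "distinct (minus_list m i)"
    using len unfolding tandem_cycle_def by auto
  have "fst ` set ?ts = set (plus_list m i)" "snd ` set ?ts = set (minus_list m i)"
    using len by (metis list.set_map map_fst_zip, metis list.set_map map_snd_zip)
  then show "output_rotation m i \<in> rotations_at Y"
    using rotation_of_cycle[OF ts] unfolding output_rotation_def by simp
qed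

lemma row_cong:
  assumes "\<And>j. m' ''plus_w'' i j = m ''plus_w'' i j" "\<And>j. m' ''plus_f'' i j = m ''plus_f'' i j"
    "\<And>j. m' ''minus_w'' i j = m ''minus_w'' i j" "\<And>j. m' ''minus_f'' i j = m ''minus_f'' i j"
    "m' ''plus_len'' i 0 = m ''plus_len'' i 0" "m' ''minus_len'' i 0 = m ''minus_len'' i 0"
  shows "output_rotation m' i = output_rotation m i" "recorded m' i Y = recorded m i Y"
    "plus_list m' i = plus_list m i" "minus_list m' i = minus_list m i"
  using assms unfolding output_rotation_def recorded_def plus_list_def minus_list_def by simp_all

definition found :: "memory \<Rightarrow> ((nat \<times> nat) set \<times> (nat \<times> nat) set) list" where
  "found m = map (output_rotation m) [0..<m ''rot_count'' 0 0]"

text \<open>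
  The last condition bounds the total length of the rotations by \<open>card E\<close>; it is kept up since
  each added edge advances a pointer.
\<close>

definition explored :: "(nat \<times> nat) set \<Rightarrow> memory \<Rightarrow> bool" where
  "explored X m \<longleftrightarrow> matched X m \<and> feasible X_min (found m) \<and> X = result X_min (found m) \<and>
     (\<forall>i<m ''rot_count'' 0 0. recorded m i (result X_min (take i (found m)))) \<and>
     (\<forall>w<k. m ''dead'' w 0 \<noteq> 0 \<longrightarrow> stuck X w) \<and>
     (\<Sum>i<m ''rot_count'' 0 0. m ''plus_len'' i 0) \<le> (\<Sum>w<k. m ''ptr'' w 0)"

definition link :: "(nat \<times> nat) set \<Rightarrow> memory \<Rightarrow> nat \<Rightarrow> nat \<Rightarrow> bool" where
  "link X m w v \<longleftrightarrow> m ''ptr'' w 0 < deg w \<and> tandem X (pointed m w) (v, snd (pointed m w))"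

definition path_ok :: "(nat \<times> nat) set \<Rightarrow> memory \<Rightarrow> bool" where
  "path_ok X m \<longleftrightarrow> inj_on (\<lambda>i. m ''st'' i 0) {..<m ''s'' 0 0} \<and>
     (\<forall>i<m ''s'' 0 0. m ''st'' i 0 < k \<and> m ''dead'' (m ''st'' i 0) 0 = 0) \<and>
     (\<forall>i. Suc i < m ''s'' 0 0 \<longrightarrow> link X m (m ''st'' i 0) (m ''st'' (Suc i) 0))"

definition alive :: "memory \<Rightarrow> nat set" where
  "alive m = {w. w < k \<and> m ''dead'' w 0 = 0}"

text \<open>
  The weights make every round count.  A push lengthens the path by one; discarding a path of
  length \<open>s\<close> costs \<open>s\<close> live vertices but shortens the path by \<open>s\<close>; cutting off a cycle of length
  \<open>n\<close> shortens the path by \<open>n\<close> but advances \<open>n\<close> pointers.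
\<close>

definition work_left :: "memory \<Rightarrow> nat" where
  "work_left m = 2 * (card E - (\<Sum>w<k. m ''ptr'' w 0)) + 2 * card (alive m) - m ''s'' 0 0"

lemma finite_alive [simp]: "finite (alive m)"
  unfolding alive_def by simp

lemma path_alive:
  assumes "path_ok X m"
  shows "(\<lambda>i. m ''st'' i 0) ` {..<m ''s'' 0 0} \<subseteq> alive m" "m ''s'' 0 0 \<le> card (alive m)" "card (alive m) \<le> k"
proof -
  show *: "(\<lambda>i. m ''st'' i 0) ` {..<m ''s'' 0 0} \<subseteq> alive m"
    using assms unfolding path_ok_def alive_def by auto
  have "card ((\<lambda>i. m ''st'' i 0) ` {..<m ''s'' 0 0}) = m ''s'' 0 0"
    using assms unfolding path_ok_def by (simp add: card_image)
  then show "m ''s'' 0 0 \<le> card (alive m)" using card_mono[OF finite_alive *] by simp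
  have "alive m \<subseteq> {..<k}" unfolding alive_def by auto
  then have "card (alive m) \<le> card {..<k}" by (intro card_mono) auto
  then show "card (alive m) \<le> k" by simp
qed

lemma explored_cong:
  assumes "same_except S m m'"
    and "S \<inter> {''W_size'', ''deg'', ''pref'', ''quota'', ''X'', ''ptr'', ''dead'', ''rot_count'', ''plus_w'', ''plus_f'',
      ''minus_w'', ''minus_f'', ''plus_len'', ''minus_len''} = {}"
  shows "explored X m' = explored X m"
proof -
  note d = disjoint_iff[THEN iffD1, OF assms(2), rule_format]
  have e: "m' ''W_size'' = m ''W_size''" "m' ''deg'' = m ''deg''" "m' ''pref'' = m ''pref''" "m' ''quota'' = m ''quota''"
    "m' ''X'' = m ''X''" "m' ''ptr'' = m ''ptr''" "m' ''dead'' = m ''dead''" "m' ''rot_count'' = m ''rot_count''"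
    "m' ''plus_w'' = m ''plus_w''" "m' ''plus_f'' = m ''plus_f''" "m' ''minus_w'' = m ''minus_w''"
    "m' ''minus_f'' = m ''minus_f''" "m' ''plus_len'' = m ''plus_len''" "m' ''minus_len'' = m ''minus_len''"
    by (rule same_exceptD[OF assms(1)], rule notI, drule d, simp)+
  have "output_rotation m' = output_rotation m" "recorded m' = recorded m"
    by (intro ext row_cong; simp add: e)+
  then show ?thesis unfolding explored_def found_def matched_def inputs_def by (simp add: e)
qed

lemma sum_ptr_le:
  assumes "matched X m" shows "(\<Sum>w<k. m ''ptr'' w 0) \<le> card E"
  using sum_mono[of "{..<k}" "\<lambda>w. m ''ptr'' w 0" deg] assms sum_deg unfolding matched_def ptr_ok_def by auto


text \<open>
  The first unsettled edge of a vertex is its admissible edge, and the pointer stops there.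
\<close>

lemma pointer_moved:
  assumes X: "stable X" and ok: "ptr_ok X p" and w: "w < k" and n: "p w \<le> n" "n \<le> deg w"
    and rej: "\<And>i. p w \<le> i \<Longrightarrow> i < n \<Longrightarrow> \<not> accepts X (w, nb w i)"
  shows "ptr_ok X (p(w := n))"
    and "n < deg w \<Longrightarrow> accepts X (w, nb w n) \<Longrightarrow> W_admissible X (w, nb w n)"
    and "W_admissible X a \<Longrightarrow> fst a = w \<Longrightarrow> n < deg w"
proof -
  let ?q = "p(w := n)"
  have settled: "settled X e" if e: "e \<in> proposed ?q" for e
  proof (cases "e \<in> proposed p")
    case True
    then show ?thesis using ok unfolding ptr_ok_def by blast
  next
    case False
    obtain v i where vi: "e = (v, nb v i)" "v < k" "i < ?q v" using e unfolding proposed_def by blast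
    then have "\<not> i < p v" using False unfolding proposed_def by blast
    then have "v = w" "p w \<le> i" "i < n" using vi(3) by (auto split: if_splits)
    with vi show ?thesis using rej unfolding settled_def by auto
  qed
  have seen: "settled X (w, nb w i)" if "i < n" for i
  proof (rule settled)
    show "(w, nb w i) \<in> proposed ?q"
      unfolding proposed_def mem_Collect_eq by (intro exI[of _ w] exI[of _ i]) (simp add: w that)
  qed
  have "proposed p \<subseteq> proposed ?q" using n(1) unfolding proposed_def by (auto split: if_splits) force
  then show "ptr_ok X ?q" using ok n(2) settled unfolding ptr_ok_def by (auto split: if_splits)
  show "W_admissible X (w, nb w n)" if nd: "n < deg w" and acc: "accepts X (w, nb w n)"
  proof -
    let ?a = "(w, nb w n)"
    have a: "?a \<in> E" "?a \<notin> X" using edge_nb[OF w nd] ptr_ok_new[OF ok w n(1) nd] by auto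
    have "(?a, e) \<in> gt w" if e: "e \<in> E" "fst e = w" "\<not> settled X e" "e \<noteq> ?a" for e
    proof -
      obtain i where i: "i < deg w" "e = (w, nb w i)" using edge_index[OF e(1)] e(2) by metis
      have "\<not> i < n" using seen i e(3) by blast
      then have "n < i" using e(4) i(2) by (metis linorder_neqE_nat)
      then show ?thesis using nb_order[OF w nd i(1)] i(2) by simp
    qed
    then show ?thesis unfolding W_admissible_iff[OF X] using a acc unfolding settled_def by auto
  qed
  show "n < deg w" if a: "W_admissible X a" "fst a = w"
  proof -
    have aE: "a \<in> E" "\<not> settled X a" using a(1) unfolding W_admissible_iff[OF X] by auto
    then obtain i where i: "i < deg w" "a = (w, nb w i)" using edge_index[OF aE(1)] a(2) by metis
    then have "\<not> i < n" using seen aE(2) by blast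
    then show ?thesis using i by simp
  qed
qed

lemma probed_tandem:
  assumes X: "stable X" and ok: "ptr_ok X (\<lambda>w. m ''ptr'' w 0)" and w: "w < k"
    and pr: "probed X w m n m'"
  shows "ptr_ok X (\<lambda>w. m' ''ptr'' w 0)"
    and "m' ''b'' 0 0 < k \<Longrightarrow> link X m' w (m' ''b'' 0 0)"
    and "\<not> m' ''b'' 0 0 < k \<Longrightarrow> tandem X a b \<Longrightarrow> fst a \<noteq> w"
proof -
  let ?p = "\<lambda>w. m ''ptr'' w 0" and ?b = "m' ''b'' 0 0"
  have n: "?p w \<le> n" "n \<le> deg w" "\<And>i. ?p w \<le> i \<Longrightarrow> i < n \<Longrightarrow> \<not> accepts X (w, nb w i)"
    "m' ''ptr'' = (m ''ptr'')(w := (m ''ptr'' w)(0 := n))" using pr unfolding probed_def by auto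
  have q: "(\<lambda>w. m' ''ptr'' w 0) = ?p(w := n)" using n(4) by auto
  have moved: "ptr_ok X (?p(w := n))" "n < deg w \<Longrightarrow> accepts X (w, nb w n) \<Longrightarrow> W_admissible X (w, nb w n)"
    "\<And>a. W_admissible X a \<Longrightarrow> fst a = w \<Longrightarrow> n < deg w"
    using pointer_moved[where p = ?p, OF X ok w n(1,2)] n(3) by blast+
  show "ptr_ok X (\<lambda>w. m' ''ptr'' w 0)" unfolding q by (rule moved(1))
  have adm: "W_admissible X (w, nb w n)" if "n < deg w"
    using moved(2) pr that unfolding probed_def by (auto simp: Let_def)
  show "link X m' w ?b" if b: "?b < k"
  proof -
    have nd: "n < deg w" using pr b unfolding probed_def by (auto split: if_splits)
    then have a: "(?b, nb w n) \<in> X"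
      "C (nb w n) (insert (w, nb w n) (X \<inter> EF (nb w n))) = insert (w, nb w n) (X \<inter> EF (nb w n) - {(?b, nb w n)})"
      using pr b unfolding probed_def by (auto simp: Let_def)
    have "(?b, nb w n) \<in> EF (nb w n)" using a(1) stableD(2)[OF X] by (auto simp: EF_iff)
    moreover have "m' ''ptr'' w 0 = n" using n(4) by simp
    ultimately show ?thesis unfolding link_def pointed_def tandem_def using adm[OF nd] a nd by simp
  qed
  show "fst a \<noteq> w" if b: "\<not> ?b < k" and t: "tandem X a b"
  proof
    assume fa: "fst a = w"
    note td = tandemD[OF X t]
    have nd: "n < deg w" using moved(3)[OF td(1) fa] .
    then have free: "C (nb w n) (insert (w, nb w n) (X \<inter> EF (nb w n))) = insert (w, nb w n) (X \<inter> EF (nb w n))"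
      using pr b unfolding probed_def by (auto simp: Let_def)
    have "a = (w, nb w n)" using W_admissible_unique[OF X td(1) adm[OF nd]] fa by simp
    then show False using td(4,5,6,8) free by (auto simp: EF_iff)
  qed
qed

definition searching :: "(nat \<times> nat) set \<Rightarrow> memory \<Rightarrow> bool" where
  "searching X m \<longleftrightarrow> explored X m \<and> path_ok X m"

lemma path_ok_cong:
  assumes "m' ''st'' = m ''st''" "m' ''s'' = m ''s''" "m' ''dead'' = m ''dead''"
    "\<And>i. Suc i < m ''s'' 0 0 \<Longrightarrow> m' ''ptr'' (m ''st'' i 0) 0 = m ''ptr'' (m ''st'' i 0) 0"
  shows "path_ok X m \<Longrightarrow> path_ok X m'"
  using assms unfolding path_ok_def link_def pointed_def by simp

lemma run_start_path:
  assumes S: "searching X m" and s: "m ''s'' 0 0 = 0"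
  shows "run E C start_path m (\<lambda>t m'. t \<le> 100 * k + 100 \<and> same_except {''w'', ''v'', ''st'', ''s''} m m' \<and>
     searching X m' \<and> (if alive m = {} then alive m' = {} \<and> m' ''s'' 0 0 = 0 else work_left m' < work_left m))"
proof -
  let ?S = "{''w'', ''v'', ''st'', ''s''}"
  have ex: "explored X m" and W: "m ''W_size'' 0 0 = k"
    using S input_size unfolding searching_def explored_def matched_def inputs_def by auto
  have srch: "run E C (search ''w'' (Var ''W_size'') (Equal (Arr ''dead'' (Var ''v'')) (Const 0))) m
     (\<lambda>t m'. same_except {''w'', ''v''} m m' \<and> t \<le> 60 * k + 60 \<and>
       (if \<exists>v<k. m ''dead'' v 0 = 0 then m' ''w'' 0 0 < k \<and> m ''dead'' (m' ''w'' 0 0) 0 = 0 else m' ''w'' 0 0 = k))"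
  proof (rule run_mono[OF run_search[where N = k and P = "\<lambda>v. m ''dead'' v 0 = 0"]])
    fix m' i assume "same_except {''w'', ''v''} m m'" "m' ''v'' 0 0 = i"
    then show "bval (Equal (Arr ''dead'' (Var ''v'')) (Const 0)) m' = (m ''dead'' i 0 = 0)"
      by (simp add: same_except_def)
  next
    fix m' assume "same_except {''w'', ''v''} m m'"
    then show "aval (Var ''W_size'') m' = k" using W by (simp add: same_except_def)
  qed (simp_all add: algebra_simps)
  show ?thesis unfolding start_path_def run_Seq[of E C "search _ _ _"]
  proof (rule run_mono[OF srch])
    fix t m1
    assume a: "same_except {''w'', ''v''} m m1 \<and> t \<le> 60 * k + 60 \<and>
       (if \<exists>v<k. m ''dead'' v 0 = 0 then m1 ''w'' 0 0 < k \<and> m ''dead'' (m1 ''w'' 0 0) 0 = 0 else m1 ''w'' 0 0 = k)"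
    have sm: "same_except {''w'', ''v''} m m1" and t: "t \<le> 60 * k + 60" using a by blast+
    have sm': "same_except ?S m m1" using sm by (rule same_except_mono) auto
    have e: "m1 ''W_size'' = m ''W_size''" "m1 ''dead'' = m ''dead''" "m1 ''ptr'' = m ''ptr''" "m1 ''s'' = m ''s''"
      "m1 ''st'' = m ''st''"
      by (rule same_exceptD[OF sm]; simp)+
    show "run E C (If (Less (Var ''w'') (Var ''W_size''))
       (Seq (Write ''st'' (Const 0) (Const 0) (Var ''w'')) (Assign ''s'' (Const 1))) Skip) m1
       (\<lambda>t' m'. t + t' \<le> 100 * k + 100 \<and> same_except ?S m m' \<and> searching X m' \<and>
         (if alive m = {} then alive m' = {} \<and> m' ''s'' 0 0 = 0 else work_left m' < work_left m))"
    proof (cases "alive m = {}")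
      case True
      then have w: "m1 ''w'' 0 0 = k" using a unfolding alive_def by auto
      have "explored X m1" using explored_cong[OF sm] ex by simp
      moreover have "path_ok X m1" using s unfolding path_ok_def e by simp
      moreover have "alive m1 = alive m" unfolding alive_def e ..
      ultimately show ?thesis unfolding run_If run_Skip
        using True w W e s sm' t by (simp add: searching_def)
    next
      case False
      then have w: "m1 ''w'' 0 0 < k" "m ''dead'' (m1 ''w'' 0 0) 0 = 0" using a unfolding alive_def by (auto split: if_splits)
      let ?m = "store (store m1 ''st'' 0 0 (m1 ''w'' 0 0)) ''s'' 0 0 1"
      have sm2: "same_except ?S m ?m" using sm' by (intro same_except_store) simp_all
      have "explored X ?m" using explored_cong[OF sm2] ex by simp
      moreover have "path_ok X ?m" unfolding path_ok_def using w by (simp add: store_apply e lessThan_Suc)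
      moreover have "work_left ?m < work_left m"
      proof -
        have "alive ?m = alive m" "?m ''ptr'' = m ''ptr''" "?m ''s'' 0 0 = 1"
          unfolding alive_def by (simp_all add: store_apply e)
        moreover have "card (alive m) > 0" using False by (simp add: card_gt_0_iff)
        ultimately show ?thesis unfolding work_left_def using s by simp
      qed
      ultimately show ?thesis unfolding run_simps
        using False w W e sm2 t by (simp add: searching_def)
    qed
  qed
qed

lemma run_kill_path:
  assumes S: "searching X m" and s: "0 < m ''s'' 0 0"
    and last: "stuck X (m ''st'' (m ''s'' 0 0 - 1) 0)"
  shows "run E C kill_path m (\<lambda>t m'. t \<le> 100 * k + 100 \<and> same_except {''v'', ''dead'', ''s''} m m' \<and>
     searching X m' \<and> work_left m' < work_left m)"
proof -
  let ?s = "m ''s'' 0 0" and ?st = "\<lambda>i. m ''st'' i 0"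
  have ex: "explored X m" and pa: "path_ok X m" using S unfolding searching_def by auto
  have X: "stable X" using ex unfolding explored_def matched_def by auto
  have stuck: "stuck X (?st i)" if "i < ?s" for i
    using that
  proof (induction "?s - i" arbitrary: i)
    case (Suc n)
    show ?case
    proof (cases "Suc i < ?s")
      case True
      then have "link X m (?st i) (?st (Suc i))" using pa unfolding path_ok_def by auto
      then have "tandem X (pointed m (?st i)) (?st (Suc i), snd (pointed m (?st i)))" unfolding link_def by auto
      moreover have "stuck X (?st (Suc i))" using Suc.hyps(1)[of "Suc i"] Suc.hyps(2) True by simp
      ultimately show ?thesis using stuck_backwards[OF X] unfolding pointed_def by fastforce
    next
      case False
      then have "i = ?s - 1" using Suc.prems by simp
      then show ?thesis using last by simp
    qed
  qed simp
  let ?J = "\<lambda>i m'. same_except {''v'', ''dead''} m m' \<and> m' ''v'' 0 0 = i \<and>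
    (\<forall>w. m' ''dead'' w 0 = (if w \<in> ?st ` {..<i} then 1 else m ''dead'' w 0))"
  have loop: "run E C (For ''v'' (Var ''s'') (Write ''dead'' (Arr ''st'' (Var ''v'')) (Const 0) (Const 1))) m
     (\<lambda>t m'. t \<le> 60 * ?s + 60 \<and> ?J ?s m')"
  proof (rule run_For_uniform[where J = ?J and N = ?s and B = 30])
    show "?J 0 (store m ''v'' 0 0 0)" by (simp add: store_apply same_except_def)
  next
    fix i m' assume "?J i m'"
    then show "aval (Var ''s'') m' = ?s \<and> m' ''v'' 0 0 = i" by (simp add: same_except_def)
  next
    fix i m' assume J: "?J i m'" and i: "i < ?s"
    then have sm: "same_except {''v'', ''dead''} m m'" by blast
    have e: "m' ''st'' = m ''st''" by (rule same_exceptD[OF sm]) simp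
    let ?m = "store m' ''dead'' (?st i) 0 1"
    have "same_except {''v'', ''dead''} m (store ?m ''v'' 0 0 (Suc i))"
      using sm by (intro same_except_store) simp_all
    then have "?J (Suc i) (store ?m ''v'' 0 0 (Suc i))"
      using J by (auto simp: store_apply lessThan_Suc)
    then show "run E C (Write ''dead'' (Arr ''st'' (Var ''v'')) (Const 0) (Const 1)) m'
      (\<lambda>t m'. t \<le> 30 \<and> m' ''v'' 0 0 = i \<and> ?J (Suc i) (store m' ''v'' 0 0 (Suc i)))"
      unfolding run_simps using J e by (simp add: store_apply)
  next
    fix t m' assume "?J ?s m'" "t \<le> ?s * (30 + acost (Var ''s'') + 13) + acost (Var ''s'') + 9"
    then show "t \<le> 60 * ?s + 60 \<and> ?J ?s m'" by simp
  qed
  show ?thesis unfolding kill_path_def run_Seq[of E C "For _ _ _"]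
  proof (rule run_mono[OF loop])
    fix t m1 assume a: "t \<le> 60 * ?s + 60 \<and> ?J ?s m1"
    then have sm: "same_except {''v'', ''dead''} m m1" and t: "t \<le> 60 * ?s + 60"
      and dead: "\<And>w. m1 ''dead'' w 0 = (if w \<in> ?st ` {..<?s} then 1 else m ''dead'' w 0)" by blast+
    let ?m = "store m1 ''s'' 0 0 0"
    have e: "?m ''W_size'' = m ''W_size''" "?m ''deg'' = m ''deg''" "?m ''pref'' = m ''pref''" "?m ''quota'' = m ''quota''"
      "?m ''X'' = m ''X''" "?m ''ptr'' = m ''ptr''" "?m ''rot_count'' = m ''rot_count''"
      "?m ''plus_w'' = m ''plus_w''" "?m ''plus_f'' = m ''plus_f''" "?m ''minus_w'' = m ''minus_w''"
      "?m ''minus_f'' = m ''minus_f''" "?m ''plus_len'' = m ''plus_len''" "?m ''minus_len'' = m ''minus_len''"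
      using same_exceptD[OF sm] by (simp_all add: store_apply)
    have "output_rotation ?m = output_rotation m" "recorded ?m = recorded m"
      by (intro ext row_cong; simp only: e)+
    moreover have "stuck X w" if "w < k" "?m ''dead'' w 0 \<noteq> 0" for w
      using that dead[of w] stuck ex unfolding explored_def by (auto simp: store_apply split: if_splits)
    ultimately have "explored X ?m" using ex unfolding explored_def found_def matched_def inputs_def e by auto
    moreover have "path_ok X ?m" unfolding path_ok_def by (simp add: store_apply)
    moreover have "work_left ?m < work_left m"
    proof -
      have "alive ?m = alive m - ?st ` {..<?s}" unfolding alive_def using dead by (auto simp: store_apply)
      moreover have "card (?st ` {..<?s}) = ?s" using pa unfolding path_ok_def by (simp add: card_image)
      ultimately have "card (alive ?m) = card (alive m) - ?s"
        using path_alive(1)[OF pa] by (simp add: card_Diff_subset finite_subset)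
      moreover have "?m ''s'' 0 0 = 0" by (simp add: store_apply)
      ultimately show ?thesis unfolding work_left_def e(6) using s path_alive(2)[OF pa] by simp
    qed
    moreover have "same_except {''v'', ''dead'', ''s''} m ?m"
      by (rule same_except_store, rule same_except_mono[OF sm]) auto
    moreover have "?s \<le> k" using path_alive(2,3)[OF pa] by simp
    ultimately show "run E C (Assign ''s'' (Const 0)) m1 (\<lambda>t' m'. t + t' \<le> 100 * k + 100 \<and>
      same_except {''v'', ''dead'', ''s''} m m' \<and> searching X m' \<and> work_left m' < work_left m)"
      unfolding run_simps using t by (simp add: searching_def)
  qed
qed

end

context market_input
begin

lemma run_list_cycle:
  assumes m: "inputs m" "m ''i'' 0 0 = i" "m ''p'' 0 0 = p" "m ''len'' 0 0 = n"
  shows "run E C list_cycle m (\<lambda>t m'. t \<le> 100 * n + 100 \<and>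
     same_except {''w'', ''f'', ''j'', ''plus_w'', ''plus_f'', ''minus_w'', ''minus_f''} m m' \<and>
     (\<forall>i' j. m' ''plus_w'' i' j = (if i' = i \<and> j < n then m ''st'' (p + j) 0 else m ''plus_w'' i' j)) \<and>
     (\<forall>i' j. m' ''plus_f'' i' j = (if i' = i \<and> j < n then snd (pointed m (m ''st'' (p + j) 0)) else m ''plus_f'' i' j)) \<and>
     (\<forall>i' j. m' ''minus_w'' i' j = (if i' = i \<and> j < n then m ''st'' (p + j + 1) 0 else m ''minus_w'' i' j)) \<and>
     (\<forall>i' j. m' ''minus_f'' i' j = (if i' = i \<and> j < n then snd (pointed m (m ''st'' (p + j) 0)) else m ''minus_f'' i' j)))"
proof -
  let ?S = "{''w'', ''f'', ''j'', ''plus_w'', ''plus_f'', ''minus_w'', ''minus_f''}"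
  let ?st = "\<lambda>j. m ''st'' j 0" and ?f = "\<lambda>j. snd (pointed m (m ''st'' (p + j) 0))"
  let ?R = "\<lambda>r m'. (\<forall>i' j. m' ''plus_w'' i' j = (if i' = i \<and> j < r then ?st (p + j) else m ''plus_w'' i' j)) \<and>
     (\<forall>i' j. m' ''plus_f'' i' j = (if i' = i \<and> j < r then ?f j else m ''plus_f'' i' j)) \<and>
     (\<forall>i' j. m' ''minus_w'' i' j = (if i' = i \<and> j < r then ?st (p + j + 1) else m ''minus_w'' i' j)) \<and>
     (\<forall>i' j. m' ''minus_f'' i' j = (if i' = i \<and> j < r then ?f j else m ''minus_f'' i' j))"
  let ?J = "\<lambda>r m'. same_except ?S m m' \<and> m' ''j'' 0 0 = r \<and> ?R r m'"
  show ?thesis unfolding list_cycle_def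
  proof (rule run_For_uniform[where J = ?J and N = n and B = 80])
    show "?J 0 (store m ''j'' 0 0 0)" by (simp add: store_apply same_except_def)
  next
    fix r m' assume "?J r m'"
    then show "aval (Var ''len'') m' = n \<and> m' ''j'' 0 0 = r" using m by (simp add: same_except_def)
  next
    fix r m' assume J: "?J r m'" and r: "r < n"
    then have sm: "same_except ?S m m'" and j: "m' ''j'' 0 0 = r" and R: "?R r m'" by blast+
    have e: "m' ''st'' = m ''st''" "m' ''i'' = m ''i''" "m' ''p'' = m ''p''" "m' ''ptr'' = m ''ptr''" "m' ''pref'' = m ''pref''"
      by (rule same_exceptD[OF sm]; simp)+
    have pref: "m ''pref'' = m0 ''pref''" using m(1) unfolding inputs_def by simp
    let ?m = "store (store (store (store (store (store m' ''w'' 0 0 (?st (p + r))) ''f'' 0 0 (?f r)) ''plus_w'' i r (?st (p + r)))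
      ''plus_f'' i r (?f r)) ''minus_w'' i r (?st (p + r + 1))) ''minus_f'' i r (?f r)"
    let ?m' = "store ?m ''j'' 0 0 (Suc r)"
    have sm': "same_except ?S m ?m'" using sm by (intro same_except_store) simp_all
    have upd: "(fn(i := (fn i)(r := v))) i' j = (if i' = i \<and> j = r then v else fn i' j)"
      for fn :: "nat \<Rightarrow> nat \<Rightarrow> nat" and v i' j by simp
    have row: "\<And>j. j < Suc r \<longleftrightarrow> j < r \<or> j = r" by auto
    have m'R: "m' ''plus_w'' i' j = (if i' = i \<and> j < r then ?st (p + j) else m ''plus_w'' i' j)"
      "m' ''plus_f'' i' j = (if i' = i \<and> j < r then ?f j else m ''plus_f'' i' j)"
      "m' ''minus_w'' i' j = (if i' = i \<and> j < r then ?st (p + j + 1) else m ''minus_w'' i' j)"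
      "m' ''minus_f'' i' j = (if i' = i \<and> j < r then ?f j else m ''minus_f'' i' j)" for i' j
      using R by blast+
    have "?m' ''plus_w'' = (m' ''plus_w'')(i := (m' ''plus_w'' i)(r := ?st (p + r)))"
      "?m' ''plus_f'' = (m' ''plus_f'')(i := (m' ''plus_f'' i)(r := ?f r))"
      "?m' ''minus_w'' = (m' ''minus_w'')(i := (m' ''minus_w'' i)(r := ?st (p + r + 1)))"
      "?m' ''minus_f'' = (m' ''minus_f'')(i := (m' ''minus_f'' i)(r := ?f r))"
      by (simp_all add: store_apply)
    then have "?R (Suc r) ?m'" unfolding row by (simp only: upd m'R) auto
    moreover have "?m' ''j'' 0 0 = Suc r" by (simp add: store_apply)
    ultimately have "?J (Suc r) ?m'" using sm' by blast
    moreover have "?m ''j'' 0 0 = r" using j by (simp add: store_apply)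
    ultimately have *: "?m ''j'' 0 0 = r \<and> ?J (Suc r) (store ?m ''j'' 0 0 (Suc r))" by blast
    have av: "aval (Arr ''st'' (Plus (Var ''p'') (Var ''j''))) m' = ?st (p + r)" using e m j by simp
    show "run E C list_entry m'
       (\<lambda>t m'. t \<le> 80 \<and> m' ''j'' 0 0 = r \<and> ?J (Suc r) (store m' ''j'' 0 0 (Suc r)))"
    proof -
      let ?a = "store m' ''w'' 0 0 (?st (p + r))"
      have a: "aval (Read ''pref'' (Var ''w'') (Arr ''ptr'' (Var ''w''))) ?a = ?f r"
        using e pref by (simp add: store_apply pointed_def)
      let ?b = "store ?a ''f'' 0 0 (?f r)"
      have b: "aval (Var ''i'') ?b = i" "aval (Var ''j'') ?b = r" "aval (Var ''w'') ?b = ?st (p + r)"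
        using e m j by (simp_all add: store_apply)
      let ?c = "store ?b ''plus_w'' i r (?st (p + r))"
      have c: "aval (Var ''i'') ?c = i" "aval (Var ''j'') ?c = r" "aval (Var ''f'') ?c = ?f r"
        using e m j by (simp_all add: store_apply)
      let ?d = "store ?c ''plus_f'' i r (?f r)"
      have d: "aval (Var ''i'') ?d = i" "aval (Var ''j'') ?d = r"
        "aval (Arr ''st'' (Plus (Plus (Var ''p'') (Var ''j'')) (Const 1))) ?d = ?st (p + r + 1)"
        using e m j by (simp_all add: store_apply)
      let ?e = "store ?d ''minus_w'' i r (?st (p + r + 1))"
      have ee: "aval (Var ''i'') ?e = i" "aval (Var ''j'') ?e = r" "aval (Var ''f'') ?e = ?f r"
        using e m j by (simp_all add: store_apply)
      show ?thesis unfolding run_Seq run_Write av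
        unfolding aval.simps(1) a b c d ee using * by (intro conjI; (elim conjE)?; (assumption | simp))
    qed
  next
    fix t m' assume "?J n m'" "t \<le> n * (80 + acost (Var ''len'') + 13) + acost (Var ''len'') + 9"
    then show "t \<le> 100 * n + 100 \<and> same_except ?S m m' \<and> ?R n m'" by simp
  qed
qed

abbreviation cycle_names :: "string set" where
  "cycle_names \<equiv> {''w'', ''f'', ''j'', ''plus_w'', ''plus_f'', ''minus_w'', ''minus_f'', ''plus_len'', ''minus_len'',
     ''i'', ''len'', ''X'', ''ptr'', ''rot_count'', ''s''}"

text \<open>
  The entry \<open>st s\<close> above the top repeats the vertex \<open>st p\<close>, so that every vertex of the cycle,
  the last one included, is followed by its successor.
\<close>

lemma run_extract_cycle:
  assumes S: "explored X m" "path_ok X m" and p: "m ''p'' 0 0 = p" "p < m ''s'' 0 0"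
    and last: "link X m (m ''st'' (m ''s'' 0 0 - 1) 0) (m ''st'' (m ''s'' 0 0) 0)"
    and closed: "m ''st'' (m ''s'' 0 0) 0 = m ''st'' p 0"
  shows "run E C extract_cycle m (\<lambda>t m'. t \<le> 300 * k + 400 \<and> same_except cycle_names m m' \<and>
     (\<exists>X'. searching X' m') \<and> work_left m' < work_left m)"
proof -
  define s where "s = m ''s'' 0 0"
  define n where "n = s - p"
  define N where "N = m ''rot_count'' 0 0"
  define st where "st = (\<lambda>i. m ''st'' i 0)"
  have np: "0 < n" "p + n = s" using p(2) unfolding n_def s_def by auto
  have M: "matched X m" and inp: "inputs m" and X: "stable X" and Xm: "m ''X'' = ind X"
    and ok: "ptr_ok X (\<lambda>w. m ''ptr'' w 0)"
    using S(1) unfolding explored_def matched_def by auto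
  have inj: "inj_on st {..<s}" and stk: "\<And>i. i < s \<Longrightarrow> st i < k \<and> m ''dead'' (st i) 0 = 0"
    using S(2) unfolding path_ok_def st_def s_def by auto
  have links: "link X m (st i) (st (Suc i))" if "i < s" for i
  proof (cases "Suc i < s")
    case True
    then show ?thesis using S(2) unfolding path_ok_def st_def s_def by auto
  next
    case False
    then have "i = s - 1" "Suc i = s" using that by auto
    then show ?thesis using last unfolding st_def s_def by simp
  qed
  have sk: "s \<le> k" using path_alive(2,3)[OF S(2)] unfolding s_def by simp
  let ?A = "\<lambda>j. pointed m (st (p + j))" and ?B = "\<lambda>j. (st (p + j + 1), snd (pointed m (st (p + j))))"
  let ?ts = "map (\<lambda>j. (?A j, ?B j)) [0..<n]"
  have tc: "tandem_cycle X ?ts"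
  proof (rule cycle_of_tandems[where v = "\<lambda>j. st (p + j)", OF np(1)])
    show "inj_on (\<lambda>j. st (p + j)) {..<n}" using inj np unfolding inj_on_def by (metis add_left_cancel lessThan_iff nat_add_left_cancel_less)
  next
    fix j assume j: "j < n"
    have "fst (?B j) = st (p + (Suc j mod n))"
    proof (cases "Suc j = n")
      case True
      then have "p + j + 1 = s" using np(2) by simp
      then have "st (p + j + 1) = st s" by (rule arg_cong)
      then show ?thesis using True closed unfolding st_def s_def by simp
    next
      case False
      then have "Suc j mod n = Suc j" using j by simp
      then show ?thesis by simp
    qed
    then show "tandem X (?A j) (?B j) \<and> fst (?A j) = st (p + j) \<and> fst (?B j) = st (p + (Suc j mod n))"
      using links[of "p + j"] j np(2) unfolding link_def pointed_def by simp
  qed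
  let ?L = "(?A ` {..<n}, ?B ` {..<n})"
  have L: "?L \<in> rotations_at X" using rotation_of_cycle[OF tc] by (simp add: image_image atLeast0LessThan)
  define m1 where "m1 = store (store m ''len'' 0 0 n) ''i'' 0 0 N"
  have m1: "inputs m1" "m1 ''i'' 0 0 = N" "m1 ''p'' 0 0 = p" "m1 ''len'' 0 0 = n" "same_except cycle_names m m1"
    using inp p unfolding m1_def inputs_def by (simp_all add: store_apply same_except_def)
  have st1: "m1 ''st'' = m ''st''" "pointed m1 = pointed m" unfolding m1_def by (auto simp: store_apply pointed_def)
  have av: "aval (Minus (Var ''s'') (Var ''p'')) m = n" "aval (Var ''rot_count'') (store m ''len'' 0 0 n) = N"
    using p unfolding n_def s_def N_def by (simp_all add: store_apply)
  show ?thesis unfolding extract_cycle_def run_Seq[of E C "Write _ _ _ _"] run_Write av unfolding aval.simps(1) av m1_def[symmetric]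
    unfolding run_Seq[of E C list_cycle]
  proof (rule run_mono[OF run_list_cycle[OF m1(1-4)]])
    let ?S = "{''w'', ''f'', ''j'', ''plus_w'', ''plus_f'', ''minus_w'', ''minus_f''}"
    fix t m2
    assume "t \<le> 100 * n + 100 \<and> same_except ?S m1 m2 \<and>
     (\<forall>i' j. m2 ''plus_w'' i' j = (if i' = N \<and> j < n then m1 ''st'' (p + j) 0 else m1 ''plus_w'' i' j)) \<and>
     (\<forall>i' j. m2 ''plus_f'' i' j = (if i' = N \<and> j < n then snd (pointed m1 (m1 ''st'' (p + j) 0)) else m1 ''plus_f'' i' j)) \<and>
     (\<forall>i' j. m2 ''minus_w'' i' j = (if i' = N \<and> j < n then m1 ''st'' (p + j + 1) 0 else m1 ''minus_w'' i' j)) \<and>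
     (\<forall>i' j. m2 ''minus_f'' i' j = (if i' = N \<and> j < n then snd (pointed m1 (m1 ''st'' (p + j) 0)) else m1 ''minus_f'' i' j))"
    then have t: "t \<le> 100 * n + 100" and s2: "same_except ?S m1 m2"
      and r2: "\<And>i' j. m2 ''plus_w'' i' j = (if i' = N \<and> j < n then st (p + j) else m ''plus_w'' i' j)"
        "\<And>i' j. m2 ''plus_f'' i' j = (if i' = N \<and> j < n then snd (?A j) else m ''plus_f'' i' j)"
        "\<And>i' j. m2 ''minus_w'' i' j = (if i' = N \<and> j < n then st (p + j + 1) else m ''minus_w'' i' j)"
        "\<And>i' j. m2 ''minus_f'' i' j = (if i' = N \<and> j < n then snd (?A j) else m ''minus_f'' i' j)"
      unfolding st1 st_def by (simp_all add: m1_def store_apply)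
    define m3 where "m3 = store (store m2 ''plus_len'' N 0 n) ''minus_len'' N 0 n"
    have e2: "m2 ''i'' 0 0 = N" "m2 ''len'' 0 0 = n" using m1 same_exceptD[OF s2] by simp_all
    have s3: "same_except cycle_names m m3" unfolding m3_def
      by (intro same_except_store same_except_trans[OF m1(5) s2]) simp_all
    have e3: "m3 ''ptr'' = m ''ptr''" "m3 ''X'' = m ''X''" "m3 ''dead'' = m ''dead''" "m3 ''st'' = m ''st''" "m3 ''s'' = m ''s''"
      "m3 ''rot_count'' = m ''rot_count''" "m3 ''p'' = m ''p''" "m3 ''i'' 0 0 = N"
      using same_exceptD[OF s2] e2 unfolding m3_def by (simp_all add: store_apply m1_def)
    have in3: "inputs m3" using m1(1) same_exceptD[OF s2] unfolding inputs_def m3_def by (simp add: store_apply)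
    have len3: "m3 ''plus_len'' N 0 = n" "m3 ''minus_len'' N 0 = n"
      "\<And>i. i \<noteq> N \<Longrightarrow> m3 ''plus_len'' i 0 = m ''plus_len'' i 0 \<and> m3 ''minus_len'' i 0 = m ''minus_len'' i 0"
      using same_exceptD[OF s2] unfolding m3_def by (simp_all add: store_apply m1_def)
    have r3: "m3 ''plus_w'' = m2 ''plus_w''" "m3 ''plus_f'' = m2 ''plus_f''" "m3 ''minus_w'' = m2 ''minus_w''" "m3 ''minus_f'' = m2 ''minus_f''"
      unfolding m3_def by (simp_all add: store_apply)
    have pl: "plus_list m3 N = map ?A [0..<n]"
      unfolding plus_list_def len3 r3 r2 by (simp add: pointed_def)
    have ml: "minus_list m3 N = map ?B [0..<n]"
      unfolding minus_list_def len3 r3 r2 by simp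
    have zip: "zip (plus_list m3 N) (minus_list m3 N) = ?ts" unfolding pl ml by (simp add: zip_map_map zip_same_conv_map)
    have rec3: "recorded m3 N X" unfolding recorded_def zip len3 using tc by simp
    have out: "output_rotation m3 N = ?L" unfolding output_rotation_def pl ml by (simp add: atLeast0LessThan)
    have M3: "matched X m3" using M in3 unfolding matched_def e3 by simp
    have pt: "m3 ''ptr'' (fst a) 0 < deg (fst a) \<and> a = pointed m3 (fst a)" if "a \<in> set (plus_list m3 N)" for a
      using that links np(2) unfolding pl link_def pointed_def e3 by auto
    have av2: "aval (Var ''i'') m2 = N" "aval (Var ''len'') m2 = n" using e2 by simp_all
    have av3: "aval (Var ''i'') (store m2 ''plus_len'' N 0 n) = N" "aval (Var ''len'') (store m2 ''plus_len'' N 0 n) = n"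
      using e2 by (simp_all add: store_apply)
    show "run E C (Seq (Write ''plus_len'' (Var ''i'') (Const 0) (Var ''len''))
     (Seq (Write ''minus_len'' (Var ''i'') (Const 0) (Var ''len''))
     (Seq apply_listed
     (Seq (Assign ''rot_count'' (Plus (Var ''rot_count'') (Const 1)))
          (Assign ''s'' (Var ''p'')))))) m2
      (\<lambda>t' m'. acost (Const 0) + acost (Const 0) + acost (Minus (Var ''s'') (Var ''p'')) + 1 +
         (acost (Const 0) + acost (Const 0) + acost (Var ''rot_count'') + 1 + (t + t')) \<le> 300 * k + 400 \<and>
         same_except cycle_names m m' \<and> (\<exists>X'. searching X' m') \<and> work_left m' < work_left m)"
      unfolding run_Seq[of E C "Write _ _ _ _"] run_Write av2 unfolding aval.simps(1) av3 m3_def[symmetric]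
      unfolding run_Seq[of E C apply_listed]
    proof (rule run_mono[OF run_apply_listed[OF M3 e3(8) _ _ recordedD(2)[OF rec3] pt]])
      show "output_rotation m3 N \<in> rotations_at X" using L out by simp
      show "m3 ''minus_len'' N 0 = m3 ''plus_len'' N 0" using len3 by simp
    next
      fix t' m4
      assume "t' \<le> 100 * m3 ''plus_len'' N 0 + 100 \<and> same_except {''X'', ''ptr'', ''j''} m3 m4 \<and>
        matched (apply_rotation (output_rotation m3 N) X) m4 \<and>
        (\<Sum>w<k. m4 ''ptr'' w 0) = (\<Sum>w<k. m3 ''ptr'' w 0) + m3 ''plus_len'' N 0 \<and>
        (\<forall>w. w \<notin> fst ` set (plus_list m3 N) \<longrightarrow> m4 ''ptr'' w 0 = m3 ''ptr'' w 0)"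
      then have t': "t' \<le> 100 * n + 100" and s4: "same_except {''X'', ''ptr'', ''j''} m3 m4"
        and M4: "matched (apply_rotation ?L X) m4" and sum4: "(\<Sum>w<k. m4 ''ptr'' w 0) = (\<Sum>w<k. m ''ptr'' w 0) + n"
        and ptr4: "\<And>w. w \<notin> fst ` fst ?L \<Longrightarrow> m4 ''ptr'' w 0 = m ''ptr'' w 0"
        unfolding out len3 e3 pl by (simp_all add: atLeast0LessThan)
      let ?X = "apply_rotation ?L X"
      define m5 where "m5 = store (store m4 ''rot_count'' 0 0 (N + 1)) ''s'' 0 0 p"
      have e4: "m4 ''rot_count'' 0 0 = N" "m4 ''p'' 0 0 = p"
        using same_exceptD[OF s4] e3 p unfolding N_def by simp_all
      have s5: "same_except cycle_names m m5" unfolding m5_def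
        by (intro same_except_store same_except_trans[OF s3 s4]) simp_all
      have e5: "m5 ''ptr'' = m4 ''ptr''" "m5 ''X'' = m4 ''X''" "m5 ''dead'' = m ''dead''" "m5 ''st'' = m ''st''" "m5 ''s'' 0 0 = p"
        "m5 ''rot_count'' 0 0 = Suc N" "m5 ''plus_len'' = m3 ''plus_len''" "m5 ''minus_len'' = m3 ''minus_len''"
        "m5 ''plus_w'' = m2 ''plus_w''" "m5 ''plus_f'' = m2 ''plus_f''" "m5 ''minus_w'' = m2 ''minus_w''" "m5 ''minus_f'' = m2 ''minus_f''"
        using same_exceptD[OF s4] e3 r3 unfolding m5_def by (simp_all add: store_apply)
      have M5: "matched ?X m5" using M4 unfolding matched_def inputs_def m5_def by (simp add: store_apply)
      have rows: "output_rotation m5 i = output_rotation m i" "recorded m5 i Y = recorded m i Y" if "i \<noteq> N" for i Y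
        by (rule row_cong; simp add: e5 r2 that len3)+
      have rowN: "output_rotation m5 N = ?L" "recorded m5 N X"
        using out rec3 row_cong[where m' = m5 and m = m3 and i = N] by (simp_all add: e5 r3)
      have found: "found m5 = found m @ [?L]"
      proof -
        have "map (output_rotation m5) [0..<N] = map (output_rotation m) [0..<N]" using rows by simp
        then show ?thesis unfolding found_def e5(6) N_def[symmetric] using rowN(1) by simp
      qed
      have lenf: "length (found m) = N" unfolding found_def N_def by simp
      note ex = S(1)[unfolded explored_def N_def[symmetric]]
      have "explored ?X m5" unfolding explored_def
      proof (intro conjI allI impI)
        show "matched ?X m5" by (rule M5)
        show "feasible X_min (found m5)" "?X = result X_min (found m5)"
          unfolding found using ex L by (auto simp: feasible_append result_append)
        show "recorded m5 i (result X_min (take i (found m5)))" if "i < m5 ''rot_count'' 0 0" for i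
        proof (cases "i = N")
          case True
          then show ?thesis using rowN(2) ex unfolding found by (simp add: lenf)
        next
          case False
          then show ?thesis using that rows(2)[OF False] ex unfolding found e5(6) by (simp add: lenf)
        qed
        show "stuck ?X w" if "w < k" "m5 ''dead'' w 0 \<noteq> 0" for w
        proof (rule stuck_apply[OF _ L])
          show "stuck X w" using that ex unfolding e5 by blast
        qed
        have "(\<Sum>i<Suc N. m5 ''plus_len'' i 0) = (\<Sum>i<N. m ''plus_len'' i 0) + n"
          unfolding e5 using len3 by simp
        then show "(\<Sum>i<m5 ''rot_count'' 0 0. m5 ''plus_len'' i 0) \<le> (\<Sum>w<k. m5 ''ptr'' w 0)"
          unfolding e5(6) e5(1) sum4 using ex by simp
      qed
      moreover have "path_ok ?X m5"
      proof -
        have "link ?X m5 (st i) (st (Suc i))" if i: "Suc i < p" for i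
        proof -
          have off: "st q \<notin> fst ` fst ?L" if "q < p" for q
          proof
            assume "st q \<in> fst ` fst ?L"
            then obtain j where j: "j < n" "st q = st (p + j)" by (auto simp: pointed_def)
            then have "q = p + j" using inj that np(2) by (auto dest!: inj_onD)
            then show False using that by simp
          qed
          have ptr: "m5 ''ptr'' (st i) 0 = m ''ptr'' (st i) 0" unfolding e5 using ptr4 off i by simp
          have "link X m (st i) (st (Suc i))" using links i np by simp
          then have t: "m ''ptr'' (st i) 0 < deg (st i)" "tandem X (pointed m (st i)) (st (Suc i), snd (pointed m (st i)))"
            unfolding link_def by auto
          have "(st (Suc i), snd (pointed m (st i))) \<notin> snd ?L"
          proof
            assume "(st (Suc i), snd (pointed m (st i))) \<in> snd ?L"
            from imageI[OF this, of fst] have "st (Suc i) \<in> fst ` snd ?L" by (simp only: fst_conv)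
            then show False using off[OF i] unfolding rotationD(8)[OF X L] by (rule notE[rotated])
          qed
          then have "(st (Suc i), snd (pointed m (st i))) \<in> ?X"
            using tandemD(4)[OF X t(2)] unfolding apply_rotation_def by blast
          then have "tandem ?X (pointed m (st i)) (st (Suc i), snd (pointed m (st i)))"
            using tandem_persists[OF X apply_rotation_stable[OF X L] t(2)] by blast
          then show ?thesis using t(1) ptr unfolding link_def pointed_def by simp
        qed
        moreover have "inj_on st {..<p}" using inj np by (auto intro: inj_on_subset)
        ultimately show ?thesis unfolding path_ok_def e5(3-5) using stk np unfolding st_def by auto
      qed
      moreover have "work_left m5 < work_left m"
      proof -
        have "alive m5 = alive m" unfolding alive_def e5 ..
        moreover have "(\<Sum>w<k. m ''ptr'' w 0) + n \<le> card E" using sum_ptr_le[OF M5] sum4 e5 by simp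
        moreover have "s \<le> card (alive m)" using path_alive(2)[OF S(2)] unfolding s_def .
        moreover have "m ''s'' 0 0 = s" unfolding s_def ..
        ultimately show ?thesis unfolding work_left_def e5(1) e5(5) sum4 using np by simp
      qed
      moreover have "n \<le> k" using np sk by simp
      moreover have av4: "aval (Plus (Var ''rot_count'') (Const 1)) m4 = N + 1"
        "aval (Var ''p'') (store m4 ''rot_count'' 0 0 (N + 1)) = p" using e4 by (simp_all add: store_apply)
      ultimately show "run E C (Seq (Assign ''rot_count'' (Plus (Var ''rot_count'') (Const 1))) (Assign ''s'' (Var ''p''))) m4
        (\<lambda>t'' m'. acost (Const 0) + acost (Const 0) + acost (Minus (Var ''s'') (Var ''p'')) + 1 +
         (acost (Const 0) + acost (Const 0) + acost (Var ''rot_count'') + 1 + (t +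
          (acost (Var ''i'') + acost (Const 0) + acost (Var ''len'') + 1 +
          (acost (Var ''i'') + acost (Const 0) + acost (Var ''len'') + 1 + (t' + t''))))) \<le> 300 * k + 400 \<and>
         same_except cycle_names m m' \<and> (\<exists>X'. searching X' m') \<and> work_left m' < work_left m)"
        unfolding run_Seq run_Write av4 unfolding aval.simps(1) av4 m5_def[symmetric]
        using s5 t t' unfolding searching_def by auto
    qed
  qed
qed


abbreviation path_names :: "string set" where
  "path_names \<equiv> {''go'', ''A'', ''b'', ''v'', ''p'', ''st'', ''dead''} \<union> cycle_names"

lemma run_extend_path:
  assumes S: "explored X m" "path_ok X m" and s: "0 < m ''s'' 0 0" and b: "m ''b'' 0 0 = b" "b < k" "m ''dead'' b 0 = 0"
    and last: "link X m (m ''st'' (m ''s'' 0 0 - 1) 0) b"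
  shows "run E C extend_path m (\<lambda>t m'. t \<le> 500 * k + 600 \<and> same_except path_names m m' \<and>
     (\<exists>X'. searching X' m') \<and> work_left m' < work_left m)"
proof -
  let ?s = "m ''s'' 0 0"
  have sk: "?s \<le> k" using path_alive(2,3)[OF S(2)] by simp
  have srch: "run E C (search ''p'' (Var ''s'') (Equal (Arr ''st'' (Var ''v'')) (Var ''b''))) m
     (\<lambda>t m'. same_except {''p'', ''v''} m m' \<and> t \<le> 60 * ?s + 60 \<and>
       (if \<exists>i<?s. m ''st'' i 0 = b then m' ''p'' 0 0 < ?s \<and> m ''st'' (m' ''p'' 0 0) 0 = b else m' ''p'' 0 0 = ?s))"
  proof (rule run_mono[OF run_search[where N = ?s and P = "\<lambda>i. m ''st'' i 0 = b"]])
    fix m' i assume "same_except {''p'', ''v''} m m'" "m' ''v'' 0 0 = i"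
    then show "bval (Equal (Arr ''st'' (Var ''v'')) (Var ''b'')) m' = (m ''st'' i 0 = b)"
      using b by (simp add: same_except_def)
  next
    fix m' assume "same_except {''p'', ''v''} m m'"
    then show "aval (Var ''s'') m' = ?s" by (simp add: same_except_def)
  qed (simp_all add: algebra_simps)
  show ?thesis unfolding extend_path_def run_Seq[of E C "search _ _ _"]
  proof (rule run_mono[OF srch])
    fix t m1
    assume a: "same_except {''p'', ''v''} m m1 \<and> t \<le> 60 * ?s + 60 \<and>
       (if \<exists>i<?s. m ''st'' i 0 = b then m1 ''p'' 0 0 < ?s \<and> m ''st'' (m1 ''p'' 0 0) 0 = b else m1 ''p'' 0 0 = ?s)"
    then have s1: "same_except {''p'', ''v''} m m1" and t: "t \<le> 60 * ?s + 60" by blast+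
    define m2 where "m2 = store m1 ''st'' ?s 0 b"
    have s2: "same_except {''p'', ''v'', ''st''} m m2" unfolding m2_def
      by (rule same_except_store, rule same_except_mono[OF s1]) auto
    have e2: "m2 ''s'' = m ''s''" "m2 ''dead'' = m ''dead''" "m2 ''ptr'' = m ''ptr''" "m2 ''p'' = m1 ''p''"
      "m2 ''st'' i 0 = (if i = ?s then b else m ''st'' i 0)" for i
      using same_exceptD[OF s1] unfolding m2_def by (simp_all add: store_apply)
    have ex2: "explored X m2" using explored_cong[OF s2] S(1) by simp
    have st2: "inj_on (\<lambda>i. m2 ''st'' i 0) {..<?s} = inj_on (\<lambda>i. m ''st'' i 0) {..<?s}"
      by (rule inj_on_cong) (simp add: e2)
    have l2: "link X m2 = link X m" by (intro ext) (simp add: link_def pointed_def e2)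
    have pa2: "path_ok X m2" using S(2) unfolding path_ok_def e2(1,2) st2 l2 by (simp add: e2)
    have lastl: "link X m2 (m2 ''st'' (?s - 1) 0) b"
    proof -
      have "?s - 1 \<noteq> ?s" using s by simp
      then show ?thesis unfolding l2 e2(5) using last by (simp only: if_False)
    qed
    have wl2: "work_left m2 = work_left m" unfolding work_left_def alive_def e2(1-3) ..
    have av: "aval (Var ''s'') m1 = ?s" "aval (Var ''b'') m1 = b" using same_exceptD[OF s1] b by simp_all
    show "run E C (Seq (Write ''st'' (Var ''s'') (Const 0) (Var ''b''))
          close_or_push) m1
       (\<lambda>t' m'. t + t' \<le> 500 * k + 600 \<and> same_except path_names m m' \<and> (\<exists>X'. searching X' m') \<and> work_left m' < work_left m)"
      unfolding run_Seq run_Write av unfolding aval.simps(1) m2_def[symmetric]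
    proof (cases "m1 ''p'' 0 0 < ?s")
      case True
      then have pb: "m ''st'' (m1 ''p'' 0 0) 0 = b" using a by (auto split: if_splits)
      have bv: "bval (Less (Var ''p'') (Var ''s'')) m2" using True e2 by simp
      show "run E C close_or_push m2
        (\<lambda>t' m'. t + (acost (Var ''s'') + acost (Const 0) + acost (Var ''b'') + 1 + t') \<le> 500 * k + 600 \<and>
           same_except path_names m m' \<and> (\<exists>X'. searching X' m') \<and> work_left m' < work_left m)"
        unfolding run_If if_P[OF bv]
      proof (rule run_mono[OF run_extract_cycle[OF ex2 pa2 refl]])
        show "m2 ''p'' 0 0 < m2 ''s'' 0 0" using True e2 by simp
        show "link X m2 (m2 ''st'' (m2 ''s'' 0 0 - 1) 0) (m2 ''st'' (m2 ''s'' 0 0) 0)" using lastl e2 by simp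
        show "m2 ''st'' (m2 ''s'' 0 0) 0 = m2 ''st'' (m2 ''p'' 0 0) 0" using pb True e2 by simp
      next
        fix t' m3
        assume "t' \<le> 300 * k + 400 \<and> same_except cycle_names m2 m3 \<and> (\<exists>X'. searching X' m3) \<and> work_left m3 < work_left m2"
        then have t': "t' \<le> 300 * k + 400" and s3: "same_except cycle_names m2 m3" and rest: "\<exists>X'. searching X' m3" "work_left m3 < work_left m"
          using wl2 by simp_all
        have "same_except path_names m m3" by (rule same_except_trans[OF s2 s3]) simp
        then show "t + (acost (Var ''s'') + acost (Const 0) + acost (Var ''b'') + 1 + (bcost (Less (Var ''p'') (Var ''s'')) + t' + 1)) \<le> 500 * k + 600 \<and>
          same_except path_names m m3 \<and> (\<exists>X'. searching X' m3) \<and> work_left m3 < work_left m"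
          using t t' rest sk by simp
      qed
    next
      case False
      then have nb: "\<not> (\<exists>i<?s. m ''st'' i 0 = b)" using a by (auto split: if_splits)
      define m3 where "m3 = store m2 ''s'' 0 0 (Suc ?s)"
      have s3: "same_except path_names m m3" unfolding m3_def
        by (rule same_except_store, rule same_except_mono[OF s2]) auto
      have e3: "m3 ''s'' 0 0 = Suc ?s" "m3 ''st'' = m2 ''st''" "m3 ''dead'' = m ''dead''" "m3 ''ptr'' = m ''ptr''"
        unfolding m3_def by (simp_all add: store_apply e2)
      have "same_except {''s''} m2 m3" unfolding m3_def by (intro same_except_store same_except_refl) simp
      then have "explored X m3" using explored_cong ex2 by simp
      moreover have pa3: "path_ok X m3"
      proof -
        have "inj_on (\<lambda>i. m2 ''st'' i 0) {..<Suc ?s}"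
          unfolding lessThan_Suc inj_on_insert using S(2) nb st2 unfolding path_ok_def by (auto simp: e2)
        moreover have "link X m3 = link X m" by (intro ext) (simp add: link_def pointed_def e3)
        moreover have "link X m (m2 ''st'' i 0) (m2 ''st'' (Suc i) 0)" if "Suc i < Suc ?s" for i
        proof (cases "Suc i = ?s")
          case True
          then have "i = ?s - 1" by simp
          then show ?thesis using last s True by (simp add: e2)
        next
          case False
          then show ?thesis using that S(2) unfolding path_ok_def by (simp add: e2)
        qed
        ultimately show ?thesis using S(2) b unfolding path_ok_def e3 by (auto simp: e2 less_Suc_eq)
      qed
      moreover have "work_left m3 < work_left m"
      proof -
        have al: "alive m3 = alive m" unfolding alive_def e3 ..
        then show ?thesis using path_alive(2)[OF pa3] unfolding work_left_def e3 al by simp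
      qed
      moreover have "aval (Plus (Var ''s'') (Const 1)) m2 = Suc ?s" using e2 by simp
      ultimately show "run E C close_or_push m2
        (\<lambda>t' m'. t + (acost (Var ''s'') + acost (Const 0) + acost (Var ''b'') + 1 + t') \<le> 500 * k + 600 \<and>
           same_except path_names m m' \<and> (\<exists>X'. searching X' m') \<and> work_left m' < work_left m)"
        unfolding run_If run_Write using False e2 s3 t sk
        by (auto simp: m3_def[symmetric] searching_def)
    qed
  qed
qed

lemma run_path_round:
  assumes S: "searching X m"
  shows "run E C path_round m (\<lambda>t m'. t \<le> 1000 * (card E + k + 3) \<and> same_except path_names m m' \<and>
     (\<exists>X'. searching X' m') \<and>
     (if m ''s'' 0 0 = 0 \<and> alive m = {} then m' ''s'' 0 0 = 0 \<and> alive m' = {} else work_left m' < work_left m))"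
proof (cases "m ''s'' 0 0 = 0")
  case True
  then have bv: "bval (Equal (Var ''s'') (Const 0)) m" by simp
  show ?thesis unfolding path_round_def run_If[of E C "Equal (Var ''s'') _"] if_P[OF bv]
  proof (rule run_mono[OF run_start_path[OF S True]])
    fix t m'
    assume a: "t \<le> 100 * k + 100 \<and> same_except {''w'', ''v'', ''st'', ''s''} m m' \<and>
     searching X m' \<and> (if alive m = {} then alive m' = {} \<and> m' ''s'' 0 0 = 0 else work_left m' < work_left m)"
    then have "same_except {''w'', ''v'', ''st'', ''s''} m m'" by blast
    then have "same_except path_names m m'" by (rule same_except_mono) auto
    moreover have "t \<le> 100 * k + 100" "searching X m'"
      "if alive m = {} then alive m' = {} \<and> m' ''s'' 0 0 = 0 else work_left m' < work_left m" using a by blast+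
    ultimately show "bcost (Equal (Var ''s'') (Const 0)) + t + 1 \<le> 1000 * (card E + k + 3) \<and> same_except path_names m m' \<and>
     (\<exists>X'. searching X' m') \<and>
     (if m ''s'' 0 0 = 0 \<and> alive m = {} then m' ''s'' 0 0 = 0 \<and> alive m' = {} else work_left m' < work_left m)"
      using True by (cases "alive m = {}") auto
  qed
next
  case s: False
  let ?s = "m ''s'' 0 0"
  have ex: "explored X m" and pa: "path_ok X m" using S unfolding searching_def by auto
  then have M: "matched X m" unfolding explored_def by auto
  then have inp: "inputs m" and Xm: "m ''X'' = ind X" and X: "stable X" and ok: "ptr_ok X (\<lambda>w. m ''ptr'' w 0)"
    unfolding matched_def by auto
  define w where "w = m ''st'' (?s - 1) 0"
  have w: "w < k" using pa s unfolding path_ok_def w_def by auto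
  define m1 where "m1 = store m ''w'' 0 0 w"
  have e1: "m1 ''w'' 0 0 = w" "m1 ''ptr'' = m ''ptr''" "m1 ''X'' = ind X" "inputs m1" "same_except {''w''} m m1"
    using inp Xm unfolding m1_def by (simp_all add: store_apply inputs_def same_except_def)
  have nbv: "\<not> bval (Equal (Var ''s'') (Const 0)) m" using s by simp
  have av: "aval (Arr ''st'' (Minus (Var ''s'') (Const 1))) m = w" unfolding w_def by simp
  show ?thesis unfolding path_round_def run_If[of E C "Equal (Var ''s'') _"] if_not_P[OF nbv] run_Seq run_Write av
    unfolding aval.simps(1) m1_def[symmetric]
  proof (rule run_mono[OF run_probe[OF e1(4,3) stableD(1)[OF X] e1(1) w]])
    show "m1 ''ptr'' w 0 \<le> deg w" using ok w e1 unfolding ptr_ok_def by simp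
    show "\<And>i. m1 ''ptr'' w 0 \<le> i \<Longrightarrow> i < deg w \<Longrightarrow> (w, nb w i) \<notin> X" using ptr_ok_new[OF ok w] e1 by simp
  next
    fix t m2
    assume "\<exists>n. probed X w m1 n m2 \<and> same_except {''go'', ''f'', ''A'', ''ptr'', ''X'', ''b'', ''v''} m1 m2 \<and>
      m2 ''X'' = ind X \<and> t \<le> 100 * deg w + 100 * k + 300"
    then obtain n where n: "probed X w m1 n m2" and s2: "same_except {''go'', ''f'', ''A'', ''ptr'', ''X'', ''b'', ''v''} m1 m2"
      and X2: "m2 ''X'' = ind X" and t: "t \<le> 100 * deg w + 100 * k + 300" by auto
    have ok1: "ptr_ok X (\<lambda>w. m1 ''ptr'' w 0)" using ok e1 by simp
    note pt = probed_tandem[OF X ok1 w n]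
    have sm: "same_except path_names m m2" by (rule same_except_trans[OF e1(5) s2]) simp
    have e2: "m2 ''W_size'' = m ''W_size''" "m2 ''deg'' = m ''deg''" "m2 ''pref'' = m ''pref''" "m2 ''quota'' = m ''quota''"
      "m2 ''dead'' = m ''dead''" "m2 ''rot_count'' = m ''rot_count''" "m2 ''st'' = m ''st''" "m2 ''s'' = m ''s''"
      "m2 ''plus_w'' = m ''plus_w''" "m2 ''plus_f'' = m ''plus_f''" "m2 ''minus_w'' = m ''minus_w''"
      "m2 ''minus_f'' = m ''minus_f''" "m2 ''plus_len'' = m ''plus_len''" "m2 ''minus_len'' = m ''minus_len''"
      using same_exceptD[OF s2] unfolding m1_def by (simp_all add: store_apply)
    have ptr2: "m2 ''ptr'' = (m ''ptr'')(w := (m ''ptr'' w)(0 := n))" "m ''ptr'' w 0 \<le> n"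
      using n e1 unfolding probed_def by auto
    have le: "(\<Sum>w<k. m ''ptr'' w 0) \<le> (\<Sum>w<k. m2 ''ptr'' w 0)"
      using ptr2 by (intro sum_mono) auto
    have M2: "matched X m2" using inp X X2 pt(1) unfolding matched_def inputs_def e2(1-4) by auto
    have "output_rotation m2 = output_rotation m" "recorded m2 = recorded m"
      by (intro ext row_cong; simp only: e2)+
    then have ex2: "explored X m2" using ex M2 le unfolding explored_def found_def e2 by auto
    have pa2: "path_ok X m2"
    proof (rule path_ok_cong[OF e2(7,8,5) _ pa])
      fix i assume i: "Suc i < ?s"
      have "m ''st'' i 0 \<noteq> w"
      proof
        assume "m ''st'' i 0 = w"
        then have "i = ?s - 1" using pa i unfolding path_ok_def w_def by (auto dest!: inj_onD)
        then show False using i by simp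
      qed
      then show "m2 ''ptr'' (m ''st'' i 0) 0 = m ''ptr'' (m ''st'' i 0) 0" using ptr2 by simp
    qed
    have wl2: "work_left m2 \<le> work_left m"
    proof -
      have "card E - (\<Sum>w<k. m2 ''ptr'' w 0) \<le> card E - (\<Sum>w<k. m ''ptr'' w 0)" using le by simp
      then show ?thesis unfolding work_left_def alive_def e2 by (intro diff_le_mono add_mono mult_le_mono) auto
    qed
    have T: "t \<le> 100 * card E + 100 * k + 300" using t deg_le[OF w] by simp
    have W: "m2 ''W_size'' 0 0 = k" using M2 input_size unfolding matched_def inputs_def by simp
    have rest: "run E C (If end_alive
             extend_path kill_path) m2 (\<lambda>t' m'. t' \<le> 500 * k + 650 \<and> same_except path_names m2 m' \<and>
               (\<exists>X'. searching X' m') \<and> work_left m' < work_left m2)"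
    proof (cases "m2 ''b'' 0 0 < k \<and> m2 ''dead'' (m2 ''b'' 0 0) 0 = 0")
      case True
      then have bv: "bval end_alive m2"
        using W by simp
      have "link X m2 (m2 ''st'' (m2 ''s'' 0 0 - 1) 0) (m2 ''b'' 0 0)"
        using pt(2) True unfolding e2 w_def by simp
      then show ?thesis unfolding run_If if_P[OF bv]
        by (intro run_mono[OF run_extend_path[OF ex2 pa2 _ refl]]) (use True s e2 in auto)
    next
      case False
      then have bv: "\<not> bval end_alive m2"
        using W by simp
      have "stuck X w"
      proof (cases "m2 ''b'' 0 0 < k")
        case b: True
        then have "stuck X (m2 ''b'' 0 0)" using False ex2 unfolding explored_def by auto
        moreover have "tandem X (pointed m2 w) (m2 ''b'' 0 0, snd (pointed m2 w))" using pt(2)[OF b] unfolding link_def by auto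
        ultimately show ?thesis using stuck_backwards[OF X] unfolding pointed_def by fastforce
      next
        case b: False
        then show ?thesis using stuck_without_tandem[OF X] pt(3) by blast
      qed
      then have st: "stuck X (m2 ''st'' (m2 ''s'' 0 0 - 1) 0)" unfolding e2 w_def .
      have S2: "searching X m2" using ex2 pa2 unfolding searching_def by auto
      show ?thesis unfolding run_If if_not_P[OF bv]
      proof (rule run_mono[OF run_kill_path[OF S2 _ st]])
        show "0 < m2 ''s'' 0 0" using s e2 by simp
        fix t' m' assume a: "t' \<le> 100 * k + 100 \<and> same_except {''v'', ''dead'', ''s''} m2 m' \<and> searching X m' \<and> work_left m' < work_left m2"
        then have "same_except {''v'', ''dead'', ''s''} m2 m'" by blast
        then have "same_except path_names m2 m'" by (rule same_except_mono) auto
        then show "bcost end_alive + t' + 1 \<le> 500 * k + 650 \<and>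
          same_except path_names m2 m' \<and> (\<exists>X'. searching X' m') \<and> work_left m' < work_left m2"
          using a by auto
      qed
    qed
    show "run E C (If end_alive
             extend_path kill_path) m2
      (\<lambda>t' m'. bcost (Equal (Var ''s'') (Const 0)) +
          (acost (Const 0) + acost (Const 0) + acost (Arr ''st'' (Minus (Var ''s'') (Const 1))) + 1 + (t + t')) + 1
          \<le> 1000 * (card E + k + 3) \<and> same_except path_names m m' \<and> (\<exists>X'. searching X' m') \<and>
       (if ?s = 0 \<and> alive m = {} then m' ''s'' 0 0 = 0 \<and> alive m' = {} else work_left m' < work_left m))"
    proof (rule run_mono[OF rest])
      fix t' m3 assume a: "t' \<le> 500 * k + 650 \<and> same_except path_names m2 m3 \<and> (\<exists>X'. searching X' m3) \<and> work_left m3 < work_left m2"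
      then have "same_except path_names m2 m3" by blast
      then have "same_except path_names m m3" by (rule same_except_trans[OF sm]) (intro Un_least order_refl)
      then show "bcost (Equal (Var ''s'') (Const 0)) +
          (acost (Const 0) + acost (Const 0) + acost (Arr ''st'' (Minus (Var ''s'') (Const 1))) + 1 + (t + t')) + 1
          \<le> 1000 * (card E + k + 3) \<and> same_except path_names m m3 \<and> (\<exists>X'. searching X' m3) \<and>
       (if ?s = 0 \<and> alive m = {} then m3 ''s'' 0 0 = 0 \<and> alive m3 = {} else work_left m3 < work_left m)"
        using a wl2 T s by simp
    qed
  qed
qed

lemma run_find_route:
  assumes S: "searching X m" and edges: "m ''edges'' 0 0 = card E" and start: "m ''s'' 0 0 = 0"
  shows "run E C find_route m (\<lambda>t m'. t \<le> (2 * card E + 2 * k + 1) * (1000 * (card E + k + 3) + 40) + 40 \<and>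
     same_except (insert ''t'' path_names) m m' \<and> (\<exists>X. explored X m' \<and> rotations_at X = {}))"
proof -
  let ?N = "2 * card E + 2 * k + 1"
  let ?n = "Plus (Plus (Var ''edges'') (Var ''edges'')) (Plus (Var ''W_size'') (Plus (Var ''W_size'') (Const 1)))"
  let ?done = "\<lambda>m'. m' ''s'' 0 0 = 0 \<and> alive m' = {}"
  let ?J = "\<lambda>i m'. same_except (insert ''t'' path_names) m m' \<and> m' ''t'' 0 0 = i \<and> (\<exists>X'. searching X' m') \<and>
    (?done m' \<or> work_left m' + i \<le> 2 * card E + 2 * k)"
  have upd: "searching X' (store m' ''t'' 0 0 i) = searching X' m'" "work_left (store m' ''t'' 0 0 i) = work_left m'"
    "alive (store m' ''t'' 0 0 i) = alive m'" "store m' ''t'' 0 0 i ''s'' = m' ''s''" for X' m' i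
  proof -
    have sm: "same_except {''t''} m' (store m' ''t'' 0 0 i)" by (simp add: same_except_def store_apply)
    have e: "store m' ''t'' 0 0 i ''st'' = m' ''st''" "store m' ''t'' 0 0 i ''s'' = m' ''s''"
      "store m' ''t'' 0 0 i ''dead'' = m' ''dead''" "store m' ''t'' 0 0 i ''ptr'' = m' ''ptr''"
      by (simp_all add: store_apply)
    have "path_ok X' (store m' ''t'' 0 0 i) = path_ok X' m'"
      unfolding path_ok_def link_def pointed_def e ..
    then show "searching X' (store m' ''t'' 0 0 i) = searching X' m'"
      unfolding searching_def using explored_cong[OF sm] by simp
    show "alive (store m' ''t'' 0 0 i) = alive m'" "store m' ''t'' 0 0 i ''s'' = m' ''s''"
      "work_left (store m' ''t'' 0 0 i) = work_left m'"
      unfolding work_left_def alive_def e by auto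
  qed
  show ?thesis unfolding find_route_def
  proof (rule run_For_uniform[where J = ?J and N = ?N and B = "1000 * (card E + k + 3)"])
    have "card (alive m) \<le> k" using path_alive(3) S unfolding searching_def by blast
    then have "work_left m \<le> 2 * card E + 2 * k" unfolding work_left_def by simp
    moreover have "same_except (insert ''t'' path_names) m (store m ''t'' 0 0 0)"
      by (intro same_except_store same_except_refl) simp
    moreover have "store m ''t'' 0 0 0 ''t'' 0 0 = 0" by (simp add: store_apply)
    ultimately show "?J 0 (store m ''t'' 0 0 0)" using S unfolding upd by auto
  next
    fix i m' assume J: "?J i m'"
    then have sm: "same_except (insert ''t'' path_names) m m'" by blast
    have "m' ''edges'' = m ''edges''" by (rule same_exceptD[OF sm]) simp
    moreover obtain X' where "searching X' m'" using J by blast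
    then have "m' ''W_size'' 0 0 = k"
      using input_size unfolding searching_def explored_def matched_def inputs_def by simp
    moreover have "m' ''t'' 0 0 = i" using J by blast
    ultimately show "aval ?n m' = ?N \<and> m' ''t'' 0 0 = i" using edges by simp
  next
    fix i m' assume J: "?J i m'"
    then obtain X' where X': "searching X' m'" by blast
    show "run E C path_round m' (\<lambda>t m'. t \<le> 1000 * (card E + k + 3) \<and> m' ''t'' 0 0 = i \<and> ?J (Suc i) (store m' ''t'' 0 0 (Suc i)))"
    proof (rule run_mono[OF run_path_round[OF X']])
      fix t m''
      assume a: "t \<le> 1000 * (card E + k + 3) \<and> same_except path_names m' m'' \<and> (\<exists>X'. searching X' m'') \<and>
        (if ?done m' then m'' ''s'' 0 0 = 0 \<and> alive m'' = {} else work_left m'' < work_left m')"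
      then have s2: "same_except path_names m' m''" and s1: "same_except (insert ''t'' path_names) m m'" using J by blast+
      have "m'' ''t'' = m' ''t''" by (rule same_exceptD[OF s2]) simp
      moreover have "m' ''t'' 0 0 = i" using J by blast
      ultimately have t: "m'' ''t'' 0 0 = i" by simp
      have "same_except (insert ''t'' path_names) m m''"
        by (rule same_except_trans[OF s1 s2]) (intro Un_least order_refl subset_insertI)
      then have sm: "same_except (insert ''t'' path_names) m (store m'' ''t'' 0 0 (Suc i))" by (rule same_except_store) simp
      have "?done m'' \<or> work_left m'' + Suc i \<le> 2 * card E + 2 * k"
      proof (cases "?done m'")
        case True
        then show ?thesis using a by presburger
      next
        case False
        then have "work_left m'' < work_left m'" using a by presburger
        moreover have "work_left m' + i \<le> 2 * card E + 2 * k" using J False by blast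
        ultimately show ?thesis by linarith
      qed
      moreover have "store m'' ''t'' 0 0 (Suc i) ''t'' 0 0 = Suc i" by (simp add: store_apply)
      moreover have "t \<le> 1000 * (card E + k + 3)" "\<exists>X'. searching X' m''" using a by blast+
      ultimately show "t \<le> 1000 * (card E + k + 3) \<and> m'' ''t'' 0 0 = i \<and> ?J (Suc i) (store m'' ''t'' 0 0 (Suc i))"
        using t sm unfolding upd by blast
    qed
  next
    fix t m' assume J: "?J ?N m'" and t: "t \<le> ?N * (1000 * (card E + k + 3) + acost ?n + 13) + acost ?n + 9"
    then obtain X' where X': "searching X' m'" by blast
    have al: "alive m' = {}" using J by linarith
    have ex: "explored X' m'" using X' unfolding searching_def by auto
    have "stable X'" using ex unfolding explored_def matched_def by auto
    moreover have "stuck X' w" if "w \<in> {..<k}" for w using al ex that unfolding alive_def explored_def by auto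
    ultimately have "rotations_at X' = {}" by (rule no_rotation_if_stuck)
    moreover have "t \<le> ?N * (1000 * (card E + k + 3) + 40) + 40"
    proof -
      have c: "acost ?n + 13 \<le> 40" "acost ?n + 9 \<le> 40" by simp_all
      have "?N * (1000 * (card E + k + 3) + acost ?n + 13) \<le> ?N * (1000 * (card E + k + 3) + 40)"
        by (rule mult_le_mono2) (use c(1) in linarith)
      then show ?thesis using t c(2) by linarith
    qed
    ultimately show "t \<le> ?N * (1000 * (card E + k + 3) + 40) + 40 \<and>
      same_except (insert ''t'' path_names) m m' \<and> (\<exists>X. explored X m' \<and> rotations_at X = {})"
      using J ex by blast
  qed
qed

end

section \<open>Constructing the Hasse diagram\<close>

abbreviation copy_row :: "string \<Rightarrow> string \<Rightarrow> com" where
  "copy_row px qx \<equiv> For ''j'' (Arr ''deg'' (Var ''v''))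
             (Write qx (Var ''v'') (Read ''pref'' (Var ''v'') (Var ''j''))
                (Read px (Var ''v'') (Read ''pref'' (Var ''v'') (Var ''j''))))"

definition copy_state :: "string \<Rightarrow> string \<Rightarrow> string \<Rightarrow> string \<Rightarrow> com" where
  "copy_state px pp qx qp = For ''v'' (Var ''W_size'')
     (Seq (Write qp (Var ''v'') (Const 0) (Arr pp (Var ''v'')))
          (copy_row px qx))"

text \<open>
  The pair listed in row \<open>i\<close> at \<open>j\<close> is a tandem iff its first edge is where the pointer stops and
  its second edge is matched but missing in the answer of the oracle.  This needs only single
  entries of the answer, in contrast to \<open>find_dropped\<close>.
\<close>

abbreviation tandem_seen :: bexp where
  "tandem_seen \<equiv> And (And (Equal (Var ''go'') (Const 0)) (Equal (Var ''f'') (Read ''plus_f'' (Var ''i'') (Var ''j''))))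
                  (And (Equal (Read ''X'' (Read ''minus_w'' (Var ''i'') (Var ''j'')) (Var ''f'')) (Const 1))
                       (Equal (Read ''A'' (Read ''minus_w'' (Var ''i'') (Var ''j'')) (Var ''f'')) (Const 0)))"

abbreviation check_entry :: com where
  "check_entry \<equiv> Seq (Assign ''w'' (Read ''plus_w'' (Var ''i'') (Var ''j'')))
       (Seq advance
         (If tandem_seen
            Skip (Assign ''ok'' (Const 0))))"

definition check_listed :: com where
  "check_listed = Seq (Assign ''ok'' (Const 1))
     (For ''j'' (Arr ''plus_len'' (Var ''i''))
       check_entry)"

definition try_listed :: com where
  "try_listed = Seq check_listed (If (Equal (Var ''ok'') (Const 1)) apply_listed Skip)"

abbreviation try_other :: com where
  "try_other \<equiv> If (Equal (Var ''i'') (Var ''r'')) Skip try_listed"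

abbreviation row_entry :: com where
  "row_entry \<equiv> Seq check_listed (Write ''hasse'' (Var ''r'') (Var ''i'') (Var ''ok''))"

definition successor_row :: com where
  "successor_row =
     Seq (copy_state ''X0'' ''ptr0'' ''X'' ''ptr'')
     (Seq (For ''i'' (Var ''rot_count'') try_other)
     (Seq (Assign ''i'' (Var ''r''))
     (Seq try_listed
          (For ''i'' (Var ''rot_count'') row_entry))))"

definition find_successors :: com where
  "find_successors = For ''r'' (Var ''rot_count'') successor_row"

context market_input
begin

lemma ptr_ok_cong: "(\<And>w. w < k \<Longrightarrow> p w = p' w) \<Longrightarrow> ptr_ok X p = ptr_ok X p'"
proof -
  assume a: "\<And>w. w < k \<Longrightarrow> p w = p' w"
  have "proposed p = proposed p'" unfolding proposed_def using a by (intro Collect_cong) metis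
  then show ?thesis unfolding ptr_ok_def using a by simp
qed

lemma run_copy_state:
  assumes m: "inputs m" and names: "qx \<notin> {''v'', ''j'', ''W_size'', ''deg'', ''pref'', ''quota'', px, pp, qp}"
    "qp \<notin> {''v'', ''j'', ''W_size'', ''deg'', ''pref'', ''quota'', px, pp, qx}"
    "px \<notin> {''v'', ''j''}" "pp \<notin> {''v'', ''j''}"
  shows "run E C (copy_state px pp qx qp) m (\<lambda>t m'. t \<le> 100 * card E + 100 * k + 100 \<and>
     same_except {''v'', ''j'', qx, qp} m m' \<and> (\<forall>w<k. m' qp w 0 = m pp w 0) \<and>
     (\<forall>w f. m' qx w f = (if (w, f) \<in> E then m px w f else m qx w f)))"
proof -
  let ?S = "{''v'', ''j'', qx, qp}"
  let ?R = "\<lambda>D m'. \<forall>w f. m' qx w f = (if (w, f) \<in> D then m px w f else m qx w f)"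
  let ?D = "\<lambda>i. {e \<in> E. fst e < i}"
  let ?I = "\<lambda>i t m'. same_except ?S m m' \<and> m' ''v'' 0 0 = i \<and> (\<forall>w<i. m' qp w 0 = m pp w 0) \<and>
    ?R (?D i) m' \<and> t \<le> 60 * (\<Sum>w<i. deg w) + 60 * i"
  have frame: "m' ''W_size'' 0 0 = k \<and> m' ''deg'' = m ''deg'' \<and> m' ''pref'' = m ''pref'' \<and> m' px = m px \<and> m' pp = m pp \<and>
      m ''deg'' = m0 ''deg'' \<and> m ''pref'' = m0 ''pref''"
    if sm: "same_except ?S m m'" for m'
  proof -
    have "m' ''W_size'' = m ''W_size''" "m' ''deg'' = m ''deg''" "m' ''pref'' = m ''pref''" "m' px = m px" "m' pp = m pp"
      by (rule same_exceptD[OF sm], use names in auto)+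
    then show ?thesis using m input_size unfolding inputs_def by simp
  qed
  show ?thesis unfolding copy_state_def
  proof (rule run_For[where I = ?I and N = k])
    have "same_except ?S m (store m ''v'' 0 0 0)" by (intro same_except_store same_except_refl) simp
    then show "?I 0 0 (store m ''v'' 0 0 0)" using names by (simp add: store_apply)
  next
    fix i t m' assume "?I i t m'"
    then show "aval (Var ''W_size'') m' = k \<and> m' ''v'' 0 0 = i" using frame[of m'] by simp
  next
    fix i t m' assume I: "?I i t m'" and i: "i < k"
    then have sm: "same_except ?S m m'" and v: "m' ''v'' 0 0 = i" and cp: "\<forall>w<i. m' qp w 0 = m pp w 0"
      and R: "?R (?D i) m'" and t: "t \<le> 60 * (\<Sum>w<i. deg w) + 60 * i" by blast+
    note fr = frame[OF sm]
    define m1 where "m1 = store m' qp i 0 (m pp i 0)"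
    have s1: "same_except ?S m m1" unfolding m1_def using sm by (rule same_except_store) simp
    let ?J = "\<lambda>r m''. same_except ?S m m'' \<and> m'' ''v'' 0 0 = i \<and> m'' ''j'' 0 0 = r \<and>
      (\<forall>w<Suc i. m'' qp w 0 = m pp w 0) \<and> ?R (?D i \<union> {(i, nb i j) |j. j < r}) m''"
    have inner: "run E C (copy_row px qx) m1
        (\<lambda>t m''. ?J (deg i) m'' \<and> t \<le> 50 * deg i + 20)"
    proof (rule run_For_uniform[where J = ?J and N = "deg i" and B = 30])
      have "same_except ?S m (store m1 ''j'' 0 0 0)" using s1 by (rule same_except_store) simp
      then show "?J 0 (store m1 ''j'' 0 0 0)"
        using names v cp R unfolding m1_def by (auto simp: store_apply less_Suc_eq)
    next
      fix r m'' assume J: "?J r m''"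
      then show "aval (Arr ''deg'' (Var ''v'')) m'' = deg i \<and> m'' ''j'' 0 0 = r" using frame[of m''] by simp
    next
      fix r m'' assume J: "?J r m''" and r: "r < deg i"
      then have s2: "same_except ?S m m''" and v2: "m'' ''v'' 0 0 = i" and j2: "m'' ''j'' 0 0 = r"
        and cp2: "\<forall>w<Suc i. m'' qp w 0 = m pp w 0" and R2: "?R (?D i \<union> {(i, nb i j) |j. j < r}) m''" by blast+
      note fr2 = frame[OF s2]
      let ?m = "store m'' qx i (nb i r) (m px i (nb i r))"
      have s3: "same_except ?S m (store ?m ''j'' 0 0 (Suc r))" using s2 by (intro same_except_store) simp_all
      have "?R (?D i \<union> {(i, nb i j) |j. j < Suc r}) ?m"
        using R2 by (auto simp: store_apply less_Suc_eq)
      then have "?J (Suc r) (store ?m ''j'' 0 0 (Suc r))"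
        using s3 v2 cp2 names by (auto simp: store_apply)
      then show "run E C (Write qx (Var ''v'') (Read ''pref'' (Var ''v'') (Var ''j''))
                (Read px (Var ''v'') (Read ''pref'' (Var ''v'') (Var ''j'')))) m''
         (\<lambda>t m'. t \<le> 30 \<and> m' ''j'' 0 0 = r \<and> ?J (Suc r) (store m' ''j'' 0 0 (Suc r)))"
        unfolding run_Write using fr2 v2 j2 names by (auto simp: store_apply)
    next
      fix t m'' assume J: "?J (deg i) m''"
        and t: "t \<le> deg i * (30 + acost (Arr ''deg'' (Var ''v'')) + 13) + acost (Arr ''deg'' (Var ''v'')) + 9"
      show "?J (deg i) m'' \<and> t \<le> 50 * deg i + 20"
        using J t by (intro conjI) (blast, blast, blast, blast, blast, simp)
    qed
    have D: "?D i \<union> {(i, nb i j) |j. j < deg i} = ?D (Suc i)"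
    proof -
      have "{(i, nb i j) |j. j < deg i} = EW i" using set_pref[OF i] by auto
      then show ?thesis unfolding EW_def by (auto simp: less_Suc_eq)
    qed
    have av: "aval (Var ''v'') m' = i" "aval (Arr pp (Var ''v'')) m' = m pp i 0" using v fr by simp_all
    show "run E C (Seq (Write qp (Var ''v'') (Const 0) (Arr pp (Var ''v'')))
          (copy_row px qx)) m'
       (\<lambda>t' m'. m' ''v'' 0 0 = i \<and> ?I (Suc i) (t + t' + acost (Var ''W_size'') + 13) (store m' ''v'' 0 0 (Suc i)))"
      unfolding run_Seq run_Write av unfolding aval.simps(1) m1_def[symmetric]
    proof (rule run_mono[OF inner])
      fix t' m'' assume a: "?J (deg i) m'' \<and> t' \<le> 50 * deg i + 20"
      then have "same_except ?S m m''" by blast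
      then have "same_except ?S m (store m'' ''v'' 0 0 (Suc i))" by (rule same_except_store) simp
      then show "m'' ''v'' 0 0 = i \<and> ?I (Suc i) (t + (acost (Var ''v'') + acost (Const 0) + acost (Arr pp (Var ''v'')) + 1 + t') + acost (Var ''W_size'') + 13) (store m'' ''v'' 0 0 (Suc i))"
        using a t names unfolding D by (simp add: store_apply)
    qed
  next
    fix t m' assume I: "?I k t m'"
    have D: "?D k = E" using edge_ends(1) by auto
    show "t + acost (Var ''W_size'') + 9 \<le> 100 * card E + 100 * k + 100 \<and> same_except ?S m m' \<and>
      (\<forall>w<k. m' qp w 0 = m pp w 0) \<and> ?R E m'"
      using I sum_deg unfolding D by simp
  qed
qed

lemma recorded_rows:
  assumes Y: "stable Y" and r: "recorded m i Y" and j: "j < m ''plus_len'' i 0"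
  shows "tandem Y (plus_list m i ! j) (minus_list m i ! j)"
    and "plus_list m i ! j = (m ''plus_w'' i j, m ''plus_f'' i j)"
    and "minus_list m i ! j = (m ''minus_w'' i j, m ''plus_f'' i j)"
    and "m ''plus_w'' i j < k" and "distinct (map fst (plus_list m i))"
proof -
  have len: "length (plus_list m i) = m ''plus_len'' i 0" "length (minus_list m i) = m ''plus_len'' i 0"
    using r unfolding recorded_def plus_list_def minus_list_def by simp_all
  have "(plus_list m i ! j, minus_list m i ! j) \<in> set (zip (plus_list m i) (minus_list m i))"
    using j len by (auto simp: set_zip)
  then show t: "tandem Y (plus_list m i ! j) (minus_list m i ! j)"
    using r unfolding recorded_def tandem_cycle_def by auto
  show p: "plus_list m i ! j = (m ''plus_w'' i j, m ''plus_f'' i j)" using j unfolding plus_list_def by simp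
  have "minus_list m i ! j = (m ''minus_w'' i j, m ''minus_f'' i j)"
    using j r unfolding recorded_def minus_list_def by simp
  then show "minus_list m i ! j = (m ''minus_w'' i j, m ''plus_f'' i j)" using tandemD(6)[OF Y t] p by simp
  show "m ''plus_w'' i j < k" using edge_ends(1)[OF tandemD(2)[OF Y t]] p by simp
  show "distinct (map fst (plus_list m i))"
    using recordedD(1,2)[OF r] rotationD(9)[OF Y recordedD(1)[OF r]] unfolding output_rotation_def by (simp add: distinct_map)
qed

abbreviation check_names :: "string set" where
  "check_names \<equiv> {''go'', ''f'', ''A'', ''ptr'', ''X'', ''w'', ''j'', ''ok''}"

text \<open>
  Moving a pointer is paid for by the increase of the sum of the pointers, which never exceeds
  \<open>card E\<close> during a whole pass.
\<close>

lemma run_check_listed: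
  assumes M: "matched X m" and i: "m ''i'' 0 0 = i" and Y: "stable Y" and rec: "recorded m i Y"
  shows "run E C check_listed m (\<lambda>t m'.
     t + 200 * (\<Sum>w<k. m ''ptr'' w 0) \<le> 200 * (\<Sum>w<k. m' ''ptr'' w 0) + 300 * m ''plus_len'' i 0 + 300 \<and>
     same_except check_names m m' \<and> matched X m' \<and>
     m' ''ok'' 0 0 = (if \<forall>j<m ''plus_len'' i 0. tandem X (plus_list m i ! j) (minus_list m i ! j) then 1 else 0) \<and>
     (m' ''ok'' 0 0 = 1 \<longrightarrow> (\<forall>a\<in>set (plus_list m i). m' ''ptr'' (fst a) 0 < deg (fst a) \<and> a = pointed m' (fst a))))"
proof -
  let ?n = "m ''plus_len'' i 0" and ?as = "plus_list m i" and ?bs = "minus_list m i"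
  let ?T = "\<lambda>j. tandem X (?as ! j) (?bs ! j)"
  let ?sum = "\<lambda>m. \<Sum>w<k. m ''ptr'' w 0"
  let ?I = "\<lambda>r t m'. same_except check_names m m' \<and> matched X m' \<and> m' ''j'' 0 0 = r \<and>
    m' ''ok'' 0 0 = (if \<forall>j<r. ?T j then 1 else 0) \<and>
    (m' ''ok'' 0 0 = 1 \<longrightarrow> (\<forall>j<r. m' ''ptr'' (fst (?as ! j)) 0 < deg (fst (?as ! j)) \<and> ?as ! j = pointed m' (fst (?as ! j)))) \<and>
    t + 200 * ?sum m \<le> 200 * ?sum m' + 250 * r"
  have X: "stable X" using M unfolding matched_def by auto
  note rows = recorded_rows[OF Y rec]
  have lenas: "length ?as = ?n" unfolding plus_list_def by simp
  define m1 where "m1 = store m ''ok'' 0 0 1"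
  have loop: "run E C (For ''j'' (Arr ''plus_len'' (Var ''i''))
       check_entry) m1
     (\<lambda>t m'. ?I ?n (t - 20) m')"
  proof (rule run_For[where I = ?I and N = ?n])
    have s: "same_except check_names m (store m1 ''j'' 0 0 0)" unfolding m1_def
      by (intro same_except_store same_except_refl) simp_all
    have "matched X (store m1 ''j'' 0 0 0)" using M unfolding matched_def inputs_def m1_def by (simp add: store_apply)
    then show "?I 0 0 (store m1 ''j'' 0 0 0)" using s unfolding m1_def by (simp add: store_apply)
  next
    fix r t m' assume I: "?I r t m'"
    then have sm: "same_except check_names m m'" by blast
    have "m' ''plus_len'' = m ''plus_len''" "m' ''i'' = m ''i''" by (rule same_exceptD[OF sm]; simp)+
    then show "aval (Arr ''plus_len'' (Var ''i'')) m' = ?n \<and> m' ''j'' 0 0 = r" using I i by simp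
  next
    fix r t m' assume I: "?I r t m'" and r: "r < ?n"
    then have sm: "same_except check_names m m'" and M': "matched X m'" and j: "m' ''j'' 0 0 = r"
      and okv: "m' ''ok'' 0 0 = (if \<forall>j<r. ?T j then 1 else 0)"
      and pts: "m' ''ok'' 0 0 = 1 \<Longrightarrow> \<forall>j<r. m' ''ptr'' (fst (?as ! j)) 0 < deg (fst (?as ! j)) \<and> ?as ! j = pointed m' (fst (?as ! j))"
      and t: "t + 200 * ?sum m \<le> 200 * ?sum m' + 250 * r" by blast+
    have e: "m' ''i'' = m ''i''" "m' ''plus_w'' = m ''plus_w''" "m' ''plus_f'' = m ''plus_f''" "m' ''minus_w'' = m ''minus_w''"
      by (rule same_exceptD[OF sm]; simp)+
    define w where "w = m ''plus_w'' i r"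
    define f where "f = m ''plus_f'' i r"
    define b where "b = m ''minus_w'' i r"
    have ab: "?as ! r = (w, f)" "?bs ! r = (b, f)" "w < k" using rows(2-4)[OF r] unfolding w_def f_def b_def by auto
    have bE: "(b, f) \<in> E" using tandemD(5)[OF Y rows(1)[OF r]] ab by simp
    define m2 where "m2 = store m' ''w'' 0 0 w"
    have inp: "inputs m'" and X': "m' ''X'' = ind X" and ok': "ptr_ok X (\<lambda>w. m' ''ptr'' w 0)"
      using M' unfolding matched_def by auto
    have e2: "inputs m2" "m2 ''X'' = ind X" "m2 ''w'' 0 0 = w" "m2 ''ptr'' = m' ''ptr''"
      using inp X' unfolding m2_def inputs_def by (simp_all add: store_apply)
    have s2: "same_except check_names m m2" unfolding m2_def using sm by (rule same_except_store) simp
    have pd: "m2 ''ptr'' w 0 \<le> deg w" using ok' ab(3) unfolding ptr_ok_def e2 by auto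
    have new: "\<And>i. m2 ''ptr'' w 0 \<le> i \<Longrightarrow> i < deg w \<Longrightarrow> (w, nb w i) \<notin> X" using ptr_ok_new[OF ok' ab(3)] unfolding e2 by blast
    have av: "aval (Read ''plus_w'' (Var ''i'') (Var ''j'')) m' = w" using e i j unfolding w_def by simp
    show "run E C check_entry m'
      (\<lambda>t' m''. m'' ''j'' 0 0 = r \<and> ?I (Suc r) (t + t' + acost (Arr ''plus_len'' (Var ''i'')) + 13) (store m'' ''j'' 0 0 (Suc r)))"
      unfolding run_Seq run_Write av unfolding aval.simps(1) m2_def[symmetric]
    proof (rule run_mono[OF run_advance[OF e2(1,2) stableD(2)[OF X] e2(3) ab(3) pd new]])
      fix t' m3
      assume "\<exists>n. advanced X w m2 n m3 \<and> same_except {''go'', ''f'', ''A'', ''ptr'', ''X''} m2 m3 \<and> m3 ''X'' = ind X \<and>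
        t' + 100 * m2 ''ptr'' w 0 \<le> 100 * n + 100"
      then obtain n where n: "advanced X w m2 n m3" and s3: "same_except {''go'', ''f'', ''A'', ''ptr'', ''X''} m2 m3"
        and X3: "m3 ''X'' = ind X" and t': "t' + 100 * m2 ''ptr'' w 0 \<le> 100 * n + 100" by auto
      let ?p = "\<lambda>w. m' ''ptr'' w 0"
      have n1: "?p w \<le> n" "n \<le> deg w" "\<And>i. ?p w \<le> i \<Longrightarrow> i < n \<Longrightarrow> \<not> accepts X (w, nb w i)"
        "m3 ''ptr'' = (m' ''ptr'')(w := (m' ''ptr'' w)(0 := n))"
        using n unfolding advanced_def e2 by auto
      have q: "(\<lambda>w. m3 ''ptr'' w 0) = ?p(w := n)" using n1(4) by auto
      have moved: "ptr_ok X (?p(w := n))" "n < deg w \<Longrightarrow> accepts X (w, nb w n) \<Longrightarrow> W_admissible X (w, nb w n)"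
        "\<And>a. W_admissible X a \<Longrightarrow> fst a = w \<Longrightarrow> n < deg w"
        using pointer_moved[where p = ?p, OF X ok' ab(3) n1(1,2)] n1(3) by blast+
      have e3: "m3 ''W_size'' = m2 ''W_size''" "m3 ''deg'' = m2 ''deg''" "m3 ''pref'' = m2 ''pref''" "m3 ''quota'' = m2 ''quota''"
        "m3 ''i'' 0 0 = i" "m3 ''j'' 0 0 = r" "m3 ''ok'' = m' ''ok''" "m3 ''plus_f'' = m ''plus_f''" "m3 ''minus_w'' = m ''minus_w''"
        using same_exceptD[OF s3] e i j unfolding m2_def by (simp_all add: store_apply)
      have M3: "matched X m3" using e2(1) X X3 moved(1) unfolding matched_def inputs_def e3(1-4) q by auto
      have sm3: "same_except check_names m m3" by (rule same_except_trans[OF s2 s3]) simp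
      define good where "good = bval tandem_seen m3"
      have good_eq: "good \<longleftrightarrow> m3 ''go'' 0 0 = 0 \<and> m3 ''f'' 0 0 = f \<and> (b, f) \<in> X \<and> m3 ''A'' b f = 0"
        unfolding good_def f_def b_def using e3 X3 by (auto simp: ind_def)
      have goodT: "good \<longleftrightarrow> ?T r" "good \<Longrightarrow> n < deg w \<and> nb w n = f"
      proof -
        show g: "n < deg w \<and> nb w n = f" if good
          using that n unfolding good_eq advanced_def by (auto split: if_splits)
        show "good \<longleftrightarrow> ?T r"
        proof
          assume good
          note gd = this[unfolded good_eq] and g = g[OF this]
          have acc: "accepts X (w, nb w n)" and A: "m3 ''A'' b f = answer X w f b"
            using n g bE unfolding advanced_def by auto
          have "W_admissible X (w, f)" using moved(2) acc g by simp
          moreover have "(b, f) \<notin> C f (insert (w, f) (X \<inter> EF f))"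
            using gd A unfolding answer_def by (auto split: if_splits)
          ultimately show "?T r" unfolding ab tandem_iff[OF X] using gd bE by (simp add: EF_iff)
        next
          assume t: "?T r"
          note td = tandemD[OF X t[unfolded ab]]
          have nd: "n < deg w" using moved(3)[OF td(1)] by simp
          then have acc: "accepts X (w, nb w n)" "m3 ''go'' 0 0 = 0" "m3 ''f'' 0 0 = nb w n"
            and A: "\<And>v. (v, nb w n) \<in> E \<Longrightarrow> m3 ''A'' v (nb w n) = answer X w (nb w n) v"
            using n unfolding advanced_def by auto
          have "(w, f) = (w, nb w n)" using W_admissible_unique[OF X td(1) moved(2)[OF nd acc(1)]] by simp
          then show good unfolding good_eq using acc A[of b] bE td(4,8) unfolding answer_def by simp
        qed
      qed
      have sumle: "?sum m3 + ?p w = ?sum m' + n"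
      proof -
        have "?sum m3 = (\<Sum>v<k. if v = w then n else ?p v)" using n1(4) by (intro sum.cong) auto
        also have "\<dots> = n + (\<Sum>v\<in>{..<k} - {w}. ?p v)" using ab(3) by (simp add: sum.remove)
        moreover have "?sum m' = ?p w + (\<Sum>v\<in>{..<k} - {w}. ?p v)" using ab(3) by (simp add: sum.remove)
        ultimately show ?thesis by simp
      qed
      define m4 where "m4 = (if good then m3 else store m3 ''ok'' 0 0 0)"
      have e4: "m4 ''ptr'' = m3 ''ptr''" "m4 ''j'' 0 0 = r" "m4 ''ok'' 0 0 = (if good then m' ''ok'' 0 0 else 0)"
        unfolding m4_def by (simp_all add: store_apply e3)
      have M4: "matched X m4" using M3 unfolding m4_def matched_def inputs_def by (simp add: store_apply)
      have s4: "same_except check_names m m4" unfolding m4_def using sm3 same_except_store[OF sm3] by simp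
      have all: "(\<forall>j<Suc r. ?T j) \<longleftrightarrow> (\<forall>j<r. ?T j) \<and> ?T r" by (auto simp: less_Suc_eq)
      have okS: "m4 ''ok'' 0 0 = (if \<forall>j<Suc r. ?T j then 1 else 0)"
        unfolding e4 all goodT(1)[symmetric] using okv by simp
      have ptS: "m4 ''ptr'' (fst (?as ! j)) 0 < deg (fst (?as ! j)) \<and> ?as ! j = pointed m4 (fst (?as ! j))"
        if ok1: "m4 ''ok'' 0 0 = 1" and jr: "j < Suc r" for j
      proof (cases "j = r")
        case True
        have good using ok1 e4 by (auto split: if_splits)
        then have "n < deg w \<and> nb w n = f" using goodT(2) by simp
        then show ?thesis unfolding True ab pointed_def e4 n1(4) by simp
      next
        case False
        then have jr': "j < r" using jr by simp
        have "m' ''ok'' 0 0 = 1" using ok1 e4 by (auto split: if_splits)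
        then have pj: "m' ''ptr'' (fst (?as ! j)) 0 < deg (fst (?as ! j)) \<and> ?as ! j = pointed m' (fst (?as ! j))"
          using pts jr' by blast
        have "map fst ?as ! j \<noteq> map fst ?as ! r"
          using nth_eq_iff_index_eq[OF rows(5)[OF r], of j r] jr' r lenas by simp
        then have "fst (?as ! j) \<noteq> w" using jr' r lenas ab by simp
        then show ?thesis using pj unfolding pointed_def e4 n1(4) by simp
      qed
      have fin: "m4 ''j'' 0 0 = r \<and> ?I (Suc r) T (store m4 ''j'' 0 0 (Suc r))" if T: "T \<le> t + t' + 100" for T
      proof -
        let ?m = "store m4 ''j'' 0 0 (Suc r)"
        have s5: "same_except check_names m ?m" using s4 by (rule same_except_store) simp
        have M5: "matched X ?m" using M4 unfolding matched_def inputs_def by (simp add: store_apply)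
        have e5: "?m ''ptr'' = m4 ''ptr''" "?m ''ok'' = m4 ''ok''" "?m ''j'' 0 0 = Suc r" by (simp_all add: store_apply)
        have "T + 200 * ?sum m \<le> 200 * ?sum ?m + 250 * Suc r"
          unfolding e5 e4 using T t t' sumle n1(1) unfolding e2 by simp
        moreover have "pointed ?m = pointed m4" by (intro ext) (simp add: pointed_def e5)
        ultimately show ?thesis using s5 M5 okS ptS e4(2) unfolding e5 by simp
      qed
      show "run E C (If tandem_seen
            Skip (Assign ''ok'' (Const 0))) m3
        (\<lambda>t'' m''. m'' ''j'' 0 0 = r \<and> ?I (Suc r) (t + (acost (Const 0) + acost (Const 0) + acost (Read ''plus_w'' (Var ''i'') (Var ''j'')) + 1 + (t' + t'')) +
            acost (Arr ''plus_len'' (Var ''i'')) + 13) (store m'' ''j'' 0 0 (Suc r)))"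
      proof (cases good)
        case True
        then have m4: "m4 = m3" unfolding m4_def by simp
        show ?thesis unfolding run_If if_P[OF True[unfolded good_def]] run_Skip
          by (rule fin[unfolded m4]) simp
      next
        case False
        then have m4: "m4 = store m3 ''ok'' 0 0 0" unfolding m4_def by simp
        show ?thesis unfolding run_If if_not_P[OF False[unfolded good_def]] run_Write aval.simps(1)
          by (rule fin[unfolded m4]) simp
      qed
    qed
  next
    fix t m' assume I: "?I ?n t m'"
    have "t + acost (Arr ''plus_len'' (Var ''i'')) + 9 - 20 \<le> t" by simp
    then show "?I ?n (t + acost (Arr ''plus_len'' (Var ''i'')) + 9 - 20) m'" using I by (meson add_le_mono1 le_trans)
  qed
  show ?thesis unfolding check_listed_def run_Seq[of E C "Assign _ _"] run_Write aval.simps(1) m1_def[symmetric]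
  proof (rule run_mono[OF loop])
    fix t m' assume I: "?I ?n (t - 20) m'"
    have "\<forall>a\<in>set ?as. m' ''ptr'' (fst a) 0 < deg (fst a) \<and> a = pointed m' (fst a)" if "m' ''ok'' 0 0 = 1"
    proof
      fix a assume "a \<in> set ?as"
      then obtain j where "j < ?n" "a = ?as ! j" using lenas by (metis in_set_conv_nth)
      then show "m' ''ptr'' (fst a) 0 < deg (fst a) \<and> a = pointed m' (fst a)" using I that by blast
    qed
    then show "acost (Const 0) + acost (Const 0) + acost (Const 1) + 1 + t + 200 * ?sum m \<le> 200 * ?sum m' + 300 * ?n + 300 \<and>
      same_except check_names m m' \<and> matched X m' \<and> m' ''ok'' 0 0 = (if \<forall>j<?n. ?T j then 1 else 0) \<and>
      (m' ''ok'' 0 0 = 1 \<longrightarrow> (\<forall>a\<in>set ?as. m' ''ptr'' (fst a) 0 < deg (fst a) \<and> a = pointed m' (fst a)))"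
      using I by auto
  qed
qed

end

context market_input
begin

definition listed :: "memory \<Rightarrow> bool" where
  "listed m \<longleftrightarrow> inputs m \<and> stable X_min \<and> rotations_at X_max = {} \<and> full_route (found m) \<and>
     (\<forall>i<m ''rot_count'' 0 0. recorded m i (result X_min (take i (found m)))) \<and>
     (\<Sum>i<m ''rot_count'' 0 0. m ''plus_len'' i 0) \<le> card E"

lemma listed_nth: "i < m ''rot_count'' 0 0 \<Longrightarrow> found m ! i = output_rotation m i"
  and length_found: "length (found m) = m ''rot_count'' 0 0"
  unfolding found_def by simp_all

lemma listed_prefix:
  assumes "listed m" "i < m ''rot_count'' 0 0"
  shows "feasible X_min (take i (found m))" "stable (result X_min (take i (found m)))"
    "recorded m i (result X_min (take i (found m)))"
proof -
  have l: "stable X_min" "rotations_at X_max = {}" "full_route (found m)" using assms(1) unfolding listed_def by auto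
  then have "feasible X_min (take i (found m) @ drop i (found m))" using full_route_iff by simp
  then show f: "feasible X_min (take i (found m))" unfolding feasible_append by blast
  show "stable (result X_min (take i (found m)))" using feasible_stable[OF l(1) f] .
  show "recorded m i (result X_min (take i (found m)))" using assms unfolding listed_def by blast
qed

text \<open>
  The tandems of a rotation are tested as they were recorded; \<open>rotation_pairs\<close> excludes that the
  rotation is available with a different pairing of its edges.
\<close>

lemma check_available:
  assumes l: "listed m" and i: "i < m ''rot_count'' 0 0" and v: "feasible X_min v"
  shows "(\<forall>j<m ''plus_len'' i 0. tandem (result X_min v) (plus_list m i ! j) (minus_list m i ! j)) \<longleftrightarrow>
    output_rotation m i \<in> rotations_at (result X_min v)"
proof -
  let ?X = "result X_min v" and ?u = "take i (found m)"
  let ?as = "plus_list m i" and ?bs = "minus_list m i"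
  note pre = listed_prefix[OF l i]
  have st: "stable X_min" using l unfolding listed_def by auto
  have X: "stable ?X" using feasible_stable[OF st v] .
  have len: "length ?as = m ''plus_len'' i 0" "length ?bs = m ''plus_len'' i 0"
    using pre(3) unfolding recorded_def plus_list_def minus_list_def by simp_all
  show ?thesis
  proof
    assume t: "\<forall>j<m ''plus_len'' i 0. tandem ?X (?as ! j) (?bs ! j)"
    have "tandem ?X (fst x) (snd x)" if x: "x \<in> set (zip ?as ?bs)" for x
    proof -
      obtain j where "j < m ''plus_len'' i 0" "x = (?as ! j, ?bs ! j)" using x len by (auto simp: set_zip)
      then show ?thesis using t by simp
    qed
    then have "recorded m i ?X" using pre(3) unfolding recorded_def tandem_cycle_def by blast
    then show "output_rotation m i \<in> rotations_at ?X" by (rule recordedD(1))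
  next
    assume L: "output_rotation m i \<in> rotations_at ?X"
    show "\<forall>j<m ''plus_len'' i 0. tandem ?X (?as ! j) (?bs ! j)"
    proof (intro allI impI)
      fix j assume j: "j < m ''plus_len'' i 0"
      have a: "?as ! j \<in> fst (output_rotation m i)" using j len unfolding output_rotation_def by simp
      obtain b where b: "tandem ?X (?as ! j) b" using rotationD(6)[OF X L a] by blast
      have "?bs ! j = b"
        using rotation_pairs[OF st pre(1) recordedD(1)[OF pre(3)] v L a recorded_rows(1)[OF pre(2,3) j] b] .
      then show "tandem ?X (?as ! j) (?bs ! j)" using b by simp
    qed
  qed
qed

lemma listed_cong:
  assumes "same_except S m m'"
    and "S \<inter> {''W_size'', ''deg'', ''pref'', ''quota'', ''rot_count'', ''plus_w'', ''plus_f'',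
      ''minus_w'', ''minus_f'', ''plus_len'', ''minus_len''} = {}"
  shows "listed m' = listed m" "found m' = found m" "output_rotation m' = output_rotation m" "recorded m' = recorded m"
    "plus_list m' = plus_list m" "minus_list m' = minus_list m" "m' ''rot_count'' = m ''rot_count''"
    "m' ''plus_len'' = m ''plus_len''" "m' ''minus_len'' = m ''minus_len''" "inputs m' = inputs m"
proof -
  note d = disjoint_iff[THEN iffD1, OF assms(2), rule_format]
  have e: "m' ''W_size'' = m ''W_size''" "m' ''deg'' = m ''deg''" "m' ''pref'' = m ''pref''" "m' ''quota'' = m ''quota''"
    "m' ''rot_count'' = m ''rot_count''"
    "m' ''plus_w'' = m ''plus_w''" "m' ''plus_f'' = m ''plus_f''" "m' ''minus_w'' = m ''minus_w''"
    "m' ''minus_f'' = m ''minus_f''" "m' ''plus_len'' = m ''plus_len''" "m' ''minus_len'' = m ''minus_len''"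
    by (rule same_exceptD[OF assms(1)], rule notI, drule d, simp)+
  show l: "output_rotation m' = output_rotation m" "recorded m' = recorded m" "plus_list m' = plus_list m"
    "minus_list m' = minus_list m"
    by (intro ext row_cong; simp only: e)+
  show i: "inputs m' = inputs m" unfolding inputs_def e ..
  show f: "found m' = found m" unfolding found_def e l ..
  show "listed m' = listed m" unfolding listed_def i f e l ..
  show "m' ''rot_count'' = m ''rot_count''" "m' ''plus_len'' = m ''plus_len''" "m' ''minus_len'' = m ''minus_len''"
    by (fact e)+
qed

definition reachable :: "(nat \<times> nat) set \<Rightarrow> bool" where
  "reachable X \<longleftrightarrow> (\<exists>v. feasible X_min v \<and> X = result X_min v)"

lemma reachable_min: "reachable X_min"
  unfolding reachable_def by (intro exI[of _ "[]"]) simp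

lemma reachable_apply: "reachable X \<Longrightarrow> L \<in> rotations_at X \<Longrightarrow> reachable (apply_rotation L X)"
  unfolding reachable_def
proof (elim exE conjE)
  fix v assume "L \<in> rotations_at X" "feasible X_min v" "X = result X_min v"
  then show "\<exists>v. feasible X_min v \<and> apply_rotation L X = result X_min v"
    by (intro exI[of _ "v @ [L]"]) (simp add: feasible_append result_append)
qed

lemma run_try_listed:
  assumes l: "listed m" and i: "m ''i'' 0 0 = i" "i < m ''rot_count'' 0 0" and M: "matched X m" and re: "reachable X"
  defines "L \<equiv> output_rotation m i"
  shows "run E C try_listed m (\<lambda>t m'.
     t + 200 * (\<Sum>w<k. m ''ptr'' w 0) \<le> 200 * (\<Sum>w<k. m' ''ptr'' w 0) + 500 * m ''plus_len'' i 0 + 500 \<and>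
     same_except check_names m m' \<and> matched (if L \<in> rotations_at X then apply_rotation L X else X) m')"
proof -
  note pre = listed_prefix[OF l i(2)]
  obtain v where v: "feasible X_min v" "X = result X_min v" using re unfolding reachable_def by auto
  note av = check_available[OF l i(2) v(1), folded v(2), folded L_def]
  show ?thesis unfolding try_listed_def run_Seq
  proof (rule run_mono[OF run_check_listed[OF M i(1) pre(2,3)]])
    fix t m1
    assume a: "t + 200 * (\<Sum>w<k. m ''ptr'' w 0) \<le> 200 * (\<Sum>w<k. m1 ''ptr'' w 0) + 300 * m ''plus_len'' i 0 + 300 \<and>
     same_except check_names m m1 \<and> matched X m1 \<and>
     m1 ''ok'' 0 0 = (if \<forall>j<m ''plus_len'' i 0. tandem X (plus_list m i ! j) (minus_list m i ! j) then 1 else 0) \<and>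
     (m1 ''ok'' 0 0 = 1 \<longrightarrow> (\<forall>a\<in>set (plus_list m i). m1 ''ptr'' (fst a) 0 < deg (fst a) \<and> a = pointed m1 (fst a)))"
    then have t: "t + 200 * (\<Sum>w<k. m ''ptr'' w 0) \<le> 200 * (\<Sum>w<k. m1 ''ptr'' w 0) + 300 * m ''plus_len'' i 0 + 300"
      and s1: "same_except check_names m m1" and M1: "matched X m1"
      and ok: "m1 ''ok'' 0 0 = (if L \<in> rotations_at X then 1 else 0)"
      and pt: "m1 ''ok'' 0 0 = 1 \<Longrightarrow> \<forall>a\<in>set (plus_list m i). m1 ''ptr'' (fst a) 0 < deg (fst a) \<and> a = pointed m1 (fst a)"
      unfolding av by blast+
    have c: "output_rotation m1 = output_rotation m" "recorded m1 = recorded m" "plus_list m1 = plus_list m"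
      "m1 ''plus_len'' = m ''plus_len''" "m1 ''minus_len'' = m ''minus_len''"
      by (rule listed_cong[OF s1]; simp)+
    have i1: "m1 ''i'' 0 0 = i" using same_exceptD[OF s1] i by simp
    show "run E C (If (Equal (Var ''ok'') (Const 1)) apply_listed Skip) m1 (\<lambda>t' m'.
       t + t' + 200 * (\<Sum>w<k. m ''ptr'' w 0) \<le> 200 * (\<Sum>w<k. m' ''ptr'' w 0) + 500 * m ''plus_len'' i 0 + 500 \<and>
       same_except check_names m m' \<and> matched (if L \<in> rotations_at X then apply_rotation L X else X) m')"
    proof (cases "L \<in> rotations_at X")
      case True
      then have ok1: "m1 ''ok'' 0 0 = 1" using ok by simp
      then have bv: "bval (Equal (Var ''ok'') (Const 1)) m1" by simp
      have L1: "output_rotation m1 i = L" unfolding c L_def ..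
      show ?thesis unfolding run_If if_P[OF bv]
      proof (rule run_mono[OF run_apply_listed[OF M1 i1]])
        show "output_rotation m1 i \<in> rotations_at X" using True L1 by simp
        show "m1 ''minus_len'' i 0 = m1 ''plus_len'' i 0" unfolding c using pre(3) unfolding recorded_def by simp
        show "distinct (plus_list m1 i)" unfolding c by (rule recordedD(2)[OF pre(3)])
        show "m1 ''ptr'' (fst a) 0 < deg (fst a) \<and> a = pointed m1 (fst a)" if "a \<in> set (plus_list m1 i)" for a
          using pt[OF ok1] that unfolding c by blast
      next
        fix t' m'
        assume "t' \<le> 100 * m1 ''plus_len'' i 0 + 100 \<and> same_except {''X'', ''ptr'', ''j''} m1 m' \<and>
          matched (apply_rotation (output_rotation m1 i) X) m' \<and>
          (\<Sum>w<k. m' ''ptr'' w 0) = (\<Sum>w<k. m1 ''ptr'' w 0) + m1 ''plus_len'' i 0 \<and>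
          (\<forall>w. w \<notin> fst ` set (plus_list m1 i) \<longrightarrow> m' ''ptr'' w 0 = m1 ''ptr'' w 0)"
        then have b: "t' \<le> 100 * m ''plus_len'' i 0 + 100" "same_except {''X'', ''ptr'', ''j''} m1 m'"
          "matched (apply_rotation L X) m'" "(\<Sum>w<k. m' ''ptr'' w 0) = (\<Sum>w<k. m1 ''ptr'' w 0) + m ''plus_len'' i 0"
          unfolding L1 c(3-5) by blast+
        have "same_except check_names m m'" by (rule same_except_trans[OF s1 b(2)]) simp
        then show "t + (bcost (Equal (Var ''ok'') (Const 1)) + t' + 1) + 200 * (\<Sum>w<k. m ''ptr'' w 0)
            \<le> 200 * (\<Sum>w<k. m' ''ptr'' w 0) + 500 * m ''plus_len'' i 0 + 500 \<and>
          same_except check_names m m' \<and> matched (if L \<in> rotations_at X then apply_rotation L X else X) m'"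
          using t b True by simp
      qed
    next
      case False
      then have bv: "\<not> bval (Equal (Var ''ok'') (Const 1)) m1" using ok by simp
      show ?thesis unfolding run_If if_not_P[OF bv] run_Skip using False t s1 M1 by simp
    qed
  qed
qed

lemma sum_len_pos:
  assumes l: "listed m" and i: "i < m ''rot_count'' 0 0" shows "0 < m ''plus_len'' i 0"
proof (rule ccontr)
  assume "\<not> 0 < m ''plus_len'' i 0"
  then have "zip (plus_list m i) (minus_list m i) = []" unfolding plus_list_def by simp
  then show False using listed_prefix(3)[OF l i] unfolding recorded_def tandem_cycle_def by simp
qed

lemma rot_count_le:
  assumes l: "listed m" shows "m ''rot_count'' 0 0 \<le> card E"
proof -
  have "(\<Sum>i<m ''rot_count'' 0 0. 1) \<le> (\<Sum>i<m ''rot_count'' 0 0. m ''plus_len'' i 0)"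
    using sum_len_pos[OF l] by (intro sum_mono) (simp add: Suc_leI)
  then show ?thesis using l unfolding listed_def by simp
qed

text \<open>
  The index loop that omits \<open>r\<close> is the pass of \<open>greedy_hasse\<close>.
\<close>

lemma skip_one:
  assumes "r < length xs"
  shows "map ((!) xs) (filter (\<lambda>j. j \<noteq> r) [0..<length xs]) = take r xs @ drop (Suc r) xs"
proof -
  have "[0..<length xs] = [0..<r] @ r # [Suc r..<length xs]"
    using upt_add_eq_append[of 0 r "length xs - r"] upt_conv_Cons[OF assms] assms by simp
  moreover have "filter (\<lambda>j. j \<noteq> r) [0..<r] = [0..<r]" "filter (\<lambda>j. j \<noteq> r) [Suc r..<length xs] = [Suc r..<length xs]"
    by (auto simp: filter_id_conv)
  moreover have "map ((!) xs) [0..<r] = take r xs" "map ((!) xs) [Suc r..<length xs] = drop (Suc r) xs"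
    using assms by (simp_all add: list_eq_iff_nth_eq)
  ultimately show ?thesis by simp
qed

abbreviation row_names :: "string set" where
  "row_names \<equiv> {''v'', ''i'', ''hasse'', ''go'', ''f'', ''A'', ''ptr'', ''X'', ''w'', ''j'', ''ok''}"

definition saved :: "(nat \<Rightarrow> nat) \<Rightarrow> memory \<Rightarrow> bool" where
  "saved p m \<longleftrightarrow> m ''X0'' = ind X_min \<and> (\<forall>w<k. m ''ptr0'' w 0 = p w) \<and> ptr_ok X_min p"

lemma run_successor_row:
  assumes l: "listed m" and sv: "saved p m" and Z: "m ''X'' = ind Z" "Z \<subseteq> E"
    and r: "m ''r'' 0 0 = r" "r < m ''rot_count'' 0 0"
  shows "run E C successor_row m (\<lambda>t m'. t \<le> 5000 * (card E + k + 3) \<and> same_except row_names m m' \<and>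
     (\<exists>Z. m' ''X'' = ind Z \<and> Z \<subseteq> E) \<and>
     (\<forall>j<m ''rot_count'' 0 0. m' ''hasse'' r j \<noteq> 0 \<longleftrightarrow> rot_hasse (found m ! r) (found m ! j)) \<and>
     (\<forall>r'. r' \<noteq> r \<longrightarrow> m' ''hasse'' r' = m ''hasse'' r'))"
proof -
  let ?N = "m ''rot_count'' 0 0"
  define \<rho> where "\<rho> = found m"
  define len where "len j = m ''plus_len'' j 0" for j
  define G where "G i = greedy X_min (map ((!) \<rho>) (filter (\<lambda>j. j \<noteq> r) [0..<i]))" for i
  let ?sum = "\<lambda>m. \<Sum>w<k. m ''ptr'' w 0"
  have inp: "inputs m" and st: "stable X_min" and top: "rotations_at X_max = {}" and full: "full_route \<rho>"
    and lenE: "(\<Sum>i<?N. len i) \<le> card E"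
    using l unfolding listed_def \<rho>_def len_def by auto
  have \<rho>: "length \<rho> = ?N" "\<And>i. i < ?N \<Longrightarrow> \<rho> ! i = output_rotation m i"
    unfolding \<rho>_def using listed_nth length_found by simp_all
  have NE: "?N \<le> card E" by (rule rot_count_le[OF l])
  have G0: "G 0 = X_min" unfolding G_def by simp
  have GS: "G (Suc i) = (if i \<noteq> r \<and> \<rho> ! i \<in> rotations_at (G i) then apply_rotation (\<rho> ! i) (G i) else G i)" for i
    unfolding G_def by (auto simp: greedy_append)
  have Gre: "reachable (G i)" for i
    by (induction i) (use reachable_min reachable_apply in \<open>auto simp: G0 GS\<close>)
  have split: "\<rho> = take r \<rho> @ \<rho> ! r # drop (Suc r) \<rho>" using r \<rho>(1) by (simp add: id_take_nth_drop)
  have GN: "G ?N = greedy X_min (take r \<rho> @ drop (Suc r) \<rho>)" unfolding G_def \<rho>(1)[symmetric]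
    using skip_one[of r \<rho>] r \<rho>(1) by simp
  let ?H = "apply_rotation (\<rho> ! r) (G ?N)"
  have hs: "\<rho> ! r \<in> rotations_at (G ?N)"
    "\<And>x. x \<in> set \<rho> \<Longrightarrow> x \<in> rotations_at ?H \<longleftrightarrow> rot_hasse (\<rho> ! r) x"
    using greedy_hasse(2)[OF st top, of "take r \<rho>" "\<rho> ! r" "drop (Suc r) \<rho>" "\<rho> ! r"]
      greedy_hasse(3)[OF st top, of "take r \<rho>" "\<rho> ! r" "drop (Suc r) \<rho>"] full r \<rho>(1)
    unfolding split[symmetric] GN by simp_all
  have Hre: "reachable ?H" using reachable_apply[OF Gre hs(1)] .
  have frame: "listed m' \<and> found m' = \<rho> \<and> m' ''rot_count'' = m ''rot_count'' \<and> m' ''plus_len'' = m ''plus_len'' \<and>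
      output_rotation m' = output_rotation m \<and> plus_list m' = plus_list m \<and> minus_list m' = minus_list m \<and> recorded m' = recorded m \<and>
      m' ''r'' = m ''r'' \<and> inputs m'"
    if s: "same_except row_names m m'" for m'
  proof -
    have "listed m' = listed m" "found m' = found m" "m' ''rot_count'' = m ''rot_count''" "m' ''plus_len'' = m ''plus_len''"
      "output_rotation m' = output_rotation m" "plus_list m' = plus_list m" "minus_list m' = minus_list m"
      "recorded m' = recorded m" "inputs m' = inputs m"
      by (rule listed_cong[OF s]; simp)+
    moreover have "m' ''r'' = m ''r''" by (rule same_exceptD[OF s]) simp
    ultimately show ?thesis using l inp unfolding \<rho>_def by simp
  qed
  have matched_i: "matched X (store m' ''i'' 0 0 a) = matched X m'" for X m' a
    unfolding matched_def inputs_def by (simp add: store_apply)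
  show ?thesis unfolding successor_row_def run_Seq[of E C "copy_state _ _ _ _"]
  proof (rule run_mono[OF run_copy_state[OF inp]])
    fix t1 m1
    assume a: "t1 \<le> 100 * card E + 100 * k + 100 \<and> same_except {''v'', ''j'', ''X'', ''ptr''} m m1 \<and>
      (\<forall>w<k. m1 ''ptr'' w 0 = m ''ptr0'' w 0) \<and>
      (\<forall>w f. m1 ''X'' w f = (if (w, f) \<in> E then m ''X0'' w f else m ''X'' w f))"
    then have t1: "t1 \<le> 100 * card E + 100 * k + 100" and s1: "same_except {''v'', ''j'', ''X'', ''ptr''} m m1" by blast+
    have s1': "same_except row_names m m1" by (rule same_except_mono[OF s1]) simp
    have "m1 ''X'' = ind X_min"
    proof (intro ext)
      fix w f
      have "(w, f) \<notin> E \<Longrightarrow> ind Z w f = 0 \<and> ind X_min w f = 0" using Z(2) stableD(2)[OF st] unfolding ind_def by auto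
      moreover have "m1 ''X'' w f = (if (w, f) \<in> E then m ''X0'' w f else m ''X'' w f)" using a by blast
      moreover have "m ''X0'' = ind X_min" using sv unfolding saved_def by blast
      ultimately show "m1 ''X'' w f = ind X_min w f" using Z(1) by simp
    qed
    moreover have "ptr_ok X_min (\<lambda>w. m1 ''ptr'' w 0) = ptr_ok X_min p"
      by (rule ptr_ok_cong) (use a sv in \<open>simp add: saved_def\<close>)
    ultimately have M1: "matched X_min m1" using frame[OF s1'] st sv unfolding matched_def saved_def by simp
    let ?I = "\<lambda>i t m'. same_except row_names m m' \<and> m' ''hasse'' = m ''hasse'' \<and> m' ''i'' 0 0 = i \<and> matched (G i) m' \<and>
      t + 200 * ?sum m1 \<le> 200 * ?sum m' + (\<Sum>j<i. 500 * len j + 600)"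
    have loop1: "run E C (For ''i'' (Var ''rot_count'') try_other) m1
       (\<lambda>t m'. ?I ?N (t - 12) m')"
    proof (rule run_For[where I = ?I and N = ?N])
      have "same_except row_names m (store m1 ''i'' 0 0 0)" using s1' by (rule same_except_store) simp
      moreover have "m1 ''hasse'' = m ''hasse''" by (rule same_exceptD[OF s1]) simp
      ultimately show "?I 0 0 (store m1 ''i'' 0 0 0)" using M1 unfolding matched_i G0 by (simp add: store_apply)
    next
      fix i t m' assume I: "?I i t m'"
      then show "aval (Var ''rot_count'') m' = ?N \<and> m' ''i'' 0 0 = i" using frame[of m'] by simp
    next
      fix i t m' assume I: "?I i t m'" and i: "i < ?N"
      then have s': "same_except row_names m m'" and h': "m' ''hasse'' = m ''hasse''" and i': "m' ''i'' 0 0 = i"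
        and M': "matched (G i) m'" and t: "t + 200 * ?sum m1 \<le> 200 * ?sum m' + (\<Sum>j<i. 500 * len j + 600)" by blast+
      note fr = frame[OF s']
      have fin: "m'' ''i'' 0 0 = i \<and> ?I (Suc i) T (store m'' ''i'' 0 0 (Suc i))"
        if s: "same_except check_names m' m''" and M: "matched (G (Suc i)) m''"
          and T: "T + 200 * ?sum m' \<le> t + 200 * ?sum m'' + 500 * len i + 600" for T m''
      proof -
        have "same_except row_names m m''" by (rule same_except_trans[OF s' s]) simp
        then have 1: "same_except row_names m (store m'' ''i'' 0 0 (Suc i))" by (rule same_except_store) simp
        have 2: "m'' ''hasse'' = m ''hasse''" "m'' ''i'' 0 0 = i" using same_exceptD[OF s] h' i' by simp_all
        have 3: "store m'' ''i'' 0 0 (Suc i) ''ptr'' = m'' ''ptr''" by (simp add: store_apply)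
        show ?thesis using 1 2 M T t unfolding matched_i 3 by (simp add: store_apply)
      qed
      show "run E C try_other m'
        (\<lambda>t' m''. m'' ''i'' 0 0 = i \<and> ?I (Suc i) (t + t' + acost (Var ''rot_count'') + 13) (store m'' ''i'' 0 0 (Suc i)))"
      proof (cases "i = r")
        case True
        then have bv: "bval (Equal (Var ''i'') (Var ''r'')) m'" using i' fr r by simp
        show ?thesis unfolding run_If if_P[OF bv] run_Skip
          by (rule fin[OF same_except_refl]) (use M' True in \<open>simp_all add: GS\<close>)
      next
        case False
        then have bv: "\<not> bval (Equal (Var ''i'') (Var ''r'')) m'" using i' fr r by simp
        have li: "listed m'" "i < m' ''rot_count'' 0 0" using fr i by simp_all
        show ?thesis unfolding run_If if_not_P[OF bv]
        proof (rule run_mono[OF run_try_listed[OF li(1) i' li(2) M' Gre]])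
          fix t' m''
          assume b: "t' + 200 * ?sum m' \<le> 200 * ?sum m'' + 500 * m' ''plus_len'' i 0 + 500 \<and>
            same_except check_names m' m'' \<and>
            matched (if output_rotation m' i \<in> rotations_at (G i) then apply_rotation (output_rotation m' i) (G i) else G i) m''"
          have "output_rotation m' i = \<rho> ! i" "m' ''plus_len'' i 0 = len i" using fr \<rho>(2)[OF i] unfolding len_def by simp_all
          then have b': "t' + 200 * ?sum m' \<le> 200 * ?sum m'' + 500 * len i + 500"
            "same_except check_names m' m''" "matched (G (Suc i)) m''" using b False unfolding GS by (simp_all split: if_splits)
          show "m'' ''i'' 0 0 = i \<and> ?I (Suc i) (t + (bcost (Equal (Var ''i'') (Var ''r'')) + t' + 1) + acost (Var ''rot_count'') + 13) (store m'' ''i'' 0 0 (Suc i))"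
            by (rule fin[OF b'(2,3)]) (use b'(1) in simp)
        qed
      qed
    next
      fix t m' assume I: "?I ?N t m'"
      then show "?I ?N (t + acost (Var ''rot_count'') + 9 - 12) m'" by simp
    qed
    have sum1: "(\<Sum>j<?N. 500 * len j + 600) \<le> 1100 * card E"
    proof -
      have "(\<Sum>j<?N. 500 * len j + 600) = 500 * (\<Sum>j<?N. len j) + 600 * ?N"
        by (simp add: sum.distrib sum_distrib_left)
      then show ?thesis using lenE NE by simp
    qed
    show "run E C (Seq (For ''i'' (Var ''rot_count'') try_other)
     (Seq (Assign ''i'' (Var ''r''))
     (Seq try_listed
          (For ''i'' (Var ''rot_count'') row_entry)))) m1
      (\<lambda>t m'. t1 + t \<le> 5000 * (card E + k + 3) \<and> same_except row_names m m' \<and>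
     (\<exists>Z. m' ''X'' = ind Z \<and> Z \<subseteq> E) \<and>
     (\<forall>j<?N. m' ''hasse'' r j \<noteq> 0 \<longleftrightarrow> rot_hasse (found m ! r) (found m ! j)) \<and>
     (\<forall>r'. r' \<noteq> r \<longrightarrow> m' ''hasse'' r' = m ''hasse'' r'))"
      unfolding run_Seq[of E C "For _ _ _"]
    proof (rule run_mono[OF loop1])
      fix t2 m2 assume I: "?I ?N (t2 - 12) m2"
      then have s2: "same_except row_names m m2" and h2: "m2 ''hasse'' = m ''hasse''" and M2: "matched (G ?N) m2"
        and t2: "t2 \<le> 200 * ?sum m2 + 1100 * card E + 12" using sum1 by auto
      have t2': "t2 \<le> 1300 * card E + 12" using t2 sum_ptr_le[OF M2] by simp
      define m3 where "m3 = store m2 ''i'' 0 0 r"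
      have s3: "same_except row_names m m3" unfolding m3_def using s2 by (rule same_except_store) simp
      note fr3 = frame[OF s3]
      have M3: "matched (G ?N) m3" unfolding m3_def matched_i by (rule M2)
      have i3: "m3 ''i'' 0 0 = r" "m3 ''hasse'' = m ''hasse''" unfolding m3_def using h2 by (simp_all add: store_apply)
      have l3: "listed m3" "r < m3 ''rot_count'' 0 0" using fr3 r by simp_all
      have av: "aval (Var ''r'') m2 = r" using frame[OF s2] r by simp
      show "run E C (Seq (Assign ''i'' (Var ''r'')) (Seq try_listed
          (For ''i'' (Var ''rot_count'') row_entry))) m2
        (\<lambda>t m'. t1 + (t2 + t) \<le> 5000 * (card E + k + 3) \<and> same_except row_names m m' \<and>
         (\<exists>Z. m' ''X'' = ind Z \<and> Z \<subseteq> E) \<and>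
         (\<forall>j<?N. m' ''hasse'' r j \<noteq> 0 \<longleftrightarrow> rot_hasse (found m ! r) (found m ! j)) \<and>
         (\<forall>r'. r' \<noteq> r \<longrightarrow> m' ''hasse'' r' = m ''hasse'' r'))"
        unfolding run_Seq[of E C "Write _ _ _ _"] run_Write av unfolding aval.simps(1) m3_def[symmetric] run_Seq[of E C try_listed]
      proof (rule run_mono[OF run_try_listed[OF l3(1) i3(1) l3(2) M3 Gre]])
        fix t4 m4
        assume b: "t4 + 200 * ?sum m3 \<le> 200 * ?sum m4 + 500 * m3 ''plus_len'' r 0 + 500 \<and>
            same_except check_names m3 m4 \<and>
            matched (if output_rotation m3 r \<in> rotations_at (G ?N) then apply_rotation (output_rotation m3 r) (G ?N) else G ?N) m4"
        have out: "output_rotation m3 r = \<rho> ! r" "m3 ''plus_len'' r 0 = len r" using fr3 \<rho>(2)[OF r(2)] unfolding len_def by simp_all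
        have s4: "same_except check_names m3 m4" and M4: "matched ?H m4"
          and t4: "t4 \<le> 200 * ?sum m4 + 500 * len r + 500" using b hs(1) unfolding out by simp_all
        have s4': "same_except row_names m m4" by (rule same_except_trans[OF s3 s4]) simp
        have lr: "len r \<le> card E" using lenE member_le_sum[of r "{..<?N}" len] r(2) by simp
        have t4': "t4 \<le> 700 * card E + 500" using t4 sum_ptr_le[OF M4] lr by simp
        have h4: "m4 ''hasse'' = m ''hasse''" using same_exceptD[OF s4] i3 by simp
        let ?K = "\<lambda>i t m'. same_except row_names m m' \<and> m' ''i'' 0 0 = i \<and> matched ?H m' \<and>
          (\<forall>j<i. m' ''hasse'' r j \<noteq> 0 \<longleftrightarrow> rot_hasse (\<rho> ! r) (\<rho> ! j)) \<and> (\<forall>r'. r' \<noteq> r \<longrightarrow> m' ''hasse'' r' = m ''hasse'' r') \<and>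
          t + 200 * ?sum m4 \<le> 200 * ?sum m' + (\<Sum>j<i. 500 * len j + 600)"
        show "run E C (For ''i'' (Var ''rot_count'') row_entry) m4
          (\<lambda>t m'. t1 + (t2 + (acost (Const 0) + acost (Const 0) + acost (Var ''r'') + 1 + (t4 + t))) \<le> 5000 * (card E + k + 3) \<and>
             same_except row_names m m' \<and> (\<exists>Z. m' ''X'' = ind Z \<and> Z \<subseteq> E) \<and>
             (\<forall>j<?N. m' ''hasse'' r j \<noteq> 0 \<longleftrightarrow> rot_hasse (found m ! r) (found m ! j)) \<and>
             (\<forall>r'. r' \<noteq> r \<longrightarrow> m' ''hasse'' r' = m ''hasse'' r'))"
        proof (rule run_For[where I = ?K and N = ?N])
          have "same_except row_names m (store m4 ''i'' 0 0 0)" using s4' by (rule same_except_store) simp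
          then show "?K 0 0 (store m4 ''i'' 0 0 0)" using M4 h4 unfolding matched_i by (simp add: store_apply)
        next
          fix i t m' assume "?K i t m'"
          then show "aval (Var ''rot_count'') m' = ?N \<and> m' ''i'' 0 0 = i" using frame[of m'] by simp
        next
          fix i t m' assume I: "?K i t m'" and i: "i < ?N"
          then have s': "same_except row_names m m'" and i': "m' ''i'' 0 0 = i" and M': "matched ?H m'"
            and h': "\<forall>j<i. m' ''hasse'' r j \<noteq> 0 \<longleftrightarrow> rot_hasse (\<rho> ! r) (\<rho> ! j)" "\<forall>r'. r' \<noteq> r \<longrightarrow> m' ''hasse'' r' = m ''hasse'' r'"
            and t: "t + 200 * ?sum m4 \<le> 200 * ?sum m' + (\<Sum>j<i. 500 * len j + 600)" by blast+
          note fr = frame[OF s']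
          note pre = listed_prefix[OF l i]
          have rec': "recorded m' i (result X_min (take i (found m)))" using pre(3) fr by simp
          obtain v where v: "feasible X_min v" "?H = result X_min v" using Hre unfolding reachable_def by auto
          have "\<rho> ! i \<in> set \<rho>" using i \<rho>(1) by simp
          note hsi = hs(2)[OF this]
          have avail: "(\<forall>j<m' ''plus_len'' i 0. tandem ?H (plus_list m' i ! j) (minus_list m' i ! j)) \<longleftrightarrow> rot_hasse (\<rho> ! r) (\<rho> ! i)"
            using check_available[OF l i v(1)] fr hsi \<rho>(2)[OF i] unfolding v(2) by simp
          show "run E C row_entry m'
            (\<lambda>t' m''. m'' ''i'' 0 0 = i \<and> ?K (Suc i) (t + t' + acost (Var ''rot_count'') + 13) (store m'' ''i'' 0 0 (Suc i)))"
            unfolding run_Seq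
          proof (rule run_mono[OF run_check_listed[OF M' i' pre(2) rec']])
            fix t5 m5
            assume c: "t5 + 200 * ?sum m' \<le> 200 * ?sum m5 + 300 * m' ''plus_len'' i 0 + 300 \<and>
              same_except check_names m' m5 \<and> matched ?H m5 \<and>
              m5 ''ok'' 0 0 = (if \<forall>j<m' ''plus_len'' i 0. tandem ?H (plus_list m' i ! j) (minus_list m' i ! j) then 1 else 0) \<and>
              (m5 ''ok'' 0 0 = 1 \<longrightarrow> (\<forall>a\<in>set (plus_list m' i). m5 ''ptr'' (fst a) 0 < deg (fst a) \<and> a = pointed m5 (fst a)))"
            have li: "m' ''plus_len'' i 0 = len i" using fr unfolding len_def by simp
            have t5: "t5 + 200 * ?sum m' \<le> 200 * ?sum m5 + 300 * len i + 300" using c unfolding li by blast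
            have s5: "same_except check_names m' m5" and M5: "matched ?H m5" using c by blast+
            have ok5: "m5 ''ok'' 0 0 = (if rot_hasse (\<rho> ! r) (\<rho> ! i) then 1 else 0)" using c unfolding avail by blast
            have e5: "m5 ''r'' 0 0 = r" "m5 ''i'' 0 0 = i" "m5 ''hasse'' = m' ''hasse''"
              using same_exceptD[OF s5] fr r i' by simp_all
            let ?m = "store m5 ''hasse'' r i (if rot_hasse (\<rho> ! r) (\<rho> ! i) then 1 else 0)"
            have "same_except row_names m m5" by (rule same_except_trans[OF s' s5]) simp
            then have s6: "same_except row_names m (store ?m ''i'' 0 0 (Suc i))" by (intro same_except_store) simp_all
            have M6: "matched ?H (store ?m ''i'' 0 0 (Suc i))" using M5 unfolding matched_def inputs_def by (simp add: store_apply)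
            have e6: "store ?m ''i'' 0 0 (Suc i) ''ptr'' = m5 ''ptr''" "store ?m ''i'' 0 0 (Suc i) ''i'' 0 0 = Suc i" "?m ''i'' 0 0 = i"
              "store ?m ''i'' 0 0 (Suc i) ''hasse'' = (m' ''hasse'')(r := (m' ''hasse'' r)(i := if rot_hasse (\<rho> ! r) (\<rho> ! i) then 1 else 0))"
              using e5 by (simp_all add: store_apply)
            have h6: "\<forall>j<Suc i. store ?m ''i'' 0 0 (Suc i) ''hasse'' r j \<noteq> 0 \<longleftrightarrow> rot_hasse (\<rho> ! r) (\<rho> ! j)"
              "\<forall>r'. r' \<noteq> r \<longrightarrow> store ?m ''i'' 0 0 (Suc i) ''hasse'' r' = m ''hasse'' r'"
              unfolding e6 using h' by (auto simp: less_Suc_eq)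
            have av5: "aval (Var ''r'') m5 = r" "aval (Var ''i'') m5 = i" "aval (Var ''ok'') m5 = (if rot_hasse (\<rho> ! r) (\<rho> ! i) then 1 else 0)"
              using e5 ok5 by simp_all
            have T: "t + (t5 + (acost (Var ''r'') + acost (Var ''i'') + acost (Var ''ok'') + 1)) + acost (Var ''rot_count'') + 13 + 200 * ?sum m4
              \<le> 200 * ?sum m5 + (\<Sum>j<Suc i. 500 * len j + 600)" using t t5 by simp
            show "run E C (Write ''hasse'' (Var ''r'') (Var ''i'') (Var ''ok'')) m5
              (\<lambda>t' m''. m'' ''i'' 0 0 = i \<and> ?K (Suc i) (t + (t5 + t') + acost (Var ''rot_count'') + 13) (store m'' ''i'' 0 0 (Suc i)))"
              unfolding run_Write av5 e6(1) using s6 M6 h6 T e6(2,3) by blast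
          qed
        next
          fix t m' assume I: "?K ?N t m'"
          then have M': "matched ?H m'" and t: "t + 200 * ?sum m4 \<le> 200 * ?sum m' + (\<Sum>j<?N. 500 * len j + 600)" by blast+
          have "t \<le> 1300 * card E" using t sum1 sum_ptr_le[OF M'] by simp
          then have T: "t1 + (t2 + (acost (Const 0) + acost (Const 0) + acost (Var ''r'') + 1 + (t4 + (t + acost (Var ''rot_count'') + 9)))) \<le> 5000 * (card E + k + 3)"
            using t1 t2' t4' by simp
          have "\<exists>Z. m' ''X'' = ind Z \<and> Z \<subseteq> E" using M' stableD(2) unfolding matched_def by blast
          then show "t1 + (t2 + (acost (Const 0) + acost (Const 0) + acost (Var ''r'') + 1 + (t4 + (t + acost (Var ''rot_count'') + 9)))) \<le> 5000 * (card E + k + 3) \<and>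
             same_except row_names m m' \<and> (\<exists>Z. m' ''X'' = ind Z \<and> Z \<subseteq> E) \<and>
             (\<forall>j<?N. m' ''hasse'' r j \<noteq> 0 \<longleftrightarrow> rot_hasse (found m ! r) (found m ! j)) \<and>
             (\<forall>r'. r' \<noteq> r \<longrightarrow> m' ''hasse'' r' = m ''hasse'' r')"
            using I T unfolding \<rho>_def by blast
        qed
      qed
    qed
  qed simp_all
qed

lemma run_find_successors:
  assumes l: "listed m" and sv: "saved p m" and Z: "m ''X'' = ind Z" "Z \<subseteq> E"
  shows "run E C find_successors m (\<lambda>t m'. t \<le> card E * (5000 * (card E + k + 3) + 20) + 20 \<and>
     listed m' \<and> found m' = found m \<and> m' ''rot_count'' = m ''rot_count'' \<and>
     (\<forall>i<m ''rot_count'' 0 0. \<forall>j<m ''rot_count'' 0 0. m' ''hasse'' i j \<noteq> 0 \<longleftrightarrow> rot_hasse (found m ! i) (found m ! j)))"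
proof -
  let ?N = "m ''rot_count'' 0 0" and ?S = "insert ''r'' row_names"
  let ?J = "\<lambda>r m'. same_except ?S m m' \<and> m' ''r'' 0 0 = r \<and> (\<exists>Z. m' ''X'' = ind Z \<and> Z \<subseteq> E) \<and>
     (\<forall>i<r. \<forall>j<?N. m' ''hasse'' i j \<noteq> 0 \<longleftrightarrow> rot_hasse (found m ! i) (found m ! j))"
  have frame: "listed m' \<and> found m' = found m \<and> m' ''rot_count'' = m ''rot_count'' \<and> saved p m'"
    if s: "same_except ?S m m'" for m'
  proof -
    have "listed m' = listed m" "found m' = found m" "m' ''rot_count'' = m ''rot_count''"
      by (rule listed_cong[OF s]; simp)+
    moreover have "m' ''X0'' = m ''X0''" "m' ''ptr0'' = m ''ptr0''" by (rule same_exceptD[OF s]; simp)+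
    ultimately show ?thesis using l sv unfolding saved_def by simp
  qed
  show ?thesis unfolding find_successors_def
  proof (rule run_For_uniform[where J = ?J and N = ?N and B = "5000 * (card E + k + 3)"])
    have "same_except ?S m (store m ''r'' 0 0 0)" by (intro same_except_store same_except_refl) simp
    then show "?J 0 (store m ''r'' 0 0 0)" using Z by (auto simp: store_apply)
  next
    fix r m' assume "?J r m'"
    then show "aval (Var ''rot_count'') m' = ?N \<and> m' ''r'' 0 0 = r" using frame[of m'] by simp
  next
    fix r m' assume J: "?J r m'" and r: "r < ?N"
    then have s': "same_except ?S m m'" and r': "m' ''r'' 0 0 = r" 
      and h': "\<forall>i<r. \<forall>j<?N. m' ''hasse'' i j \<noteq> 0 \<longleftrightarrow> rot_hasse (found m ! i) (found m ! j)" by blast+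
    obtain Z' where Z': "m' ''X'' = ind Z'" "Z' \<subseteq> E" using J by blast
    have fr: "listed m'" "saved p m'" "found m' = found m" "m' ''rot_count'' = m ''rot_count''" using frame[OF s'] by blast+
    have rN: "r < m' ''rot_count'' 0 0" using r fr by simp
    show "run E C successor_row m' (\<lambda>t m'. t \<le> 5000 * (card E + k + 3) \<and> m' ''r'' 0 0 = r \<and> ?J (Suc r) (store m' ''r'' 0 0 (Suc r)))"
    proof (rule run_mono[OF run_successor_row[OF fr(1,2) Z' r' rN]])
      fix t m''
      assume a: "t \<le> 5000 * (card E + k + 3) \<and> same_except row_names m' m'' \<and> (\<exists>Z. m'' ''X'' = ind Z \<and> Z \<subseteq> E) \<and>
        (\<forall>j<m' ''rot_count'' 0 0. m'' ''hasse'' r j \<noteq> 0 \<longleftrightarrow> rot_hasse (found m' ! r) (found m' ! j)) \<and>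
        (\<forall>r'. r' \<noteq> r \<longrightarrow> m'' ''hasse'' r' = m' ''hasse'' r')"
      then have t: "t \<le> 5000 * (card E + k + 3)" and s2: "same_except row_names m' m''" and X2: "\<exists>Z. m'' ''X'' = ind Z \<and> Z \<subseteq> E"
        and h2: "\<forall>j<?N. m'' ''hasse'' r j \<noteq> 0 \<longleftrightarrow> rot_hasse (found m ! r) (found m ! j)"
          "\<forall>r'. r' \<noteq> r \<longrightarrow> m'' ''hasse'' r' = m' ''hasse'' r'" unfolding fr by blast+
      have r2: "m'' ''r'' 0 0 = r" using same_exceptD[OF s2] r' by simp
      have "same_except ?S m m''" by (rule same_except_trans[OF s' s2]) (intro Un_least order_refl subset_insertI)
      then have s3: "same_except ?S m (store m'' ''r'' 0 0 (Suc r))" by (rule same_except_store) simp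
      have e: "store m'' ''r'' 0 0 (Suc r) ''X'' = m'' ''X''" "store m'' ''r'' 0 0 (Suc r) ''hasse'' = m'' ''hasse''"
        "store m'' ''r'' 0 0 (Suc r) ''r'' 0 0 = Suc r" by (simp_all add: store_apply)
      have "\<forall>i<Suc r. \<forall>j<?N. m'' ''hasse'' i j \<noteq> 0 \<longleftrightarrow> rot_hasse (found m ! i) (found m ! j)"
      proof (intro allI impI)
        fix i j assume ij: "i < Suc r" "j < ?N"
        show "m'' ''hasse'' i j \<noteq> 0 \<longleftrightarrow> rot_hasse (found m ! i) (found m ! j)"
        proof (cases "i = r")
          case True
          then show ?thesis using h2(1) ij by blast
        next
          case False
          then show ?thesis using h2(2) h' ij by simp
        qed
      qed
      then show "t \<le> 5000 * (card E + k + 3) \<and> m'' ''r'' 0 0 = r \<and> ?J (Suc r) (store m'' ''r'' 0 0 (Suc r))"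
        unfolding e using t r2 s3 X2 by blast
    qed
  next
    fix t m' assume J: "?J ?N m'" and t: "t \<le> ?N * (5000 * (card E + k + 3) + acost (Var ''rot_count'') + 13) + acost (Var ''rot_count'') + 9"
    have "?N * (5000 * (card E + k + 3) + acost (Var ''rot_count'') + 13) \<le> card E * (5000 * (card E + k + 3) + 20)"
      by (rule mult_le_mono[OF rot_count_le[OF l]]) simp
    then have "t \<le> card E * (5000 * (card E + k + 3) + 20) + 20" using t by simp
    then show "t \<le> card E * (5000 * (card E + k + 3) + 20) + 20 \<and> listed m' \<and> found m' = found m \<and> m' ''rot_count'' = m ''rot_count'' \<and>
     (\<forall>i<?N. \<forall>j<?N. m' ''hasse'' i j \<noteq> 0 \<longleftrightarrow> rot_hasse (found m ! i) (found m ! j))"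
      using J frame[of m'] by blast
  qed
qed

end

section \<open>The whole algorithm\<close>

definition poset_program :: com where
  "poset_program = Seq count_edges (Seq deferred_acceptance (Seq (copy_state ''X'' ''ptr'' ''X0'' ''ptr0'')
     (Seq find_route find_successors)))"

context market_input
begin

lemma run_poset_program:
  "run E C poset_program m0 (\<lambda>t m'. t \<le> 100000 * ((card E)\<^sup>2 + 1) \<and> output_poset m' rotations rot_hasse)"
proof -
  let ?e = "card E"
  have inp0: "inputs m0" unfolding inputs_def by simp
  have z: "m0 x i j = 0" if "x \<notin> {''W_size'', ''F_size'', ''deg'', ''quota'', ''pref''}" for x i j using input_zero[OF that] .
  have zf: "m0 x = (\<lambda>i j. 0)" if "x \<notin> {''W_size'', ''F_size'', ''deg'', ''quota'', ''pref''}" for x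
    using z[OF that] by (intro ext)
  show ?thesis unfolding poset_program_def run_Seq[of E C count_edges]
  proof (rule run_mono[OF run_count_edges[OF inp0]])
    show "m0 ''edges'' 0 0 = 0" by (rule z) simp
  next
    fix t1 m1 assume "t1 \<le> 40 * k + 40 \<and> same_except {''edges'', ''v''} m0 m1 \<and> m1 ''edges'' 0 0 = ?e"
    then have t1: "t1 \<le> 40 * k + 40" and s1: "same_except {''edges'', ''v''} m0 m1" and e1: "m1 ''edges'' 0 0 = ?e" by blast+
    have x1: "m1 ''X'' = (\<lambda>i j. 0)" "m1 ''ptr'' = (\<lambda>i j. 0)" "m1 ''cnt'' = (\<lambda>i j. 0)"
      using same_exceptD[OF s1] zf by simp_all
    have D: "deferring {} m1" unfolding deferring_def x1 inputs_def
      using same_exceptD[OF s1] deferred_empty by (simp add: ind_def proposed_def)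
    show "run E C (Seq deferred_acceptance (Seq (copy_state ''X'' ''ptr'' ''X0'' ''ptr0'') (Seq find_route find_successors))) m1
      (\<lambda>t m'. t1 + t \<le> 100000 * (?e\<^sup>2 + 1) \<and> output_poset m' rotations rot_hasse)"
      unfolding run_Seq[of E C deferred_acceptance]
    proof (rule run_mono[OF run_deferred_acceptance[OF D e1]])
      let ?S2 = "{''go'', ''f'', ''A'', ''ptr'', ''X'', ''b'', ''v'', ''w'', ''cnt'', ''t''}"
      fix t2 m2 assume "t2 \<le> ?e * (300 * (?e + k + 3) + 20) + 20 \<and> matched X_min m2 \<and> same_except ?S2 m1 m2"
      then have t2: "t2 \<le> ?e * (300 * (?e + k + 3) + 20) + 20" and M2: "matched X_min m2" and s2: "same_except ?S2 m1 m2" by blast+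
      have inp2: "inputs m2" and st: "stable X_min" and X2: "m2 ''X'' = ind X_min" and ok2: "ptr_ok X_min (\<lambda>w. m2 ''ptr'' w 0)"
        using M2 unfolding matched_def by auto
      let ?p = "\<lambda>w. m2 ''ptr'' w 0"
      show "run E C (Seq (copy_state ''X'' ''ptr'' ''X0'' ''ptr0'') (Seq find_route find_successors)) m2
        (\<lambda>t m'. t1 + (t2 + t) \<le> 100000 * (?e\<^sup>2 + 1) \<and> output_poset m' rotations rot_hasse)"
        unfolding run_Seq[of E C "copy_state _ _ _ _"]
      proof (rule run_mono[OF run_copy_state[OF inp2]])
        fix t3 m3
        assume a: "t3 \<le> 100 * ?e + 100 * k + 100 \<and> same_except {''v'', ''j'', ''X0'', ''ptr0''} m2 m3 \<and>
          (\<forall>w<k. m3 ''ptr0'' w 0 = m2 ''ptr'' w 0) \<and>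
          (\<forall>w f. m3 ''X0'' w f = (if (w, f) \<in> E then m2 ''X'' w f else m2 ''X0'' w f))"
        then have t3: "t3 \<le> 100 * ?e + 100 * k + 100" and s3: "same_except {''v'', ''j'', ''X0'', ''ptr0''} m2 m3" by blast+
        have old: "m3 x = m0 x" if "x \<notin> {''edges'', ''v'', ''j'', ''X0'', ''ptr0''} \<union> ?S2" for x
          using same_exceptD[OF s1, of x] same_exceptD[OF s2, of x] same_exceptD[OF s3, of x] that by simp
        have z3: "m3 ''dead'' = (\<lambda>i j. 0)" "m3 ''rot_count'' = (\<lambda>i j. 0)" "m3 ''s'' = (\<lambda>i j. 0)"
          using old zf by simp_all
        have e3: "m3 ''edges'' 0 0 = ?e" using same_exceptD[OF s3] same_exceptD[OF s2] e1 by simp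
        have X0z: "m2 ''X0'' = (\<lambda>i j. 0)" using same_exceptD[OF s2] same_exceptD[OF s1] zf by simp
        have "m3 ''X0'' = ind X_min"
        proof (intro ext)
          fix w f
          have "m3 ''X0'' w f = (if (w, f) \<in> E then m2 ''X'' w f else m2 ''X0'' w f)" using a by blast
          then show "m3 ''X0'' w f = ind X_min w f" using X0z X2 stableD(2)[OF st] by (auto simp: ind_def)
        qed
        then have sv3: "saved ?p m3" using a ok2 unfolding saved_def by blast
        have "m3 ''W_size'' = m2 ''W_size''" "m3 ''deg'' = m2 ''deg''" "m3 ''pref'' = m2 ''pref''" "m3 ''quota'' = m2 ''quota''"
          "m3 ''X'' = m2 ''X''" "m3 ''ptr'' = m2 ''ptr''" using same_exceptD[OF s3] by simp_all
        then have M3: "matched X_min m3" using M2 unfolding matched_def inputs_def by simp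
        have S3: "searching X_min m3" unfolding searching_def explored_def path_ok_def found_def z3 using M3 by simp
        show "run E C (Seq find_route find_successors) m3
          (\<lambda>t m'. t1 + (t2 + (t3 + t)) \<le> 100000 * (?e\<^sup>2 + 1) \<and> output_poset m' rotations rot_hasse)"
          unfolding run_Seq
        proof (rule run_mono[OF run_find_route[OF S3 e3]])
          show "m3 ''s'' 0 0 = 0" unfolding z3 ..
        next
          fix t4 m4
          assume b: "t4 \<le> (2 * ?e + 2 * k + 1) * (1000 * (?e + k + 3) + 40) + 40 \<and>
            same_except (insert ''t'' path_names) m3 m4 \<and> (\<exists>X. explored X m4 \<and> rotations_at X = {})"
          then obtain X where ex: "explored X m4" and none: "rotations_at X = {}" by blast
          have t4: "t4 \<le> (2 * ?e + 2 * k + 1) * (1000 * (?e + k + 3) + 40) + 40"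
            and s4: "same_except (insert ''t'' path_names) m3 m4" using b by blast+
          have M4: "matched X m4" using ex unfolding explored_def by blast
          then have X: "stable X" "inputs m4" "m4 ''X'' = ind X" unfolding matched_def by blast+
          note mx = no_rotation_at_max[OF X(1) none]
          have "full_route (found m4)" unfolding full_route_iff[OF st mx(2)] mx(1) using ex unfolding explored_def by blast
          moreover have "(\<Sum>i<m4 ''rot_count'' 0 0. m4 ''plus_len'' i 0) \<le> ?e"
            using ex sum_ptr_le[OF M4] unfolding explored_def by linarith
          ultimately have l4: "listed m4" using X(2) st mx(2) ex unfolding listed_def explored_def by blast
          have "m4 ''X0'' = m3 ''X0''" "m4 ''ptr0'' = m3 ''ptr0''" by (rule same_exceptD[OF s4]; simp)+
          then have sv4: "saved ?p m4" using sv3 unfolding saved_def by simp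
          show "run E C find_successors m4
            (\<lambda>t m'. t1 + (t2 + (t3 + (t4 + t))) \<le> 100000 * (?e\<^sup>2 + 1) \<and> output_poset m' rotations rot_hasse)"
          proof (rule run_mono[OF run_find_successors[OF l4 sv4 X(3) stableD(2)[OF X(1)]]])
            fix t5 m5
            assume c: "t5 \<le> ?e * (5000 * (?e + k + 3) + 20) + 20 \<and> listed m5 \<and> found m5 = found m4 \<and>
              m5 ''rot_count'' = m4 ''rot_count'' \<and>
              (\<forall>i<m4 ''rot_count'' 0 0. \<forall>j<m4 ''rot_count'' 0 0. m5 ''hasse'' i j \<noteq> 0 \<longleftrightarrow> rot_hasse (found m4 ! i) (found m4 ! j))"
            let ?N = "m5 ''rot_count'' 0 0"
            have t5: "t5 \<le> ?e * (5000 * (?e + k + 3) + 20) + 20" and l5: "listed m5"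
              and h5: "\<And>i j. i < ?N \<Longrightarrow> j < ?N \<Longrightarrow> m5 ''hasse'' i j \<noteq> 0 \<longleftrightarrow> rot_hasse (found m5 ! i) (found m5 ! j)"
              using c by simp_all
            have fr: "full_route (found m5)" using l5 unfolding listed_def by blast
            have "output_poset m5 rotations rot_hasse" unfolding output_poset_def Let_def
            proof (intro conjI allI impI)
              have "distinct (found m5)" "rotations = set (found m5)"
                using full_route_distinct[OF st mx(2) fr] full_route_set[OF st mx(2) fr] by auto
              then show "bij_betw (output_rotation m5) {..<?N} rotations"
                unfolding found_def bij_betw_def by (simp add: distinct_map atLeast0LessThan)
              show "distinct (plus_list m5 i)" "distinct (minus_list m5 i)" if "i < ?N" for i
                using recordedD(2,3)[OF listed_prefix(3)[OF l5 that]] by auto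
              show "m5 ''hasse'' i j \<noteq> 0 \<longleftrightarrow> rot_hasse (output_rotation m5 i) (output_rotation m5 j)" if "i < ?N" "j < ?N" for i j
                using h5[OF that] listed_nth that by simp
            qed
            moreover have "t1 + (t2 + (t3 + (t4 + t5))) \<le> 100000 * (?e\<^sup>2 + 1)"
            proof -
              have k: "k \<le> ?e + 1" by (rule k_le)
              have "?e * (300 * (?e + k + 3) + 20) \<le> ?e * (300 * (2 * ?e + 4) + 20)"
                "?e * (5000 * (?e + k + 3) + 20) \<le> ?e * (5000 * (2 * ?e + 4) + 20)"
                by (rule mult_le_mono2, use k in simp)+
              moreover have "(2 * ?e + 2 * k + 1) * (1000 * (?e + k + 3) + 40) \<le> (4 * ?e + 3) * (1000 * (2 * ?e + 4) + 40)"
                by (rule mult_le_mono) (use k in simp_all)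
              ultimately have T: "t2 \<le> ?e * (300 * (2 * ?e + 4) + 20) + 20" "t5 \<le> ?e * (5000 * (2 * ?e + 4) + 20) + 20"
                "t4 \<le> (4 * ?e + 3) * (1000 * (2 * ?e + 4) + 40) + 40"
                using t2 t4 t5 by (meson add_le_mono1 le_trans)+
              define y where "y = ?e * ?e"
              have Y: "?e * (300 * (2 * ?e + 4) + 20) = 600 * y + 1220 * ?e"
                "?e * (5000 * (2 * ?e + 4) + 20) = 10000 * y + 20020 * ?e"
                "(4 * ?e + 3) * (1000 * (2 * ?e + 4) + 40) = 8000 * y + 22160 * ?e + 12120"
                "?e\<^sup>2 = y"
                unfolding y_def by (simp_all add: algebra_simps power2_eq_square)
              have "?e \<le> y" unfolding y_def by simp
              then show ?thesis unfolding Y(4) using T[unfolded Y(1-3)] t1 t3 k by simp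
            qed
            ultimately show "t1 + (t2 + (t3 + (t4 + t5))) \<le> 100000 * (?e\<^sup>2 + 1) \<and> output_poset m5 rotations rot_hasse" by blast
          qed
        qed
      qed simp_all
    qed
  qed
qed

end

theorem mainTheorem8:
  shows "\<exists>(P :: com) (c :: nat).
    \<forall>k l E gt q C m.
      stable_market {..<k} {..<l} E gt q C \<and> input_memory k l E gt q m \<longrightarrow>
      (\<exists>t m'. exec E C P m t m' \<and> t \<le> c * ((card E)\<^sup>2 + 1) \<and>
         output_poset m'
           (stable_market.rotations {..<k} {..<l} E gt q C)
           (stable_market.rot_hasse {..<k} {..<l} E gt q C))"
proof (rule exI[of _ poset_program], rule exI[of _ 100000], intro allI impI)
  fix k l E gt q C m
  assume "stable_market {..<k} {..<l} E gt q C \<and> input_memory k l E gt q m"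
  then interpret market_input k l E gt q C m
    unfolding market_input_def market_input_axioms_def by simp
  show "\<exists>t m'. exec E C poset_program m t m' \<and> t \<le> 100000 * ((card E)\<^sup>2 + 1) \<and>
         output_poset m'
           (stable_market.rotations {..<k} {..<l} E gt q C)
           (stable_market.rot_hasse {..<k} {..<l} E gt q C)"
    using run_poset_program unfolding run_def by blast
qed

end
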